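(* Let $M=M_N$ satisfy $M\gg N^{p-1}$. Then there exist a permutation $\sigma^\ast\in S_r$ (depending on the initialization $\boldsymbol X_0$) and a time $T_0=T_0(N)\gg N^{\frac{p-2}{2}}$ such that for every $\varepsilon>0$ and every $T\ge T_0$, $$\lim_{N\to\infty}\mathbb P_{\boldsymbol X_0^+}\Big(\inf_{t\in[T_0,T]} m^{(N)}_{\sigma^\ast(i)\,i}(\boldsymbol X_t)\ge 1-\varepsilon \ \text{ for every } i\in[r]\Big)=1 .$$
   Context: Notation: $[n]=\{1,\dots,n\}$; for sequences, $x_N\ll y_N$ (equivalently $y_N\gg x_N$) means $x_N/y_N\to0$ as $N\to\infty$. Setting. Fix integers $p\ge3$, $r\ge1$ and signal-to-noise ratios $\lambda_1\ge\cdots\ge\lambda_r\ge 0$ of order $1$ (positive constants not depending on $N$). Let $M=M_N$ be the number of samples. Let $\boldsymbol v_1,\dots,\boldsymbol v_r\in\mathbb R^N$ be orthogonal vectors of norm $\sqrt N$. Let $\mathcal S_{N,r}=\{\boldsymbol X=[\boldsymbol x_1,\dots,\boldsymbol x_r]\in\mathbb R^{N\times r}:\langle\boldsymbol x_i,\boldsymbol x_j\rangle=N\delta_{ij}\}$ (normalized Stiefel manifold). Correlations: $m_{ij}^{(N)}(\boldsymbol X)=\frac1N\langle\boldsymbol v_i,\boldsymbol x_j\rangle$. Let $\boldsymbol W\in(\mathbb R^N)^{\otimes p}$ have i.i.d. $\mathcal N(0,1)$ entries, and define $$H_0(\boldsymbol X)=N^{-\frac{p-1}{2}}\sum_{i=1}^r\lambda_i\langle\boldsymbol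 W,\boldsymbol x_i^{\otimes p}\rangle,\qquad \mathcal R(\boldsymbol X)=\frac1{\sqrt M}H_0(\boldsymbol X)-\sum_{1\le i,j\le r}N\lambda_i\lambda_j\big(m_{ij}^{(N)}(\boldsymbol X)\big)^p .$$ (This $\mathcal R$ is equal in law to the maximum-likelihood empirical risk of the multi-spiked tensor model with $M$ i.i.d. observations $\boldsymbol Y^\ell=\sum_i\lambda_i\sqrt N(\boldsymbol v_i/\sqrt N)^{\otimes p}+\boldsymbol W^\ell$.) Gradient flow: $(\boldsymbol X_t)_{t\ge0}$ on $\mathcal S_{N,r}$ solves $\frac{d\boldsymbol X_t}{dt}=-\nabla\mathcal R(\boldsymbol X_t)$, where $\nabla$ is the Riemannian gradient $\nabla f(\boldsymbol X)=\hat\nabla f(\boldsymbol X)-\frac1{2N}\boldsymbol X\big(\boldsymbol X^\top\hat\nabla f(\boldsymbol X)+\hat\nabla f(\boldsymbol X)^\top\boldsymbol X\big)$ and $\hat\nabla$ is the Euclidean gradient. Initialization: $\mu_{N\times r}$ is the uniform probability measure on $\mathcal S_{N,r}$ (the unique one invariant under left and right orthogonal transformations), and $\boldsymbol X_0\sim\mu_{N\times r}$ independently of $\boldsymbol W$. $\mathbb P_{\boldsymbol X_0^+}$ denotes the law of the process (including the randomness of $\boldsymbol W$) initiated at $\boldsymbol X_0\sim\mu_{N\times r}$ subject to the condition $m_{ij}^{(N)}(\boldsymbol X_0)>0$ for all $1\le i,j\le r$. *)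

theory Defs
  imports "HOL-Probability.Probability"
begin

text \<open>
  Since the dimension \<open>N\<close> tends to infinity, vectors in \<open>R^N\<close> are functions \<open>nat \<Rightarrow> real\<close> read on
  \<open>{1..N}\<close>, and \<open>n \<times> m\<close> matrices are functions on pairs (row, column) read on
  \<open>{1..n} \<times> {1..m}\<close>. Matrices that carry a measure or a flow are extensional, so that the
  coordinate representation is unique.
\<close>

definition much_less :: "(nat \<Rightarrow> real) \<Rightarrow> (nat \<Rightarrow> real) \<Rightarrow> bool" where
  "much_less x y \<longleftrightarrow> (\<lambda>N. x N / y N) \<longlonglongrightarrow> 0"

type_synonym rmat = "nat \<times> nat \<Rightarrow> real"

definition inner_N :: "nat \<Rightarrow> (nat \<Rightarrow> real) \<Rightarrow> (nat \<Rightarrow> real) \<Rightarrow> real" where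
  "inner_N N x y = (\<Sum>k=1..N. x k * y k)"

definition mat_col :: "rmat \<Rightarrow> nat \<Rightarrow> nat \<Rightarrow> real" where
  "mat_col X i = (\<lambda>k. X (k, i))"

definition mat_idx :: "nat \<Rightarrow> nat \<Rightarrow> (nat \<times> nat) set" where
  "mat_idx n m = {1..n} \<times> {1..m}"

definition mat_mult :: "nat \<Rightarrow> nat \<Rightarrow> nat \<Rightarrow> rmat \<Rightarrow> rmat \<Rightarrow> rmat" where
  "mat_mult n l m A B = (\<lambda>(i, j)\<in>mat_idx n m. \<Sum>k=1..l. A (i, k) * B (k, j))"

definition mat_borel :: "nat \<Rightarrow> nat \<Rightarrow> rmat measure" where
  "mat_borel n m = Pi\<^sub>M (mat_idx n m) (\<lambda>_. borel)"

definition orthogonal_mat :: "nat \<Rightarrow> rmat \<Rightarrow> bool" where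
  "orthogonal_mat n Q \<longleftrightarrow> (\<forall>i\<in>{1..n}. \<forall>j\<in>{1..n}.
     inner_N n (mat_col Q i) (mat_col Q j) = (if i = j then 1 else 0))"

definition stiefel :: "nat \<Rightarrow> nat \<Rightarrow> rmat set" where
  "stiefel N r = {X \<in> extensional (mat_idx N r). \<forall>i\<in>{1..r}. \<forall>j\<in>{1..r}.
     inner_N N (mat_col X i) (mat_col X j) = (if i = j then real N else 0)}"

text \<open>
  \<open>uniform_stiefel N r \<mu>\<close> says that \<open>\<mu>\<close> is the uniform probability measure on the normalized
  Stiefel manifold, viewed as a measure on all \<open>N \<times> r\<close> matrices: it is carried by the manifold
  and invariant under left and right multiplication by orthogonal matrices.
\<close>

definition uniform_stiefel :: "nat \<Rightarrow> nat \<Rightarrow> rmat measure \<Rightarrow> bool" where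
  "uniform_stiefel N r \<mu> \<longleftrightarrow>
     prob_space \<mu> \<and> sets \<mu> = sets (mat_borel N r) \<and> measure \<mu> (stiefel N r) = 1 \<and>
     (\<forall>Q. orthogonal_mat N Q \<longrightarrow> distr \<mu> (mat_borel N r) (\<lambda>X. mat_mult N N r Q X) = \<mu>) \<and>
     (\<forall>Q. orthogonal_mat r Q \<longrightarrow> distr \<mu> (mat_borel N r) (\<lambda>X. mat_mult N r r X Q) = \<mu>)"

text \<open>Order-\<open>p\<close> tensors over \<open>R^N\<close> are functions on multi-indices \<open>{1..p} \<rightarrow> {1..N}\<close>.\<close>

definition tensor_idx :: "nat \<Rightarrow> nat \<Rightarrow> (nat \<Rightarrow> nat) set" where
  "tensor_idx N p = ({1..p} \<rightarrow>\<^sub>E {1..N})"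

type_synonym rtensor = "(nat \<Rightarrow> nat) \<Rightarrow> real"

definition tensor_inner :: "nat \<Rightarrow> nat \<Rightarrow> rtensor \<Rightarrow> rtensor \<Rightarrow> real" where
  "tensor_inner N p S T = (\<Sum>a\<in>tensor_idx N p. S a * T a)"

definition tensor_power :: "nat \<Rightarrow> (nat \<Rightarrow> real) \<Rightarrow> rtensor" where
  "tensor_power p x = (\<lambda>a. \<Prod>l=1..p. x (a l))"

definition corr :: "nat \<Rightarrow> (nat \<Rightarrow> nat \<Rightarrow> real) \<Rightarrow> rmat \<Rightarrow> nat \<Rightarrow> nat \<Rightarrow> real" where
  "corr N v X i j = inner_N N (v i) (mat_col X j) / real N"

definition H0 :: "nat \<Rightarrow> nat \<Rightarrow> nat \<Rightarrow> (nat \<Rightarrow> real) \<Rightarrow> rtensor \<Rightarrow> rmat \<Rightarrow> real" where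
  "H0 p r N lam W X =
     real N powr (- (real p - 1) / 2) *
     (\<Sum>i=1..r. lam i * tensor_inner N p W (tensor_power p (mat_col X i)))"

definition risk :: "nat \<Rightarrow> nat \<Rightarrow> nat \<Rightarrow> nat \<Rightarrow> (nat \<Rightarrow> real) \<Rightarrow> (nat \<Rightarrow> nat \<Rightarrow> real) \<Rightarrow>
    rtensor \<Rightarrow> rmat \<Rightarrow> real" where
  "risk p r N M lam v W X =
     1 / sqrt (real M) * H0 p r N lam W X -
     (\<Sum>i=1..r. \<Sum>j=1..r. real N * lam i * lam j * corr N v X i j ^ p)"

text \<open>The Euclidean gradient in coordinates, i.e. the matrix of partial derivatives.\<close>

definition eucl_grad :: "(rmat \<Rightarrow> real) \<Rightarrow> rmat \<Rightarrow> rmat" where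
  "eucl_grad f X = (\<lambda>e. deriv (\<lambda>s. f (X(e := s))) (X e))"

text \<open>
  For \<open>G\<close> the Euclidean gradient, \<open>inner_N N (mat_col X i) (mat_col G j)\<close> is the \<open>(i, j)\<close> entry of
  the product of the transpose of \<open>X\<close> with \<open>G\<close>.
\<close>

definition riem_grad :: "nat \<Rightarrow> nat \<Rightarrow> (rmat \<Rightarrow> real) \<Rightarrow> rmat \<Rightarrow> rmat" where
  "riem_grad N r f X = (let G = eucl_grad f X in
     (\<lambda>(k, j). G (k, j) - 1 / (2 * real N) *
        (\<Sum>i=1..r. X (k, i) *
           (inner_N N (mat_col X i) (mat_col G j) + inner_N N (mat_col G i) (mat_col X j)))))"

definition gradient_flow :: "nat \<Rightarrow> nat \<Rightarrow> (rmat \<Rightarrow> real) \<Rightarrow> (real \<Rightarrow> rmat) \<Rightarrow> bool" where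
  "gradient_flow N r f X \<longleftrightarrow> (\<forall>t\<ge>0. X t \<in> stiefel N r \<and>
     (\<forall>e\<in>mat_idx N r.
        ((\<lambda>s. X s e) has_real_derivative - riem_grad N r f (X t) e) (at t within {0..})))"

end

theory Submission
  imports Defs "HOL-Real_Asymp.Real_Asymp"
begin

text \<open>
  Let \<open>m\<^sub>i\<^sub>j(t)\<close> be the correlation of the signal \<open>v\<^sub>i\<close> with the column \<open>x\<^sub>j(t)\<close> and put \<open>q = p - 2\<close>. Taking inner
  products of the flow with the signals gives an \<open>r \<times> r\<close> system
  \<open>m\<^sub>i\<^sub>j' = \<alpha>\<^sub>i\<^sub>j m\<^sub>i\<^sub>j^(q+1) - drag\<^sub>i\<^sub>j(m) + E\<^sub>i\<^sub>j\<close> with \<open>\<alpha>\<^sub>i\<^sub>j = p \<lambda>\<^sub>i \<lambda>\<^sub>j\<close>, where the drag is the component of the signal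
  gradient normal to the constraint and \<open>E\<close> comes from \<open>W\<close> (lemma \<open>corr_flow\<close>). The injective norm of \<open>W\<close> is
  \<open>O(\<surd>N)\<close> outside an event of probability \<open>O(exp (-N))\<close>, which bounds \<open>E\<close> by \<open>O(1/\<surd>M)\<close> on the whole manifold and
  hence at all times at once (\<open>inj_norm_bound\<close>, \<open>corr_noise_le\<close>). At the start \<open>m\<^sub>i\<^sub>j\<close> is of order
  \<open>b = 1/\<surd>N\<close>, so the drift is of order \<open>b^(q+1) = N^(-(p-1)/2)\<close>; the condition on \<open>M\<close> says precisely that the noise
  is negligible against it. What remains is deterministic.

  As long as all entries are small the drag is of higher order and every entry follows \<open>m' = \<alpha> m^(q+1)\<close>, which blows up
  at time \<open>1 / (q \<alpha> m(0)^q)\<close>, of order \<open>N^(q/2)\<close>. The race is decided by the numbers \<open>\<alpha>\<^sub>i\<^sub>j^(1/q) m\<^sub>i\<^sub>j(0)\<close>: the largest one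
  wins, its row and column are suppressed by the drag, then the largest of the remaining ones wins, and so on. This greedy
  rule defines the permutation. Only one property of it enters the proof (\<open>greedy_matching\<close>): every entry
  that is not selected is beaten by the selected entry of its row or by the one of its column. After relabelling the
  signals the selected entries are the diagonal ones.

  The difficulty is to keep the off-diagonal entries of order \<open>b\<close> while different diagonal entries escape at different
  times of order \<open>b^(-q)\<close>. The errors that are not pointwise small are products \<open>m\<^sub>i\<^sub>j\<^sup>2 m\<^sub>i\<^sub>i^(q+1)\<close>, collected in
  the quantity \<open>leak\<close>. They are paid for by the weighted energy \<open>2 \<Sum> m\<^sub>i\<^sub>j\<^sup>2 exp (- m\<^sub>i\<^sub>i - m\<^sub>j\<^sub>j)\<close>, whose derivative is at most
  \<open>-c leak\<close> up to small terms: where the drag alone is too weak, the growth of \<open>m\<^sub>i\<^sub>i\<close> makes the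
  weight decrease (\<open>pair_dissipation\<close>, \<open>energy_rate_le\<close>). Hence a multiple of the energy, corrected by a small linear function
  of time, is a control function whose derivative dominates all errors although the function itself varies by less than
  \<open>\<epsilon> b\<close> (\<open>leak_absorbed\<close>, \<open>ctrl_var\<close>). Comparison with scalar equations then gives a continuation argument:
  an off-diagonal entry is at most \<open>K1 b\<close> until one of its two competitors reaches the level \<open>B b\<close>
  (\<open>off_before_hit\<close>), and after that the pair energy grows by at most \<open>2 K1\<^sup>2 b\<^sup>2\<close> (\<open>pair_energy_after_hit\<close>). So the bound
  \<open>\<kappa> = 6 K1 b\<close> is never attained, and by the time \<open>T / b^q\<close> all diagonal entries are close to 1. From there they cannot
  leave a neighbourhood of 1 (\<open>trapped\<close>). As \<open>T / b^q\<close> is far smaller than \<open>(N+1)^p\<close>, the latter serves as \<open>T\<^sub>0\<close>.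

  The argument needs the entries \<open>\<surd>N m\<^sub>i\<^sub>j(0)\<close> to stay away from 0 and from infinity, and the differences of weighted
  entries within a row or a column to stay away from 0, with high probability (\<open>generic_entries\<close>). The law of \<open>\<langle>u, x\<rangle>\<close>
  is the same for all unit vectors \<open>u\<close>, because reflections preserve the law of the frame; so \<open>u\<close> may be replaced by a
  normalized Gaussian vector, and the small-ball bound for the normal distribution carries over (\<open>small_ball\<close>). Conditioning
  on positive correlations costs only a constant factor, since this event has probability at least
  \<open>2^(-r\<^sup>2) - r\<^sup>2/N\<close> (\<open>frame_positive_prob\<close>).
\<close>

section \<open>The drag at a nearly diagonal matrix\<close>

definition drag_summand :: "nat \<Rightarrow> (nat \<Rightarrow> nat \<Rightarrow> real) \<Rightarrow> (nat \<Rightarrow> nat \<Rightarrow> real) \<Rightarrow>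
    nat \<Rightarrow> nat \<Rightarrow> nat \<Rightarrow> nat \<Rightarrow> real" where
  "drag_summand q \<alpha> m i j k l =
     m i k * m l k * m l j * (\<alpha> l j * m l j ^ q + \<alpha> l k * m l k ^ q)"

text \<open>In terms of correlations with orthogonal signals, this is the part of the signal gradient that the constraint
  removes. The summation index \<open>k\<close> runs over the columns of the frame and \<open>l\<close> over the
  signals; the two terms in a summand come from \<open>X\<^sup>T G\<close> and from \<open>G\<^sup>T X\<close>.\<close>

definition drag :: "nat \<Rightarrow> nat \<Rightarrow> (nat \<Rightarrow> nat \<Rightarrow> real) \<Rightarrow> (nat \<Rightarrow> nat \<Rightarrow> real) \<Rightarrow>
    nat \<Rightarrow> nat \<Rightarrow> real" where
  "drag q r \<alpha> m i j = 1/2 * (\<Sum>k=1..r. \<Sum>l=1..r. drag_summand q \<alpha> m i j k l)"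

lemma abs_prod3_le:
  fixes x y z :: real
  assumes "\<bar>x\<bar> \<le> X" "\<bar>y\<bar> \<le> Y" "\<bar>z\<bar> \<le> Z"
  shows "\<bar>x * y * z\<bar> \<le> X * Y * Z"
  unfolding abs_mult using assms
  by (intro mult_mono) (auto intro: order_trans[OF abs_ge_zero] mult_nonneg_nonneg)

text \<open>Products of off-diagonal entries with a high power of a diagonal entry are not of order
  \<open>\<kappa>^(q+2)\<close> once that diagonal entry is of order 1. They are measured separately by
  \<open>P\<close>.\<close>

locale near_diagonal =
  fixes q r :: nat and \<alpha> m :: "nat \<Rightarrow> nat \<Rightarrow> real" and a A \<kappa> P :: real
  assumes a_pos: "a > 0"
    and weight: "\<And>i j. i \<in> {1..r} \<Longrightarrow> j \<in> {1..r} \<Longrightarrow> a \<le> \<alpha> i j \<and> \<alpha> i j \<le> A"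
    and entry_le_1: "\<And>i j. i \<in> {1..r} \<Longrightarrow> j \<in> {1..r} \<Longrightarrow> \<bar>m i j\<bar> \<le> 1"
    and diag_nonneg: "\<And>i. i \<in> {1..r} \<Longrightarrow> 0 \<le> m i i"
    and \<kappa>: "0 \<le> \<kappa>" "\<kappa> \<le> 1"
    and off_small: "\<And>i j. i \<in> {1..r} \<Longrightarrow> j \<in> {1..r} \<Longrightarrow> i \<noteq> j \<Longrightarrow> \<bar>m i j\<bar> \<le> \<kappa>"
    and P_row: "\<And>i j. i \<in> {1..r} \<Longrightarrow> j \<in> {1..r} \<Longrightarrow> i \<noteq> j \<Longrightarrow> (m i j)\<^sup>2 * m i i ^ (q+1) \<le> P"
    and P_col: "\<And>i j. i \<in> {1..r} \<Longrightarrow> j \<in> {1..r} \<Longrightarrow> i \<noteq> j \<Longrightarrow> (m i j)\<^sup>2 * m j j ^ (q+1) \<le> P"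
    and P_nonneg: "0 \<le> P"
begin

lemma weighted_power_le:
  assumes "i \<in> {1..r}" "j \<in> {1..r}" "\<bar>m i j\<bar> \<le> b"
  shows "\<bar>\<alpha> i j * m i j ^ n\<bar> \<le> A * b ^ n"
proof -
  have "\<bar>\<alpha> i j\<bar> \<le> A" using weight[OF assms(1,2)] a_pos by auto
  moreover have "\<bar>m i j ^ n\<bar> \<le> b ^ n" using assms(3) by (simp add: power_abs power_mono)
  ultimately show ?thesis unfolding abs_mult by (intro mult_mono) auto
qed

lemma A_pos: "r \<ge> 1 \<Longrightarrow> A > 0"
  using weight[of 1 1] a_pos by auto

lemma kappa_power_le: "n \<le> k \<Longrightarrow> \<kappa> ^ k \<le> \<kappa> ^ n"
  using \<kappa> by (simp add: power_decreasing)

text \<open>The two off-diagonal entries lie in row and column \<open>c\<close> of the same diagonal entry, so the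
  arithmetic-geometric mean inequality reduces their product to squares that \<open>P\<close> controls.\<close>

lemma cross_le:
  assumes "i \<in> {1..r}" "j \<in> {1..r}" "c \<in> {1..r}" "i \<noteq> c" "j \<noteq> c"
  shows "\<bar>m i c\<bar> * m c c ^ (q+1) * \<bar>m c j\<bar> \<le> P"
proof -
  have "\<bar>m i c\<bar> * \<bar>m c j\<bar> \<le> ((m i c)\<^sup>2 + (m c j)\<^sup>2) / 2"
    using sum_squares_bound[of "\<bar>m i c\<bar>" "\<bar>m c j\<bar>"] by simp
  hence "\<bar>m i c\<bar> * \<bar>m c j\<bar> * m c c ^ (q+1) \<le> ((m i c)\<^sup>2 + (m c j)\<^sup>2) / 2 * m c c ^ (q+1)"
    using diag_nonneg[OF assms(3)] by (intro mult_right_mono) auto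
  also have "\<dots> = ((m i c)\<^sup>2 * m c c ^ (q+1) + (m c j)\<^sup>2 * m c c ^ (q+1)) / 2"
    by (simp add: field_simps)
  also have "\<dots> \<le> P" using P_col[of i c] P_row[of c j] assms by auto
  finally show ?thesis by (simp add: mult_ac)
qed

text \<open>Two off-diagonal factors come from outside the bracket, and each term of the bracket contributes
  \<open>q\<close> more.\<close>

lemma summand_le_power:
  assumes r: "i \<in> {1..r}" "j \<in> {1..r}" "k \<in> {1..r}" "l \<in> {1..r}"
    and b: "\<bar>m i k * m l k * m l j\<bar> \<le> \<kappa>\<^sup>2" "l \<noteq> j" "l \<noteq> k"
  shows "\<bar>drag_summand q \<alpha> m i j k l\<bar> \<le> 2 * A * \<kappa> ^ (q+2)"
proof -
  have "\<bar>\<alpha> l j * m l j ^ q + \<alpha> l k * m l k ^ q\<bar> \<le> A * \<kappa> ^ q + A * \<kappa> ^ q"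
    using weighted_power_le[OF r(4) r(2) off_small, of q]
      weighted_power_le[OF r(4) r(3) off_small, of q] b r by linarith
  hence "\<bar>drag_summand q \<alpha> m i j k l\<bar> \<le> \<kappa>\<^sup>2 * (A * \<kappa> ^ q + A * \<kappa> ^ q)"
    unfolding drag_summand_def abs_mult[of _ "_ + _"] using b
    by (intro mult_mono) auto
  thus ?thesis by (simp add: power_add power2_eq_square algebra_simps)
qed

text \<open>Every summand other than \<open>k = l = i\<close> contains two off-diagonal factors. They are accompanied either
  by \<open>q\<close> further off-diagonal factors, or by the power \<open>q + 1\<close> of the diagonal entry in
  their row or column, which is what \<open>P\<close> bounds.\<close>

lemma drag_diag:
  assumes i: "i \<in> {1..r}"
  shows "\<bar>drag q r \<alpha> m i i - \<alpha> i i * m i i ^ (q+3)\<bar> \<le> real r ^ 2 * A * (P + \<kappa> ^ (q+2))"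
proof -
  let ?I = "{1..r}"
  have A0: "A > 0" using A_pos i by auto
  have main: "drag_summand q \<alpha> m i i i i = 2 * (\<alpha> i i * m i i ^ (q+3))"
    by (simp add: drag_summand_def power_add power3_eq_cube algebra_simps)
  have b: "\<bar>drag_summand q \<alpha> m i i k l\<bar> \<le> 2 * A * (P + \<kappa> ^ (q+2))"
    if k: "k \<in> ?I" and l: "l \<in> ?I" and ne: "\<not> (k = i \<and> l = i)" for k l
  proof -
    consider "k = l" "k \<noteq> i" | "l = i" "k \<noteq> i" | "l \<noteq> i" "k \<noteq> l" using ne by blast
    thus ?thesis
    proof cases
      case 1
      have 2: "drag_summand q \<alpha> m i i k l = m i k * m k i * m k k * (\<alpha> k i * m k i ^ q)
          + \<alpha> k k * (m i k * m k k ^ (q+1) * m k i)"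
        by (simp add: 1 drag_summand_def algebra_simps)
      have "\<bar>m i k * m k i * m k k * (\<alpha> k i * m k i ^ q)\<bar> \<le> (\<kappa> * \<kappa> * 1) * (A * \<kappa> ^ q)"
        unfolding abs_mult[of _ "\<alpha> k i * m k i ^ q"]
        using abs_prod3_le[of "m i k" \<kappa> "m k i" \<kappa> "m k k" 1] weighted_power_le[of k i \<kappa> q]
          off_small entry_le_1 k i 1 \<kappa> by (intro mult_mono) auto
      moreover have "\<bar>\<alpha> k k * (m i k * m k k ^ (q+1) * m k i)\<bar> \<le> A * P"
        unfolding abs_mult
        using cross_le[of i i k] weight[OF k k] a_pos k i 1 A0 P_nonneg diag_nonneg[OF k]
        by (intro mult_mono) auto
      moreover have "\<kappa> * \<kappa> * 1 * (A * \<kappa> ^ q) = A * \<kappa> ^ (q+2)" by (simp add: power2_eq_square power_add)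
      moreover have "0 \<le> A * P" "0 \<le> A * \<kappa> ^ (q+2)" using A0 P_nonneg \<kappa> by auto
      ultimately show ?thesis unfolding 2 by (simp add: algebra_simps abs_le_iff)
    next
      case 2
      have 3: "drag_summand q \<alpha> m i i k l = m i k * m i k * m i i * (\<alpha> i k * m i k ^ q)
          + \<alpha> i i * ((m i k)\<^sup>2 * m i i ^ (q+1))"
        by (simp add: 2 drag_summand_def power2_eq_square algebra_simps)
      have "\<bar>m i k * m i k * m i i * (\<alpha> i k * m i k ^ q)\<bar> \<le> (\<kappa> * \<kappa> * 1) * (A * \<kappa> ^ q)"
        unfolding abs_mult[of _ "\<alpha> i k * m i k ^ q"]
        using abs_prod3_le[of "m i k" \<kappa> "m i k" \<kappa> "m i i" 1] weighted_power_le[of i k \<kappa> q]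
          off_small entry_le_1 k i 2 \<kappa> by (intro mult_mono) auto
      moreover have "\<bar>\<alpha> i i * ((m i k)\<^sup>2 * m i i ^ (q+1))\<bar> \<le> A * P"
        unfolding abs_mult[of "\<alpha> i i"]
        using P_row[of i k] weight[OF i i] a_pos k i 2 A0 P_nonneg diag_nonneg[OF i]
        by (intro mult_mono) auto
      moreover have "\<kappa> * \<kappa> * 1 * (A * \<kappa> ^ q) = A * \<kappa> ^ (q+2)" by (simp add: power2_eq_square power_add)
      moreover have "0 \<le> A * P" "0 \<le> A * \<kappa> ^ (q+2)" using A0 P_nonneg \<kappa> by auto
      ultimately show ?thesis unfolding 3 by (simp add: algebra_simps abs_le_iff)
    next
      case 3
      have "\<bar>m i k * m l k * m l i\<bar> \<le> 1 * \<kappa> * \<kappa>"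
        using 3 k l i entry_le_1 off_small by (intro abs_prod3_le) auto
      hence "\<bar>drag_summand q \<alpha> m i i k l\<bar> \<le> 2 * A * \<kappa> ^ (q+2)"
        using 3 k l i by (intro summand_le_power) (auto simp: power2_eq_square)
      thus ?thesis using A0 P_nonneg by (simp add: algebra_simps add_increasing)
    qed
  qed
  define B where "B = 2 * A * (P + \<kappa> ^ (q+2))"
  have B0: "B \<ge> 0" unfolding B_def using A0 P_nonneg \<kappa> by auto
  have bB: "\<bar>drag_summand q \<alpha> m i i (fst x) (snd x)\<bar> \<le> B" if "x \<in> ?I\<times>?I-{(i,i)}" for x
    unfolding B_def using that by (intro b) (auto simp: prod_eq_iff)
  have "(\<Sum>k\<in>?I. \<Sum>l\<in>?I. drag_summand q \<alpha> m i i k l) - drag_summand q \<alpha> m i i i i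
      = (\<Sum>x\<in>?I\<times>?I. drag_summand q \<alpha> m i i (fst x) (snd x)) - drag_summand q \<alpha> m i i i i"
    by (simp add: sum.cartesian_product case_prod_unfold)
  also have "\<dots> = (\<Sum>x\<in>?I\<times>?I-{(i,i)}. drag_summand q \<alpha> m i i (fst x) (snd x))"
    using i by (subst sum_diff1) auto
  also have "\<bar>\<dots>\<bar> \<le> (\<Sum>x\<in>?I\<times>?I-{(i,i)}. B)"
    by (rule order_trans[OF sum_abs sum_mono[OF bB]])
  also have "\<dots> = real (card (?I\<times>?I-{(i,i)})) * B" by simp
  also have "\<dots> \<le> real (card (?I\<times>?I)) * B"
    using B0 by (intro mult_right_mono of_nat_mono card_mono) auto
  also have "\<dots> = real r ^ 2 * B" by (simp add: power2_eq_square)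
  finally show ?thesis using main unfolding drag_def B_def by (simp add: algebra_simps abs_le_iff)
qed

text \<open>The three summands that are kept have a single off-diagonal factor outside the bracket, from the pair
  \<open>m\<^sub>i\<^sub>j, m\<^sub>j\<^sub>i\<close>, so they are as large as the pair itself once the diagonal
  entries are of order 1; they are \<open>(k,l) = (j,j), (i,i), (i,j)\<close>. Among the others, \<open>l = j\<close>
  produces \<open>m\<^sub>i\<^sub>k m\<^sub>j\<^sub>k m\<^sub>j\<^sub>j^(q+1)\<close>. The factor
  \<open>m\<^sub>i\<^sub>k\<close> is not in row or column \<open>j\<close>, so \<open>P\<close> does not cover this
  product. The bound \<open>H\<close> for the rest of it is left open because it is chosen differently before the
  escape, in the energy estimate, and in the final trap.\<close>

lemma drag_off:
  assumes i: "i \<in> {1..r}" and j: "j \<in> {1..r}" and ij: "i \<noteq> j"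
    and H: "\<And>k. k \<in> {1..r} \<Longrightarrow> k \<noteq> j \<Longrightarrow> \<bar>m j k\<bar> * m j j ^ (q+1) \<le> H" "0 \<le> H"
  shows "\<bar>drag q r \<alpha> m i j - (m i j * (\<alpha> j j * m j j ^ (q+2))
     + 1/2 * (m i i)\<^sup>2 * m i j * (\<alpha> i j * m i j ^ q + \<alpha> i i * m i i ^ q)
     + 1/2 * m i i * m j j * m j i * (\<alpha> j j * m j j ^ q + \<alpha> j i * m j i ^ q))\<bar>
     \<le> real r ^ 2 * A * (\<kappa> ^ (q+2) + P + \<kappa> * H)"
proof -
  let ?I = "{1..r}" and ?T = "drag_summand q \<alpha> m i j"
  have A0: "A > 0" using A_pos i by auto
  have main: "?T j j + ?T i i + ?T i j = 2 * (m i j * (\<alpha> j j * m j j ^ (q+2))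
     + 1/2 * (m i i)\<^sup>2 * m i j * (\<alpha> i j * m i j ^ q + \<alpha> i i * m i i ^ q)
     + 1/2 * m i i * m j j * m j i * (\<alpha> j j * m j j ^ q + \<alpha> j i * m j i ^ q))"
    by (simp add: drag_summand_def power_add power2_eq_square algebra_simps)
  have b: "\<bar>?T k l\<bar> \<le> 2 * A * (\<kappa> ^ (q+2) + P + \<kappa> * H)"
    if k: "k \<in> ?I" and l: "l \<in> ?I" and ne: "(k,l) \<notin> {(j,j),(i,i),(i,j)}" for k l
  proof -
    have n: "0 \<le> A * P" "0 \<le> A * \<kappa> ^ (q+2)" "0 \<le> A * (\<kappa> * H)"
      using A0 P_nonneg \<kappa> H by auto
    have fin: ?thesis if "\<bar>?T k l\<bar> \<le> 2 * A * \<kappa> ^ (q+2)"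
      using that n by (simp add: algebra_simps)
    consider "k = l" "k \<noteq> i" "k \<noteq> j" | "l = j" "k \<noteq> j" "k \<noteq> i" | "l \<noteq> j" "k \<noteq> l" using ne by auto
    thus ?thesis
    proof cases
      case 1
      have 2: "?T k l = m i k * m k j * m k k * (\<alpha> k j * m k j ^ q)
          + \<alpha> k k * (m i k * m k k ^ (q+1) * m k j)"
        by (simp add: 1 drag_summand_def algebra_simps)
      have "\<bar>m i k * m k j * m k k * (\<alpha> k j * m k j ^ q)\<bar> \<le> (\<kappa> * \<kappa> * 1) * (A * \<kappa> ^ q)"
        unfolding abs_mult[of _ "\<alpha> k j * m k j ^ q"]
        using abs_prod3_le[of "m i k" \<kappa> "m k j" \<kappa> "m k k" 1] weighted_power_le[of k j \<kappa> q]
          off_small entry_le_1 k i j 1 \<kappa> by (intro mult_mono) auto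
      moreover have "\<bar>\<alpha> k k * (m i k * m k k ^ (q+1) * m k j)\<bar> \<le> A * P"
        unfolding abs_mult
        using cross_le[of i j k] weight[OF k k] a_pos k i j 1 A0 P_nonneg diag_nonneg[OF k]
        by (intro mult_mono) auto
      moreover have "\<kappa> * \<kappa> * 1 * (A * \<kappa> ^ q) = A * \<kappa> ^ (q+2)" by (simp add: power2_eq_square power_add)
      ultimately show ?thesis unfolding 2 using n by (simp add: algebra_simps abs_le_iff)
    next
      case 2
      have 3: "?T k l = m i k * m j k * m j j * (\<alpha> j k * m j k ^ q)
          + \<alpha> j j * (m i k * (m j k * m j j ^ (q+1)))"
        by (simp add: 2 drag_summand_def algebra_simps)
      have "\<bar>m i k * m j k * m j j * (\<alpha> j k * m j k ^ q)\<bar> \<le> (\<kappa> * \<kappa> * 1) * (A * \<kappa> ^ q)"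
        unfolding abs_mult[of _ "\<alpha> j k * m j k ^ q"]
        using abs_prod3_le[of "m i k" \<kappa> "m j k" \<kappa> "m j j" 1] weighted_power_le[of j k \<kappa> q]
          off_small entry_le_1 k i j 2 \<kappa> by (intro mult_mono) auto
      moreover have "\<bar>m i k * (m j k * m j j ^ (q+1))\<bar> \<le> \<kappa> * H"
        unfolding abs_mult[of "m i k"] using off_small[of i k] H(1)[of k] k i j 2 \<kappa> diag_nonneg[OF j]
        by (intro mult_mono) (auto simp: abs_mult)
      hence "\<bar>\<alpha> j j * (m i k * (m j k * m j j ^ (q+1)))\<bar> \<le> A * (\<kappa> * H)"
        unfolding abs_mult[of "\<alpha> j j"] using weight[OF j j] a_pos by (intro mult_mono) auto
      moreover have "\<kappa> * \<kappa> * 1 * (A * \<kappa> ^ q) = A * \<kappa> ^ (q+2)" by (simp add: power2_eq_square power_add)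
      ultimately show ?thesis unfolding 3 using n by (simp add: algebra_simps abs_le_iff)
    next
      case 3
      have "\<bar>m i k * m l k * m l j\<bar> \<le> 1 * \<kappa> * \<kappa>"
        using 3 k l i j entry_le_1 off_small by (intro abs_prod3_le) auto
      hence "\<bar>?T k l\<bar> \<le> 2 * A * \<kappa> ^ (q+2)"
        using 3 k l i j by (intro summand_le_power) (auto simp: power2_eq_square)
      thus ?thesis by (rule fin)
    qed
  qed
  define B where "B = 2 * A * (\<kappa> ^ (q+2) + P + \<kappa> * H)"
  have B0: "B \<ge> 0" unfolding B_def using A0 P_nonneg \<kappa> H by auto
  let ?S = "{(j,j),(i,i),(i,j)}"
  have bB: "\<bar>?T (fst x) (snd x)\<bar> \<le> B" if "x \<in> ?I\<times>?I-?S" for x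
    unfolding B_def using that by (intro b) (auto simp: prod_eq_iff)
  have "(\<Sum>k\<in>?I. \<Sum>l\<in>?I. ?T k l) - (?T j j + ?T i i + ?T i j)
      = (\<Sum>x\<in>?I\<times>?I. ?T (fst x) (snd x)) - (\<Sum>x\<in>?S. ?T (fst x) (snd x))"
    using ij by (simp add: sum.cartesian_product case_prod_unfold)
  also have "\<dots> = (\<Sum>x\<in>?I\<times>?I-?S. ?T (fst x) (snd x))"
    using i j by (subst sum_diff) auto
  also have "\<bar>\<dots>\<bar> \<le> (\<Sum>x\<in>?I\<times>?I-?S. B)"
    by (rule order_trans[OF sum_abs sum_mono[OF bB]])
  also have "\<dots> = real (card (?I\<times>?I-?S)) * B" by simp
  also have "\<dots> \<le> real (card (?I\<times>?I)) * B"
    using B0 by (intro mult_right_mono of_nat_mono card_mono) auto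
  also have "\<dots> = real r ^ 2 * B" by (simp add: power2_eq_square)
  finally show ?thesis unfolding main unfolding drag_def B_def by (simp add: algebra_simps abs_le_iff)
qed

end

section \<open>Comparison principles for scalar differential inequalities\<close>

text \<open>Derivatives are taken within \<open>[0, \<infinity>)\<close>, since at time 0 the flow has only a one-sided
  derivative.\<close>

lemma within_Ici_interior:
  fixes f :: "real \<Rightarrow> real"
  assumes "(f has_real_derivative D) (at t within {0..})" "t > 0"
  shows "(f has_real_derivative D) (at t)"
proof -
  have "at t within {0..} = at t" using assms(2) by (intro at_within_interior) auto
  thus ?thesis using assms(1) by simp
qed

lemma cont_within_Ici:
  fixes f :: "real \<Rightarrow> real"
  assumes "\<And>t. s \<le> t \<Longrightarrow> t \<le> \<tau> \<Longrightarrow> (f has_real_derivative D t) (at t within {0..})" "0 \<le> s"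
  shows "continuous_on {s..\<tau>} f"
proof (rule DERIV_continuous_on)
  fix t assume "t \<in> {s..\<tau>}"
  thus "(f has_real_derivative D t) (at t within {s..\<tau>})"
    using assms(2) by (intro DERIV_subset[OF assms(1)]) auto
qed

lemma nondecreasing_within:
  fixes f :: "real \<Rightarrow> real"
  assumes d: "\<And>t. s \<le> t \<Longrightarrow> t \<le> \<tau> \<Longrightarrow> (f has_real_derivative D t) (at t within {0..})"
    and D: "\<And>t. s \<le> t \<Longrightarrow> t \<le> \<tau> \<Longrightarrow> D t \<ge> 0" and s: "0 \<le> s" "s \<le> \<tau>"
  shows "f s \<le> f \<tau>"
proof (rule DERIV_nonneg_imp_increasing_open[OF s(2)])
  show "continuous_on {s..\<tau>} f" by (rule cont_within_Ici[OF d s(1)])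
  fix x assume "s < x" "x < \<tau>"
  thus "\<exists>y. (f has_real_derivative y) (at x) \<and> 0 \<le> y"
    using within_Ici_interior[OF d[of x]] D[of x] s by (intro exI[of _ "D x"]) auto
qed

text \<open>Up to and including the first time at which some \<open>f c\<close> is nonnegative, all of them are \<open>\<le>
  0\<close>; at that time the hypothesis \<open>step\<close> gives a strict sign, a contradiction. Weak inequalities
  on the past have to yield strict ones at the present, which is the form in which the escape argument improves its
  own assumptions.\<close>

lemma continuation_bootstrap:
  fixes f :: "'i \<Rightarrow> real \<Rightarrow> real"
  assumes fin: "finite C" and cont: "\<And>c. c \<in> C \<Longrightarrow> continuous_on {s..\<tau>} (f c)"
    and step: "\<And>t c. s \<le> t \<Longrightarrow> t \<le> \<tau> \<Longrightarrow> (\<And>u d. s \<le> u \<Longrightarrow> u \<le> t \<Longrightarrow> d \<in> C \<Longrightarrow> f d u \<le> 0) \<Longrightarrow>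
       c \<in> C \<Longrightarrow> f c t < 0"
    and init: "\<And>c. c \<in> C \<Longrightarrow> f c s \<le> 0"
    and t: "s \<le> t" "t \<le> \<tau>" and c: "c \<in> C"
  shows "f c t < 0"
proof (rule ccontr)
  assume neg: "\<not> f c t < 0"
  define S where "S = (\<Union>c\<in>C. {u \<in> {s..\<tau>}. f c u \<ge> 0})"
  have S_eq: "S = (\<Union>c\<in>C. {s..\<tau>} \<inter> f c -` {0..})" by (auto simp: S_def)
  have "closed S" unfolding S_eq
    by (intro closed_UN[OF fin] ballI continuous_closed_preimage cont) auto
  have tS: "t \<in> S" using neg t c by (auto simp: S_def not_less)
  have bdd: "bdd_below S" by (auto simp: S_def bdd_below_def intro!: exI[of _ s])
  define t0 where "t0 = Inf S"
  have t0: "t0 \<in> S" unfolding t0_def using \<open>closed S\<close> tS bdd by (intro closed_contains_Inf) auto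
  have t0r: "s \<le> t0" "t0 \<le> \<tau>" using t0 by (auto simp: S_def)
  have before: "f d u < 0" if "s \<le> u" "u < t0" "d \<in> C" for d u
  proof (rule ccontr)
    assume "\<not> f d u < 0"
    hence "u \<in> S" using that t0r by (auto simp: S_def not_less)
    hence "t0 \<le> u" unfolding t0_def using bdd by (rule cInf_lower)
    thus False using that by simp
  qed
  have at: "f d t0 \<le> 0" if d: "d \<in> C" for d
  proof (cases "t0 = s")
    case True thus ?thesis using init d by simp
  next
    case False
    hence "s < t0" using t0r by simp
    have "continuous_on {s..t0} (f d)" using cont[OF d] t0r by (auto intro: continuous_on_subset)
    hence lim: "(f d \<longlongrightarrow> f d t0) (at t0 within {s..t0})"
      using t0r by (auto simp: continuous_on_def)
    have nb: "at t0 within {s..t0} \<noteq> bot"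
      using \<open>s < t0\<close> by (simp add: at_within_Icc_at_left)
    have ev: "eventually (\<lambda>u. f d u \<le> 0) (at t0 within {s..t0})"
      unfolding eventually_at_filter
      by (rule always_eventually) (use before[of _ d] d in \<open>auto simp: less_le\<close>)
    show ?thesis by (rule tendsto_upperbound[OF lim ev nb])
  qed
  have "f d t0 < 0" if "d \<in> C" for d
    using step[of t0 d] t0r before at that by (metis less_eq_real_def)
  thus False using t0 by (auto simp: S_def not_less dest: leD)
qed

text \<open>For an invariant region a condition on its boundary suffices: if \<open>f c\<close> vanished for the first time
  with negative derivative, it would have been positive just before.\<close>

lemma barrier:
  fixes f :: "'i \<Rightarrow> real \<Rightarrow> real"
  assumes fin: "finite C" and s: "0 \<le> s"
    and d: "\<And>t c. s \<le> t \<Longrightarrow> c \<in> C \<Longrightarrow> (f c has_real_derivative D c t) (at t within {0..})"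
    and D: "\<And>t c. s \<le> t \<Longrightarrow> (\<And>d. d \<in> C \<Longrightarrow> f d t \<le> 0) \<Longrightarrow> c \<in> C \<Longrightarrow> f c t = 0 \<Longrightarrow> D c t < 0"
    and init: "\<And>c. c \<in> C \<Longrightarrow> f c s < 0" and t: "s \<le> t" and c: "c \<in> C"
  shows "f c t < 0"
proof (rule continuation_bootstrap[where C=C and s=s and \<tau>=t and f=f])
  show "continuous_on {s..t} (f c)" if "c \<in> C" for c
    by (rule cont_within_Ici[of _ _ _ "D c"]) (use d that s in auto)
  fix \<tau> c assume \<tau>: "s \<le> \<tau>" "\<tau> \<le> t" and c: "c \<in> C"
    and le: "\<And>u d. s \<le> u \<Longrightarrow> u \<le> \<tau> \<Longrightarrow> d \<in> C \<Longrightarrow> f d u \<le> 0"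
  show "f c \<tau> < 0"
  proof (rule ccontr)
    assume "\<not> f c \<tau> < 0"
    hence 0: "f c \<tau> = 0" using le[of \<tau> c] \<tau> c by auto
    hence st: "s < \<tau>" using init[OF c] \<tau> by (cases "s = \<tau>") auto
    have "D c \<tau> < 0" using D[of \<tau> c] le \<tau> c 0 by auto
    moreover have "(f c has_real_derivative D c \<tau>) (at \<tau>)"
      by (rule within_Ici_interior) (use d[OF \<tau>(1) c] st s in auto)
    ultimately obtain e where e: "e > 0" "\<And>h. 0 < h \<Longrightarrow> h < e \<Longrightarrow> f c \<tau> < f c (\<tau> - h)"
      using DERIV_neg_dec_left by blast
    define h where "h = min (e/2) (\<tau> - s)"
    have "0 < h" "h < e" "s \<le> \<tau> - h" using e(1) st by (auto simp: h_def min_def)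
    thus False using e(2)[of h] le[of "\<tau> - h" c] c 0 by auto
  qed
qed (use fin init t c in \<open>auto intro: less_imp_le\<close>)

lemma inverse_power_deriv:
  fixes w :: "real \<Rightarrow> real"
  assumes "(w has_real_derivative D) (at u within S)" "w u > 0"
  shows "((\<lambda>u. 1 / w u ^ q) has_real_derivative - (real q * D / w u ^ (q+1))) (at u within S)"
proof (cases q)
  case (Suc n)
  have "((\<lambda>u. inverse (w u ^ q)) has_real_derivative
      - (inverse (w u ^ q) * (real q * w u ^ (q - Suc 0) * D) * inverse (w u ^ q))) (at u within S)"
    using assms by (intro derivative_eq_intros) auto
  moreover have "inverse (w u ^ q) * (real q * w u ^ (q - Suc 0) * D) * inverse (w u ^ q)
      = real q * D / w u ^ (q+1)"
    using assms(2) by (simp add: Suc field_simps)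
  ultimately show ?thesis by (simp add: inverse_eq_divide)
qed simp

text \<open>Subtracting the variation of \<open>\<Psi>\<close> and the constant \<open>c\<close> from \<open>y\<close> gives
  a function \<open>w \<le> y\<close> with \<open>w' \<ge> a w^(q+1)\<close>. Then \<open>- 1 / w^q - q a u\<close> is
  nondecreasing in \<open>u\<close>, which bounds the time spent. The control function \<open>\<Psi>\<close> stands
  for an integral of the error: only its total variation matters, so \<open>\<Psi>'\<close> may be large for a short
  time.\<close>

lemma rise_time:
  fixes y \<Psi> :: "real \<Rightarrow> real"
  assumes dy: "\<And>u. s \<le> u \<Longrightarrow> u \<le> t \<Longrightarrow> (y has_real_derivative y' u) (at u within {0..})"
    and d\<Psi>: "\<And>u. s \<le> u \<Longrightarrow> u \<le> t \<Longrightarrow> (\<Psi> has_real_derivative \<Psi>' u) (at u within {0..})"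
    and ge: "\<And>u. s \<le> u \<Longrightarrow> u \<le> t \<Longrightarrow> y' u \<ge> a * y u ^ (q+1) + \<Psi>' u"
    and nonneg: "\<And>u. s \<le> u \<Longrightarrow> u \<le> t \<Longrightarrow> y u \<ge> 0"
    and var: "\<And>u. s \<le> u \<Longrightarrow> u \<le> t \<Longrightarrow> \<bar>\<Psi> u - \<Psi> s\<bar> \<le> c"
    and a: "a \<ge> 0" and c: "c < y s" and s: "0 \<le> s" "s \<le> t"
  shows "real q * a * (t - s) \<le> 1 / (y s - c) ^ q"
proof -
  \<comment> \<open>Subtracting \<open>c\<close> on top of the variation of \<open>\<Psi>\<close> ensures \<open>w \<le> y\<close>.\<close>
  define w where "w u = y u - (\<Psi> u - \<Psi> s) - c" for u
  have dw: "(w has_real_derivative y' u - \<Psi>' u) (at u within {0..})" if "s \<le> u" "u \<le> t" for u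
    unfolding w_def using dy[OF that] d\<Psi>[OF that] by (auto intro!: derivative_eq_intros)
  have ws: "w s = y s - c" by (simp add: w_def)
  have w_pos: "w u > 0" if u: "s \<le> u" "u \<le> t" for u
  proof -
    have "w s \<le> w u"
    proof (rule nondecreasing_within[where f=w and D="\<lambda>u. y' u - \<Psi>' u"])
      fix v assume v: "s \<le> v" "v \<le> u"
      have "0 \<le> a * y v ^ (q+1)" using a nonneg[of v] v u by (intro mult_nonneg_nonneg) auto
      thus "0 \<le> y' v - \<Psi>' v" using ge[of v] v u by linarith
    qed (use dw u s in auto)
    thus ?thesis using ws c by linarith
  qed
  have w_le: "w u \<le> y u" if u: "s \<le> u" "u \<le> t" for u
    using var[OF u] unfolding w_def by linarith
  define g where "g u = - (1 / w u ^ q) - real q * a * u" for u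
  have "g s \<le> g t"
  proof (rule nondecreasing_within[where f=g and D="\<lambda>u. real q * (y' u - \<Psi>' u) / w u ^ (q+1) - real q * a"])
    fix u assume u: "s \<le> u" "u \<le> t"
    have wp: "w u > 0" by (rule w_pos[OF u])
    show "(g has_real_derivative real q * (y' u - \<Psi>' u) / w u ^ (q + 1) - real q * a) (at u within {0..})"
      unfolding g_def using wp dw[OF u]
      using DERIV_diff[OF DERIV_minus[OF inverse_power_deriv[OF dw[OF u] wp, of q]] DERIV_cmult_Id[of "real q * a"]] by simp
    have "a * w u ^ (q+1) \<le> a * y u ^ (q+1)"
      using w_le[OF u] wp a by (intro mult_left_mono power_mono) auto
    hence "a * w u ^ (q+1) \<le> y' u - \<Psi>' u" using ge[OF u] by linarith
    hence "a \<le> (y' u - \<Psi>' u) / w u ^ (q+1)" using wp by (simp add: pos_le_divide_eq)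
    hence "real q * a \<le> real q * ((y' u - \<Psi>' u) / w u ^ (q+1))" by (intro mult_left_mono) auto
    thus "0 \<le> real q * (y' u - \<Psi>' u) / w u ^ (q + 1) - real q * a" by simp
  qed (use s in auto)
  moreover have "0 \<le> 1 / w t ^ q" using w_pos[of t] s by simp
  ultimately show ?thesis unfolding g_def ws right_diff_distrib by linarith
qed

text \<open>The mirror image of \<open>rise_time\<close>: here \<open>w \<ge> y\<close>, and an entry cannot blow up before
  its own blow-up time, up to the variation of \<open>\<Psi>\<close>.\<close>

lemma free_growth:
  fixes y \<Psi> :: "real \<Rightarrow> real"
  assumes dy: "\<And>u. s \<le> u \<Longrightarrow> u \<le> t \<Longrightarrow> (y has_real_derivative y' u) (at u within {0..})"
    and d\<Psi>: "\<And>u. s \<le> u \<Longrightarrow> u \<le> t \<Longrightarrow> (\<Psi> has_real_derivative \<Psi>' u) (at u within {0..})"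
    and le: "\<And>u. s \<le> u \<Longrightarrow> u \<le> t \<Longrightarrow> y' u \<le> a * y u ^ (q+1) - \<Psi>' u"
    and pos: "\<And>u. s \<le> u \<Longrightarrow> u \<le> t \<Longrightarrow> y u > 0"
    and var: "\<And>u. s \<le> u \<Longrightarrow> u \<le> t \<Longrightarrow> \<bar>\<Psi> u - \<Psi> s\<bar> \<le> c"
    and a: "a \<ge> 0" and s: "0 \<le> s" "s \<le> t"
  shows "1 / y t ^ q \<ge> 1 / (y s + c) ^ q - real q * a * (t - s)"
proof -
  define w where "w u = y u + (\<Psi> u - \<Psi> s) + c" for u
  have dw: "(w has_real_derivative y' u + \<Psi>' u) (at u within {0..})" if "s \<le> u" "u \<le> t" for u
    unfolding w_def using dy[OF that] d\<Psi>[OF that] by (auto intro!: derivative_eq_intros)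
  have ws: "w s = y s + c" by (simp add: w_def)
  have w_ge: "w u \<ge> y u" if u: "s \<le> u" "u \<le> t" for u
    using var[OF u] unfolding w_def by linarith
  define g where "g u = 1 / w u ^ q + real q * a * u" for u
  have "g s \<le> g t"
  proof (rule nondecreasing_within[where f=g and D="\<lambda>u. real q * a - real q * (y' u + \<Psi>' u) / w u ^ (q+1)"])
    fix u assume u: "s \<le> u" "u \<le> t"
    have wp: "w u > 0" using w_ge[OF u] pos[OF u] by linarith
    show "(g has_real_derivative real q * a - real q * (y' u + \<Psi>' u) / w u ^ (q + 1)) (at u within {0..})"
      unfolding g_def using wp dw[OF u]
      using DERIV_add[OF inverse_power_deriv[OF dw[OF u] wp, of q] DERIV_cmult_Id[of "real q * a"]] by simp
    have "a * y u ^ (q+1) \<le> a * w u ^ (q+1)"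
      using w_ge[OF u] pos[OF u] a by (intro mult_left_mono power_mono) auto
    hence "y' u + \<Psi>' u \<le> a * w u ^ (q+1)" using le[OF u] by linarith
    hence "(y' u + \<Psi>' u) / w u ^ (q+1) \<le> a" using wp by (simp add: pos_divide_le_eq)
    hence "real q * ((y' u + \<Psi>' u) / w u ^ (q+1)) \<le> real q * a" by (intro mult_left_mono) auto
    thus "0 \<le> real q * a - real q * (y' u + \<Psi>' u) / w u ^ (q + 1)" by simp
  qed (use s in auto)
  moreover have "1 / w t ^ q \<le> 1 / y t ^ q"
    using w_ge[of t] pos[of t] s by (intro divide_left_mono power_mono) auto
  ultimately show ?thesis unfolding g_def ws by (simp add: algebra_simps)
qed

text \<open>The differential inequality is only available while \<open>y \<ge> 0\<close>, so nonnegativity and the lower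
  bound are obtained together by continuation.\<close>

lemma stays_above:
  fixes y \<Psi> :: "real \<Rightarrow> real"
  assumes dy: "\<And>u. s \<le> u \<Longrightarrow> u \<le> t \<Longrightarrow> (y has_real_derivative y' u) (at u within {0..})"
    and d\<Psi>: "\<And>u. s \<le> u \<Longrightarrow> u \<le> t \<Longrightarrow> (\<Psi> has_real_derivative \<Psi>' u) (at u within {0..})"
    and ge: "\<And>u. s \<le> u \<Longrightarrow> u \<le> t \<Longrightarrow> y u \<ge> 0 \<Longrightarrow> y' u \<ge> \<Psi>' u"
    and var: "\<And>u. s \<le> u \<Longrightarrow> u \<le> t \<Longrightarrow> \<bar>\<Psi> u - \<Psi> s\<bar> \<le> c"
    and c: "c < y s" and s: "0 \<le> s" "s \<le> t"
  shows "y t \<ge> y s - c \<and> y t > 0"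
proof -
  have mono: "y u \<ge> y s - c" if u: "s \<le> u" "u \<le> t" and nn: "\<And>v. s \<le> v \<Longrightarrow> v \<le> u \<Longrightarrow> y v \<ge> 0" for u
  proof -
    have "y s - \<Psi> s \<le> y u - \<Psi> u"
      by (rule nondecreasing_within[where f="\<lambda>v. y v - \<Psi> v" and D="\<lambda>v. y' v - \<Psi>' v"])
         (use dy d\<Psi> ge nn u s in \<open>auto intro!: derivative_eq_intros\<close>)
    thus ?thesis using var[OF u] by linarith
  qed
  have neg: "- y u < 0" if u: "s \<le> u" "u \<le> t" for u
  proof (rule continuation_bootstrap[where C="{()}" and s=s and \<tau>=t and f="\<lambda>_ u. - y u"])
    show "continuous_on {s..t} (\<lambda>u. - y u)"
      by (intro continuous_intros cont_within_Ici[of _ _ _ y']) (use dy s in auto)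
    fix v assume v: "s \<le> v" "v \<le> t" and "\<And>u d. s \<le> u \<Longrightarrow> u \<le> v \<Longrightarrow> d \<in> {()} \<Longrightarrow> - y u \<le> 0"
    hence "y v \<ge> y s - c" by (intro mono) auto
    thus "- y v < 0" using c by linarith
  next
    have "c \<ge> 0" using var[of s] s by simp
    thus "- y s \<le> 0" using c by simp
  qed (use u in auto)
  have "y t \<ge> y s - c"
  proof (rule mono)
    fix v assume "s \<le> v" "v \<le> t"
    thus "0 \<le> y v" using neg[of v] by simp
  qed (use s in auto)
  thus ?thesis using c by linarith
qed

section \<open>Dissipation of the off-diagonal energy\<close>

lemma exp_minus_2_ge: "1/8 \<le> exp (-2::real)"
proof -
  have "exp (2::real) = exp 1 ^ 2" by (simp flip: exp_of_nat_mult)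
  also have "\<dots> \<le> (272/100)^2" using e_less_272 by (intro power_mono) auto
  finally have "exp (2::real) \<le> 8" by (simp add: power2_eq_square)
  thus ?thesis by (simp add: exp_minus field_simps)
qed

text \<open>Algebraic core of the energy estimate. Here \<open>z, w\<close> are the entries of an off-diagonal pair,
  \<open>x, y\<close> the two diagonal entries, and \<open>X, Y\<close> their drifts \<open>\<alpha> x^(q+1)\<close>,
  \<open>\<alpha> y^(q+1)\<close>; the left-hand side is, to leading order, the derivative of \<open>(z\<^sup>2 +
  w\<^sup>2) exp (-x-y)\<close> divided by the exponential. The drag damps the pair at a rate proportional to \<open>X
  x\<close> and \<open>Y y\<close>, which is too weak for small \<open>x, y\<close> against the cross terms in
  \<open>z w\<close>. The last line comes from differentiating the weight and supplies the rates \<open>X (1 -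
  x\<^sup>2)\<close> and \<open>Y (1 - y\<^sup>2)\<close>, which are strong exactly there.\<close>

lemma pair_dissipation:
  fixes z w x y X Y a1 a2 A \<kappa> :: real
  assumes x: "0 \<le> x" "x \<le> 1" and y: "0 \<le> y" "y \<le> 1" and XY: "0 \<le> X" "0 \<le> Y"
    and zw: "\<bar>z\<bar> \<le> \<kappa>" "\<bar>w\<bar> \<le> \<kappa>" and a: "0 \<le> a1" "a1 \<le> A" "0 \<le> a2" "a2 \<le> A"
  shows "(a1 * (2 - x\<^sup>2) * z^(q+2) - 2 * z\<^sup>2 * Y * y - z\<^sup>2 * X * x - x * z * w * Y - x * y * a2 * z * w^(q+1))
     + (a2 * (2 - y\<^sup>2) * w^(q+2) - 2 * w\<^sup>2 * X * x - w\<^sup>2 * Y * y - y * z * w * X - x * y * a1 * w * z^(q+1))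
     - (z\<^sup>2 + w\<^sup>2) * (X * (1 - x\<^sup>2) + Y * (1 - y\<^sup>2))
     \<le> - (1/2) * (z\<^sup>2 + w\<^sup>2) * (X + Y) + 3 * A * \<kappa>^q * (z\<^sup>2 + w\<^sup>2)"
proof -
  have k: "0 \<le> \<kappa>" using zw by linarith
  have A: "0 \<le> A" using a by linarith
  have sq: "2 * \<bar>z * w\<bar> \<le> z\<^sup>2 + w\<^sup>2"
    using sum_squares_bound[of "\<bar>z\<bar>" "\<bar>w\<bar>"] by (simp add: abs_mult)
  have damp: "- 2 * u\<^sup>2 * Y * y - v\<^sup>2 * Y * y - x * (z * w) * Y - (u\<^sup>2 + v\<^sup>2) * (Y * (1 - y\<^sup>2))
      \<le> - (1/2) * (u\<^sup>2 + v\<^sup>2) * Y"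
    if "0 \<le> x" "x \<le> 1" "0 \<le> y" "y \<le> 1" "0 \<le> Y" "2 * \<bar>z * w\<bar> \<le> u\<^sup>2 + v\<^sup>2" for u v x y Y :: real
  proof -
    have "- (x * (z * w)) \<le> \<bar>x * (z * w)\<bar>" by linarith
    also have "\<dots> \<le> 1 * \<bar>z * w\<bar>" unfolding abs_mult[of x] using that by (intro mult_right_mono) auto
    also have "\<dots> \<le> (u\<^sup>2 + v\<^sup>2) / 2" using that(6) by simp
    finally have 1: "- (x * (z * w)) \<le> (u\<^sup>2 + v\<^sup>2) / 2" .
    have 2: "0 \<le> u\<^sup>2 * y" "0 \<le> (u\<^sup>2 + v\<^sup>2) * (y * (1 - y))" using that by auto
    have "- 2 * u\<^sup>2 * y - v\<^sup>2 * y - x * (z * w) - (u\<^sup>2 + v\<^sup>2) * (1 - y\<^sup>2) \<le> - (1/2) * (u\<^sup>2 + v\<^sup>2)"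
      using 1 2 by (simp add: algebra_simps power2_eq_square)
    hence "Y * (- 2 * u\<^sup>2 * y - v\<^sup>2 * y - x * (z * w) - (u\<^sup>2 + v\<^sup>2) * (1 - y\<^sup>2))
        \<le> Y * (- (1/2) * (u\<^sup>2 + v\<^sup>2))" using that by (intro mult_left_mono) auto
    thus ?thesis by (simp add: algebra_simps)
  qed
  have free: "b * (2 - x\<^sup>2) * u^(q+2) \<le> 2 * A * \<kappa>^q * u\<^sup>2"
    if "0 \<le> b" "b \<le> A" "\<bar>u\<bar> \<le> \<kappa>" "0 \<le> x" "x \<le> 1" for b u x :: real
  proof -
    have "x\<^sup>2 \<le> 1" using that by (simp add: power_le_one)
    hence "\<bar>b * (2 - x\<^sup>2)\<bar> \<le> A * 2" unfolding abs_mult using that by (intro mult_mono) auto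
    moreover have "\<bar>u ^ q\<bar> \<le> \<kappa> ^ q" using that by (simp add: power_abs power_mono)
    ultimately have "\<bar>b * (2 - x\<^sup>2) * u ^ q\<bar> \<le> A * 2 * \<kappa> ^ q"
      unfolding abs_mult[of "b * _"] using A k by (intro mult_mono) auto
    hence "b * (2 - x\<^sup>2) * u ^ q * u\<^sup>2 \<le> A * 2 * \<kappa> ^ q * u\<^sup>2" by (intro mult_right_mono) auto
    thus ?thesis by (simp add: power_add power2_eq_square mult_ac)
  qed
  have mixed: "- (x * y * b * u * v^(q+1)) \<le> A * \<kappa>^q * (z\<^sup>2 + w\<^sup>2) / 2"
    if "0 \<le> b" "b \<le> A" "\<bar>v\<bar> \<le> \<kappa>" "\<bar>u * v\<bar> = \<bar>z * w\<bar>" for b u v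
  proof -
    have "\<bar>v ^ q\<bar> \<le> \<kappa> ^ q" using that by (simp add: power_abs power_mono)
    hence "\<bar>b * v ^ q\<bar> \<le> A * \<kappa> ^ q" unfolding abs_mult using that A by (intro mult_mono) auto
    moreover have "\<bar>x * y\<bar> \<le> 1 * 1" unfolding abs_mult using x y by (intro mult_mono) auto
    ultimately have "\<bar>x * y * (b * v ^ q)\<bar> \<le> 1 * (A * \<kappa> ^ q)"
      unfolding abs_mult[of "x * y"] by (intro mult_mono) auto
    moreover have "\<bar>u * v\<bar> \<le> (z\<^sup>2 + w\<^sup>2) / 2" using sq that by simp
    ultimately have "\<bar>x * y * (b * v ^ q) * (u * v)\<bar> \<le> 1 * (A * \<kappa> ^ q) * ((z\<^sup>2 + w\<^sup>2) / 2)"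
      unfolding abs_mult[of "x * y * (b * v ^ q)"] using A k by (intro mult_mono) auto
    thus ?thesis by (simp add: mult_ac abs_le_iff)
  qed
  show ?thesis
    using damp[OF x y XY(2) sq] damp[OF y x XY(1), of w z]
      free[OF a(1,2) zw(1) x] free[OF a(3,4) zw(2) y]
      mixed[OF a(3,4) zw(2), of z] mixed[OF a(1,2) zw(1), of w] sq
    by (simp add: algebra_simps add_divide_distrib)
qed

definition pair_const :: "nat \<Rightarrow> real \<Rightarrow> real" where
  "pair_const r A = 12 * real r ^ 2 * A + 8"

definition energy_const :: "nat \<Rightarrow> real \<Rightarrow> real" where
  "energy_const r A = real r ^ 2 * (8 * A + 2 * pair_const r A)"

text \<open>The deterministic system of an \<open>r \<times> r\<close> matrix of correlations. The bound \<open>e\<close> on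
  the perturbation is uniform in time.\<close>

locale correlation_flow =
  fixes q r :: nat and \<alpha> :: "nat \<Rightarrow> nat \<Rightarrow> real" and a A e :: real
    and m E :: "nat \<Rightarrow> nat \<Rightarrow> real \<Rightarrow> real"
  assumes q: "q \<ge> 1" and r: "r \<ge> 1" and a_pos: "a > 0" and A1: "A \<ge> 1"
    and weight: "\<And>i j. i \<in> {1..r} \<Longrightarrow> j \<in> {1..r} \<Longrightarrow> a \<le> \<alpha> i j \<and> \<alpha> i j \<le> A"
    and flow: "\<And>i j t. i \<in> {1..r} \<Longrightarrow> j \<in> {1..r} \<Longrightarrow> 0 \<le> t \<Longrightarrow>
       (m i j has_real_derivative
          \<alpha> i j * m i j t ^ (q+1) - drag q r \<alpha> (\<lambda>i j. m i j t) i j + E i j t) (at t within {0..})"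
    and entry_le_1: "\<And>i j t. i \<in> {1..r} \<Longrightarrow> j \<in> {1..r} \<Longrightarrow> 0 \<le> t \<Longrightarrow> \<bar>m i j t\<bar> \<le> 1"
    and noise: "\<And>i j t. i \<in> {1..r} \<Longrightarrow> j \<in> {1..r} \<Longrightarrow> 0 \<le> t \<Longrightarrow> \<bar>E i j t\<bar> \<le> e"
    and e_nonneg: "e \<ge> 0"
begin

definition corr_rate :: "nat \<Rightarrow> nat \<Rightarrow> real \<Rightarrow> real" where
  "corr_rate i j t = \<alpha> i j * m i j t ^ (q+1) - drag q r \<alpha> (\<lambda>i j. m i j t) i j + E i j t"

text \<open>The part of the error that is not pointwise small. Its time integral is small, because the energy dissipates at
  the rate \<open>leak\<close>.\<close>

definition leak :: "real \<Rightarrow> real" where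
  "leak t = (\<Sum>i=1..r. \<Sum>j\<in>{1..r}-{i}. (m i j t)\<^sup>2 * (m i i t ^ (q+1) + m j j t ^ (q+1)))"

text \<open>The weight decreases while the diagonal entries rise, which turns their growth into dissipation. On the interval
  \<open>[0, 1]\<close> it lies between \<open>exp (-2)\<close> and 1.\<close>

definition pair_energy :: "nat \<Rightarrow> nat \<Rightarrow> real \<Rightarrow> real" where
  "pair_energy i j t = ((m i j t)\<^sup>2 + (m j i t)\<^sup>2) * exp (- m i i t - m j j t)"

definition pair_rate :: "nat \<Rightarrow> nat \<Rightarrow> real \<Rightarrow> real" where
  "pair_rate i j t = exp (- m i i t - m j j t) * (2 * m i j t * corr_rate i j t + 2 * m j i t * corr_rate j i t
      - ((m i j t)\<^sup>2 + (m j i t)\<^sup>2) * (corr_rate i i t + corr_rate j j t))"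

definition energy :: "real \<Rightarrow> real" where
  "energy t = (\<Sum>i=1..r. \<Sum>j\<in>{1..r}-{i}. pair_energy i j t)"

definition energy_rate :: "real \<Rightarrow> real" where
  "energy_rate t = (\<Sum>i=1..r. \<Sum>j\<in>{1..r}-{i}. pair_rate i j t)"

lemma corr_deriv: "i \<in> {1..r} \<Longrightarrow> j \<in> {1..r} \<Longrightarrow> 0 \<le> t \<Longrightarrow>
    (m i j has_real_derivative corr_rate i j t) (at t within {0..})"
  unfolding corr_rate_def by (rule flow)

lemma pair_energy_deriv:
  assumes "i \<in> {1..r}" "j \<in> {1..r}" "0 \<le> t"
  shows "(pair_energy i j has_real_derivative pair_rate i j t) (at t within {0..})"
proof -
  note d = corr_deriv[OF assms(1,2,3)] corr_deriv[OF assms(2,1,3)] corr_deriv[OF assms(1,1,3)] corr_deriv[OF assms(2,2,3)]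
  show ?thesis unfolding pair_energy_def[abs_def] pair_rate_def
    by (rule derivative_eq_intros d refl)+ (simp add: algebra_simps power2_eq_square)
qed

lemma energy_deriv:
  assumes "0 \<le> t" shows "(energy has_real_derivative energy_rate t) (at t within {0..})"
  unfolding energy_def[abs_def] energy_rate_def using assms
  by (intro DERIV_sum pair_energy_deriv) auto

definition nearly_diagonal :: "real \<Rightarrow> real \<Rightarrow> bool" where
  "nearly_diagonal \<kappa> t \<longleftrightarrow> (\<forall>i\<in>{1..r}. 0 \<le> m i i t) \<and>
     (\<forall>i\<in>{1..r}. \<forall>j\<in>{1..r}. i \<noteq> j \<longrightarrow> \<bar>m i j t\<bar> \<le> \<kappa>)"

lemma diag_power_nonneg: "nearly_diagonal \<kappa> t \<Longrightarrow> i \<in> {1..r} \<Longrightarrow> 0 \<le> m i i t ^ n"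
  by (auto simp: nearly_diagonal_def)

lemma leak_ge:
  assumes nd: "nearly_diagonal \<kappa> t" and ij: "i \<in> {1..r}" "j \<in> {1..r}" "i \<noteq> j"
  shows "(m i j t)\<^sup>2 * (m i i t ^ (q+1) + m j j t ^ (q+1)) \<le> leak t"
proof -
  let ?f = "\<lambda>i j. (m i j t)\<^sup>2 * (m i i t ^ (q+1) + m j j t ^ (q+1))"
  have nn: "0 \<le> ?f i j" if "i \<in> {1..r}" "j \<in> {1..r}" for i j
    by (intro mult_nonneg_nonneg add_nonneg_nonneg zero_le_power2 diag_power_nonneg[OF nd] that)
  have "?f i j \<le> (\<Sum>j\<in>{1..r}-{i}. ?f i j)"
    by (rule member_le_sum) (use nn ij in auto)
  also have "\<dots> \<le> leak t" unfolding leak_def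
    by (rule member_le_sum[of i _ "\<lambda>i. \<Sum>j\<in>{1..r}-{i}. ?f i j"]) (use nn ij in \<open>auto intro!: sum_nonneg\<close>)
  finally show ?thesis .
qed

lemma leak_nonneg: "nearly_diagonal \<kappa> t \<Longrightarrow> 0 \<le> leak t"
  unfolding leak_def
  by (intro sum_nonneg mult_nonneg_nonneg add_nonneg_nonneg zero_le_power2 diag_power_nonneg) auto

lemma near_diagonalI:
  assumes nd: "nearly_diagonal \<kappa> t" and t: "0 \<le> t" and \<kappa>: "0 \<le> \<kappa>" "\<kappa> \<le> 1"
  shows "near_diagonal q r \<alpha> (\<lambda>i j. m i j t) a A \<kappa> (leak t)"
proof
  fix i j assume ij: "i \<in> {1..r}" "j \<in> {1..r}" "i \<noteq> j"
  have "0 \<le> (m i j t)\<^sup>2 * m i i t ^ (q+1)" "0 \<le> (m i j t)\<^sup>2 * m j j t ^ (q+1)"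
    by (intro mult_nonneg_nonneg zero_le_power2 diag_power_nonneg[OF nd] ij)+
  thus "(m i j t)\<^sup>2 * m i i t ^ (q+1) \<le> leak t" "(m i j t)\<^sup>2 * m j j t ^ (q+1) \<le> leak t"
    using leak_ge[OF nd ij] by (auto simp: algebra_simps)
qed (use a_pos weight entry_le_1 nd t \<kappa> leak_nonneg[OF nd] in \<open>auto simp: nearly_diagonal_def\<close>)

abbreviation C0 :: real where "C0 \<equiv> pair_const r A"
abbreviation C1 :: real where "C1 \<equiv> energy_const r A"

text \<open>Along the diagonal the leading drag term is \<open>\<alpha>\<^sub>i\<^sub>i m\<^sub>i\<^sub>i^(q+3)\<close>,
  which turns the free growth into logistic growth.\<close>

lemma diag_rate_error:
  assumes nd: "nearly_diagonal \<kappa> t" and t: "0 \<le> t" and \<kappa>: "0 \<le> \<kappa>" "\<kappa> \<le> 1" and i: "i \<in> {1..r}"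
  shows "\<bar>corr_rate i i t - \<alpha> i i * m i i t ^ (q+1) * (1 - (m i i t)\<^sup>2)\<bar>
    \<le> real r ^ 2 * A * (leak t + \<kappa> ^ (q+2)) + e"
proof -
  have "\<alpha> i i * m i i t ^ (q+1) * (1 - (m i i t)\<^sup>2) = \<alpha> i i * m i i t ^ (q+1) - \<alpha> i i * m i i t ^ (q+3)"
    by (simp add: algebra_simps power_add power2_eq_square power3_eq_cube)
  thus ?thesis
    using near_diagonal.drag_diag[OF near_diagonalI[OF nd t \<kappa>] i] noise[OF i i t] unfolding corr_rate_def by linarith
qed

text \<open>The error of \<open>drag_off\<close> enters the energy multiplied by \<open>m\<^sub>i\<^sub>j\<close>. Therefore
  the bound \<open>H = leak / \<bar>m\<^sub>i\<^sub>j\<bar>\<close> is affordable, and it holds because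
  \<open>m\<^sub>i\<^sub>j\<close> and \<open>m\<^sub>j\<^sub>k\<close> do lie in column and row \<open>j\<close>. The
  resulting errors all carry an extra factor \<open>\<kappa>\<close>.\<close>

lemma pair_rate_le:
  assumes nd: "nearly_diagonal \<kappa> t" and t: "0 \<le> t" and \<kappa>: "0 \<le> \<kappa>" "\<kappa> \<le> 1"
    and ij: "i \<in> {1..r}" "j \<in> {1..r}" "i \<noteq> j"
  shows "pair_rate i j t \<le> - (a/16) * (((m i j t)\<^sup>2 + (m j i t)\<^sup>2) * (m i i t ^ (q+1) + m j j t ^ (q+1)))
    + 4 * A * \<kappa> ^ q * ((m i j t)\<^sup>2 + (m j i t)\<^sup>2) + C0 * (\<kappa> * leak t + \<kappa> ^ (q+3) + \<kappa> * e)"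
proof -
  interpret near_diagonal q r \<alpha> "\<lambda>i j. m i j t" a A \<kappa> "leak t" by (rule near_diagonalI[OF nd t \<kappa>])
  define z where "z = m i j t" define w where "w = m j i t"
  define x where "x = m i i t" define y where "y = m j j t"
  define X where "X = \<alpha> i i * x ^ (q+1)" define Y where "Y = \<alpha> j j * y ^ (q+1)"
  define R where "R = real r ^ 2 * A * (\<kappa> ^ (q+3) + 2 * (\<kappa> * leak t))"
  have x: "0 \<le> x" "x \<le> 1" and y: "0 \<le> y" "y \<le> 1"
    using diag_nonneg entry_le_1[OF ij(1,1)] entry_le_1[OF ij(2,2)] ij unfolding x_def y_def by auto
  have zw: "\<bar>z\<bar> \<le> \<kappa>" "\<bar>w\<bar> \<le> \<kappa>" using off_small ij unfolding z_def w_def by auto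
  have off: "\<exists>\<rho>. corr_rate i j t = \<alpha> i j * m i j t ^ (q+1) - (m i j t * (\<alpha> j j * m j j t ^ (q+2))
     + 1/2 * (m i i t)\<^sup>2 * m i j t * (\<alpha> i j * m i j t ^ q + \<alpha> i i * m i i t ^ q)
     + 1/2 * m i i t * m j j t * m j i t * (\<alpha> j j * m j j t ^ q + \<alpha> j i * m j i t ^ q)) + \<rho>
     \<and> \<bar>m i j t * \<rho>\<bar> \<le> R + \<kappa> * e"
    if ij: "i \<in> {1..r}" "j \<in> {1..r}" "i \<noteq> j" for i j
  proof -
    let ?M = "m i j t * (\<alpha> j j * m j j t ^ (q+2))
     + 1/2 * (m i i t)\<^sup>2 * m i j t * (\<alpha> i j * m i j t ^ q + \<alpha> i i * m i i t ^ q)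
     + 1/2 * m i i t * m j j t * m j i t * (\<alpha> j j * m j j t ^ q + \<alpha> j i * m j i t ^ q)"
    define D where "D = drag q r \<alpha> (\<lambda>i j. m i j t) i j - ?M"
    \<comment> \<open>For \<open>m i j t = 0\<close> the choice of \<open>H\<close> below degenerates, but then there is nothing to show.\<close>
    have "\<bar>m i j t * D\<bar> \<le> R"
    proof (cases "m i j t = 0")
      case True
      have "R \<ge> 0" unfolding R_def using A_pos r \<kappa> P_nonneg by auto
      thus ?thesis using True by simp
    next
      case False
      have "\<bar>m j k t\<bar> * m j j t ^ (q+1) \<le> leak t / \<bar>m i j t\<bar>" if k: "k \<in> {1..r}" "k \<noteq> j" for k
      proof -
        have "\<bar>m i j t\<bar> * \<bar>m j k t\<bar> \<le> ((m i j t)\<^sup>2 + (m j k t)\<^sup>2) / 2"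
          using sum_squares_bound[of "\<bar>m i j t\<bar>" "\<bar>m j k t\<bar>"] by simp
        hence "\<bar>m i j t\<bar> * \<bar>m j k t\<bar> * m j j t ^ (q+1) \<le> ((m i j t)\<^sup>2 + (m j k t)\<^sup>2) / 2 * m j j t ^ (q+1)"
          using diag_nonneg[OF ij(2)] by (intro mult_right_mono) auto
        also have "\<dots> = ((m i j t)\<^sup>2 * m j j t ^ (q+1) + (m j k t)\<^sup>2 * m j j t ^ (q+1)) / 2"
          by (simp add: field_simps)
        also have "\<dots> \<le> leak t" using P_col[of i j] P_row[of j k] ij k by auto
        finally show ?thesis using False by (simp add: field_simps)
      qed
      moreover have "0 \<le> leak t / \<bar>m i j t\<bar>" using P_nonneg by simp
      ultimately have "\<bar>D\<bar> \<le> real r ^ 2 * A * (\<kappa> ^ (q+2) + leak t + \<kappa> * (leak t / \<bar>m i j t\<bar>))"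
        unfolding D_def by (rule drag_off[OF ij])
      hence "\<bar>m i j t\<bar> * \<bar>D\<bar> \<le> \<bar>m i j t\<bar> * (real r ^ 2 * A * (\<kappa> ^ (q+2) + leak t + \<kappa> * (leak t / \<bar>m i j t\<bar>)))"
        by (intro mult_left_mono) auto
      also have "\<dots> = real r ^ 2 * A * (\<bar>m i j t\<bar> * \<kappa> ^ (q+2) + \<bar>m i j t\<bar> * leak t + \<kappa> * leak t)"
        using False by (simp add: field_simps)
      also have "\<dots> \<le> real r ^ 2 * A * (\<kappa> * \<kappa> ^ (q+2) + \<kappa> * leak t + \<kappa> * leak t)"
        using off_small[OF ij] P_nonneg \<kappa> A_pos r by (intro mult_left_mono add_mono mult_right_mono) auto
      finally show ?thesis unfolding R_def abs_mult by (simp add: algebra_simps power_add power3_eq_cube power2_eq_square)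
    qed
    moreover have "\<bar>m i j t * E i j t\<bar> \<le> \<kappa> * e"
      unfolding abs_mult using off_small[OF ij] noise[OF ij(1,2) t] \<kappa> by (intro mult_mono) auto
    ultimately have "\<bar>m i j t * (E i j t - D)\<bar> \<le> R + \<kappa> * e"
      by (simp add: right_diff_distrib abs_le_iff)
    thus ?thesis unfolding corr_rate_def D_def by (intro exI[of _ "E i j t - D"]) (auto simp: D_def)
  qed
  obtain \<rho>1 where \<rho>1: "corr_rate i j t = \<alpha> i j * z ^ (q+1) - (z * (\<alpha> j j * y ^ (q+2))
     + 1/2 * x\<^sup>2 * z * (\<alpha> i j * z ^ q + \<alpha> i i * x ^ q)
     + 1/2 * x * y * w * (\<alpha> j j * y ^ q + \<alpha> j i * w ^ q)) + \<rho>1" "\<bar>z * \<rho>1\<bar> \<le> R + \<kappa> * e"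
    using off[OF ij] unfolding z_def w_def x_def y_def by blast
  obtain \<rho>2 where \<rho>2: "corr_rate j i t = \<alpha> j i * w ^ (q+1) - (w * (\<alpha> i i * x ^ (q+2))
     + 1/2 * y\<^sup>2 * w * (\<alpha> j i * w ^ q + \<alpha> j j * y ^ q)
     + 1/2 * y * x * z * (\<alpha> i i * x ^ q + \<alpha> i j * z ^ q)) + \<rho>2" "\<bar>w * \<rho>2\<bar> \<le> R + \<kappa> * e"
    using off[OF ij(2,1)] ij unfolding z_def w_def x_def y_def by blast
  define L where "L = real r ^ 2 * A * (leak t + \<kappa> ^ (q+2)) + e"
  have dx: "\<bar>corr_rate i i t - X * (1 - x\<^sup>2)\<bar> \<le> L" and dy: "\<bar>corr_rate j j t - Y * (1 - y\<^sup>2)\<bar> \<le> L"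
    unfolding X_def Y_def x_def y_def L_def
    using diag_rate_error[OF nd t \<kappa> ij(1)] diag_rate_error[OF nd t \<kappa> ij(2)] by simp_all
  have XY: "0 \<le> X" "0 \<le> Y" unfolding X_def Y_def
    using x y a_pos weight[OF ij(1,1)] weight[OF ij(2,2)] by (auto intro!: mult_nonneg_nonneg)
  let ?S = "z\<^sup>2 + w\<^sup>2"
  have S2: "?S \<le> 2 * \<kappa>\<^sup>2" using zw abs_le_square_iff[of z \<kappa>] abs_le_square_iff[of w \<kappa>] \<kappa> by auto
  have e1: "2 * z * corr_rate i j t = (\<alpha> i j * (2 - x\<^sup>2) * z^(q+2) - 2 * z\<^sup>2 * Y * y - z\<^sup>2 * X * x - x * z * w * Y
      - x * y * \<alpha> j i * z * w^(q+1)) + 2 * (z * \<rho>1)"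
    unfolding \<rho>1 X_def Y_def by (simp add: algebra_simps power_add power2_eq_square)
  have e2: "2 * w * corr_rate j i t = (\<alpha> j i * (2 - y\<^sup>2) * w^(q+2) - 2 * w\<^sup>2 * X * x - w\<^sup>2 * Y * y - y * z * w * X
      - x * y * \<alpha> i j * w * z^(q+1)) + 2 * (w * \<rho>2)"
    unfolding \<rho>2 X_def Y_def by (simp add: algebra_simps power_add power2_eq_square)
  have "?S * (X * (1 - x\<^sup>2) + Y * (1 - y\<^sup>2)) - ?S * (corr_rate i i t + corr_rate j j t) \<le> 2 * \<kappa>\<^sup>2 * (2 * L)"
  proof -
    have "?S * (X * (1 - x\<^sup>2) + Y * (1 - y\<^sup>2)) - ?S * (corr_rate i i t + corr_rate j j t)
       = ?S * ((X * (1 - x\<^sup>2) - corr_rate i i t) + (Y * (1 - y\<^sup>2) - corr_rate j j t))" by (simp add: algebra_simps)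
    also have "\<dots> \<le> ?S * (2 * L)" using dx dy by (intro mult_left_mono) auto
    also have "\<dots> \<le> 2 * \<kappa>\<^sup>2 * (2 * L)" using S2 dx by (intro mult_right_mono) auto
    finally show ?thesis .
  qed
  moreover have "2 * \<kappa>\<^sup>2 * (2 * L) \<le> 4 * (real r ^ 2 * A * (\<kappa> * leak t + \<kappa> ^ (q+3)) + \<kappa> * e)"
  proof -
    have "\<kappa>\<^sup>2 \<le> \<kappa>" using \<kappa> by (simp add: power2_eq_square mult_left_le)
    hence "\<kappa>\<^sup>2 * L \<le> \<kappa> * L" using dx by (intro mult_right_mono) auto
    thus ?thesis unfolding L_def by (simp add: algebra_simps power_add power2_eq_square power3_eq_cube)
  qed
  ultimately have D: "2 * z * corr_rate i j t + 2 * w * corr_rate j i t - ?S * (corr_rate i i t + corr_rate j j t)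
     \<le> - (1/2) * ?S * (X + Y) + (3 * A * \<kappa>^q * ?S + C0 * (\<kappa> * leak t + \<kappa> ^ (q+3) + \<kappa> * e))"
  proof -
    assume 1: "?S * (X * (1 - x\<^sup>2) + Y * (1 - y\<^sup>2)) - ?S * (corr_rate i i t + corr_rate j j t) \<le> 2 * \<kappa>\<^sup>2 * (2 * L)"
    assume 2: "2 * \<kappa>\<^sup>2 * (2 * L) \<le> 4 * (real r ^ 2 * A * (\<kappa> * leak t + \<kappa> ^ (q+3)) + \<kappa> * e)"
    have 3: "0 \<le> \<kappa> * leak t" "0 \<le> \<kappa> * e" "0 \<le> \<kappa> ^ (q+3)" "0 \<le> real r ^ 2 * A * (\<kappa> ^ (q+3))"
      using \<kappa> P_nonneg e_nonneg A1 by auto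
    have 4: "4 * (R + \<kappa> * e) + 4 * (real r ^ 2 * A * (\<kappa> * leak t + \<kappa> ^ (q+3)) + \<kappa> * e)
       \<le> C0 * (\<kappa> * leak t + \<kappa> ^ (q+3) + \<kappa> * e)"
    proof -
      have "0 \<le> real r ^ 2 * A * (\<kappa> * e)" using 3 A1 by auto
      thus ?thesis using 3 unfolding pair_const_def R_def by (simp add: algebra_simps)
    qed
    have a': "0 \<le> \<alpha> i j" "\<alpha> i j \<le> A" "0 \<le> \<alpha> j i" "\<alpha> j i \<le> A"
      using weight[of i j] weight[of j i] ij a_pos by auto
    have combine: "M1 + 2 * p1 + (M2 + 2 * p2) - V \<le> b1 + (b2 + c3)"
      if "M1 + M2 - U \<le> b1 + b2" "U - V \<le> c1" "c1 \<le> c2" "4 * k + c2 \<le> c3" "\<bar>p1\<bar> \<le> k" "\<bar>p2\<bar> \<le> k"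
      for M1 M2 p1 p2 U V b1 b2 c1 c2 c3 k :: real using that by linarith
    show ?thesis unfolding e1 e2
      by (rule combine[OF pair_dissipation[OF x y XY zw a'] 1 2 4 \<rho>1(2) \<rho>2(2)])
  qed
  define g where "g = exp (- x - y)"
  have "exp (-2) \<le> g" unfolding g_def using x y by simp
  hence g: "1/8 \<le> g" using exp_minus_2_ge by linarith
  have "g \<le> 1" unfolding g_def using x y by simp
  note g = g this
  have pos: "0 \<le> 3 * A * \<kappa>^q * ?S + C0 * (\<kappa> * leak t + \<kappa> ^ (q+3) + \<kappa> * e)"
    unfolding pair_const_def using A1 \<kappa> P_nonneg e_nonneg
    by (intro add_nonneg_nonneg mult_nonneg_nonneg) auto
  have "pair_rate i j t \<le> g * (- (1/2) * ?S * (X + Y) + (3 * A * \<kappa>^q * ?S + C0 * (\<kappa> * leak t + \<kappa> ^ (q+3) + \<kappa> * e)))"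
    unfolding pair_rate_def using D g unfolding g_def z_def w_def x_def y_def
    by (intro mult_left_mono) auto
  also have "\<dots> = - (1/2) * (g * (?S * (X + Y))) + g * (3 * A * \<kappa>^q * ?S + C0 * (\<kappa> * leak t + \<kappa> ^ (q+3) + \<kappa> * e))"
    by (simp add: algebra_simps add_divide_distrib)
  also have "\<dots> \<le> - (1/2) * (1/8 * (?S * (X + Y))) + 1 * (3 * A * \<kappa>^q * ?S + C0 * (\<kappa> * leak t + \<kappa> ^ (q+3) + \<kappa> * e))"
    using g pos XY by (intro add_mono mult_right_mono mult_left_mono_neg) auto
  also have "\<dots> \<le> - (a/16) * (?S * (x ^ (q+1) + y ^ (q+1))) + (4 * A * \<kappa>^q * ?S + C0 * (\<kappa> * leak t + \<kappa> ^ (q+3) + \<kappa> * e))"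
  proof -
    have "a * x ^ (q+1) + a * y ^ (q+1) \<le> X + Y" unfolding X_def Y_def
      using weight ij x y by (intro add_mono mult_right_mono) auto
    hence "?S * (a * x ^ (q+1) + a * y ^ (q+1)) \<le> ?S * (X + Y)" by (intro mult_left_mono) auto
    moreover have "0 \<le> A * \<kappa>^q * ?S" using A1 \<kappa> by (intro mult_nonneg_nonneg) auto
    ultimately show ?thesis by (simp add: algebra_simps)
  qed
  finally show ?thesis unfolding z_def w_def x_def y_def by simp
qed

text \<open>Each entry occurs in two ordered pairs, so the pairs dissipate \<open>(a/8) leak\<close> altogether. Half of it
  absorbs the errors \<open>C0 \<kappa> leak\<close> of all pairs.\<close>

lemma energy_rate_le:
  assumes nd: "nearly_diagonal \<kappa> t" and t: "0 \<le> t" and \<kappa>: "0 \<le> \<kappa>" "\<kappa> \<le> 1"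
    and small: "real r ^ 2 * C0 * \<kappa> \<le> a/16" and e: "e \<le> \<kappa> ^ (q+1)"
  shows "energy_rate t \<le> - (a/16) * leak t + C1 * \<kappa> ^ (q+2)"
proof -
  interpret near_diagonal q r \<alpha> "\<lambda>i j. m i j t" a A \<kappa> "leak t" by (rule near_diagonalI[OF nd t \<kappa>])
  let ?q = "\<lambda>i j. ((m i j t)\<^sup>2 + (m j i t)\<^sup>2) * (m i i t ^ (q+1) + m j j t ^ (q+1))"
  have C0: "0 \<le> C0" unfolding pair_const_def using A1 by auto
  define B where "B = 8 * A * \<kappa> ^ (q+2) + C0 * (\<kappa> * leak t + \<kappa> ^ (q+3) + \<kappa> * e)"
  have B0: "0 \<le> B" unfolding B_def using A1 \<kappa> P_nonneg e_nonneg C0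
    by (intro add_nonneg_nonneg mult_nonneg_nonneg) auto
  have d: "pair_rate i j t \<le> - (a/16) * ?q i j + B" if ij: "i \<in> {1..r}" "j \<in> {1..r}" "i \<noteq> j" for i j
  proof -
    have "(m i j t)\<^sup>2 \<le> \<kappa>\<^sup>2" "(m j i t)\<^sup>2 \<le> \<kappa>\<^sup>2"
      using off_small[of i j] off_small[of j i] ij \<kappa> abs_le_square_iff[of "m i j t" \<kappa>]
        abs_le_square_iff[of "m j i t" \<kappa>] by auto
    hence "4 * A * \<kappa> ^ q * ((m i j t)\<^sup>2 + (m j i t)\<^sup>2) \<le> 4 * A * \<kappa> ^ q * (2 * \<kappa>\<^sup>2)"
      using A1 \<kappa> by (intro mult_left_mono) auto
    thus ?thesis using pair_rate_le[OF nd t \<kappa> ij] unfolding B_def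
      by (simp add: power_add power2_eq_square algebra_simps)
  qed
  \<comment> \<open>The two halves of the dissipation agree by symmetry in \<open>i\<close> and \<open>j\<close>.\<close>
  have swap: "(\<Sum>i=1..r. \<Sum>j\<in>{1..r}-{i}. (m j i t)\<^sup>2 * (m i i t ^ (q+1) + m j j t ^ (q+1))) = leak t"
  proof -
    have "(\<Sum>i=1..r. \<Sum>j\<in>{1..r}-{i}. (m j i t)\<^sup>2 * (m i i t ^ (q+1) + m j j t ^ (q+1)))
        = (\<Sum>i=1..r. \<Sum>j | j \<in> {1..r} \<and> j \<noteq> i. (m j i t)\<^sup>2 * (m i i t ^ (q+1) + m j j t ^ (q+1)))"
      by (intro sum.cong) auto
    also have "\<dots> = (\<Sum>j=1..r. \<Sum>i | i \<in> {1..r} \<and> j \<noteq> i. (m j i t)\<^sup>2 * (m i i t ^ (q+1) + m j j t ^ (q+1)))"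
      by (rule sum.swap_restrict) auto
    also have "\<dots> = leak t" unfolding leak_def by (intro sum.cong) (auto simp: add.commute)
    finally show ?thesis .
  qed
  have "energy_rate t \<le> (\<Sum>i=1..r. \<Sum>j\<in>{1..r}-{i}. - (a/16) * ?q i j + B)"
    unfolding energy_rate_def by (intro sum_mono d) auto
  also have "\<dots> = - (a/16) * (\<Sum>i=1..r. \<Sum>j\<in>{1..r}-{i}. ?q i j) + (\<Sum>i=1..r. \<Sum>j\<in>{1..r}-{i}. B)"
    by (simp only: sum.distrib sum_distrib_left)
  also have "(\<Sum>i=1..r. \<Sum>j\<in>{1..r}-{i}. ?q i j) = leak t + leak t"
    using swap by (simp add: leak_def sum.distrib distrib_right)
  also have "(\<Sum>i=1..r. \<Sum>j\<in>{1..r}-{i}. B) \<le> (\<Sum>i::nat=1..r. \<Sum>j::nat=1..r. B)"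
    using B0 by (intro sum_mono sum_mono2) auto
  also have "\<dots> = real r ^ 2 * B" by (simp add: power2_eq_square)
  also have "real r ^ 2 * B \<le> (a/16) * leak t + C1 * \<kappa> ^ (q+2)"
  proof -
    have "real r ^ 2 * C0 * \<kappa> * leak t \<le> a/16 * leak t" using small P_nonneg by (rule mult_right_mono)
    moreover have "\<kappa> ^ (q+3) \<le> \<kappa> ^ (q+2)" using \<kappa> by (intro power_decreasing) auto
    moreover have "\<kappa> * e \<le> \<kappa> * \<kappa> ^ (q+1)" using e \<kappa> by (intro mult_left_mono)
    ultimately have "real r ^ 2 * C0 * \<kappa> * leak t + real r ^ 2 * C0 * (\<kappa> ^ (q+3) + \<kappa> * e)
        \<le> a/16 * leak t + real r ^ 2 * C0 * (\<kappa> ^ (q+2) + \<kappa> ^ (q+2))"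
      using C0 by (intro add_mono mult_left_mono) (auto simp: power_add power2_eq_square)
    thus ?thesis unfolding B_def energy_const_def by (simp add: algebra_simps)
  qed
  finally show ?thesis by (simp add: algebra_simps)
qed

lemma energy_bounds:
  assumes nd: "nearly_diagonal \<kappa> t" and t: "0 \<le> t" and \<kappa>: "0 \<le> \<kappa>" "\<kappa> \<le> 1"
  shows "0 \<le> energy t" "energy t \<le> 2 * real r ^ 2 * \<kappa>\<^sup>2"
proof -
  interpret near_diagonal q r \<alpha> "\<lambda>i j. m i j t" a A \<kappa> "leak t" by (rule near_diagonalI[OF nd t \<kappa>])
  show "0 \<le> energy t" unfolding energy_def pair_energy_def by (intro sum_nonneg) auto
  have "pair_energy i j t \<le> 2 * \<kappa>\<^sup>2" if ij: "i \<in> {1..r}" "j \<in> {1..r}" "i \<noteq> j" for i j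
  proof -
    have "(m i j t)\<^sup>2 \<le> \<kappa>\<^sup>2" "(m j i t)\<^sup>2 \<le> \<kappa>\<^sup>2"
      using off_small[of i j] off_small[of j i] ij \<kappa> abs_le_square_iff[of "m i j t" \<kappa>]
        abs_le_square_iff[of "m j i t" \<kappa>] by auto
    moreover have "exp (- m i i t - m j j t) \<le> 1" using diag_nonneg[OF ij(1)] diag_nonneg[OF ij(2)] by simp
    ultimately have "pair_energy i j t \<le> (\<kappa>\<^sup>2 + \<kappa>\<^sup>2) * 1" unfolding pair_energy_def
      by (intro mult_mono) auto
    thus ?thesis by simp
  qed
  hence "energy t \<le> (\<Sum>i=1..r. \<Sum>j\<in>{1..r}-{i}. 2 * \<kappa>\<^sup>2)"
    unfolding energy_def by (intro sum_mono) auto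
  also have "\<dots> \<le> (\<Sum>i::nat=1..r. \<Sum>j::nat=1..r. 2 * \<kappa>\<^sup>2)"
    by (intro sum_mono sum_mono2) auto
  also have "\<dots> = 2 * real r ^ 2 * \<kappa>\<^sup>2" by (simp add: power2_eq_square)
  finally show "energy t \<le> 2 * real r ^ 2 * \<kappa>\<^sup>2" .
qed

end

section \<open>Escape of the diagonal entries\<close>

text \<open>If \<open>g\<close> starts above the level, the hitting time is 0 and nothing is claimed about the past.\<close>

lemma first_hit:
  fixes g :: "real \<Rightarrow> real"
  assumes cont: "continuous_on {0..\<tau>} g" and u: "0 \<le> u" "u \<le> \<tau>" "g u \<ge> c"
  obtains s where "0 \<le> s" "s \<le> u" "g s \<ge> c" "s > 0 \<Longrightarrow> \<forall>v\<in>{0..s}. g v \<le> c"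
proof -
  define S where "S = {0..u} \<inter> g -` {c..}"
  have "continuous_on {0..u} g" using cont u by (auto intro: continuous_on_subset)
  hence "closed S" unfolding S_def by (intro continuous_closed_preimage) auto
  have uS: "u \<in> S" using u by (auto simp: S_def)
  have bdd: "bdd_below S" by (auto simp: S_def bdd_below_def intro!: exI[of _ 0])
  define s where "s = Inf S"
  have "s \<in> S" unfolding s_def using \<open>closed S\<close> uS bdd by (intro closed_contains_Inf) auto
  hence s: "0 \<le> s" "s \<le> u" "g s \<ge> c" by (auto simp: S_def)
  have before: "g v < c" if "0 \<le> v" "v < s" for v
  proof (rule ccontr)
    assume "\<not> g v < c"
    hence "v \<in> S" using that s by (auto simp: S_def)
    hence "s \<le> v" unfolding s_def using bdd by (rule cInf_lower)
    thus False using that by simp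
  qed
  show ?thesis
  proof (rule that[OF s])
    assume s0: "s > 0"
    have "g s = c"
    proof -
      have "continuous_on {0..s} g" using cont u s by (auto intro: continuous_on_subset)
      moreover have "g 0 \<le> c" using before[of 0] s0 by simp
      ultimately obtain v where v: "0 \<le> v" "v \<le> s" "g v = c" using IVT'[of g 0 c s] s s0 by auto
      thus ?thesis using before[of v] by (cases "v = s") auto
    qed
    thus "\<forall>v\<in>{0..s}. g v \<le> c" using before by (force simp: less_eq_real_def)
  qed
qed

text \<open>All smallness conditions of the escape argument. The initial entries are of order \<open>b\<close>, at least
  \<open>\<delta> b\<close>. The hypothesis \<open>gap\<close> compares blow-up times: an off-diagonal entry is slower
  than the diagonal entry of its row or of its column, by a margin of order \<open>b^(-q)\<close>. A diagonal entry
  counts as having won the race at the level \<open>B b\<close>, and as having left the neighbourhood of 0 at the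
  level \<open>\<rho>\<close>. The control function will vary by at most \<open>\<epsilon> b\<close> over the horizon
  \<open>T / b^q\<close>, and \<open>\<nu>\<close> bounds the relative errors that this and the logistic factor
  \<open>1 - \<rho>\<^sup>2\<close> cause in the initial values and in the rates.\<close>

locale escaping_flow = correlation_flow +
  fixes b \<delta> K1 B \<epsilon> \<nu> \<rho> T :: real
  assumes b_pos: "b > 0" and \<delta>: "\<delta> > 0"
    and init: "\<And>i j. i \<in> {1..r} \<Longrightarrow> j \<in> {1..r} \<Longrightarrow> \<delta> * b \<le> m i j 0"
    and gap: "\<And>i j. i \<in> {1..r} \<Longrightarrow> j \<in> {1..r} \<Longrightarrow> i \<noteq> j \<Longrightarrow> \<exists>h\<in>{i,j}.
       1 / (real q * \<alpha> h h * m h h 0 ^ q) + \<delta> / b ^ q \<le> 1 / (real q * \<alpha> i j * m i j 0 ^ q)"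
    and K1: "K1 \<ge> 1" "K1 \<ge> 2 / (real q * a * \<delta>)"
    and B: "B \<ge> 6 * K1" "8 * A * (6 * K1) ^ (q+2) * (2 ^ (q+2) / (a * B)) \<le> K1\<^sup>2"
    and \<nu>: "0 < \<nu>" "\<nu> \<le> 1/2" "(1 / (1 - \<nu>) ^ (q+1) - 1) * (1 / (real q * a * \<delta> ^ q)) \<le> \<delta> / 4"
       "(1 - 1 / (1 + \<nu>) ^ q) * (1 / (real q * a * \<delta> ^ q)) \<le> \<delta> / 4"
    and \<rho>: "0 < \<rho>" "\<rho>\<^sup>2 \<le> \<nu>" "\<rho> \<le> 1"
    and \<epsilon>: "0 < \<epsilon>" "\<epsilon> \<le> 1" "\<epsilon> \<le> \<nu> * \<delta>" "\<epsilon> < \<delta>" "C0 * (6 * K1) * \<epsilon> \<le> K1\<^sup>2"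
    and b_small: "B * b \<le> \<rho>" "6 * K1 * b \<le> 1" "real r ^ 2 * C0 * (6 * K1 * b) \<le> a/16"
       "4 * A * (6 * K1 * b) ^ q \<le> (a/16) * (\<rho>/2) ^ (q+1)"
    and e_small: "e \<le> (6 * K1 * b) ^ (q+1)"
    and var_small: "16 * real r ^ 2 * A / a * (2 * real r ^ 2 * (6 * K1 * b)\<^sup>2)
       + ((16 * real r ^ 2 * A / a * C1 + 2 * real r ^ 2 * A + 3 * A) * (B * b) ^ (q+2) + e) * (T / b ^ q) \<le> \<epsilon> * b"
    and T_pos: "T > 0"
begin

text \<open>The bound on the off-diagonal entries that the continuation argument maintains. The factor 6 leaves room: after a hit the pair energy is
  at most \<open>4 K1\<^sup>2 b\<^sup>2\<close> and its weight at least \<open>1/8\<close>, so an off-diagonal entry is at most \<open>\<surd>32 K1 b\<close>.\<close>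

definition \<kappa> :: real where "\<kappa> = 6 * K1 * b"
text \<open>The control function. By \<open>energy_rate_le\<close> its multiple of the energy decreases at the rate of the leak errors, up to terms that are
  uniformly of order \<open>(B b)^(q+2)\<close>; the linear term takes care of these and of the other uniform errors. So the negative derivative dominates every error, while the
  function itself is almost constant.\<close>

definition ctrl_slope :: real where
  "ctrl_slope = (16 * real r ^ 2 * A / a * C1 + 2 * real r ^ 2 * A + 3 * A) * (B * b) ^ (q+2) + e"
definition ctrl :: "real \<Rightarrow> real" where "ctrl t = 16 * real r ^ 2 * A / a * energy t - ctrl_slope * t"
definition ctrl_rate :: "real \<Rightarrow> real" where "ctrl_rate t = 16 * real r ^ 2 * A / a * energy_rate t - ctrl_slope"

lemma ctrl_deriv: "0 \<le> t \<Longrightarrow> (ctrl has_real_derivative ctrl_rate t) (at t within {0..})"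
  unfolding ctrl_def[abs_def] ctrl_rate_def
  by (intro DERIV_diff DERIV_cmult DERIV_cmult_Id energy_deriv)

lemma kappa_bounds: "0 < \<kappa>" "0 \<le> \<kappa>" "\<kappa> \<le> 1" "\<kappa> \<le> B * b" "B * b \<le> 1"
  using b_pos K1 b_small B(1) \<rho> unfolding \<kappa>_def by (auto simp: mult_right_mono)

lemma B_pos: "B \<ge> 6" using B K1 by linarith

lemma C01: "0 \<le> C0" "0 \<le> C1" unfolding pair_const_def energy_const_def using A1 by auto

lemma ctrl_slope_nonneg: "0 \<le> ctrl_slope" unfolding ctrl_slope_def using A1 a_pos C01 B_pos b_pos e_nonneg
  by (intro add_nonneg_nonneg mult_nonneg_nonneg) auto

lemma eps_b: "\<epsilon> * b \<le> \<rho> / 2" "\<epsilon> * b \<le> B * b / 2"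
proof -
  have "\<epsilon> * b \<le> 1 * b" using \<epsilon> b_pos by (intro mult_right_mono) auto
  moreover have "6 * b \<le> B * b" using B_pos b_pos by (intro mult_right_mono) auto
  ultimately show "\<epsilon> * b \<le> \<rho> / 2" "\<epsilon> * b \<le> B * b / 2" using b_small(1) b_pos by linarith+
qed

definition controlled :: "real \<Rightarrow> bool" where
  "controlled \<tau> \<longleftrightarrow> 0 \<le> \<tau> \<and> \<tau> \<le> T / b ^ q \<and> (\<forall>t\<in>{0..\<tau>}. nearly_diagonal \<kappa> t)"

lemma leak_absorbed:
  assumes "controlled \<tau>" "0 \<le> u" "u \<le> \<tau>"
  shows "real r ^ 2 * A * leak u + (2 * real r ^ 2 * A + 3 * A) * (B * b) ^ (q+2) + e \<le> - ctrl_rate u"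
proof -
  let ?G = "16 * real r ^ 2 * A / a"
  have nd: "nearly_diagonal \<kappa> u" using assms by (auto simp: controlled_def)
  have "energy_rate u \<le> - (a/16) * leak u + C1 * \<kappa> ^ (q+2)"
    by (rule energy_rate_le[OF nd assms(2) kappa_bounds(2,3)]) (use b_small e_small in \<open>auto simp: \<kappa>_def\<close>)
  also have "\<dots> \<le> - (a/16) * leak u + C1 * (B * b) ^ (q+2)"
    using kappa_bounds C01 by (intro add_left_mono mult_left_mono power_mono) auto
  finally have "?G * energy_rate u \<le> ?G * (- (a/16) * leak u + C1 * (B * b) ^ (q+2))"
    using A1 a_pos by (intro mult_left_mono) auto
  also have "\<dots> = - (real r ^ 2 * A * leak u) + ?G * C1 * (B * b) ^ (q+2)"
    using a_pos by (simp add: field_simps)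
  finally show ?thesis unfolding ctrl_rate_def ctrl_slope_def by (simp add: algebra_simps)
qed

text \<open>The energy is of order \<open>b\<^sup>2\<close>, and over a time \<open>T / b^q\<close> the linear term
  contributes the order \<open>b\<^sup>2 + e / b^q\<close>. The condition \<open>var_small\<close> makes the total at
  most \<open>\<epsilon> b\<close>.\<close>

lemma ctrl_var:
  assumes g: "controlled \<tau>" and "0 \<le> s" "s \<le> \<tau>" "0 \<le> u" "u \<le> \<tau>"
  shows "\<bar>ctrl u - ctrl s\<bar> \<le> \<epsilon> * b"
proof -
  let ?G = "16 * real r ^ 2 * A / a"
  have nd: "nearly_diagonal \<kappa> u" "nearly_diagonal \<kappa> s" using assms by (auto simp: controlled_def)
  have "\<bar>energy u - energy s\<bar> \<le> 2 * real r ^ 2 * \<kappa>\<^sup>2"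
    using energy_bounds[OF nd(1) assms(4) kappa_bounds(2,3)] energy_bounds[OF nd(2) assms(2) kappa_bounds(2,3)] by linarith
  hence 1: "\<bar>?G * (energy u - energy s)\<bar> \<le> ?G * (2 * real r ^ 2 * \<kappa>\<^sup>2)"
    unfolding abs_mult using A1 a_pos by (intro mult_mono) auto
  have "\<bar>u - s\<bar> \<le> T / b ^ q" using assms unfolding controlled_def by auto
  hence 2: "\<bar>ctrl_slope * (u - s)\<bar> \<le> ctrl_slope * (T / b ^ q)"
    unfolding abs_mult using ctrl_slope_nonneg by (intro mult_mono) auto
  have "ctrl u - ctrl s = ?G * (energy u - energy s) - ctrl_slope * (u - s)"
    unfolding ctrl_def right_diff_distrib by linarith
  hence "\<bar>ctrl u - ctrl s\<bar> \<le> \<bar>?G * (energy u - energy s)\<bar> + \<bar>ctrl_slope * (u - s)\<bar>"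
    using abs_triangle_ineq4 by metis
  also have "\<dots> \<le> ?G * (2 * real r ^ 2 * \<kappa>\<^sup>2) + ctrl_slope * (T / b ^ q)" using 1 2 by (rule add_mono)
  also have "\<dots> \<le> \<epsilon> * b" using var_small unfolding ctrl_slope_def \<kappa>_def .
  finally show ?thesis .
qed

lemma diag_rate:
  assumes g: "controlled \<tau>" "0 \<le> u" "u \<le> \<tau>" and i: "i \<in> {1..r}"
  shows "\<bar>corr_rate i i u - \<alpha> i i * m i i u ^ (q+1) * (1 - (m i i u)\<^sup>2)\<bar> \<le> - ctrl_rate u"
proof -
  have nd: "nearly_diagonal \<kappa> u" using g by (auto simp: controlled_def)
  have "real r ^ 2 * A * \<kappa> ^ (q+2) \<le> (2 * real r ^ 2 * A + 3 * A) * (B * b) ^ (q+2)"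
    using A1 kappa_bounds by (intro mult_mono power_mono) auto
  thus ?thesis using diag_rate_error[OF nd g(2) kappa_bounds(2,3) i] leak_absorbed[OF g]
    by (simp add: algebra_simps)
qed

lemma diag_rate_ge:
  assumes g: "controlled \<tau>" "0 \<le> u" "u \<le> \<tau>" and i: "i \<in> {1..r}" and le: "m i i u \<le> \<mu>" "\<mu> \<le> 1"
  shows "corr_rate i i u \<ge> \<alpha> i i * (1 - \<mu>\<^sup>2) * m i i u ^ (q+1) + ctrl_rate u"
proof -
  have nn: "0 \<le> m i i u" using g i by (auto simp: controlled_def nearly_diagonal_def)
  hence "(m i i u)\<^sup>2 \<le> \<mu>\<^sup>2" using le by (intro power_mono) auto
  hence "\<alpha> i i * m i i u ^ (q+1) * (1 - \<mu>\<^sup>2) \<le> \<alpha> i i * m i i u ^ (q+1) * (1 - (m i i u)\<^sup>2)"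
    using nn weight[OF i i] a_pos by (intro mult_left_mono mult_nonneg_nonneg) auto
  thus ?thesis using diag_rate[OF g i] by (simp add: mult_ac)
qed

lemma diag_stays:
  assumes g: "controlled \<tau>" and s: "0 \<le> s" "s \<le> u" "u \<le> \<tau>" and i: "i \<in> {1..r}" and c: "\<epsilon> * b < m i i s"
  shows "m i i u \<ge> m i i s - \<epsilon> * b \<and> m i i u > 0"
proof (rule stays_above[where y="m i i" and \<Psi>=ctrl and y'="corr_rate i i" and \<Psi>'=ctrl_rate])
  fix v assume v: "s \<le> v" "v \<le> u"
  show "(m i i has_real_derivative corr_rate i i v) (at v within {0..})" using corr_deriv i s v by auto
  show "(ctrl has_real_derivative ctrl_rate v) (at v within {0..})" using ctrl_deriv s v by auto
  show "ctrl_rate v \<le> corr_rate i i v"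
    using diag_rate_ge[OF g _ _ i _ order_refl, of v] entry_le_1[OF i i, of v] v s by auto
  show "\<bar>ctrl v - ctrl s\<bar> \<le> \<epsilon> * b" using ctrl_var[OF g] v s by auto
qed (use c s in auto)

lemma diag_rise:
  assumes g: "controlled \<tau>" and s: "0 \<le> s" "s \<le> u" "u \<le> \<tau>" and i: "i \<in> {1..r}" and c: "\<epsilon> * b < m i i s"
    and le: "\<And>v. s \<le> v \<Longrightarrow> v \<le> u \<Longrightarrow> m i i v \<le> \<mu>" and \<mu>: "\<mu> \<le> 1"
  shows "real q * (\<alpha> i i * (1 - \<mu>\<^sup>2)) * (u - s) \<le> 1 / (m i i s - \<epsilon> * b) ^ q"
proof (rule rise_time[where y="m i i" and \<Psi>=ctrl and y'="corr_rate i i" and \<Psi>'=ctrl_rate])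
  have \<mu>0: "0 \<le> \<mu>" using le[of s] c s mult_pos_pos[OF \<epsilon>(1) b_pos] by linarith
  have "\<mu>\<^sup>2 \<le> 1" using \<mu> \<mu>0 by (simp add: power_le_one)
  thus "0 \<le> \<alpha> i i * (1 - \<mu>\<^sup>2)" using weight[OF i i] a_pos by (intro mult_nonneg_nonneg) auto
  fix v assume v: "s \<le> v" "v \<le> u"
  show "(m i i has_real_derivative corr_rate i i v) (at v within {0..})" using corr_deriv i s v by auto
  show "(ctrl has_real_derivative ctrl_rate v) (at v within {0..})" using ctrl_deriv s v by auto
  show "\<alpha> i i * (1 - \<mu>\<^sup>2) * m i i v ^ (q+1) + ctrl_rate v \<le> corr_rate i i v"
    using diag_rate_ge[OF g _ _ i le \<mu>, of v] v s by auto
  show "0 \<le> m i i v" using g i v s by (auto simp: controlled_def nearly_diagonal_def)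
  show "\<bar>ctrl v - ctrl s\<bar> \<le> \<epsilon> * b" using ctrl_var[OF g] v s by auto
qed (use c s in auto)

text \<open>While both diagonal entries are at most \<open>\<beta> = B b\<close>, the three distinguished drag terms are of
  order \<open>\<beta>^(q+2)\<close>, and \<open>H = \<beta>^(q+1)\<close> is an admissible choice in
  \<open>drag_off\<close>. So up to errors that the control function absorbs the entry grows freely.\<close>

lemma off_rate:
  assumes g: "controlled \<tau>" "0 \<le> u" "u \<le> \<tau>" and ij: "i \<in> {1..r}" "j \<in> {1..r}" "i \<noteq> j"
    and le: "m i i u \<le> B * b" "m j j u \<le> B * b"
  shows "\<bar>corr_rate i j u - \<alpha> i j * m i j u ^ (q+1)\<bar> \<le> - ctrl_rate u"
proof -
  have nd: "nearly_diagonal \<kappa> u" using g by (auto simp: controlled_def)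
  interpret near_diagonal q r \<alpha> "\<lambda>i j. m i j u" a A \<kappa> "leak u" by (rule near_diagonalI[OF nd g(2) kappa_bounds(2,3)])
  define \<beta> where "\<beta> = B * b"
  have \<beta>: "0 \<le> \<beta>" "\<beta> \<le> 1" "\<kappa> \<le> \<beta>" using kappa_bounds unfolding \<beta>_def by auto
  have d: "\<bar>m k k u\<bar> \<le> \<beta>" if "k \<in> {i,j}" for k using le diag_nonneg ij that unfolding \<beta>_def by auto
  have o: "\<bar>m i j u\<bar> \<le> \<beta>" "\<bar>m j i u\<bar> \<le> \<beta>" using off_small[of i j] off_small[of j i] ij \<beta> by auto
  have "\<bar>m j k u\<bar> * m j j u ^ (q+1) \<le> \<beta> ^ (q+1)" if "k \<in> {1..r}" "k \<noteq> j" for k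
  proof -
    have "\<bar>m j k u\<bar> * m j j u ^ (q+1) \<le> 1 * \<beta> ^ (q+1)"
      using entry_le_1[OF ij(2) that(1)] g(2) d[of j] diag_nonneg[OF ij(2)]
      by (intro mult_mono power_mono) auto
    thus ?thesis by simp
  qed
  moreover have "0 \<le> \<beta> ^ (q+1)" using \<beta> by simp
  ultimately have 1: "\<bar>drag q r \<alpha> (\<lambda>i j. m i j u) i j - (m i j u * (\<alpha> j j * m j j u ^ (q+2))
     + 1/2 * (m i i u)\<^sup>2 * m i j u * (\<alpha> i j * m i j u ^ q + \<alpha> i i * m i i u ^ q)
     + 1/2 * m i i u * m j j u * m j i u * (\<alpha> j j * m j j u ^ q + \<alpha> j i * m j i u ^ q))\<bar>
     \<le> real r ^ 2 * A * (\<kappa> ^ (q+2) + leak u + \<kappa> * \<beta> ^ (q+1))"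
    by (rule drag_off[OF ij])
  have 2: "\<bar>m i j u * (\<alpha> j j * m j j u ^ (q+2))\<bar> \<le> 1 * (A * \<beta> ^ (q+2))"
    unfolding abs_mult[of "m i j u"] using o \<beta> A1 ij d[of j]
    by (intro mult_mono weighted_power_le) auto
  have 3: "\<bar>x * y * z * (w1 + w2)\<bar> \<le> \<beta> * \<beta> * 1 * (2 * (A * \<beta> ^ q))"
    if "\<bar>x\<bar> \<le> \<beta>" "\<bar>y\<bar> \<le> \<beta>" "\<bar>z\<bar> \<le> \<beta>" "\<bar>w1\<bar> \<le> A * \<beta> ^ q" "\<bar>w2\<bar> \<le> A * \<beta> ^ q" for x y z w1 w2 :: real
    unfolding abs_mult[of "x * y * z"] using that \<beta> A1
    by (intro mult_mono abs_prod3_le) auto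
  have 4: "\<bar>m i i u * m i i u * m i j u * (\<alpha> i j * m i j u ^ q + \<alpha> i i * m i i u ^ q)\<bar>
      \<le> \<beta> * \<beta> * 1 * (2 * (A * \<beta> ^ q))"
    using d[of i] o ij by (intro 3 weighted_power_le) auto
  have 5: "\<bar>m i i u * m j j u * m j i u * (\<alpha> j j * m j j u ^ q + \<alpha> j i * m j i u ^ q)\<bar>
      \<le> \<beta> * \<beta> * 1 * (2 * (A * \<beta> ^ q))"
    using d[of i] d[of j] o ij by (intro 3 weighted_power_le) auto
  have 6: "\<beta> * \<beta> * 1 * (2 * (A * \<beta> ^ q)) = 2 * (A * \<beta> ^ (q+2))" by (simp add: power_add power2_eq_square)
  have 7: "\<bar>m i j u * (\<alpha> j j * m j j u ^ (q+2))
     + 1/2 * (m i i u)\<^sup>2 * m i j u * (\<alpha> i j * m i j u ^ q + \<alpha> i i * m i i u ^ q)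
     + 1/2 * m i i u * m j j u * m j i u * (\<alpha> j j * m j j u ^ q + \<alpha> j i * m j i u ^ q)\<bar>
     \<le> 3 * A * \<beta> ^ (q+2)"
  proof -
    have "\<bar>x + 1/2 * p\<^sup>2 * y * w + 1/2 * p * v * z * w'\<bar> \<le> 3 * c"
      if "\<bar>x\<bar> \<le> 1 * c" "\<bar>p * p * y * w\<bar> \<le> 2 * c" "\<bar>p * v * z * w'\<bar> \<le> 2 * c" for x p y w v z w' c :: real
    proof -
      have "1/2 * p\<^sup>2 * y * w = (p * p * y * w) / 2" "1/2 * p * v * z * w' = (p * v * z * w') / 2"
        by (simp_all add: power2_eq_square)
      thus ?thesis using that by linarith
    qed
    from this[OF 2 4[unfolded 6] 5[unfolded 6]] show ?thesis by (simp add: mult.assoc)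
  qed
  have 8: "real r ^ 2 * A * (\<kappa> ^ (q+2) + leak u + \<kappa> * \<beta> ^ (q+1))
     \<le> real r ^ 2 * A * leak u + 2 * real r ^ 2 * A * \<beta> ^ (q+2)"
  proof -
    have "\<kappa> ^ (q+2) + \<kappa> * \<beta> ^ (q+1) \<le> \<beta> ^ (q+2) + \<beta> * \<beta> ^ (q+1)"
      using \<beta> kappa_bounds by (intro add_mono power_mono mult_right_mono) auto
    hence "real r ^ 2 * A * (\<kappa> ^ (q+2) + \<kappa> * \<beta> ^ (q+1)) \<le> real r ^ 2 * A * (2 * \<beta> ^ (q+2))"
      using A1 by (intro mult_left_mono) auto
    thus ?thesis by (simp add: algebra_simps)
  qed
  show ?thesis
    using 1 7 8 leak_absorbed[OF g] noise[OF ij(1,2) g(2)] unfolding corr_rate_def \<beta>_def[symmetric] distrib_right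
    by linarith
qed

text \<open>The gap hypothesis bounds the blow-up time of the entry from below by \<open>\<delta> / b^q\<close>, hence its
  initial value from above.\<close>

lemma off_init: 
  assumes ij: "i \<in> {1..r}" "j \<in> {1..r}" "i \<noteq> j"
  shows "0 < m i j 0" "m i j 0 \<le> K1 * b"
proof -
  have diag0: "0 < m h k 0" if "h \<in> {1..r}" "k \<in> {1..r}" for h k
    using init[OF that] mult_pos_pos[OF \<delta> b_pos] by linarith
  show z: "0 < m i j 0" using diag0 ij by auto
  obtain h where h: "h \<in> {i,j}"
    "1 / (real q * \<alpha> h h * m h h 0 ^ q) + \<delta> / b ^ q \<le> 1 / (real q * \<alpha> i j * m i j 0 ^ q)"
    using gap[OF ij] by blast
  have hr: "h \<in> {1..r}" using h ij by auto
  have "0 \<le> 1 / (real q * \<alpha> h h * m h h 0 ^ q)"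
    using diag0[OF hr hr] weight[OF hr hr] a_pos by (intro divide_nonneg_nonneg mult_nonneg_nonneg) auto
  hence "\<delta> / b ^ q \<le> 1 / (real q * \<alpha> i j * m i j 0 ^ q)" using h by linarith
  also have "\<dots> \<le> 1 / (real q * a * m i j 0 ^ q)"
    using weight[OF ij(1,2)] a_pos z q by (intro divide_left_mono mult_right_mono mult_left_mono) auto
  finally have "\<delta> / b ^ q \<le> 1 / (real q * a * m i j 0 ^ q)" .
  moreover have "M \<le> B / (x * d)" if "d / B \<le> 1 / (x * M)" "0 < d" "0 < B" "0 < M" "0 < x" for d B x M :: real
    using that by (simp add: field_simps)
  ultimately have "m i j 0 ^ q \<le> b ^ q / (real q * a * \<delta>)"
    using \<delta> b_pos z a_pos q by simp
  also have "\<dots> = b ^ q * (1 / (real q * a * \<delta>))" by simp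
  also have "\<dots> \<le> b ^ q * K1"
  proof (intro mult_left_mono)
    have "1 / (real q * a * \<delta>) \<le> 2 / (real q * a * \<delta>)"
      using a_pos \<delta> by (intro divide_right_mono) auto
    thus "1 / (real q * a * \<delta>) \<le> K1" using K1(2) by simp
  qed (use b_pos in auto)
  also have "\<dots> \<le> b ^ q * K1 ^ q" using K1 q b_pos by (intro mult_left_mono self_le_power) auto
  finally have "m i j 0 ^ q \<le> (K1 * b) ^ q" by (simp add: power_mult_distrib mult.commute)
  thus "m i j 0 \<le> K1 * b" using power_mono_iff[of "m i j 0" "K1 * b" q] z K1 b_pos q by simp
qed

text \<open>The race. Let \<open>h\<close> be the competitor that \<open>gap\<close> provides. Since
  \<open>m\<^sub>h\<^sub>h \<le> B b \<le> \<rho>\<close> so far, the elapsed time exceeds the blow-up time of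
  \<open>h\<close> by at most \<open>\<delta> / (4 b^q)\<close>. By \<open>free_growth\<close> the off-diagonal entry
  is governed by its own blow-up time, of which another \<open>\<delta> / (4 b^q)\<close> is lost to the control
  function. The gap \<open>\<delta> / b^q\<close> therefore leaves at least \<open>\<delta> / (2 b^q)\<close> until
  blow-up, which keeps the entry below \<open>K1 b\<close>.\<close>

lemma off_before_hit:
  assumes g: "controlled \<tau>" and u: "0 \<le> u" "u \<le> \<tau>" and ij: "i \<in> {1..r}" "j \<in> {1..r}" "i \<noteq> j"
    and le: "\<And>v. 0 \<le> v \<Longrightarrow> v \<le> u \<Longrightarrow> m i i v \<le> B * b \<and> m j j v \<le> B * b"
  shows "\<bar>m i j u\<bar> \<le> K1 * b"
proof -
  have eb: "\<epsilon> * b < \<delta> * b" using \<epsilon> b_pos by simp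
  have pos0: "0 < m h k 0" if "h \<in> {1..r}" "k \<in> {1..r}" for h k
    using init[OF that] mult_pos_pos[OF \<delta> b_pos] by linarith
  have pos: "m i j v > 0" if v: "0 \<le> v" "v \<le> u" for v
  proof -
    have "m i j v \<ge> m i j 0 - \<epsilon> * b \<and> m i j v > 0"
    proof (rule stays_above[where y="m i j" and \<Psi>=ctrl and y'="corr_rate i j" and \<Psi>'=ctrl_rate])
      fix w assume w: "0 \<le> w" "w \<le> v"
      show "(m i j has_real_derivative corr_rate i j w) (at w within {0..})" using corr_deriv ij w by auto
      show "(ctrl has_real_derivative ctrl_rate w) (at w within {0..})" using ctrl_deriv w by auto
      show "\<bar>ctrl w - ctrl 0\<bar> \<le> \<epsilon> * b" using ctrl_var[OF g, of 0 w] v w u by auto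
      assume nn: "0 \<le> m i j w"
      have "0 \<le> \<alpha> i j * m i j w ^ (q+1)" using nn weight[OF ij(1,2)] a_pos by (intro mult_nonneg_nonneg) auto
      moreover have "\<bar>corr_rate i j w - \<alpha> i j * m i j w ^ (q+1)\<bar> \<le> - ctrl_rate w"
        by (rule off_rate[OF g w(1) _ ij]) (use le[of w] w v u in auto)
      ultimately show "ctrl_rate w \<le> corr_rate i j w" by linarith
    qed (use eb init[OF ij(1,2)] v in auto)
    thus ?thesis by simp
  qed
  have fg: "1 / m i j u ^ q \<ge> 1 / (m i j 0 + \<epsilon> * b) ^ q - real q * \<alpha> i j * (u - 0)"
  proof (rule free_growth[where y="m i j" and \<Psi>=ctrl and y'="corr_rate i j" and \<Psi>'=ctrl_rate])
    fix w assume w: "0 \<le> w" "w \<le> u"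
    show "(m i j has_real_derivative corr_rate i j w) (at w within {0..})" using corr_deriv ij w by auto
    show "(ctrl has_real_derivative ctrl_rate w) (at w within {0..})" using ctrl_deriv w by auto
    show "\<bar>ctrl w - ctrl 0\<bar> \<le> \<epsilon> * b" using ctrl_var[OF g, of 0 w] w u by auto
    have "\<bar>corr_rate i j w - \<alpha> i j * m i j w ^ (q+1)\<bar> \<le> - ctrl_rate w"
      by (rule off_rate[OF g w(1) _ ij]) (use le[of w] w u in auto)
    thus "corr_rate i j w \<le> \<alpha> i j * m i j w ^ (q+1) - ctrl_rate w" by linarith
  qed (use pos weight[OF ij(1,2)] a_pos u in auto)
  let ?\<Omega> = "1 / (real q * a * \<delta> ^ q)"
  let ?\<omega> = "\<lambda>h k. 1 / (real q * \<alpha> h k * m h k 0 ^ q)"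
  have \<omega>_le: "?\<omega> h k \<le> ?\<Omega> / b ^ q" and \<omega>_ge: "0 \<le> ?\<omega> h k" if hk: "h \<in> {1..r}" "k \<in> {1..r}" for h k
  proof -
    have "a * (\<delta> * b) ^ q \<le> \<alpha> h k * m h k 0 ^ q"
      using weight[OF hk] init[OF hk] \<delta> b_pos a_pos by (intro mult_mono power_mono) auto
    hence "real q * a * (\<delta> * b) ^ q \<le> real q * \<alpha> h k * m h k 0 ^ q"
      using q by (simp add: mult.assoc mult_left_mono)
    hence "?\<omega> h k \<le> 1 / (real q * a * (\<delta> * b) ^ q)"
      using q a_pos \<delta> b_pos by (intro frac_le) auto
    thus "?\<omega> h k \<le> ?\<Omega> / b ^ q" by (simp add: power_mult_distrib mult_ac)
    show "0 \<le> ?\<omega> h k" using pos0[OF hk] weight[OF hk] a_pos by (intro divide_nonneg_nonneg mult_nonneg_nonneg) auto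
  qed
  obtain h where h: "h \<in> {i,j}" "?\<omega> h h + \<delta> / b ^ q \<le> ?\<omega> i j" using gap[OF ij] by blast
  have hr: "h \<in> {1..r}" using h ij by auto
  let ?X = "m h h 0"
  have X: "\<delta> * b \<le> ?X" "0 < ?X" using init[OF hr hr] pos0[OF hr hr] by auto
  have shrink: "\<epsilon> * b \<le> \<nu> * Y" if "\<delta> * b \<le> Y" for Y
  proof -
    have "\<epsilon> * b \<le> \<nu> * \<delta> * b" using \<epsilon> b_pos by (intro mult_right_mono) auto
    also have "\<dots> \<le> \<nu> * Y" using that \<nu> by (simp add: mult.assoc)
    finally show ?thesis .
  qed
  have u_le: "u \<le> ?\<omega> h h + \<delta> / 4 / b ^ q"
  proof -
    have "real q * (\<alpha> h h * (1 - \<rho>\<^sup>2)) * (u - 0) \<le> 1 / (?X - \<epsilon> * b) ^ q"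
    proof (rule diag_rise[OF g _ u hr])
      show "m h h v \<le> \<rho>" if "0 \<le> v" "v \<le> u" for v using le[OF that] h(1) b_small(1) by auto
    qed (use eb X \<rho> in auto)
    moreover have "real q * (\<alpha> h h * (1 - \<nu>)) * u \<le> real q * (\<alpha> h h * (1 - \<rho>\<^sup>2)) * u"
      using \<rho> u weight[OF hr hr] a_pos by (intro mult_right_mono mult_left_mono) auto
    moreover have "1 / (?X - \<epsilon> * b) ^ q \<le> 1 / ((1 - \<nu>) * ?X) ^ q"
    proof (intro frac_le power_mono zero_less_power)
      show "(1 - \<nu>) * ?X \<le> ?X - \<epsilon> * b" using shrink[OF X(1)] by (simp add: algebra_simps)
      show "0 < (1 - \<nu>) * ?X" "0 \<le> (1 - \<nu>) * ?X" using X \<nu> by auto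
    qed auto
    ultimately have "real q * (\<alpha> h h * (1 - \<nu>)) * u \<le> 1 / ((1 - \<nu>) * ?X) ^ q" by simp
    moreover have "0 < real q * (\<alpha> h h * (1 - \<nu>))" using \<nu> q weight[OF hr hr] a_pos by auto
    ultimately have "u \<le> 1 / ((1 - \<nu>) * ?X) ^ q / (real q * (\<alpha> h h * (1 - \<nu>)))"
      by (subst pos_le_divide_eq) (simp_all add: mult.commute)
    also have "\<dots> = ?\<omega> h h * (1 / (1 - \<nu>) ^ (q+1))" by (simp add: power_mult_distrib mult_ac)
    also have "\<dots> = ?\<omega> h h + (1 / (1 - \<nu>) ^ (q+1) - 1) * ?\<omega> h h" by (simp add: algebra_simps)
    also have "(1 / (1 - \<nu>) ^ (q+1) - 1) * ?\<omega> h h \<le> (1 / (1 - \<nu>) ^ (q+1) - 1) * (?\<Omega> / b ^ q)"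
    proof (intro mult_left_mono \<omega>_le hr)
      have "(1 - \<nu>) ^ (q+1) \<le> 1" by (rule power_le_one) (use \<nu> in auto)
      moreover have "0 < (1 - \<nu>) ^ (q+1)" using \<nu> by (intro zero_less_power) auto
      ultimately show "0 \<le> 1 / (1 - \<nu>) ^ (q+1) - 1" by (simp add: field_simps)
    qed
    also have "\<dots> = (1 / (1 - \<nu>) ^ (q+1) - 1) * ?\<Omega> / b ^ q" by simp
    also have "\<dots> \<le> \<delta> / 4 / b ^ q" using \<nu>(3) b_pos by (intro divide_right_mono) auto
    finally show ?thesis by simp
  qed
  let ?z = "m i j 0"
  have z: "\<delta> * b \<le> ?z" "0 < ?z" using init[OF ij(1,2)] pos0[OF ij(1,2)] by auto
  have aij: "a \<le> \<alpha> i j" "0 < \<alpha> i j" using weight[OF ij(1,2)] a_pos by auto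
  have "1 / (K1 * b) ^ q \<le> 1 / m i j u ^ q"
  proof -
    have 1: "real q * \<alpha> i j * (?\<omega> i j - \<delta> / 4 / b ^ q) \<le> 1 / (?z + \<epsilon> * b) ^ q"
    proof -
      have "(1 - 1 / (1 + \<nu>) ^ q) * ?\<omega> i j \<le> (1 - 1 / (1 + \<nu>) ^ q) * (?\<Omega> / b ^ q)"
      proof (intro mult_left_mono \<omega>_le ij)
        have "1 \<le> (1 + \<nu>) ^ q" using \<nu> by (intro one_le_power) auto
        thus "0 \<le> 1 - 1 / (1 + \<nu>) ^ q" by simp
      qed
      also have "\<dots> = (1 - 1 / (1 + \<nu>) ^ q) * ?\<Omega> / b ^ q" by simp
      also have "\<dots> \<le> \<delta> / 4 / b ^ q" using \<nu>(4) b_pos by (intro divide_right_mono) auto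
      finally have "?\<omega> i j - \<delta> / 4 / b ^ q \<le> 1 / (1 + \<nu>) ^ q * ?\<omega> i j"
        unfolding left_diff_distrib by linarith
      hence "real q * \<alpha> i j * (?\<omega> i j - \<delta> / 4 / b ^ q) \<le> real q * \<alpha> i j * (1 / (1 + \<nu>) ^ q * ?\<omega> i j)"
        using aij by (intro mult_left_mono) auto
      also have "\<dots> = 1 / ((1 + \<nu>) * ?z) ^ q" using aij q z by (simp add: power_mult_distrib)
      also have "\<dots> \<le> 1 / (?z + \<epsilon> * b) ^ q"
      proof (intro frac_le power_mono zero_less_power)
        show "?z + \<epsilon> * b \<le> (1 + \<nu>) * ?z" using shrink[OF z(1)] by (simp add: algebra_simps)
        have "0 < \<epsilon> * b" using \<epsilon>(1) b_pos by simp
        thus "0 < ?z + \<epsilon> * b" "0 \<le> ?z + \<epsilon> * b" using z by linarith+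
      qed auto
      finally show ?thesis .
    qed
    have "\<delta> / 2 / b ^ q \<le> (?\<omega> i j - \<delta> / 4 / b ^ q) - u" using u_le h(2) by simp
    hence "real q * \<alpha> i j * (\<delta> / 2 / b ^ q) \<le> real q * \<alpha> i j * ((?\<omega> i j - \<delta> / 4 / b ^ q) - u)"
      using aij by (intro mult_left_mono) auto
    also have "\<dots> = real q * \<alpha> i j * (?\<omega> i j - \<delta> / 4 / b ^ q) - real q * \<alpha> i j * u"
      by (rule right_diff_distrib)
    also have "\<dots> \<le> 1 / m i j u ^ q" using 1 fg unfolding diff_0_right by linarith
    finally have 2: "real q * \<alpha> i j * (\<delta> / 2 / b ^ q) \<le> 1 / m i j u ^ q" .
    have "1 / (K1 * b) ^ q = 1 / K1 ^ q / b ^ q" by (simp add: power_mult_distrib)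
    also have "\<dots> \<le> 1 / K1 / b ^ q" using K1 q b_pos
      by (intro divide_right_mono divide_left_mono self_le_power) auto
    also have "\<dots> \<le> real q * a * (\<delta> / 2) / b ^ q"
    proof (intro divide_right_mono)
      have "1 / k \<le> x / 2" if "2 / x \<le> k" "0 < x" "0 < k" for x k :: real
        using that by (simp add: field_simps)
      from this[OF K1(2)] show "1 / K1 \<le> real q * a * (\<delta> / 2)" using K1 q a_pos \<delta> by simp
    qed (use b_pos in auto)
    also have "\<dots> \<le> real q * \<alpha> i j * (\<delta> / 2) / b ^ q"
      using aij q \<delta> b_pos by (intro divide_right_mono mult_right_mono mult_left_mono) auto
    finally show ?thesis using 2 by simp
  qed
  moreover have "y \<le> x" if "0 < x" "0 < y" "1 / x \<le> 1 / y" for x y :: real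
    using that by (simp add: field_simps)
  ultimately have "m i j u ^ q \<le> (K1 * b) ^ q" using pos[of u] u K1 b_pos by simp
  hence "m i j u \<le> K1 * b" using power_mono_iff[of "m i j u" "K1 * b" q] pos[of u] u K1 b_pos q by simp
  thus ?thesis using pos[of u] u by simp
qed

text \<open>Adding a small multiple of the control function removes the leak and noise errors from
  \<open>pair_rate_le\<close>. What is left is the growth at rate \<open>4 A \<kappa>^q\<close>, and as soon as one of
  the two diagonal entries is of order \<open>\<rho>\<close> the dissipation exceeds it.\<close>

lemma pair_decay:
  assumes g: "controlled \<tau>" "0 \<le> u" "u \<le> \<tau>" and ij: "i \<in> {1..r}" "j \<in> {1..r}" "i \<noteq> j"
  shows "pair_rate i j u + C0 * \<kappa> * ctrl_rate u \<le> 8 * A * \<kappa> ^ (q+2)"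
    and "\<rho> / 2 \<le> m i i u \<or> \<rho> / 2 \<le> m j j u \<Longrightarrow> pair_rate i j u + C0 * \<kappa> * ctrl_rate u \<le> 0"
proof -
  have nd: "nearly_diagonal \<kappa> u" using g by (auto simp: controlled_def)
  interpret near_diagonal q r \<alpha> "\<lambda>i j. m i j u" a A \<kappa> "leak u" by (rule near_diagonalI[OF nd g(2) kappa_bounds(2,3)])
  let ?Q = "(m i j u)\<^sup>2 + (m j i u)\<^sup>2" and ?X = "m i i u ^ (q+1) + m j j u ^ (q+1)"
  have "leak u + \<kappa> ^ (q+2) + e \<le> - ctrl_rate u"
  proof -
    have "1 * 1 \<le> real r ^ 2 * A" using r A1 by (intro mult_mono) (auto simp: one_le_power)
    hence rA: "1 \<le> real r ^ 2 * A" by simp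
    hence "1 * leak u \<le> real r ^ 2 * A * leak u" using P_nonneg by (intro mult_right_mono)
    moreover have "1 * \<kappa> ^ (q+2) \<le> (2 * real r ^ 2 * A + 3 * A) * (B * b) ^ (q+2)"
      using kappa_bounds rA A1 by (intro mult_mono power_mono) auto
    ultimately show ?thesis using leak_absorbed[OF g] by linarith
  qed
  hence "C0 * \<kappa> * (leak u + \<kappa> ^ (q+2) + e) \<le> C0 * \<kappa> * (- ctrl_rate u)"
    using C01 kappa_bounds by (intro mult_left_mono) auto
  moreover have "C0 * (\<kappa> * leak u + \<kappa> ^ (q+3) + \<kappa> * e) = C0 * \<kappa> * (leak u + \<kappa> ^ (q+2) + e)"
    by (simp add: algebra_simps power_add power2_eq_square power3_eq_cube)
  ultimately have main: "pair_rate i j u + C0 * \<kappa> * ctrl_rate u \<le> - (a/16) * (?Q * ?X) + 4 * A * \<kappa> ^ q * ?Q"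
    using pair_rate_le[OF nd g(2) kappa_bounds(2,3) ij] unfolding mult_minus_right by linarith
  have X0: "0 \<le> ?X" using diag_nonneg ij by (intro add_nonneg_nonneg zero_le_power) auto
  show "pair_rate i j u + C0 * \<kappa> * ctrl_rate u \<le> 8 * A * \<kappa> ^ (q+2)"
  proof -
    have "(m i j u)\<^sup>2 \<le> \<kappa>\<^sup>2" "(m j i u)\<^sup>2 \<le> \<kappa>\<^sup>2"
      using off_small[of i j] off_small[of j i] ij kappa_bounds abs_le_square_iff[of "m i j u" \<kappa>]
        abs_le_square_iff[of "m j i u" \<kappa>] by auto
    hence "4 * A * \<kappa> ^ q * ?Q \<le> 4 * A * \<kappa> ^ q * (2 * \<kappa>\<^sup>2)"
      using A1 kappa_bounds by (intro mult_left_mono) auto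
    moreover have "0 \<le> (a/16) * (?Q * ?X)" using a_pos X0 by (intro mult_nonneg_nonneg) auto
    ultimately show ?thesis using main by (simp add: power_add power2_eq_square algebra_simps)
  qed
  assume h: "\<rho> / 2 \<le> m i i u \<or> \<rho> / 2 \<le> m j j u"
  have "(\<rho>/2) ^ (q+1) \<le> ?X"
  proof -
    have nn: "0 \<le> m i i u ^ (q+1)" "0 \<le> m j j u ^ (q+1)" using diag_nonneg ij by auto
    from h show ?thesis
    proof
      assume "\<rho> / 2 \<le> m i i u"
      hence "(\<rho>/2) ^ (q+1) \<le> m i i u ^ (q+1)" using \<rho> by (intro power_mono) auto
      thus ?thesis using nn by linarith
    next
      assume "\<rho> / 2 \<le> m j j u"
      hence "(\<rho>/2) ^ (q+1) \<le> m j j u ^ (q+1)" using \<rho> by (intro power_mono) auto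
      thus ?thesis using nn by linarith
    qed
  qed
  hence "(a/16) * (\<rho>/2) ^ (q+1) \<le> (a/16) * ?X" using a_pos by (intro mult_left_mono) auto
  hence "4 * A * \<kappa> ^ q \<le> (a/16) * ?X" using b_small(4) unfolding \<kappa>_def by linarith
  hence "4 * A * \<kappa> ^ q * ?Q \<le> (a/16) * ?X * ?Q" by (intro mult_right_mono) auto
  moreover have "(a/16) * ?X * ?Q = (a/16) * (?Q * ?X)" by simp
  ultimately show "pair_rate i j u + C0 * \<kappa> * ctrl_rate u \<le> 0" using main by linarith
qed

text \<open>A diagonal entry at the level \<open>B b\<close> needs at most the time \<open>d = 2^(q+2) / (a B b^q)\<close>
  to reach \<open>\<rho>\<close>. In this time the energy gains at most \<open>8 A \<kappa>^(q+2) d\<close>, which is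
  at most \<open>K1\<^sup>2 b\<^sup>2\<close> because \<open>B\<close> is large; after it the energy, corrected by a
  multiple of the control function, decays.\<close>

lemma pair_energy_after_hit:
  assumes g: "controlled \<tau>" and s: "0 \<le> s" "s \<le> \<tau>" and ij: "i \<in> {1..r}" "j \<in> {1..r}" "i \<noteq> j"
    and h: "h \<in> {i,j}" "m h h s \<ge> B * b"
  shows "pair_energy i j \<tau> \<le> pair_energy i j s + 2 * K1\<^sup>2 * b\<^sup>2"
proof -
  define d where "d = 2 ^ (q+2) / (a * B * b ^ q)"
  have d0: "0 < d" unfolding d_def using a_pos B_pos b_pos by auto
  have hr: "h \<in> {1..r}" using h ij by auto
  have c: "\<epsilon> * b < m h h s" using h eps_b(2) B_pos b_pos
    mult_pos_pos[of B b] by linarith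
  \<comment> \<open>Otherwise \<open>m h h\<close> would stay below \<open>\<rho>\<close> for the time \<open>d\<close>, longer than \<open>diag_rise\<close> permits.\<close>
  have high: "\<rho> / 2 \<le> m h h u" if u: "s + d \<le> u" "u \<le> \<tau>" for u
  proof -
    obtain v where v: "s \<le> v" "v \<le> s + d" "\<rho> \<le> m h h v"
    proof (rule ccontr)
      assume no: "\<not> thesis"
      have "real q * (\<alpha> h h * (1 - \<rho>\<^sup>2)) * (s + d - s) \<le> 1 / (m h h s - \<epsilon> * b) ^ q"
        by (rule diag_rise[OF g s(1) _ _ hr c _ \<rho>(3)]) (use that no d0 u in force)+
      also have "\<dots> \<le> 1 / (B * b / 2) ^ q"
      proof (intro frac_le power_mono zero_less_power)
        show "B * b / 2 \<le> m h h s - \<epsilon> * b" using h(2) eps_b(2) by linarith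
      qed (use B_pos b_pos in auto)
      also have "\<dots> = 2 ^ q / (B ^ q * b ^ q)" by (simp add: power_divide power_mult_distrib)
      also have "\<dots> \<le> 2 ^ q / (B * b ^ q)"
        using B_pos b_pos q by (intro divide_left_mono mult_right_mono self_le_power) auto
      finally have up: "real q * (\<alpha> h h * (1 - \<rho>\<^sup>2)) * d \<le> 2 ^ q / (B * b ^ q)" by simp
      have "1/2 \<le> 1 - \<rho>\<^sup>2" using \<rho> \<nu> by linarith
      hence "1 * (a * (1/2)) * d \<le> real q * (\<alpha> h h * (1 - \<rho>\<^sup>2)) * d"
        using q weight[OF hr hr] a_pos d0 by (intro mult_right_mono mult_mono) auto
      from order_trans[OF this up] have "a * d / 2 \<le> 2 ^ q / (B * b ^ q)" by simp
      moreover have "a * d / 2 = 2 * (2 ^ q / (B * b ^ q))" unfolding d_def using a_pos by (simp add: field_simps)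
      moreover have "0 < 2 ^ q / (B * b ^ q)" using B_pos b_pos by auto
      ultimately show False by linarith
    qed
    have "m h h u \<ge> m h h v - \<epsilon> * b \<and> m h h u > 0"
      by (rule diag_stays[OF g _ _ u(2) hr]) (use v u s \<rho> eps_b in auto)
    thus ?thesis using v eps_b by linarith
  qed
  define G where "G u = pair_energy i j u + C0 * \<kappa> * ctrl u" for u
  have dG: "(G has_real_derivative pair_rate i j u + C0 * \<kappa> * ctrl_rate u) (at u within {0..})" if "0 \<le> u" for u
    unfolding G_def using that ij by (intro DERIV_add DERIV_cmult pair_energy_deriv ctrl_deriv)
  let ?R = "8 * A * \<kappa> ^ (q+2)"
  have R0: "0 \<le> ?R" using A1 kappa_bounds by auto
  have early: "G u \<le> G s + ?R * (u - s)" if u: "s \<le> u" "u \<le> \<tau>" for u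
  proof -
    have "?R * s - G s \<le> ?R * u - G u"
      by (rule nondecreasing_within[where f="\<lambda>u. ?R * u - G u" and D="\<lambda>u. ?R - (pair_rate i j u + C0 * \<kappa> * ctrl_rate u)"])
         (use pair_decay(1)[OF g _ _ ij] dG s u in \<open>auto intro!: DERIV_diff DERIV_cmult_Id\<close>)
    thus ?thesis by (simp add: algebra_simps)
  qed
  have "G \<tau> \<le> G s + ?R * d"
  proof (cases "\<tau> \<le> s + d")
    case True
    hence "?R * (\<tau> - s) \<le> ?R * d" using R0 by (intro mult_left_mono) auto
    thus ?thesis using early[of \<tau>] s by linarith
  next
    case False
    have "- G (s + d) \<le> - G \<tau>"
    proof (rule nondecreasing_within[where f="\<lambda>u. - G u" and D="\<lambda>u. - (pair_rate i j u + C0 * \<kappa> * ctrl_rate u)"])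
      fix u assume u: "s + d \<le> u" "u \<le> \<tau>"
      have u0: "0 \<le> u" using u s d0 by linarith
      show "((\<lambda>u. - G u) has_real_derivative - (pair_rate i j u + C0 * \<kappa> * ctrl_rate u)) (at u within {0..})"
        by (intro DERIV_minus dG u0)
      have "\<rho> / 2 \<le> m i i u \<or> \<rho> / 2 \<le> m j j u" using high[OF u] h(1) by auto
      thus "0 \<le> - (pair_rate i j u + C0 * \<kappa> * ctrl_rate u)" using pair_decay(2)[OF g u0 u(2) ij] by simp
    qed (use s d0 False in auto)
    thus ?thesis using early[of "s + d"] d0 False by simp
  qed
  moreover have "?R * d \<le> K1\<^sup>2 * b\<^sup>2"
  proof -
    have "?R * d = 8 * A * (6 * K1) ^ (q+2) * (2 ^ (q+2) / (a * B)) * b\<^sup>2"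
      unfolding d_def \<kappa>_def using b_pos by (simp add: power_mult_distrib power_add power2_eq_square field_simps)
    also have "\<dots> \<le> K1\<^sup>2 * b\<^sup>2" using B(2) by (intro mult_right_mono) auto
    finally show ?thesis .
  qed
  moreover have "C0 * \<kappa> * ctrl s - C0 * \<kappa> * ctrl \<tau> \<le> K1\<^sup>2 * b\<^sup>2"
  proof -
    have "ctrl s - ctrl \<tau> \<le> \<epsilon> * b" using ctrl_var[OF g, of s \<tau>] s by linarith
    hence "C0 * \<kappa> * (ctrl s - ctrl \<tau>) \<le> C0 * \<kappa> * (\<epsilon> * b)" using C01 kappa_bounds by (intro mult_left_mono) auto
    also have "\<dots> = C0 * (6 * K1) * \<epsilon> * b\<^sup>2" unfolding \<kappa>_def by (simp add: power2_eq_square)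
    also have "\<dots> \<le> K1\<^sup>2 * b\<^sup>2" using \<epsilon>(5) by (intro mult_right_mono) auto
    finally show ?thesis by (simp add: right_diff_distrib)
  qed
  ultimately show ?thesis unfolding G_def by linarith
qed

text \<open>The strict improvement that closes the continuation argument: before the first hit by
  \<open>off_before_hit\<close>, afterwards by \<open>pair_energy_after_hit\<close> applied from the hitting time on.\<close>

lemma off_strict:
  assumes g: "controlled \<tau>" and ij: "i \<in> {1..r}" "j \<in> {1..r}" "i \<noteq> j"
  shows "\<bar>m i j \<tau>\<bar> < \<kappa>"
proof -
  have \<tau>: "0 \<le> \<tau>" using g by (simp add: controlled_def)
  have K0: "0 < K1 * b" using K1 b_pos by auto
  have fin: ?thesis if "\<bar>m i j \<tau>\<bar> \<le> K1 * b" using that K0 unfolding \<kappa>_def by linarith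
  let ?g = "\<lambda>u. max (m i i u) (m j j u)"
  show ?thesis
  proof (cases "\<exists>u\<in>{0..\<tau>}. ?g u \<ge> B * b")
    case False
    hence "\<And>v. 0 \<le> v \<Longrightarrow> v \<le> \<tau> \<Longrightarrow> m i i v \<le> B * b \<and> m j j v \<le> B * b"
      by (metis atLeastAtMost_iff linorder_le_cases max.coboundedI1 max.coboundedI2 order_trans)
    hence "\<bar>m i j \<tau>\<bar> \<le> K1 * b" by (intro off_before_hit[OF g \<tau> _ ij]) auto
    thus ?thesis by (rule fin)
  next
    case True
    then obtain u where u: "0 \<le> u" "u \<le> \<tau>" "?g u \<ge> B * b" by auto
    have "continuous_on {0..\<tau>} ?g"
      by (intro continuous_intros cont_within_Ici[of _ _ _ "corr_rate _ _"]) (use corr_deriv ij in auto)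
    from first_hit[OF this u] obtain s where s: "0 \<le> s" "s \<le> u" "?g s \<ge> B * b"
      "s > 0 \<Longrightarrow> \<forall>v\<in>{0..s}. ?g v \<le> B * b" by metis
    have at_s: "\<bar>m k l s\<bar> \<le> K1 * b" if kl: "(k,l) = (i,j) \<or> (k,l) = (j,i)" for k l
    proof (cases "s = 0")
      case True
      thus ?thesis using off_init[of k l] kl ij by auto
    next
      case False
      have "\<And>v. 0 \<le> v \<Longrightarrow> v \<le> s \<Longrightarrow> m k k v \<le> B * b \<and> m l l v \<le> B * b"
        using s(1) s(4) False kl by auto
      thus ?thesis using kl ij s u by (intro off_before_hit[OF g]) auto
    qed
    obtain h where h: "h \<in> {i,j}" "m h h s \<ge> B * b" using s(3) by (auto simp: max_def split: if_splits)
    have sq: "(m k l s)\<^sup>2 \<le> K1\<^sup>2 * b\<^sup>2" if "(k,l) = (i,j) \<or> (k,l) = (j,i)" for k l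
      using at_s[OF that] abs_le_square_iff[of "m k l s" "K1 * b"] K0 by (simp add: power_mult_distrib)
    have nd: "nearly_diagonal \<kappa> s" "nearly_diagonal \<kappa> \<tau>" using g s u by (auto simp: controlled_def)
    hence dn: "0 \<le> m i i s" "0 \<le> m j j s" using ij by (auto simp: nearly_diagonal_def)
    have "pair_energy i j s \<le> (K1\<^sup>2 * b\<^sup>2 + K1\<^sup>2 * b\<^sup>2) * 1"
      unfolding pair_energy_def using sq dn by (intro mult_mono add_mono) auto
    hence "pair_energy i j \<tau> \<le> 4 * (K1\<^sup>2 * b\<^sup>2)"
      using pair_energy_after_hit[OF g s(1) _ ij h] s u by simp
    moreover have "(m i j \<tau>)\<^sup>2 * (1/8) \<le> pair_energy i j \<tau>"
    proof -
      have "exp (-2) \<le> exp (- m i i \<tau> - m j j \<tau>)"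
        using entry_le_1[OF ij(1,1) \<tau>] entry_le_1[OF ij(2,2) \<tau>] by simp
      hence "1/8 \<le> exp (- m i i \<tau> - m j j \<tau>)" using exp_minus_2_ge by linarith
      thus ?thesis unfolding pair_energy_def by (intro mult_mono) auto
    qed
    ultimately have "(m i j \<tau>)\<^sup>2 \<le> 32 * (K1\<^sup>2 * b\<^sup>2)" by simp
    also have "\<dots> < 36 * (K1\<^sup>2 * b\<^sup>2)" using K1 b_pos by auto
    also have "\<dots> = \<kappa>\<^sup>2" unfolding \<kappa>_def by (simp add: power_mult_distrib)
    finally have "\<bar>m i j \<tau>\<bar>\<^sup>2 < \<kappa>\<^sup>2" by simp
    thus ?thesis by (rule power_less_imp_less_base) (rule kappa_bounds)
  qed
qed

lemma eps_delta: "\<epsilon> * b < \<delta> * b" using \<epsilon> b_pos by simp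

lemma controlled_horizon: "controlled (T / b ^ q)"
proof -
  let ?H = "T / b ^ q" and ?C = "{1..r} \<times> {1..r}"
  \<comment> \<open>All conditions defining \<open>nearly_diagonal\<close> in the form \<open>f c t \<le> 0\<close>.\<close>
  define f where "f = (\<lambda>(i,j) t. if i = j then - m i i t else \<bar>m i j t\<bar> - \<kappa>)"
  have H0: "0 \<le> ?H" using T_pos b_pos by auto
  have lt: "f c t < 0" if "0 \<le> t" "t \<le> ?H" "c \<in> ?C" for c t
  proof (rule continuation_bootstrap[where C="?C" and f=f and s=0 and \<tau>="?H"])
    fix c assume c: "c \<in> ?C"
    obtain i j where ij: "c = (i,j)" "i \<in> {1..r}" "j \<in> {1..r}" using c by auto
    have "continuous_on {0..?H} (m i j)" if "i \<in> {1..r}" "j \<in> {1..r}" for i j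
      by (rule cont_within_Ici[of _ _ _ "corr_rate i j"]) (use corr_deriv that in auto)
    thus "continuous_on {0..?H} (f c)" unfolding f_def ij using ij
      by (cases "i = j") (auto intro!: continuous_intros)
    show "f c 0 \<le> 0"
    proof (cases "i = j")
      case True thus ?thesis using init[OF ij(2,3)] mult_pos_pos[OF \<delta> b_pos] by (simp add: f_def ij)
    next
      case False
      thus ?thesis using off_init[OF ij(2,3)] K1 b_pos mult_pos_pos[of K1 b] by (simp add: f_def ij \<kappa>_def)
    qed
  next
    fix t c assume t: "0 \<le> t" "t \<le> ?H" and c: "c \<in> ?C"
      and le: "\<And>u d. 0 \<le> u \<Longrightarrow> u \<le> t \<Longrightarrow> d \<in> ?C \<Longrightarrow> f d u \<le> 0"
    have g: "controlled t" unfolding controlled_def nearly_diagonal_def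
    proof (intro conjI ballI impI t)
      fix u i assume "u \<in> {0..t}" "i \<in> {1..r}"
      thus "0 \<le> m i i u" using le[of u "(i,i)"] by (simp add: f_def)
    next
      fix u i j assume "u \<in> {0..t}" "i \<in> {1..r}" "j \<in> {1..r}" "i \<noteq> j"
      thus "\<bar>m i j u\<bar> \<le> \<kappa>" using le[of u "(i,j)"] by (simp add: f_def)
    qed
    obtain i j where ij: "c = (i,j)" "i \<in> {1..r}" "j \<in> {1..r}" using c by auto
    show "f c t < 0"
    proof (cases "i = j")
      case True
      have "m i i t > 0" using diag_stays[OF g order_refl t(1) order_refl ij(2)] init[OF ij(2,2)] eps_delta by auto
      thus ?thesis using True by (simp add: f_def ij)
    next
      case False thus ?thesis using off_strict[OF g ij(2,3)] by (simp add: f_def ij)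
    qed
  qed (use that in auto)
  show ?thesis unfolding controlled_def nearly_diagonal_def
  proof (intro conjI ballI impI H0 order_refl)
    fix u i assume "u \<in> {0..?H}" "i \<in> {1..r}"
    thus "0 \<le> m i i u" using lt[of u "(i,i)"] by (simp add: f_def)
  next
    fix u i j assume "u \<in> {0..?H}" "i \<in> {1..r}" "j \<in> {1..r}" "i \<noteq> j"
    thus "\<bar>m i j u\<bar> \<le> \<kappa>" using lt[of u "(i,j)"] by (simp add: f_def)
  qed
qed

lemma diag_escapes:
  assumes i: "i \<in> {1..r}" and \<mu>: "0 < \<mu>" "\<mu> < 1" and T: "T > (2 / \<delta>) ^ q / (real q * a * (1 - \<mu>\<^sup>2))"
    and \<epsilon>2: "\<epsilon> \<le> \<delta> / 2" "\<epsilon> * b < \<mu>"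
  shows "m i i (T / b ^ q) \<ge> \<mu> - \<epsilon> * b"
proof -
  let ?H = "T / b ^ q"
  note g = controlled_horizon
  have H0: "0 \<le> ?H" using T_pos b_pos by auto
  have c: "\<epsilon> * b < m i i 0" using init[OF i i] eps_delta by linarith
  have \<mu>2: "0 < 1 - \<mu>\<^sup>2" using \<mu> by (simp add: power_less_one_iff)
  obtain v where v: "0 \<le> v" "v \<le> ?H" "\<mu> \<le> m i i v"
  proof (rule ccontr)
    assume no: "\<not> thesis"
    have "real q * (\<alpha> i i * (1 - \<mu>\<^sup>2)) * (?H - 0) \<le> 1 / (m i i 0 - \<epsilon> * b) ^ q"
      by (rule diag_rise[OF g order_refl H0 order_refl i c]) (use that no \<mu> in force)+
    also have "\<dots> \<le> 1 / (\<delta> * b / 2) ^ q"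
    proof (intro frac_le power_mono zero_less_power)
      have "\<epsilon> * b \<le> \<delta> / 2 * b" using \<epsilon>2 b_pos by (intro mult_right_mono) auto
      thus "\<delta> * b / 2 \<le> m i i 0 - \<epsilon> * b" using init[OF i i] by simp
    qed (use \<delta> b_pos in auto)
    also have "\<dots> = (2 / \<delta>) ^ q / b ^ q" by (simp add: power_divide power_mult_distrib)
    finally have 1: "real q * (\<alpha> i i * (1 - \<mu>\<^sup>2)) * T / b ^ q \<le> (2 / \<delta>) ^ q / b ^ q" by simp
    hence "real q * (\<alpha> i i * (1 - \<mu>\<^sup>2)) * T \<le> (2 / \<delta>) ^ q" using b_pos by (simp add: divide_le_cancel)
    moreover have "real q * (a * (1 - \<mu>\<^sup>2)) * T \<le> real q * (\<alpha> i i * (1 - \<mu>\<^sup>2)) * T"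
      using weight[OF i i] \<mu>2 T_pos by (intro mult_right_mono mult_left_mono) auto
    moreover have "(2 / \<delta>) ^ q < T * (real q * a * (1 - \<mu>\<^sup>2))"
      using T \<mu>2 q a_pos by (simp add: pos_divide_less_eq)
    ultimately show False by (simp add: mult_ac)
  qed
  thus ?thesis using diag_stays[OF g v(1,2) order_refl i] \<epsilon>2 by auto
qed

end

section \<open>Trapping near the identity\<close>

context correlation_flow
begin

text \<open>The region in which the diagonal exceeds \<open>1 - \<theta>\<close> and the off-diagonal entries are smaller
  than \<open>k = \<theta>\<^sup>2\<close> is invariant. On the face \<open>m\<^sub>i\<^sub>i = 1 - \<theta>\<close>
  the drift is at least \<open>a \<theta> / 2\<close>, against errors of order \<open>k\<^sup>2 + e\<close>. On the
  face \<open>\<bar>m\<^sub>i\<^sub>j\<bar> = k\<close> the drag decreases \<open>m\<^sub>i\<^sub>j\<^sup>2 /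
  2\<close> at the rate \<open>a k\<^sup>2 / 8\<close>, against errors of order \<open>k\<^sup>3 + k e\<close>.\<close>

lemma trapped:
  assumes s: "0 \<le> s" and \<theta>: "0 < \<theta>" "\<theta> \<le> 1/4" "real (q+1) * \<theta> \<le> 1/2"
    "(2 * A + 3 * real r ^ 2 * A) * \<theta> \<le> a / 16" and e: "e < a * \<theta>\<^sup>2 / 16"
    and diag: "\<And>i. i \<in> {1..r} \<Longrightarrow> m i i s > 1 - \<theta>"
    and off: "\<And>i j. i \<in> {1..r} \<Longrightarrow> j \<in> {1..r} \<Longrightarrow> i \<noteq> j \<Longrightarrow> \<bar>m i j s\<bar> < \<theta>\<^sup>2"
    and t: "s \<le> t" and i: "i \<in> {1..r}"
  shows "m i i t > 1 - \<theta>"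
proof -
  define k where "k = \<theta>\<^sup>2"
  have th2: "\<theta>\<^sup>2 \<le> \<theta>" using \<theta> by (simp add: power2_eq_square mult_left_le)
  have k: "0 < k" "k \<le> 1" "k \<le> \<theta>" using \<theta> th2 unfolding k_def by auto
  define C where "C = {1..r} \<times> {1..r}"
  define f where "f = (\<lambda>(i,j) t. if i = j then 1 - \<theta> - m i i t else (m i j t)\<^sup>2 - k\<^sup>2)"
  define D where "D = (\<lambda>(i,j) t. if i = j then - corr_rate i i t else 2 * m i j t * corr_rate i j t)"
  have "f (i,i) t < 0"
  proof (rule barrier[where f=f and C=C and D=D and s=s])
    show "finite C" by (simp add: C_def)
    fix t c assume t: "s \<le> t" and c: "c \<in> C"
    obtain i j where ij: "c = (i,j)" "i \<in> {1..r}" "j \<in> {1..r}" using c by (auto simp: C_def)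
    have t0: "0 \<le> t" using t s by simp
    show "(f c has_real_derivative D c t) (at t within {0..})"
    proof (cases "i = j")
      case True
      have "((\<lambda>t. 1 - \<theta> - m i i t) has_real_derivative 0 - corr_rate i i t) (at t within {0..})"
        by (intro DERIV_diff DERIV_const corr_deriv ij t0)
      thus ?thesis using True by (simp add: f_def D_def ij)
    next
      case False
      have "((\<lambda>t. (m i j t)\<^sup>2 - k\<^sup>2) has_real_derivative 2 * m i j t * corr_rate i j t) (at t within {0..})"
        by (rule derivative_eq_intros corr_deriv ij t0 refl)+ simp
      thus ?thesis using False by (simp add: f_def D_def ij)
    qed
  next
    fix t c assume t: "s \<le> t" and c: "c \<in> C" and le: "\<And>d. d \<in> C \<Longrightarrow> f d t \<le> 0" and z: "f c t = 0"
    have t0: "0 \<le> t" using t s by simp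
    have dg: "1 - \<theta> \<le> m l l t" if "l \<in> {1..r}" for l
      using le[of "(l,l)"] that by (simp add: f_def C_def)
    have dg1: "3/4 \<le> m l l t" "m l l t \<le> 1" if "l \<in> {1..r}" for l
      using dg[OF that] \<theta> entry_le_1[OF that that t0] by auto
    have of: "\<bar>m l l' t\<bar> \<le> k" if "l \<in> {1..r}" "l' \<in> {1..r}" "l \<noteq> l'" for l l'
      using le[of "(l,l')"] that k abs_le_square_iff[of "m l l' t" k] by (simp add: f_def C_def)
    have pw: "1/2 \<le> m l l t ^ (q+1)" if "l \<in> {1..r}" for l
    proof -
      have "1 + real (q+1) * (- \<theta>) \<le> (1 + - \<theta>) ^ (q+1)" using \<theta> by (intro Bernoulli_inequality) auto
      hence "1/2 \<le> (1 - \<theta>) ^ (q+1)" using \<theta> by simp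
      also have "\<dots> \<le> m l l t ^ (q+1)" using dg[OF that] \<theta> by (intro power_mono) auto
      finally show ?thesis .
    qed
    interpret near_diagonal q r \<alpha> "\<lambda>i j. m i j t" a A k "k\<^sup>2"
    proof
      fix i j assume ij: "i \<in> {1..r}" "j \<in> {1..r}" "i \<noteq> j"
      have sq: "(m i j t)\<^sup>2 \<le> k\<^sup>2" using of[OF ij] k abs_le_square_iff[of "m i j t" k] by simp
      have "(m i j t)\<^sup>2 * m l l t ^ (q+1) \<le> k\<^sup>2 * 1" if "l \<in> {1..r}" for l
        using sq dg1[OF that] by (intro mult_mono power_le_one) auto
      thus "(m i j t)\<^sup>2 * m i i t ^ (q+1) \<le> k\<^sup>2" "(m i j t)\<^sup>2 * m j j t ^ (q+1) \<le> k\<^sup>2" using ij by auto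
      show "\<bar>m i j t\<bar> \<le> k" by (rule of[OF ij])
    next
      fix i assume "i \<in> {1..r}" thus "0 \<le> m i i t" using dg1[of i] by linarith
    qed (use a_pos weight entry_le_1 t0 k in auto)
    have kq: "k ^ (q+2) \<le> k ^ 3" "k ^ (q+2) \<le> k\<^sup>2" using kappa_power_le[of 3 "q+2"] kappa_power_le[of 2 "q+2"] q by auto
    have rA0: "0 \<le> real r ^ 2 * A" using A1 by auto
    have small: "(2 * A + 3 * real r ^ 2 * A) * k \<le> a / 16"
      by (rule order_trans[OF mult_left_mono[OF k(3)] \<theta>(4)]) (use A1 in auto)
    obtain i j where ij: "c = (i,j)" "i \<in> {1..r}" "j \<in> {1..r}" using c by (auto simp: C_def)
    show "D c t < 0"
    proof (cases "i = j")
      case True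
      let ?x = "m i i t"
      have x: "?x = 1 - \<theta>" using z True by (simp add: f_def ij)
      have 1: "\<bar>drag q r \<alpha> (\<lambda>i j. m i j t) i i - \<alpha> i i * ?x ^ (q + 3)\<bar> \<le> real r ^ 2 * A * (k\<^sup>2 + k ^ (q+2))"
        by (rule drag_diag[OF ij(2)])
      have "real r ^ 2 * A * (k\<^sup>2 + k ^ (q+2)) \<le> real r ^ 2 * A * (2 * k\<^sup>2)"
        using kq rA0 by (intro mult_left_mono) auto
      also have "\<dots> \<le> (2 * A + 3 * real r ^ 2 * A) * k * k"
      proof -
        have "0 \<le> A * k\<^sup>2" "0 \<le> real r ^ 2 * A * k\<^sup>2" using A1 by auto
        thus ?thesis by (simp add: power2_eq_square algebra_simps)
      qed
      also have "\<dots> \<le> a / 16 * k" using small k by (intro mult_right_mono) auto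
      finally have 2: "real r ^ 2 * A * (k\<^sup>2 + k ^ (q+2)) \<le> a / 16 * k" .
      have "\<theta> \<le> 1 - ?x\<^sup>2" unfolding x using \<theta> th2 by (simp add: power2_eq_square algebra_simps)
      hence "a * (1/2) * \<theta> \<le> \<alpha> i i * ?x ^ (q+1) * (1 - ?x\<^sup>2)"
        using pw[OF ij(2)] weight[OF ij(2,2)] a_pos \<theta> by (intro mult_mono) auto
      also have "\<dots> = \<alpha> i i * ?x ^ (q+1) - \<alpha> i i * ?x ^ (q+3)"
        by (simp add: algebra_simps power_add power2_eq_square power3_eq_cube)
      finally have 3: "a * (1/2) * \<theta> \<le> \<alpha> i i * ?x ^ (q+1) - \<alpha> i i * ?x ^ (q+3)" .
      have "a * k \<le> a * \<theta>" using k a_pos by simp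
      moreover have "0 < a * \<theta>" using a_pos \<theta> by simp
      moreover have "e < a * k / 16" using e by (simp add: k_def)
      ultimately have "corr_rate i i t > 0" using 1 2 3 noise[OF ij(2,2) t0] unfolding corr_rate_def by linarith
      thus ?thesis using True by (simp add: D_def ij)
    next
      case False
      define w where "w = m j i t" define z where "z = m i j t"
      define x where "x = m i i t" define y where "y = m j j t"
      have z2: "z\<^sup>2 = k\<^sup>2" using \<open>f c t = 0\<close> False by (simp add: f_def ij z_def)
      hence za: "\<bar>z\<bar> = k" using k by (auto simp: power2_eq_iff)
      have wa: "\<bar>w\<bar> \<le> k" using of[OF ij(3,2)] False by (auto simp: w_def)
      have xy: "3/4 \<le> x" "x \<le> 1" "3/4 \<le> y" "y \<le> 1" using dg1 ij unfolding x_def y_def by auto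
      have al: "0 \<le> \<alpha> i j" "\<alpha> i j \<le> A" "0 \<le> \<alpha> j i" "\<alpha> j i \<le> A" "0 \<le> \<alpha> i i" "a \<le> \<alpha> j j"
        using weight a_pos ij by (auto intro: order_trans[OF less_imp_le])
      have "\<bar>m j l t\<bar> * m j j t ^ (q+1) \<le> k" if "l \<in> {1..r}" "l \<noteq> j" for l
      proof -
        have "\<bar>m j l t\<bar> * m j j t ^ (q+1) \<le> k * 1"
          using of[OF ij(3) that(1)] that dg1[OF ij(3)] k by (intro mult_mono power_le_one) auto
        thus ?thesis by simp
      qed
      from drag_off[OF ij(2,3) False this] k
      have 1: "\<bar>drag q r \<alpha> (\<lambda>i j. m i j t) i j - (z * (\<alpha> j j * y ^ (q+2))
         + 1/2 * x\<^sup>2 * z * (\<alpha> i j * z ^ q + \<alpha> i i * x ^ q)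
         + 1/2 * x * y * w * (\<alpha> j j * y ^ q + \<alpha> j i * w ^ q))\<bar>
         \<le> real r ^ 2 * A * (k ^ (q+2) + k\<^sup>2 + k * k)" unfolding x_def y_def z_def w_def by auto
      have 2: "real r ^ 2 * A * (k ^ (q+2) + k\<^sup>2 + k * k) \<le> 3 * real r ^ 2 * A * k\<^sup>2"
      proof -
        have "real r ^ 2 * A * (k ^ (q+2) + k\<^sup>2 + k * k) \<le> real r ^ 2 * A * (3 * k\<^sup>2)"
          using kq rA0 by (intro mult_left_mono) (auto simp: power2_eq_square)
        thus ?thesis by simp
      qed
      define \<rho> where "\<rho> = E i j t - (drag q r \<alpha> (\<lambda>i j. m i j t) i j - (z * (\<alpha> j j * y ^ (q+2))
         + 1/2 * x\<^sup>2 * z * (\<alpha> i j * z ^ q + \<alpha> i i * x ^ q)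
         + 1/2 * x * y * w * (\<alpha> j j * y ^ q + \<alpha> j i * w ^ q)))"
      have "\<bar>\<rho>\<bar> \<le> 3 * real r ^ 2 * A * k\<^sup>2 + e" unfolding \<rho>_def
        using 1 2 noise[OF ij(2,3) t0] by linarith
      hence "\<bar>z * \<rho>\<bar> \<le> k * (3 * real r ^ 2 * A * k\<^sup>2 + e)" unfolding abs_mult using za k
        by (intro mult_mono) auto
      hence zr: "z * \<rho> \<le> k * (3 * real r ^ 2 * A * k\<^sup>2 + e)" by linarith
      have zq: "\<bar>p * z ^ (q+2)\<bar> \<le> A * k ^ 3" if "\<bar>p\<bar> \<le> A" for p
      proof -
        have "\<bar>p * z ^ (q+2)\<bar> \<le> A * k ^ (q+2)" unfolding abs_mult power_abs za
          using that k by (intro mult_right_mono) auto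
        also have "\<dots> \<le> A * k ^ 3" using kq A1 by (intro mult_left_mono) auto
        finally show ?thesis .
      qed
      have corr_rate: "z * corr_rate i j t = \<alpha> i j * (1 - x\<^sup>2/2) * z ^ (q+2) - z\<^sup>2 * (\<alpha> j j * y ^ (q+1)) * y
          - 1/2 * x\<^sup>2 * z\<^sup>2 * \<alpha> i i * x ^ q - 1/2 * (x * (z * w)) * (\<alpha> j j * y ^ (q+1))
          - 1/2 * (x * y * \<alpha> j i) * (z * w) * w ^ q + z * \<rho>"
        unfolding corr_rate_def \<rho>_def z_def[symmetric] by (simp add: algebra_simps power_add power2_eq_square)
      have p1: "\<alpha> i j * (1 - x\<^sup>2/2) * z ^ (q+2) \<le> A * k ^ 3"
      proof -
        have "x\<^sup>2 \<le> 1" using xy by (simp add: power_le_one)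
        hence "\<bar>\<alpha> i j * (1 - x\<^sup>2/2)\<bar> \<le> A * 1" unfolding abs_mult using al by (intro mult_mono) auto
        from zq[of "\<alpha> i j * (1 - x\<^sup>2/2)"] this show ?thesis by simp
      qed
      have zw: "\<bar>z * w\<bar> \<le> k * k" unfolding abs_mult using za wa k by (intro mult_mono) auto
      have p2: "- (1/2 * (x * (z * w)) * (\<alpha> j j * y ^ (q+1))) \<le> 1/2 * k\<^sup>2 * (\<alpha> j j * y ^ (q+1))"
      proof -
        have "\<bar>x * (z * w)\<bar> \<le> 1 * (k * k)" unfolding abs_mult[of x] using zw xy by (intro mult_mono) auto
        hence "- (x * (z * w)) \<le> k\<^sup>2" by (simp add: power2_eq_square)
        hence "- (x * (z * w)) * (\<alpha> j j * y ^ (q+1)) \<le> k\<^sup>2 * (\<alpha> j j * y ^ (q+1))"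
          using al a_pos xy by (intro mult_right_mono mult_nonneg_nonneg zero_le_power) auto
        thus ?thesis by (simp add: algebra_simps)
      qed
      have p3: "- (1/2 * (x * y * \<alpha> j i) * (z * w) * w ^ q) \<le> A * k ^ 3"
      proof -
        have "\<bar>w ^ q\<bar> \<le> k" unfolding power_abs
          using power_mono[OF wa, of q] kappa_power_le[of 1 q] q by simp
        hence "\<bar>z * w * w ^ q\<bar> \<le> k * k * k" unfolding abs_mult[of "z * w"] using zw k by (intro mult_mono) auto
        moreover have "\<bar>x * y * \<alpha> j i\<bar> \<le> 1 * 1 * A" using xy al by (intro abs_prod3_le) auto
        ultimately have "\<bar>x * y * \<alpha> j i * (z * w * w ^ q)\<bar> \<le> 1 * 1 * A * (k * k * k)"
          unfolding abs_mult[of "x * y * \<alpha> j i"] using A1 by (intro mult_mono) auto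
        hence "- (x * y * \<alpha> j i * (z * w * w ^ q)) \<le> A * k ^ 3" by (simp add: power3_eq_cube)
        moreover have "0 \<le> A * k ^ 3" using A1 k by auto
        moreover have "1/2 * (x * y * \<alpha> j i) * (z * w) * w ^ q = (x * y * \<alpha> j i * (z * w * w ^ q)) / 2" by simp
        ultimately show ?thesis by linarith
      qed
      have p4: "0 \<le> 1/2 * x\<^sup>2 * z\<^sup>2 * \<alpha> i i * x ^ q" using al xy by (intro mult_nonneg_nonneg zero_le_power2 zero_le_power) auto
      \<comment> \<open>The damping beats the cross term because \<open>y > 1/2\<close>.\<close>
      have p5: "1/2 * k\<^sup>2 * (\<alpha> j j * y ^ (q+1)) - z\<^sup>2 * (\<alpha> j j * y ^ (q+1)) * y \<le> - (k\<^sup>2 * a / 8)"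
      proof -
        have "a * (1/2) \<le> \<alpha> j j * y ^ (q+1)" using pw[OF ij(3)] al a_pos unfolding y_def by (intro mult_mono) auto
        moreover have y: "1/4 \<le> y - 1/2" using xy by linarith
        moreover have nn: "0 \<le> \<alpha> j j * y ^ (q+1)" using al a_pos xy by (intro mult_nonneg_nonneg zero_le_power) auto
        ultimately have "a * (1/2) * (1/4) \<le> \<alpha> j j * y ^ (q+1) * (y - 1/2)" by (rule mult_mono) simp
        hence "k\<^sup>2 * (a * (1/2) * (1/4)) \<le> k\<^sup>2 * (\<alpha> j j * y ^ (q+1) * (y - 1/2))" by (intro mult_left_mono) auto
        thus ?thesis unfolding z2 by (simp add: algebra_simps)
      qed
      have "z * corr_rate i j t \<le> 2 * (A * k ^ 3) + k * (3 * real r ^ 2 * A * k\<^sup>2 + e) - k\<^sup>2 * a / 8"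
        unfolding corr_rate using p1 p2 p3 p4 p5 zr by linarith
      also have "\<dots> = k\<^sup>2 * ((2 * A + 3 * real r ^ 2 * A) * k) + k * e - k\<^sup>2 * a / 8"
        by (simp add: algebra_simps power2_eq_square power3_eq_cube)
      also have "\<dots> < k\<^sup>2 * (a / 16) + k * (a * k / 16) - k\<^sup>2 * a / 8"
        using small k e by (intro diff_strict_right_mono add_le_less_mono mult_left_mono mult_strict_left_mono) (auto simp: k_def)
      also have "\<dots> = 0" by (simp add: power2_eq_square)
      finally show ?thesis using False by (simp add: D_def ij z_def mult.assoc)
    qed
  next
    fix c assume "c \<in> C"
    then obtain i j where ij: "c = (i,j)" "i \<in> {1..r}" "j \<in> {1..r}" by (auto simp: C_def)
    show "f c s < 0"
    proof (cases "i = j")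
      case True thus ?thesis using diag ij by (simp add: f_def)
    next
      case False
      hence "\<bar>m i j s\<bar> < k" using off ij by (simp add: k_def)
      hence "(m i j s)\<^sup>2 < k\<^sup>2" using power_strict_mono[of "\<bar>m i j s\<bar>" k 2] by simp
      thus ?thesis using False by (simp add: f_def ij)
    qed
  qed (use s t i in \<open>auto simp: C_def\<close>)
  thus ?thesis by (simp add: f_def)
qed

end

lemma eventually_linear_less:
  assumes "(d::real) > 0" shows "eventually (\<lambda>b. c * b < d) (at_right 0)"
proof -
  have "((\<lambda>b. c * b) \<longlongrightarrow> c * 0) (at_right 0)" by (intro tendsto_intros)
  thus ?thesis using assms by (intro order_tendstoD(2)[of _ 0]) auto
qed

text \<open>The constants are chosen in the order \<open>\<theta>\<close> (final accuracy), \<open>K1\<close>,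
  \<open>B\<close>, \<open>\<nu>\<close>, \<open>\<rho>\<close>, \<open>\<epsilon>'\<close>, \<open>T\<close>,
  \<open>\<eta>\<close>, and finally \<open>b0\<close>, each depending on the preceding ones only. They do not depend
  on the flow. This uniformity is what allows to let the dimension grow, with \<open>b = 1/\<surd>N\<close>.\<close>

theorem noisy_flow_escapes:
  fixes q r :: nat and a A \<delta> \<epsilon> :: real
  assumes q: "q \<ge> 1" and r: "r \<ge> 1" and a: "a > 0" and A: "A \<ge> 1" and \<delta>: "\<delta> > 0" and \<epsilon>: "\<epsilon> > 0"
  obtains b0 \<eta> T where "b0 > 0" "\<eta> > 0" "T > 0"
    "\<forall>b \<alpha> m E. 0 < b \<and> b < b0 \<and> correlation_flow q r \<alpha> a A (\<eta> * b ^ (q+1)) m E \<and>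
      (\<forall>i\<in>{1..r}. \<forall>j\<in>{1..r}. \<delta> * b \<le> m i j 0 \<and> (i \<noteq> j \<longrightarrow> (\<exists>h\<in>{i,j}.
         1 / (real q * \<alpha> h h * m h h 0 ^ q) + \<delta> / b ^ q \<le> 1 / (real q * \<alpha> i j * m i j 0 ^ q))))
      \<longrightarrow> (\<forall>t\<ge>T / b ^ q. \<forall>i\<in>{1..r}. m i i t \<ge> 1 - \<epsilon>)"
proof -
  define R where "R = 2 * A + 3 * real r ^ 2 * A"
  have R: "R > 0" unfolding R_def using A by (intro add_pos_nonneg) auto
  define \<theta> where "\<theta> = Min {\<epsilon>, 1/4, 1 / (2 * real (q+1)), a / (16 * R)}"
  have "\<theta> > 0" unfolding \<theta>_def using \<epsilon> a R by (subst Min_gr_iff) auto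
  have "\<theta> \<le> \<epsilon>" "\<theta> \<le> 1/4" "\<theta> \<le> 1 / (2 * real (q+1))" "\<theta> \<le> a / (16 * R)"
    unfolding \<theta>_def by (auto intro!: Min_le)
  hence \<theta>: "0 < \<theta>" "\<theta> \<le> \<epsilon>" "\<theta> \<le> 1/4" "real (q+1) * \<theta> \<le> 1/2" "R * \<theta> \<le> a / 16"
    using \<open>\<theta> > 0\<close> R by (simp_all add: field_simps)
  \<comment> \<open>The diagonal is first brought above \<open>\<mu>\<close>; half of \<open>\<theta>\<close> is kept in reserve for the variation of the control function.\<close>
  define \<mu> where "\<mu> = 1 - \<theta> / 2"
  have \<mu>: "0 < \<mu>" "\<mu> < 1" unfolding \<mu>_def using \<theta> by auto
  define K1 where "K1 = max 1 (2 / (real q * a * \<delta>))"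
  have K1: "K1 \<ge> 1" "K1 \<ge> 2 / (real q * a * \<delta>)" unfolding K1_def by auto
  define B where "B = max (6 * K1) (8 * A * (6 * K1) ^ (q+2) * 2 ^ (q+2) / (a * K1\<^sup>2))"
  have B: "B \<ge> 6 * K1" "B > 0" unfolding B_def using K1 by auto
  have B2: "8 * A * (6 * K1) ^ (q+2) * (2 ^ (q+2) / (a * B)) \<le> K1\<^sup>2"
  proof -
    have "8 * A * (6 * K1) ^ (q+2) * 2 ^ (q+2) / (a * K1\<^sup>2) \<le> B" unfolding B_def by simp
    moreover have "x * (y / (a * B)) \<le> k" if "x * y / (a * k) \<le> B" "0 < k" for x y k
      using that a B by (simp add: field_simps)
    ultimately show ?thesis using K1 by simp
  qed
  let ?\<Omega> = "1 / (real q * a * \<delta> ^ q)"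
  have "eventually (\<lambda>\<nu>::real. (1 / (1 - \<nu>) ^ (q+1) - 1) * ?\<Omega> < \<delta> / 4 \<and> (1 - 1 / (1 + \<nu>) ^ q) * ?\<Omega> < \<delta> / 4
     \<and> 1 * \<nu> < 1/2) (at_right 0)"
  proof (intro eventually_conj eventually_linear_less)
    have "((\<lambda>\<nu>::real. (1 / (1 - \<nu>) ^ (q+1) - 1) * ?\<Omega>) \<longlongrightarrow> (1 / (1 - 0) ^ (q+1) - 1) * ?\<Omega>) (at_right 0)"
      by (intro tendsto_intros) auto
    thus "eventually (\<lambda>\<nu>::real. (1 / (1 - \<nu>) ^ (q+1) - 1) * ?\<Omega> < \<delta> / 4) (at_right 0)"
      using \<delta> by (intro order_tendstoD(2)[of _ 0]) auto
    have "((\<lambda>\<nu>::real. (1 - 1 / (1 + \<nu>) ^ q) * ?\<Omega>) \<longlongrightarrow> (1 - 1 / (1 + 0) ^ q) * ?\<Omega>) (at_right 0)"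
      by (intro tendsto_intros) auto
    thus "eventually (\<lambda>\<nu>::real. (1 - 1 / (1 + \<nu>) ^ q) * ?\<Omega> < \<delta> / 4) (at_right 0)"
      using \<delta> by (intro order_tendstoD(2)[of _ 0]) auto
  qed auto
  hence "eventually (\<lambda>\<nu>::real. 0 < \<nu> \<and> (1 / (1 - \<nu>) ^ (q+1) - 1) * ?\<Omega> < \<delta> / 4 \<and>
     (1 - 1 / (1 + \<nu>) ^ q) * ?\<Omega> < \<delta> / 4 \<and> \<nu> < 1/2) (at_right 0)"
    using eventually_at_right_less[of "0::real"] by eventually_elim auto
  from eventually_happens'[OF trivial_limit_at_right_real this] obtain \<nu> :: real where
    "0 < \<nu> \<and> (1 / (1 - \<nu>) ^ (q+1) - 1) * ?\<Omega> < \<delta> / 4 \<and> (1 - 1 / (1 + \<nu>) ^ q) * ?\<Omega> < \<delta> / 4 \<and> \<nu> < 1/2" ..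
  hence \<nu>: "0 < \<nu>" "\<nu> \<le> 1/2" "(1 / (1 - \<nu>) ^ (q+1) - 1) * ?\<Omega> \<le> \<delta> / 4"
    "(1 - 1 / (1 + \<nu>) ^ q) * ?\<Omega> \<le> \<delta> / 4" by (simp_all only: less_imp_le)
  define \<rho> where "\<rho> = sqrt \<nu>"
  have \<rho>: "0 < \<rho>" "\<rho>\<^sup>2 \<le> \<nu>" "\<rho> \<le> 1" unfolding \<rho>_def using \<nu> by (auto simp: real_sqrt_le_1_iff)
  define C where "C = pair_const r A"
  have C: "C = 12 * real r ^ 2 * A + 8" unfolding C_def pair_const_def ..
  define C' where "C' = energy_const r A"
  have C'0: "0 \<le> C'" unfolding C'_def energy_const_def pair_const_def using A by auto
  have C0: "C > 0" unfolding C using A by (intro add_nonneg_pos) auto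
  define \<epsilon>' where "\<epsilon>' = Min {1, \<nu> * \<delta>, \<delta> / 2, K1\<^sup>2 / (C * (6 * K1))}"
  have "\<epsilon>' > 0" unfolding \<epsilon>'_def using \<nu> \<delta> C0 K1 by (subst Min_gr_iff) auto
  have "\<epsilon>' \<le> 1" "\<epsilon>' \<le> \<nu> * \<delta>" "\<epsilon>' \<le> \<delta> / 2" "\<epsilon>' \<le> K1\<^sup>2 / (C * (6 * K1))"
    unfolding \<epsilon>'_def by (auto intro!: Min_le)
  moreover have "C * (6 * K1) * \<epsilon>' \<le> K1\<^sup>2"
  proof -
    have "0 < C * (6 * K1)" using C0 K1 by auto
    thus ?thesis using calculation(4) by (simp add: pos_le_divide_eq mult.commute)
  qed
  ultimately have \<epsilon>': "0 < \<epsilon>'" "\<epsilon>' \<le> 1" "\<epsilon>' \<le> \<nu> * \<delta>" "\<epsilon>' < \<delta>" "\<epsilon>' \<le> \<delta> / 2" "C * (6 * K1) * \<epsilon>' \<le> K1\<^sup>2"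
    using \<open>\<epsilon>' > 0\<close> \<delta> by auto
  define T where "T = (2 / \<delta>) ^ q / (real q * a * (1 - \<mu>\<^sup>2)) + 1"
  have \<mu>2: "0 < 1 - \<mu>\<^sup>2" using \<mu> by (simp add: power_less_one_iff)
  have T: "T > (2 / \<delta>) ^ q / (real q * a * (1 - \<mu>\<^sup>2))" "T > 0"
    unfolding T_def using \<delta> a \<mu>2 by (auto intro!: add_nonneg_pos divide_nonneg_nonneg mult_nonneg_nonneg)
  define \<eta> where "\<eta> = Min {1, \<epsilon>' / (2 * T)}"
  have "\<eta> > 0" unfolding \<eta>_def using \<epsilon>' T by (subst Min_gr_iff) auto
  have "\<eta> \<le> 1" "\<eta> \<le> \<epsilon>' / (2 * T)" unfolding \<eta>_def by auto
  hence \<eta>: "0 < \<eta>" "\<eta> \<le> 1" "\<eta> * T \<le> \<epsilon>' / 2" using \<open>\<eta> > 0\<close> T by (auto simp: field_simps)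
  \<comment> \<open>In the locale condition \<open>var_small\<close> all terms except the noise are \<open>V b\<^sup>2\<close>.\<close>
  define V where "V = 16 * real r ^ 2 * A / a * (2 * real r ^ 2 * (6 * K1)\<^sup>2)
     + (16 * real r ^ 2 * A / a * C' + 2 * real r ^ 2 * A + 3 * A) * B ^ (q+2) * T"
  have "eventually (\<lambda>b. B * b < \<rho> \<and> 6 * K1 * b < 1 \<and> real r ^ 2 * C * (6 * K1) * b < a / 16
     \<and> 4 * A * (6 * K1) * b < (a/16) * (\<rho>/2) ^ (q+1) \<and> V * b < \<epsilon>' / 2 \<and> \<epsilon>' * b < \<theta> / 2
     \<and> 6 * K1 * b < \<theta>\<^sup>2 \<and> 1 * b < a * \<theta>\<^sup>2 / 16 \<and> \<epsilon>' * b < \<mu>) (at_right 0)"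
    using \<rho> a \<epsilon>' \<theta> \<mu> by (intro eventually_conj eventually_linear_less) auto
  then obtain b0 where b0: "b0 > 0" and small: "\<And>b. 0 < b \<Longrightarrow> b < b0 \<Longrightarrow> B * b < \<rho> \<and> 6 * K1 * b < 1 \<and> real r ^ 2 * C * (6 * K1) * b < a / 16
     \<and> 4 * A * (6 * K1) * b < (a/16) * (\<rho>/2) ^ (q+1) \<and> V * b < \<epsilon>' / 2 \<and> \<epsilon>' * b < \<theta> / 2
     \<and> 6 * K1 * b < \<theta>\<^sup>2 \<and> 1 * b < a * \<theta>\<^sup>2 / 16 \<and> \<epsilon>' * b < \<mu>"
    unfolding eventually_at_right_field by auto
  show ?thesis
  proof (rule that[OF b0 \<eta>(1) T(2)], intro allI, rule impI)
    fix b \<alpha> m E assume start: "0 < b \<and> b < b0 \<and> correlation_flow q r \<alpha> a A (\<eta> * b ^ (q+1)) m E \<and>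
      (\<forall>i\<in>{1..r}. \<forall>j\<in>{1..r}. \<delta> * b \<le> m i j 0 \<and> (i \<noteq> j \<longrightarrow> (\<exists>h\<in>{i,j}.
         1 / (real q * \<alpha> h h * m h h 0 ^ q) + \<delta> / b ^ q \<le> 1 / (real q * \<alpha> i j * m i j 0 ^ q))))"
    hence b: "0 < b" "b < b0" and cf: "correlation_flow q r \<alpha> a A (\<eta> * b ^ (q+1)) m E" by blast+
    have init: "\<delta> * b \<le> m i j 0" if "i \<in> {1..r}" "j \<in> {1..r}" for i j using start that by blast
    have gap: "\<exists>h\<in>{i,j}.
         1 / (real q * \<alpha> h h * m h h 0 ^ q) + \<delta> / b ^ q \<le> 1 / (real q * \<alpha> i j * m i j 0 ^ q)"
      if "i \<in> {1..r}" "j \<in> {1..r}" "i \<noteq> j" for i j using start that by blast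
    note s = small[OF b]
    interpret correlation_flow q r \<alpha> a A "\<eta> * b ^ (q+1)" m E by (rule cf)
    have b1: "b < 1"
    proof -
      have "6 * b \<le> 6 * K1 * b" using K1 b by (intro mult_right_mono) auto
      thus ?thesis using s by linarith
    qed
    have kb: "0 < 6 * K1 * b" using K1 b by auto
    interpret escaping_flow q r \<alpha> a A "\<eta> * b ^ (q+1)" m E b \<delta> K1 B \<epsilon>' \<nu> \<rho> T
    proof
      show "C0 * (6 * K1) * \<epsilon>' \<le> K1\<^sup>2" using \<epsilon>'(6) unfolding C_def .
      show "real r ^ 2 * C0 * (6 * K1 * b) \<le> a / 16" using s unfolding C_def by (simp add: mult.assoc)
      have "(6 * K1 * b) ^ q \<le> 6 * K1 * b" using power_decreasing[of 1 q "6 * K1 * b"] q s kb by auto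
      hence "4 * A * (6 * K1 * b) ^ q \<le> 4 * A * (6 * K1 * b)" using A by (intro mult_left_mono) auto
      also have "4 * A * (6 * K1 * b) = 4 * A * (6 * K1) * b" by simp
      also have "\<dots> \<le> (a/16) * (\<rho>/2) ^ (q+1)" using s by simp
      finally show "4 * A * (6 * K1 * b) ^ q \<le> (a/16) * (\<rho>/2) ^ (q+1)" .
      have "1 * b \<le> 6 * K1 * b" using K1 b by (intro mult_right_mono) auto
      hence "b ^ (q+1) \<le> (6 * K1 * b) ^ (q+1)" using b by (intro power_mono) auto
      moreover have "\<eta> * b ^ (q+1) \<le> 1 * b ^ (q+1)" using \<eta> b by (intro mult_right_mono) auto
      ultimately show "\<eta> * b ^ (q+1) \<le> (6 * K1 * b) ^ (q+1)" by linarith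
      have "16 * real r ^ 2 * A / a * (2 * real r ^ 2 * (6 * K1 * b)\<^sup>2)
         + ((16 * real r ^ 2 * A / a * C1 + 2 * real r ^ 2 * A + 3 * A) * (B * b) ^ (q+2) + \<eta> * b ^ (q+1)) * (T / b ^ q)
         = V * b * b + \<eta> * T * b"
        unfolding V_def C'_def using b a by (simp add: field_simps power_add power2_eq_square)
      also have "\<dots> \<le> \<epsilon>' / 2 * b + \<epsilon>' / 2 * b" using s \<eta> b by (intro add_mono mult_right_mono) auto
      finally show "16 * real r ^ 2 * A / a * (2 * real r ^ 2 * (6 * K1 * b)\<^sup>2)
         + ((16 * real r ^ 2 * A / a * C1 + 2 * real r ^ 2 * A + 3 * A) * (B * b) ^ (q+2) + \<eta> * b ^ (q+1)) * (T / b ^ q)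
         \<le> \<epsilon>' * b" by simp
    qed (use b \<delta> init gap K1 B B2 \<nu> \<rho> \<epsilon>' s T in \<open>auto simp: mult.assoc\<close>)
    show "\<forall>t\<ge>T / b ^ q. \<forall>i\<in>{1..r}. m i i t \<ge> 1 - \<epsilon>"
    proof (intro allI impI ballI)
      fix t i assume t: "T / b ^ q \<le> t" and i: "i \<in> {1..r}"
      have "m i i t > 1 - \<theta>"
      proof (rule trapped[OF _ \<theta>(1,3,4) _ _ _ _ t i])
        show "0 \<le> T / b ^ q" using T b by auto
        show "(2 * A + 3 * real r ^ 2 * A) * \<theta> \<le> a / 16" using \<theta>(5) unfolding R_def .
        have "\<eta> * b ^ (q+1) \<le> 1 * b ^ 1" using \<eta> b b1 by (intro mult_mono power_decreasing) auto
        thus "\<eta> * b ^ (q+1) < a * \<theta>\<^sup>2 / 16" using s by simp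
      next
        fix i assume i: "i \<in> {1..r}"
        have "m i i (T / b ^ q) \<ge> \<mu> - \<epsilon>' * b" by (rule diag_escapes[OF i \<mu> T(1) \<epsilon>'(5)]) (use s in auto)
        thus "m i i (T / b ^ q) > 1 - \<theta>" using s unfolding \<mu>_def by linarith
      next
        fix i j assume ij: "i \<in> {1..r}" "j \<in> {1..r}" "i \<noteq> j"
        have "\<bar>m i j (T / b ^ q)\<bar> < 6 * K1 * b" using off_strict[OF controlled_horizon ij] unfolding \<kappa>_def .
        thus "\<bar>m i j (T / b ^ q)\<bar> < \<theta>\<^sup>2" using s by linarith
      qed
      thus "m i i t \<ge> 1 - \<epsilon>" using \<theta>(2) by linarith
    qed
  qed
qed

section \<open>From the gradient flow to the flow of correlations\<close>

definition multilinear_form :: "nat \<Rightarrow> nat \<Rightarrow> rtensor \<Rightarrow> (nat \<Rightarrow> nat \<Rightarrow> real) \<Rightarrow> real" where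
  "multilinear_form N p W f = (\<Sum>a\<in>tensor_idx N p. W a * (\<Prod>l=1..p. f l (a l)))"

definition unit_vec :: "nat \<Rightarrow> nat \<Rightarrow> real" where
  "unit_vec k = (\<lambda>k'. if k' = k then 1 else 0)"

definition with_slot :: "(nat \<Rightarrow> real) \<Rightarrow> nat \<Rightarrow> (nat \<Rightarrow> real) \<Rightarrow> nat \<Rightarrow> nat \<Rightarrow> real" where
  "with_slot u l x = (\<lambda>l'. if l' = l then u else x)"

text \<open>The directional derivative of \<open>x \<mapsto> \<langle>W, x \<otimes> \<dots> \<otimes> x\<rangle>\<close> in
  the direction \<open>u\<close>.\<close>

definition form_deriv :: "nat \<Rightarrow> nat \<Rightarrow> rtensor \<Rightarrow> (nat \<Rightarrow> real) \<Rightarrow> (nat \<Rightarrow> real) \<Rightarrow> real" where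
  "form_deriv N p W x u = (\<Sum>l=1..p. multilinear_form N p W (with_slot u l x))"

lemma finite_tensor_idx: "finite (tensor_idx N p)"
  unfolding tensor_idx_def by (intro finite_PiE) auto

lemma tensor_idx_mem: "a \<in> tensor_idx N p \<Longrightarrow> l \<in> {1..p} \<Longrightarrow> a l \<in> {1..N}"
  unfolding tensor_idx_def by (auto simp: PiE_def Pi_def)

lemma prod_with_slot:
  assumes "l \<in> {1..p}"
  shows "(\<Prod>l'=1..p. with_slot u l x l' (a l')) = u (a l) * (\<Prod>l'\<in>{1..p}-{l}. x (a l'))"
proof -
  have "(\<Prod>l'=1..p. with_slot u l x l' (a l')) =
      with_slot u l x l (a l) * (\<Prod>l'\<in>{1..p}-{l}. with_slot u l x l' (a l'))"
    using assms by (subst prod.remove[of _ l]) auto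
  also have "(\<Prod>l'\<in>{1..p}-{l}. with_slot u l x l' (a l')) = (\<Prod>l'\<in>{1..p}-{l}. x (a l'))"
    by (intro prod.cong) (auto simp: with_slot_def)
  finally show ?thesis by (simp add: with_slot_def)
qed

lemma tensor_inner_power_deriv:
  "((\<lambda>s. tensor_inner N p W (tensor_power p (x(k := s)))) has_real_derivative
     form_deriv N p W x (unit_vec k)) (at (x k))"
proof -
  have "((\<lambda>s. \<Sum>a\<in>tensor_idx N p. W a * (\<Prod>l=1..p. (x(k := s)) (a l))) has_real_derivative
     (\<Sum>a\<in>tensor_idx N p. W a * (\<Sum>l=1..p. unit_vec k (a l) * (\<Prod>l'\<in>{1..p}-{l}. (x(k := x k)) (a l'))))) (at (x k))"
  proof (intro DERIV_sum DERIV_cmult has_field_derivative_prod)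
    fix a l
    show "((\<lambda>s. (x(k := s)) (a l)) has_real_derivative unit_vec k (a l)) (at (x k))"
      by (cases "a l = k") (auto simp: unit_vec_def)
  qed
  moreover have "(\<Sum>a\<in>tensor_idx N p. W a * (\<Sum>l=1..p. unit_vec k (a l) * (\<Prod>l'\<in>{1..p}-{l}. (x(k := x k)) (a l'))))
      = form_deriv N p W x (unit_vec k)"
  proof -
    have "form_deriv N p W x (unit_vec k)
        = (\<Sum>a\<in>tensor_idx N p. \<Sum>l=1..p. W a * (\<Prod>l'=1..p. with_slot (unit_vec k) l x l' (a l')))"
      unfolding form_deriv_def multilinear_form_def by (rule sum.swap)
    also have "\<dots> = (\<Sum>a\<in>tensor_idx N p. W a * (\<Sum>l=1..p. unit_vec k (a l) * (\<Prod>l'\<in>{1..p}-{l}. x (a l'))))"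
      unfolding sum_distrib_left by (intro sum.cong refl) (simp only: prod_with_slot)
    finally show ?thesis by simp
  qed
  ultimately show ?thesis unfolding tensor_inner_def tensor_power_def by simp
qed

lemma form_deriv_linear:
  "(\<Sum>k=1..N. u k * form_deriv N p W x (unit_vec k)) = form_deriv N p W x u"
proof -
  have slot: "(\<Sum>k=1..N. u k * multilinear_form N p W (with_slot (unit_vec k) l x)) = multilinear_form N p W (with_slot u l x)"
    if l: "l \<in> {1..p}" for l
  proof -
    have "(\<Sum>k=1..N. u k * multilinear_form N p W (with_slot (unit_vec k) l x))
        = (\<Sum>a\<in>tensor_idx N p. \<Sum>k=1..N. u k * (W a * (\<Prod>l'=1..p. with_slot (unit_vec k) l x l' (a l'))))"
      unfolding multilinear_form_def sum_distrib_left by (rule sum.swap)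
    also have "\<dots> = multilinear_form N p W (with_slot u l x)" unfolding multilinear_form_def
    proof (intro sum.cong refl)
      fix a assume a: "a \<in> tensor_idx N p"
      have "(\<Sum>k=1..N. u k * (W a * (\<Prod>l'=1..p. with_slot (unit_vec k) l x l' (a l'))))
          = (\<Sum>k=1..N. if k = a l then u k * W a * (\<Prod>l'\<in>{1..p}-{l}. x (a l')) else 0)"
        unfolding prod_with_slot[OF l] by (intro sum.cong) (auto simp: unit_vec_def)
      also have "\<dots> = W a * (\<Prod>l'=1..p. with_slot u l x l' (a l'))"
        unfolding prod_with_slot[OF l] using tensor_idx_mem[OF a l] by (simp add: mult_ac)
      finally show "(\<Sum>k=1..N. u k * (W a * (\<Prod>l'=1..p. with_slot (unit_vec k) l x l' (a l'))))
          = W a * (\<Prod>l'=1..p. with_slot u l x l' (a l'))" .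
    qed
    finally show ?thesis .
  qed
  have "(\<Sum>k=1..N. u k * form_deriv N p W x (unit_vec k))
      = (\<Sum>l=1..p. \<Sum>k=1..N. u k * multilinear_form N p W (with_slot (unit_vec k) l x))"
    unfolding form_deriv_def sum_distrib_left by (rule sum.swap)
  also have "\<dots> = form_deriv N p W x u" unfolding form_deriv_def by (intro sum.cong refl slot)
  finally show ?thesis .
qed

text \<open>The inner product of \<open>u\<close> with the \<open>j\<close>-th column of the Euclidean gradient of the noise
  part of the risk.\<close>

definition noise_grad :: "nat \<Rightarrow> nat \<Rightarrow> nat \<Rightarrow> (nat \<Rightarrow> real) \<Rightarrow> rtensor \<Rightarrow> rmat \<Rightarrow> nat \<Rightarrow> (nat \<Rightarrow> real) \<Rightarrow> real" where
  "noise_grad p N M lam W X j u =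
     1 / sqrt (real M) * (real N powr (- (real p - 1) / 2) * (lam j * form_deriv N p W (mat_col X j) u))"

lemma eucl_grad_risk:
  assumes "k \<in> {1..N}" "j \<in> {1..r}"
  shows "eucl_grad (risk p r N M lam v W) X (k, j) = noise_grad p N M lam W X j (unit_vec k)
     - (\<Sum>l=1..r. real p * lam l * lam j * corr N v X l j ^ (p-1) * v l k)"
proof -
  let ?X = "\<lambda>s. X((k,j) := s)"
  have N: "N > 0" using assms by simp
  have col: "mat_col (?X s) i = (if i = j then (mat_col X j)(k := s) else mat_col X i)" for s i
    by (auto simp: mat_col_def fun_eq_iff)
  have d_form: "((\<lambda>s. tensor_inner N p W (tensor_power p (mat_col (?X s) i))) has_real_derivative
      (if i = j then form_deriv N p W (mat_col X j) (unit_vec k) else 0)) (at (X (k,j)))" for i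
  proof (cases "i = j")
    case True
    have "mat_col X j k = X (k,j)" by (simp add: mat_col_def)
    thus ?thesis using tensor_inner_power_deriv[of N p W "mat_col X j" k] by (simp only: col True if_True simp_thms)
  qed (simp add: col)
  have d_corr: "((\<lambda>s. corr N v (?X s) l i) has_real_derivative (if i = j then v l k / real N else 0)) (at (X (k,j)))" for l i
  proof (cases "i = j")
    case True
    have "((\<lambda>s. (\<Sum>k'=1..N. v l k' * ((mat_col X j)(k := s)) k') / real N) has_real_derivative
        (\<Sum>k'=1..N. v l k' * unit_vec k k') / real N) (at (X (k,j)))"
    proof (intro DERIV_cdivide DERIV_sum DERIV_cmult)
      fix k' show "((\<lambda>s. ((mat_col X j)(k := s)) k') has_real_derivative unit_vec k k') (at (X (k,j)))"
        by (cases "k' = k") (auto simp: unit_vec_def)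
    qed
    moreover have "(\<Sum>k'=1..N. v l k' * unit_vec k k') = (\<Sum>k'=1..N. if k' = k then v l k' else 0)"
      by (intro sum.cong) (auto simp: unit_vec_def)
    ultimately show ?thesis using True assms by (simp add: corr_def inner_N_def col)
  qed (simp add: corr_def col)
  have "((\<lambda>s. risk p r N M lam v W (?X s)) has_real_derivative
     1 / sqrt (real M) * (real N powr (- (real p - 1) / 2) *
       (\<Sum>i=1..r. lam i * (if i = j then form_deriv N p W (mat_col X j) (unit_vec k) else 0)))
     - (\<Sum>l=1..r. \<Sum>i=1..r. real N * lam l * lam i *
         (real p * (corr N v (?X (X (k,j))) l i ^ (p - 1) * (if i = j then v l k / real N else 0))))) (at (X (k,j)))"
    unfolding risk_def H0_def
  proof (intro DERIV_diff DERIV_cmult DERIV_sum d_form)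
    fix l i
    show "((\<lambda>s. corr N v (?X s) l i ^ p) has_real_derivative
       real p * (corr N v (?X (X (k,j))) l i ^ (p - 1) * (if i = j then v l k / real N else 0))) (at (X (k,j)))"
      using DERIV_power[OF d_corr[of l i], of p] by (simp add: mult_ac)
  qed
  hence "eucl_grad (risk p r N M lam v W) X (k, j) = 1 / sqrt (real M) * (real N powr (- (real p - 1) / 2) *
       (\<Sum>i=1..r. lam i * (if i = j then form_deriv N p W (mat_col X j) (unit_vec k) else 0)))
     - (\<Sum>l=1..r. \<Sum>i=1..r. real N * lam l * lam i *
         (real p * (corr N v (?X (X (k,j))) l i ^ (p - 1) * (if i = j then v l k / real N else 0))))"
    unfolding eucl_grad_def by (rule DERIV_imp_deriv)
  also have "(\<Sum>i=1..r. lam i * (if i = j then form_deriv N p W (mat_col X j) (unit_vec k) else 0))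
      = lam j * form_deriv N p W (mat_col X j) (unit_vec k)"
    using assms by (simp add: if_distrib[of "\<lambda>x. _ * x"] cong: if_cong)
  also have "(\<Sum>l=1..r. \<Sum>i=1..r. real N * lam l * lam i *
         (real p * (corr N v (?X (X (k,j))) l i ^ (p - 1) * (if i = j then v l k / real N else 0))))
     = (\<Sum>l=1..r. real p * lam l * lam j * corr N v X l j ^ (p-1) * v l k)"
  proof (intro sum.cong refl)
    fix l
    have "(\<Sum>i=1..r. real N * lam l * lam i *
         (real p * (corr N v (?X (X (k,j))) l i ^ (p - 1) * (if i = j then v l k / real N else 0))))
       = (\<Sum>i=1..r. if i = j then real N * lam l * lam i * (real p * (corr N v X l i ^ (p - 1) * (v l k / real N))) else 0)"
      by (intro sum.cong) auto
    also have "\<dots> = real p * lam l * lam j * corr N v X l j ^ (p-1) * v l k" using assms N by simp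
    finally show "(\<Sum>i=1..r. real N * lam l * lam i *
         (real p * (corr N v (?X (X (k,j))) l i ^ (p - 1) * (if i = j then v l k / real N else 0))))
       = real p * lam l * lam j * corr N v X l j ^ (p-1) * v l k" .
  qed
  finally show ?thesis unfolding noise_grad_def .
qed

lemma inner_N_eucl_grad_risk:
  assumes "j \<in> {1..r}"
  shows "inner_N N u (mat_col (eucl_grad (risk p r N M lam v W) X) j) = noise_grad p N M lam W X j u
     - (\<Sum>l=1..r. real p * lam l * lam j * corr N v X l j ^ (p-1) * inner_N N u (v l))"
proof -
  have "inner_N N u (mat_col (eucl_grad (risk p r N M lam v W) X) j)
     = (\<Sum>k=1..N. u k * noise_grad p N M lam W X j (unit_vec k)
        - (\<Sum>l=1..r. real p * lam l * lam j * corr N v X l j ^ (p-1) * (u k * v l k)))"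
    unfolding inner_N_def using assms
    by (intro sum.cong refl) (simp add: mat_col_def eucl_grad_risk right_diff_distrib sum_distrib_left mult_ac)
  also have "\<dots> = (\<Sum>k=1..N. u k * noise_grad p N M lam W X j (unit_vec k))
     - (\<Sum>l=1..r. \<Sum>k=1..N. real p * lam l * lam j * corr N v X l j ^ (p-1) * (u k * v l k))"
    by (simp only: sum_subtractf) (subst sum.swap, rule refl)
  also have "(\<Sum>k=1..N. u k * noise_grad p N M lam W X j (unit_vec k)) = noise_grad p N M lam W X j u"
    unfolding noise_grad_def form_deriv_linear[of u N, symmetric] sum_distrib_left by (simp add: mult_ac)
  finally show ?thesis by (simp add: inner_N_def sum_distrib_left)
qed

lemma inner_N_commute: "inner_N N x y = inner_N N y x"
  unfolding inner_N_def by (simp add: mult.commute)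

text \<open>What remains of the noise gradient after the projection of the Riemannian gradient and division by
  \<open>N\<close>.\<close>

definition corr_noise :: "nat \<Rightarrow> nat \<Rightarrow> nat \<Rightarrow> nat \<Rightarrow> (nat \<Rightarrow> real) \<Rightarrow> (nat \<Rightarrow> nat \<Rightarrow> real) \<Rightarrow> rtensor \<Rightarrow> rmat \<Rightarrow> nat \<Rightarrow> nat \<Rightarrow> real" where
  "corr_noise p r N M lam v W X i j = - noise_grad p N M lam W X j (v i) / real N
     + 1 / (2 * real N) * (\<Sum>a=1..r. corr N v X i a *
         (noise_grad p N M lam W X j (mat_col X a) + noise_grad p N M lam W X a (mat_col X j)))"

text \<open>By orthogonality of the signals, the inner product of a column of the signal gradient with
  \<open>v\<^sub>i\<close> is a single power of a correlation, and with a column of the frame a sum over the signals.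
  Hence the system closes in the correlations.\<close>

lemma corr_flow:
  assumes gf: "gradient_flow N r (risk p r N M lam v W) X" and t: "t \<ge> 0" and N: "N > 0"
    and i: "i \<in> {1..r}" and j: "j \<in> {1..r}" and p: "p = q + 2"
    and ortho: "\<And>i j. i \<in> {1..r} \<Longrightarrow> j \<in> {1..r} \<Longrightarrow> inner_N N (v i) (v j) = (if i = j then real N else 0)"
  shows "((\<lambda>t. corr N v (X t) i j) has_real_derivative
     real p * lam i * lam j * corr N v (X t) i j ^ (q+1)
     - drag q r (\<lambda>i j. real p * lam i * lam j) (\<lambda>i j. corr N v (X t) i j) i j
     + corr_noise p r N M lam v W (X t) i j) (at t within {0..})"
proof -
  let ?f = "risk p r N M lam v W" and ?m = "corr N v (X t)" and ?Y = "X t"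
  let ?G = "eucl_grad ?f ?Y" and ?\<alpha> = "\<lambda>i j. real p * lam i * lam j"
  let ?n = "\<lambda>j u. noise_grad p N M lam W ?Y j u"
  have "((\<lambda>t. corr N v (X t) i j) has_real_derivative
      (\<Sum>k=1..N. v i k * - riem_grad N r ?f ?Y (k,j)) / real N) (at t within {0..})"
    unfolding corr_def inner_N_def mat_col_def using gf t j
    by (intro DERIV_cdivide DERIV_sum DERIV_cmult) (auto simp: gradient_flow_def mat_idx_def)
  moreover have "(\<Sum>k=1..N. v i k * - riem_grad N r ?f ?Y (k,j))
     = - inner_N N (v i) (mat_col ?G j) + 1 / (2 * real N) * (\<Sum>a=1..r. inner_N N (v i) (mat_col ?Y a) *
         (inner_N N (mat_col ?Y a) (mat_col ?G j) + inner_N N (mat_col ?G a) (mat_col ?Y j)))"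
  proof -
    let ?c = "\<lambda>a. inner_N N (mat_col ?Y a) (mat_col ?G j) + inner_N N (mat_col ?G a) (mat_col ?Y j)"
    have "(\<Sum>k=1..N. v i k * - riem_grad N r ?f ?Y (k,j))
       = (\<Sum>k=1..N. - (v i k * ?G (k,j)) + 1 / (2 * real N) * (\<Sum>a=1..r. v i k * ?Y (k,a) * ?c a))"
      unfolding riem_grad_def Let_def
      by (intro sum.cong refl) (simp add: algebra_simps sum_distrib_left)
    also have "\<dots> = - (\<Sum>k=1..N. v i k * ?G (k,j)) + 1 / (2 * real N) * (\<Sum>k=1..N. \<Sum>a=1..r. v i k * ?Y (k,a) * ?c a)"
    proof -
      have "(\<Sum>k=1..N. 1 / (2 * real N) * h k) = 1 / (2 * real N) * (\<Sum>k=1..N. h k)" for h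
        by (rule sum_distrib_left[symmetric])
      thus ?thesis by (simp only: sum.distrib sum_negf)
    qed
    also have "(\<Sum>k=1..N. \<Sum>a=1..r. v i k * ?Y (k,a) * ?c a) = (\<Sum>a=1..r. inner_N N (v i) (mat_col ?Y a) * ?c a)"
      unfolding inner_N_def mat_col_def sum_distrib_right by (rule sum.swap)
    finally show ?thesis by (simp add: inner_N_def mat_col_def)
  qed
  moreover have "\<dots> / real N = real p * lam i * lam j * ?m i j ^ (q+1)
     - drag q r ?\<alpha> (\<lambda>i j. ?m i j) i j + corr_noise p r N M lam v W ?Y i j"
  proof -
    have vi: "inner_N N (v i) (mat_col ?G j) = ?n j (v i) - real N * (?\<alpha> i j * ?m i j ^ (q+1))"
    proof -
      have "(\<Sum>l=1..r. real p * lam l * lam j * ?m l j ^ (p-1) * inner_N N (v i) (v l))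
          = (\<Sum>l=1..r. if l = i then real p * lam l * lam j * ?m l j ^ (p-1) * real N else 0)"
        using i by (intro sum.cong) (auto simp: ortho)
      thus ?thesis unfolding inner_N_eucl_grad_risk[OF j] using i p by simp
    qed
    have corr_eq: "inner_N N (v l) (mat_col ?Y a) = real N * ?m l a" for l a
      using N by (simp add: corr_def)
    have xg: "inner_N N (mat_col ?Y a) (mat_col ?G b) = ?n b (mat_col ?Y a)
        - real N * (\<Sum>l=1..r. ?\<alpha> l b * ?m l b ^ (q+1) * ?m l a)" if "b \<in> {1..r}" for a b
      unfolding inner_N_eucl_grad_risk[OF that] inner_N_commute[of N "mat_col ?Y a"] corr_eq
      using p by (simp add: sum_distrib_left mult_ac)
    have "(\<Sum>a=1..r. inner_N N (v i) (mat_col ?Y a) *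
         (inner_N N (mat_col ?Y a) (mat_col ?G j) + inner_N N (mat_col ?G a) (mat_col ?Y j)))
      = (\<Sum>a=1..r. real N * (?m i a * (?n j (mat_col ?Y a) + ?n a (mat_col ?Y j)))
          - real N * real N * (\<Sum>l=1..r. drag_summand q ?\<alpha> ?m i j a l))"
    proof (intro sum.cong refl)
      fix a assume a: "a \<in> {1..r}"
      have "(\<Sum>l=1..r. drag_summand q ?\<alpha> ?m i j a l)
         = ?m i a * ((\<Sum>l=1..r. ?\<alpha> l j * ?m l j ^ (q+1) * ?m l a) + (\<Sum>l=1..r. ?\<alpha> l a * ?m l a ^ (q+1) * ?m l j))"
        unfolding drag_summand_def sum.distrib[symmetric] sum_distrib_left
        by (intro sum.cong refl) (simp add: algebra_simps)
      thus "inner_N N (v i) (mat_col ?Y a) *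
         (inner_N N (mat_col ?Y a) (mat_col ?G j) + inner_N N (mat_col ?G a) (mat_col ?Y j))
         = real N * (?m i a * (?n j (mat_col ?Y a) + ?n a (mat_col ?Y j)))
          - real N * real N * (\<Sum>l=1..r. drag_summand q ?\<alpha> ?m i j a l)"
        unfolding inner_N_commute[of N "mat_col ?G a"] xg[OF a] xg[OF j] corr_eq
        by (simp only:) (simp add: algebra_simps)
    qed
    also have "\<dots> = real N * (\<Sum>a=1..r. ?m i a * (?n j (mat_col ?Y a) + ?n a (mat_col ?Y j)))
          - 2 * real N * real N * drag q r ?\<alpha> ?m i j"
    proof -
      have "(\<Sum>a=1..r. c * h a) = c * (\<Sum>a=1..r. h a)" for c :: real and h
        by (rule sum_distrib_left[symmetric])
      thus ?thesis by (simp add: sum_subtractf drag_def)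
    qed
    finally have e: "(\<Sum>a=1..r. inner_N N (v i) (mat_col ?Y a) *
         (inner_N N (mat_col ?Y a) (mat_col ?G j) + inner_N N (mat_col ?G a) (mat_col ?Y j)))
      = real N * (\<Sum>a=1..r. ?m i a * (?n j (mat_col ?Y a) + ?n a (mat_col ?Y j)))
          - 2 * real N * real N * drag q r ?\<alpha> ?m i j" .
    \<comment> \<open>the final bookkeeping of the factors \<open>N = c\<close>\<close>
    have alg: "(- (n - c * x) + 1 / (2 * c) * (c * s - 2 * c * c * d)) / c = x - d + (- n / c + 1 / (2 * c) * s)"
      if "c \<noteq> 0" for n c x s d :: real using that by (simp add: field_simps)
    show ?thesis unfolding vi e corr_noise_def by (rule alg) (use N in simp)
  qed
  ultimately show ?thesis by simp
qed

lemma inner_N_Cauchy_Schwarz: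
  assumes "inner_N N x x \<le> c" "inner_N N y y \<le> c"
  shows "\<bar>inner_N N x y\<bar> \<le> c"
proof -
  have "0 \<le> (\<Sum>k=1..N. (x k - y k)\<^sup>2)" "0 \<le> (\<Sum>k=1..N. (x k + y k)\<^sup>2)" by (auto intro: sum_nonneg)
  moreover have "(\<Sum>k=1..N. (x k - y k)\<^sup>2) = inner_N N x x + inner_N N y y - 2 * inner_N N x y"
    unfolding inner_N_def sum_distrib_left sum.distrib[symmetric] sum_subtractf[symmetric]
    by (intro sum.cong) (auto simp: power2_eq_square algebra_simps)
  moreover have "(\<Sum>k=1..N. (x k + y k)\<^sup>2) = inner_N N x x + inner_N N y y + 2 * inner_N N x y"
    unfolding inner_N_def sum_distrib_left sum.distrib[symmetric]
    by (intro sum.cong) (auto simp: power2_eq_square algebra_simps)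
  ultimately show ?thesis using assms by linarith
qed

lemma stiefel_inner:
  assumes "X \<in> stiefel N r" "i \<in> {1..r}" "j \<in> {1..r}"
  shows "inner_N N (mat_col X i) (mat_col X j) = (if i = j then real N else 0)"
  using assms by (auto simp: stiefel_def)

lemma corr_le_1:
  assumes "X \<in> stiefel N r" "i \<in> {1..r}" "j \<in> {1..r}" "N > 0" "inner_N N (v i) (v i) = real N"
  shows "\<bar>corr N v X i j\<bar> \<le> 1"
proof -
  have "\<bar>inner_N N (v i) (mat_col X j)\<bar> \<le> real N"
    by (rule inner_N_Cauchy_Schwarz) (use assms in \<open>auto simp: stiefel_inner\<close>)
  thus ?thesis using assms(4) by (simp add: corr_def)
qed

text \<open>The injective norm of \<open>W\<close> is at most \<open>c\<close>. The arguments may differ from slot to slot,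
  since a derivative of the form puts another vector into one of them.\<close>

definition inj_norm_le :: "nat \<Rightarrow> nat \<Rightarrow> rtensor \<Rightarrow> real \<Rightarrow> bool" where
  "inj_norm_le N p W c \<longleftrightarrow> (\<forall>f. (\<forall>l\<in>{1..p}. inner_N N (f l) (f l) \<le> 1) \<longrightarrow> \<bar>multilinear_form N p W f\<bar> \<le> c)"

lemma multilinear_form_scaled:
  assumes W: "inj_norm_le N p W c" and f: "\<And>l. l \<in> {1..p} \<Longrightarrow> inner_N N (f l) (f l) \<le> real N" and N: "N > 0"
  shows "\<bar>multilinear_form N p W f\<bar> \<le> c * sqrt (real N) ^ p"
proof -
  define g where "g = (\<lambda>l k. f l k / sqrt (real N))"
  have "\<bar>multilinear_form N p W g\<bar> \<le> c"
  proof -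
    have "inner_N N (g l) (g l) \<le> 1" if "l \<in> {1..p}" for l
    proof -
      have "inner_N N (g l) (g l) = inner_N N (f l) (f l) / real N"
        unfolding inner_N_def g_def sum_divide_distrib using N by simp
      thus ?thesis using f[OF that] N by simp
    qed
    thus ?thesis using W by (auto simp: inj_norm_le_def)
  qed
  moreover have "multilinear_form N p W f = multilinear_form N p W g * sqrt (real N) ^ p"
  proof -
    have "(\<Prod>l=1..p. f l (a l)) = (\<Prod>l=1..p. g l (a l)) * sqrt (real N) ^ p" for a
    proof -
      have "(\<Prod>l=1..p. f l (a l)) = (\<Prod>l=1..p. g l (a l) * sqrt (real N))"
        unfolding g_def using N by (intro prod.cong) auto
      also have "\<dots> = (\<Prod>l=1..p. g l (a l)) * sqrt (real N) ^ p" by (simp add: prod.distrib)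
      finally show ?thesis .
    qed
    thus ?thesis unfolding multilinear_form_def sum_distrib_right by (simp add: mult_ac)
  qed
  ultimately show ?thesis by (simp add: abs_mult mult_right_mono)
qed

text \<open>Scaling: the normalization contributes \<open>N^(-(p-1)/2)\<close>, the injective norm \<open>\<surd>N\<close>,
  and the \<open>p\<close> vectors of length \<open>\<surd>N\<close> contribute \<open>N^(p/2)\<close>; the product is
  \<open>N\<close>.\<close>

lemma noise_grad_le:
  assumes W: "inj_norm_le N p W (K * sqrt (real N))" and X: "inner_N N (mat_col X j) (mat_col X j) \<le> real N"
    and u: "inner_N N u u \<le> real N" and N: "N > 0" and M: "M > 0" and lam: "0 \<le> lam j" "lam j \<le> L"
    and K: "K \<ge> 0"
  shows "\<bar>noise_grad p N M lam W X j u\<bar> \<le> L * real p * K * real N / sqrt (real M)"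
proof -
  have "\<bar>form_deriv N p W (mat_col X j) u\<bar> \<le> (\<Sum>l=1..p. K * sqrt (real N) * sqrt (real N) ^ p)"
    unfolding form_deriv_def
    by (rule order_trans[OF sum_abs sum_mono], rule multilinear_form_scaled[OF W _ N]) (use X u in \<open>auto simp: with_slot_def\<close>)
  hence 1: "\<bar>form_deriv N p W (mat_col X j) u\<bar> \<le> real p * (K * sqrt (real N) ^ (p+1))" by (simp add: mult_ac)
  have pw: "real N powr (- (real p - 1) / 2) * sqrt (real N) ^ (p+1) = real N"
  proof -
    have "sqrt (real N) ^ (p+1) = (real N powr (1/2)) powr real (p+1)"
      using N powr_realpow[of "sqrt (real N)" "p+1"] by (simp only: powr_half_sqrt of_nat_0_le_iff) simp
    also have "\<dots> = real N powr (real (p+1) / 2)" by (simp add: powr_powr)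
    finally have "real N powr (- (real p - 1) / 2) * sqrt (real N) ^ (p+1)
        = real N powr (- (real p - 1) / 2 + real (p+1) / 2)" by (simp add: powr_add)
    also have "- (real p - 1) / 2 + real (p+1) / 2 = 1" by (simp add: field_simps)
    finally show ?thesis using N by simp
  qed
  have "\<bar>noise_grad p N M lam W X j u\<bar> = 1 / sqrt (real M) * (real N powr (- (real p - 1) / 2) *
      (lam j * \<bar>form_deriv N p W (mat_col X j) u\<bar>))"
    unfolding noise_grad_def using lam by (simp add: abs_mult)
  also have "\<dots> \<le> 1 / sqrt (real M) * (real N powr (- (real p - 1) / 2) * (L * (real p * (K * sqrt (real N) ^ (p+1)))))"
    using 1 lam by (intro mult_left_mono mult_mono) auto
  also have "\<dots> = L * real p * K * (real N powr (- (real p - 1) / 2) * sqrt (real N) ^ (p+1)) / sqrt (real M)"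
    by (simp add: mult_ac)
  finally show ?thesis unfolding pw .
qed

lemma corr_noise_le:
  assumes W: "inj_norm_le N p W (K * sqrt (real N))" and X: "X \<in> stiefel N r"
    and N: "N > 0" and M: "M > 0" and lam: "\<And>i. i \<in> {1..r} \<Longrightarrow> 0 \<le> lam i \<and> lam i \<le> L"
    and K: "K \<ge> 0" and v: "\<And>i. i \<in> {1..r} \<Longrightarrow> inner_N N (v i) (v i) = real N"
    and ij: "i \<in> {1..r}" "j \<in> {1..r}"
  shows "\<bar>corr_noise p r N M lam v W X i j\<bar> \<le> L * real p * K * (1 + real r) / sqrt (real M)"
proof -
  define B where "B = L * real p * K / sqrt (real M)"
  have L: "0 \<le> L" using lam[OF ij(1)] by linarith
  have B0: "0 \<le> B" unfolding B_def using L K by auto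
  have n: "\<bar>noise_grad p N M lam W X a u\<bar> \<le> B * real N" if "a \<in> {1..r}" "inner_N N u u \<le> real N" for a u
    using noise_grad_le[OF W _ that(2) N M _ _ K, of X a lam L] lam[OF that(1)] stiefel_inner[OF X that(1,1)]
    by (simp add: B_def)
  have c: "inner_N N (mat_col X a) (mat_col X a) \<le> real N" if "a \<in> {1..r}" for a
    using stiefel_inner[OF X that that] by simp
  have "\<bar>\<Sum>a=1..r. corr N v X i a * (noise_grad p N M lam W X j (mat_col X a) + noise_grad p N M lam W X a (mat_col X j))\<bar>
     \<le> (\<Sum>a=1..r. 1 * (B * real N + B * real N))"
  proof (rule order_trans[OF sum_abs sum_mono])
    fix a assume a: "a \<in> {1..r}"
    have "\<bar>noise_grad p N M lam W X j (mat_col X a) + noise_grad p N M lam W X a (mat_col X j)\<bar> \<le> B * real N + B * real N"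
      using n[OF ij(2) c[OF a]] n[OF a c[OF ij(2)]] by linarith
    thus "\<bar>corr N v X i a * (noise_grad p N M lam W X j (mat_col X a) + noise_grad p N M lam W X a (mat_col X j))\<bar>
        \<le> 1 * (B * real N + B * real N)"
      unfolding abs_mult using corr_le_1[where v=v, OF X ij(1) a N v[OF ij(1)]] by (intro mult_mono) auto
  qed
  hence "\<bar>1 / (2 * real N) * (\<Sum>a=1..r. corr N v X i a * (noise_grad p N M lam W X j (mat_col X a) + noise_grad p N M lam W X a (mat_col X j)))\<bar>
     \<le> 1 / (2 * real N) * (real r * (2 * B * real N))"
    unfolding abs_mult using N by (intro mult_mono) auto
  moreover have "1 / (2 * real N) * (real r * (2 * B * real N)) = real r * B" using N by simp
  moreover have "\<bar>- noise_grad p N M lam W X j (v i) / real N\<bar> \<le> B"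
    using n[OF ij(2), of "v i"] v[OF ij(1)] N by (simp add: abs_divide pos_divide_le_eq)
  moreover have "L * real p * K * (1 + real r) / sqrt (real M) = B + real r * B" by (simp add: B_def add_divide_distrib algebra_simps)
  ultimately show ?thesis unfolding corr_noise_def by linarith
qed

text \<open>The signals enter the drag through a sum over all of them, so they can be renumbered; this makes the matching
  the identity.\<close>

lemma drag_relabel:
  assumes \<sigma>: "\<sigma> permutes {1..r}"
  shows "drag q r (\<lambda>i j. \<alpha> (\<sigma> i) j) (\<lambda>i j. m (\<sigma> i) j) i j = drag q r \<alpha> m (\<sigma> i) j"
proof -
  have "(\<Sum>l=1..r. drag_summand q (\<lambda>i j. \<alpha> (\<sigma> i) j) (\<lambda>i j. m (\<sigma> i) j) i j k l)
      = (\<Sum>l=1..r. drag_summand q \<alpha> m (\<sigma> i) j k l)" for k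
    unfolding sum.permute[OF \<sigma>, of "drag_summand q \<alpha> m (\<sigma> i) j k"]
    by (simp add: drag_summand_def)
  thus ?thesis by (simp add: drag_def)
qed

section \<open>The injective norm of a Gaussian tensor\<close>

lemma (in prob_space) linear_combination_normal:
  assumes fin: "finite A" and ind: "indep_vars (\<lambda>_. borel) X A"
    and X: "\<And>a. a \<in> A \<Longrightarrow> distributed M lborel (X a) std_normal_density"
    and pos: "(\<Sum>a\<in>A. (c a)\<^sup>2) > 0"
  shows "distributed M lborel (\<lambda>\<omega>. \<Sum>a\<in>A. c a * X a \<omega>) (normal_density 0 (sqrt (\<Sum>a\<in>A. (c a)\<^sup>2)))"
proof -
  define I where "I = {a\<in>A. c a \<noteq> 0}"
  have I: "finite I" "I \<noteq> {}" "I \<subseteq> A"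
  proof -
    show "I \<noteq> {}"
    proof
      assume "I = {}"
      hence "(\<Sum>a\<in>A. (c a)\<^sup>2) = 0" by (intro sum.neutral) (auto simp: I_def)
      thus False using pos by simp
    qed
  qed (use fin in \<open>auto simp: I_def\<close>)
  have "indep_vars (\<lambda>_. borel) (\<lambda>a \<omega>. c a * X a \<omega>) I"
    by (rule indep_vars_compose2[OF indep_vars_subset[OF ind I(3)]]) auto
  moreover have "distributed M lborel (\<lambda>\<omega>. c a * X a \<omega>) (normal_density 0 \<bar>c a\<bar>)" if "a \<in> I" for a
    using normal_density_affine[OF X, of a "c a" 0] that I by (auto simp: I_def)
  ultimately have "distributed M lborel (\<lambda>\<omega>. \<Sum>a\<in>I. c a * X a \<omega>)
      (normal_density (\<Sum>a\<in>I. 0) (sqrt (\<Sum>a\<in>I. \<bar>c a\<bar>\<^sup>2)))"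
    using I by (intro sum_indep_normal) (auto simp: I_def)
  moreover have "(\<Sum>a\<in>I. c a * X a \<omega>) = (\<Sum>a\<in>A. c a * X a \<omega>)" for \<omega>
    using fin by (intro sum.mono_neutral_left) (auto simp: I_def)
  moreover have "(\<Sum>a\<in>I. \<bar>c a\<bar>\<^sup>2) = (\<Sum>a\<in>A. (c a)\<^sup>2)"
    using fin by (simp, intro sum.mono_neutral_left) (auto simp: I_def)
  ultimately show ?thesis by simp
qed

text \<open>Half of the exponent is spent on the tail: for \<open>\<bar>y\<bar> > t\<close> the density is at most
  \<open>exp (-t\<^sup>2/4s\<^sup>2)\<close> times \<open>\<surd>2\<close> times the normal density of variance
  \<open>2 s\<^sup>2\<close>.\<close>

lemma (in prob_space) normal_tail:
  assumes Y: "distributed M lborel Y (normal_density 0 s)" and s: "s > 0" and t: "t \<ge> 0"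
  shows "prob {\<omega>\<in>space M. \<bar>Y \<omega>\<bar> > t} \<le> sqrt 2 * exp (- t\<^sup>2 / (4 * s\<^sup>2))"
proof -
  let ?A = "{y::real. \<bar>y\<bar> > t}" and ?c = "sqrt 2 * exp (- t\<^sup>2 / (4 * s\<^sup>2))"
  have A: "?A \<in> sets lborel" by simp
  have dens: "normal_density 0 s y * indicator ?A y \<le> ?c * normal_density 0 (sqrt 2 * s) y" for y :: real
  proof (cases "y \<in> ?A")
    case True
    hence "t\<^sup>2 \<le> y\<^sup>2" using t power_mono[of t "\<bar>y\<bar>" 2] by simp
    hence "- y\<^sup>2 / (4 * s\<^sup>2) \<le> - t\<^sup>2 / (4 * s\<^sup>2)" by (intro divide_right_mono) auto
    hence "exp (- y\<^sup>2 / (4 * s\<^sup>2)) \<le> exp (- t\<^sup>2 / (4 * s\<^sup>2))" by simp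
    moreover have "exp (- y\<^sup>2 / (2 * s\<^sup>2)) = exp (- y\<^sup>2 / (4 * s\<^sup>2)) * exp (- y\<^sup>2 / (4 * s\<^sup>2))"
      by (simp add: exp_add[symmetric])
    ultimately have "exp (- y\<^sup>2 / (2 * s\<^sup>2)) \<le> exp (- t\<^sup>2 / (4 * s\<^sup>2)) * exp (- y\<^sup>2 / (4 * s\<^sup>2))"
      by (simp add: mult_right_mono)
    hence "1 / sqrt (2 * pi * s\<^sup>2) * exp (- y\<^sup>2 / (2 * s\<^sup>2))
        \<le> 1 / sqrt (2 * pi * s\<^sup>2) * (exp (- t\<^sup>2 / (4 * s\<^sup>2)) * exp (- y\<^sup>2 / (4 * s\<^sup>2)))"
      by (intro mult_left_mono) auto
    moreover have "?c * normal_density 0 (sqrt 2 * s) y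
        = 1 / sqrt (2 * pi * s\<^sup>2) * (exp (- t\<^sup>2 / (4 * s\<^sup>2)) * exp (- y\<^sup>2 / (4 * s\<^sup>2)))"
    proof -
      have "2 * pi * (sqrt 2 * s)\<^sup>2 = 2 * (2 * pi * s\<^sup>2)" by (simp add: power_mult_distrib)
      hence "sqrt (2 * pi * (sqrt 2 * s)\<^sup>2) = sqrt 2 * sqrt (2 * pi * s\<^sup>2)" by (simp only: real_sqrt_mult)
      moreover have "- (y - 0)\<^sup>2 / (2 * (sqrt 2 * s)\<^sup>2) = - y\<^sup>2 / (4 * s\<^sup>2)" by (simp add: power_mult_distrib)
      ultimately show ?thesis unfolding normal_density_def by (simp add: divide_simps)
    qed
    ultimately show ?thesis using True by (simp add: normal_density_def)
  qed (simp add: normal_density_nonneg)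
  have "emeasure M {\<omega>\<in>space M. \<bar>Y \<omega>\<bar> > t} = emeasure M (Y -` ?A \<inter> space M)"
    by (intro arg_cong[where f="emeasure M"]) auto
  also have "\<dots> = (\<integral>\<^sup>+y. ennreal (normal_density 0 s y) * indicator ?A y \<partial>lborel)"
    by (rule distributed_emeasure[OF Y A])
  also have "\<dots> \<le> (\<integral>\<^sup>+y. ennreal ?c * ennreal (normal_density 0 (sqrt 2 * s) y) \<partial>lborel)"
  proof (intro nn_integral_mono)
    fix y :: real
    have "ennreal (normal_density 0 s y) * indicator ?A y = ennreal (normal_density 0 s y * indicator ?A y)"
      by (simp add: indicator_def)
    also have "\<dots> \<le> ennreal (?c * normal_density 0 (sqrt 2 * s) y)" by (intro ennreal_leI dens)
    finally show "ennreal (normal_density 0 s y) * indicator ?A y \<le> ennreal ?c * ennreal (normal_density 0 (sqrt 2 * s) y)"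
      by (simp add: ennreal_mult normal_density_nonneg)
  qed
  also have "\<dots> = ennreal ?c * (\<integral>\<^sup>+y. ennreal (normal_density 0 (sqrt 2 * s) y) \<partial>lborel)"
    by (rule nn_integral_cmult) simp
  also have "(\<integral>\<^sup>+y. ennreal (normal_density 0 (sqrt 2 * s) y) \<partial>lborel) = 1"
    using s by (subst nn_integral_eq_integral) (auto simp: normal_density_nonneg)
  finally show ?thesis by (simp add: emeasure_eq_measure)
qed

text \<open>A function that is affine in each coordinate attains its extrema over a box at the vertices. This replaces the
  usual approximation by a net: there is no approximation error to control.\<close>

lemma abs_affine_le_vertices:
  fixes F :: "('e \<Rightarrow> real) \<Rightarrow> real"
  assumes "finite I" and aff: "\<And>e f s. e \<in> I \<Longrightarrow> F (f(e := s)) = F (f(e := 0)) + (F (f(e := 1)) - F (f(e := 0))) * s"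
    and "\<And>e. e \<in> I \<Longrightarrow> lo e \<le> f e \<and> f e \<le> hi e"
    and "\<And>g. (\<And>e. e \<in> I \<Longrightarrow> g e = lo e \<or> g e = hi e) \<Longrightarrow> (\<And>e. e \<notin> I \<Longrightarrow> g e = f e) \<Longrightarrow> \<bar>F g\<bar> \<le> C"
  shows "\<bar>F f\<bar> \<le> C"
  using assms
proof (induction I arbitrary: f rule: finite_induct)
  case empty
  thus ?case by auto
next
  case (insert e I)
  have ends: "\<bar>F (f(e := s))\<bar> \<le> C" if s: "s = lo e \<or> s = hi e" for s
  proof (rule insert.IH)
    fix d assume "d \<in> I"
    thus "lo d \<le> (f(e := s)) d \<and> (f(e := s)) d \<le> hi d" using insert.prems(2)[of d] insert.hyps by auto
  next
    fix g assume g: "\<And>d. d \<in> I \<Longrightarrow> g d = lo d \<or> g d = hi d" "\<And>d. d \<notin> I \<Longrightarrow> g d = (f(e := s)) d"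
    show "\<bar>F g\<bar> \<le> C"
    proof (rule insert.prems(3))
      fix d assume "d \<in> insert e I"
      thus "g d = lo d \<or> g d = hi d" using g(1)[of d] g(2)[of e] insert.hyps s by (cases "d = e") auto
    next
      fix d assume "d \<notin> insert e I"
      thus "g d = f d" using g(2)[of d] by auto
    qed
  next
    fix d f s assume "d \<in> I"
    thus "F (f(d := s)) = F (f(d := 0)) + (F (f(d := 1)) - F (f(d := 0))) * s"
      by (intro insert.prems(1)) simp
  qed
  define A where "A = F (f(e := 0))"
  define B where "B = F (f(e := 1)) - F (f(e := 0))"
  have AB: "F (f(e := s)) = A + B * s" for s unfolding A_def B_def by (rule insert.prems(1)) simp
  have "F f = A + B * f e" using AB[of "f e"] by simp
  moreover have "lo e \<le> f e" "f e \<le> hi e" using insert.prems(2)[of e] by auto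
  hence "B * lo e \<le> B * f e \<and> B * f e \<le> B * hi e \<or> B * hi e \<le> B * f e \<and> B * f e \<le> B * lo e"
    by (cases "B \<ge> 0") (simp_all add: mult_left_mono mult_left_mono_neg)
  moreover have "\<bar>A + B * lo e\<bar> \<le> C" "\<bar>A + B * hi e\<bar> \<le> C" using ends[of "lo e"] ends[of "hi e"] unfolding AB by auto
  ultimately show ?case by linarith
qed

lemma multilinear_form_affine:
  fixes f :: "nat \<times> nat \<Rightarrow> real"
  assumes "fst e \<in> {1..p}"
  shows "multilinear_form N p W (\<lambda>l k. (f(e := s)) (l,k)) = multilinear_form N p W (\<lambda>l k. (f(e := 0)) (l,k))
    + (multilinear_form N p W (\<lambda>l k. (f(e := 1)) (l,k)) - multilinear_form N p W (\<lambda>l k. (f(e := 0)) (l,k))) * s"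
proof -
  have h: "(\<Prod>l=1..p. (f(e := s)) (l, a l)) = (\<Prod>l=1..p. (f(e := 0)) (l, a l))
     + ((\<Prod>l=1..p. (f(e := 1)) (l, a l)) - (\<Prod>l=1..p. (f(e := 0)) (l, a l))) * s" for a
  proof -
    have "(\<Prod>l=1..p. (f(e := x)) (l, a l)) = (f(e := x)) (fst e, a (fst e)) * (\<Prod>l\<in>{1..p}-{fst e}. f (l, a l))" for x
    proof -
      have "(\<Prod>l\<in>{1..p}-{fst e}. (f(e := x)) (l, a l)) = (\<Prod>l\<in>{1..p}-{fst e}. f (l, a l))"
        by (intro prod.cong) auto
      thus ?thesis using assms by (subst prod.remove[of _ "fst e"]) auto
    qed
    thus ?thesis by (cases "e = (fst e, a (fst e))") (auto simp: algebra_simps)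
  qed
  have "multilinear_form N p W (\<lambda>l k. (f(e := s)) (l,k)) = (\<Sum>a\<in>tensor_idx N p. W a * (\<Prod>l=1..p. (f(e := 0)) (l, a l))
     + (W a * (\<Prod>l=1..p. (f(e := 1)) (l, a l)) - W a * (\<Prod>l=1..p. (f(e := 0)) (l, a l))) * s)"
    unfolding multilinear_form_def by (intro sum.cong refl) (simp only: h, simp only: algebra_simps)
  thus ?thesis unfolding multilinear_form_def by (simp add: sum.distrib sum_subtractf sum_distrib_right[symmetric])
qed

lemma multilinear_form_cong:
  assumes "\<And>l k. l \<in> {1..p} \<Longrightarrow> k \<in> {1..N} \<Longrightarrow> f l k = g l k"
  shows "multilinear_form N p W f = multilinear_form N p W g"
  unfolding multilinear_form_def using assms tensor_idx_mem by (intro sum.cong prod.cong arg_cong2[where f="(*)"] refl) auto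

text \<open>Vectors of the unit ball, scaled by \<open>\<surd>N\<close> and rounded to integers coordinatewise in either
  direction, have squared length at most \<open>2 N + 2 N\<close>.\<close>

definition lattice_vectors :: "nat \<Rightarrow> (nat \<Rightarrow> int) set" where
  "lattice_vectors N = {z \<in> {1..N} \<rightarrow>\<^sub>E {- int (4*N)..int (4*N)}. (\<Sum>k=1..N. (z k)\<^sup>2) \<le> int (4*N)}"

definition lattice_point :: "nat \<Rightarrow> (nat \<Rightarrow> nat \<Rightarrow> int) \<Rightarrow> nat \<Rightarrow> nat \<Rightarrow> real" where
  "lattice_point N z = (\<lambda>l k. real_of_int (z l k) / sqrt (real N))"

lemma int_abs_le_square: "\<bar>z\<bar> \<le> z\<^sup>2" for z :: int
proof (cases "z = 0")
  case False
  hence "\<bar>z\<bar> * 1 \<le> \<bar>z\<bar> * \<bar>z\<bar>" by (intro mult_left_mono) auto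
  thus ?thesis by (simp add: power2_eq_square)
qed simp

lemma finite_lattice_vectors: "finite (lattice_vectors N)"
  unfolding lattice_vectors_def by (rule finite_subset[of _ "{1..N} \<rightarrow>\<^sub>E {- int (4*N)..int (4*N)}"]) (auto intro!: finite_PiE)

text \<open>The form is affine in every coordinate of every argument. So its value at a point is bounded by its values at
  the vertices of the surrounding cell of the lattice \<open>N^(-1/2) \<int>^N\<close>.\<close>

lemma inj_norm_le_lattice:
  assumes N: "N > 0" and z: "\<And>z. z \<in> {1..p} \<rightarrow>\<^sub>E lattice_vectors N \<Longrightarrow> \<bar>multilinear_form N p W (lattice_point N z)\<bar> \<le> c"
  shows "inj_norm_le N p W c"
  unfolding inj_norm_le_def
proof (intro allI impI)
  fix f :: "nat \<Rightarrow> nat \<Rightarrow> real" assume f: "\<forall>l\<in>{1..p}. inner_N N (f l) (f l) \<le> 1"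
  define S where "S = sqrt (real N)"
  have S: "S > 0" "S * S = real N" unfolding S_def using N by auto
  define fl where "fl = (\<lambda>e. \<lfloor>S * f (fst e) (snd e)\<rfloor>)"
  let ?I = "{1..p} \<times> {1..N}"
  have "\<bar>multilinear_form N p W (\<lambda>l k. f (fst (l,k)) (snd (l,k)))\<bar> \<le> c"
  proof (rule abs_affine_le_vertices[where F="\<lambda>g. multilinear_form N p W (\<lambda>l k. g (l,k))" and f="\<lambda>e. f (fst e) (snd e)" and I="?I" and lo="\<lambda>e. real_of_int (fl e) / S" and hi="\<lambda>e. real_of_int (fl e + 1) / S"])
    fix e
    have "real_of_int (fl e) \<le> S * f (fst e) (snd e)" "S * f (fst e) (snd e) \<le> real_of_int (fl e + 1)"
      unfolding fl_def by linarith+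
    thus "real_of_int (fl e) / S \<le> f (fst e) (snd e) \<and> f (fst e) (snd e) \<le> real_of_int (fl e + 1) / S"
      using S by (simp add: field_simps)
  next
    fix g assume g: "\<And>e. e \<in> ?I \<Longrightarrow> g e = real_of_int (fl e) / S \<or> g e = real_of_int (fl e + 1) / S"
    define z where "z = (\<lambda>l\<in>{1..p}. \<lambda>k\<in>{1..N}. if g (l,k) = real_of_int (fl (l,k)) / S then fl (l,k) else fl (l,k) + 1)"
    have zg: "real_of_int (z l k) / S = g (l,k)" if "l \<in> {1..p}" "k \<in> {1..N}" for l k
      using g[of "(l,k)"] that by (auto simp: z_def)
    have close: "\<bar>real_of_int (z l k) - S * f l k\<bar> \<le> 1" if "l \<in> {1..p}" "k \<in> {1..N}" for l k
      using that unfolding z_def fl_def by simp linarith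
    have sq: "(\<Sum>k=1..N. (z l k)\<^sup>2) \<le> int (4*N)" if l: "l \<in> {1..p}" for l
    proof -
      have "(\<Sum>k=1..N. (real_of_int (z l k))\<^sup>2) \<le> (\<Sum>k=1..N. 2 * (real N * (f l k * f l k)) + 2)"
      proof (intro sum_mono)
        fix k assume k: "k \<in> {1..N}"
        define y where "y = S * f l k" define d where "d = real_of_int (z l k) - y"
        \<comment> \<open>\<open>(y + d)\<^sup>2 \<le> 2 y\<^sup>2 + 2 d\<^sup>2\<close> with rounding error \<open>\<bar>d\<bar> \<le> 1\<close>\<close>
        have "\<bar>d\<bar> \<le> 1" using close[OF l k] by (simp add: d_def y_def)
        hence "d\<^sup>2 \<le> 1" using abs_square_le_1 by blast
        moreover have "0 \<le> (y - d)\<^sup>2" by simp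
        moreover have "(real_of_int (z l k))\<^sup>2 = 2 * y\<^sup>2 + 2 * d\<^sup>2 - (y - d)\<^sup>2"
          by (simp add: d_def power2_eq_square algebra_simps)
        moreover have "y\<^sup>2 = real N * (f l k * f l k)" using S(2) by (simp add: y_def power2_eq_square mult_ac)
        ultimately show "(real_of_int (z l k))\<^sup>2 \<le> 2 * (real N * (f l k * f l k)) + 2" by linarith
      qed
      also have "\<dots> = 2 * (real N * inner_N N (f l) (f l)) + 2 * real N"
        by (simp add: sum.distrib inner_N_def sum_distrib_left)
      also have "\<dots> \<le> 2 * (real N * 1) + 2 * real N" using f l by (intro add_right_mono mult_left_mono) auto
      finally have "real_of_int (\<Sum>k=1..N. (z l k)\<^sup>2) \<le> real_of_int (int (4 * N))" by simp
      thus ?thesis by (simp only: of_int_le_iff)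
    qed
    have "z l \<in> lattice_vectors N" if l: "l \<in> {1..p}" for l
    proof -
      have "\<bar>z l k\<bar> \<le> int (4*N)" if k: "k \<in> {1..N}" for k
      proof -
        have "\<bar>z l k\<bar> \<le> (z l k)\<^sup>2" by (rule int_abs_le_square)
        also have "\<dots> \<le> (\<Sum>k=1..N. (z l k)\<^sup>2)" by (rule member_le_sum) (use k in auto)
        finally show ?thesis using sq[OF l] by linarith
      qed
      moreover have "z l \<in> extensional {1..N}" using l by (simp add: z_def)
      ultimately show ?thesis using sq[OF l] by (auto simp: lattice_vectors_def PiE_def Pi_def abs_le_iff minus_le_iff)
    qed
    hence "z \<in> {1..p} \<rightarrow>\<^sub>E lattice_vectors N" by (auto simp: PiE_def extensional_def z_def)
    from \<open>\<And>z. z \<in> {1..p} \<rightarrow>\<^sub>E lattice_vectors N \<Longrightarrow> _\<close>[OF this]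
    show "\<bar>multilinear_form N p W (\<lambda>l k. g (l,k))\<bar> \<le> c"
      by (subst multilinear_form_cong[of _ _ _ "lattice_point N z"]) (use zg in \<open>auto simp: lattice_point_def S_def\<close>)
  next
    fix e :: "nat \<times> nat" and f s assume "e \<in> ?I"
    thus "multilinear_form N p W (\<lambda>l k. (f(e := s)) (l,k)) = multilinear_form N p W (\<lambda>l k. (f(e := 0)) (l,k))
    + (multilinear_form N p W (\<lambda>l k. (f(e := 1)) (l,k)) - multilinear_form N p W (\<lambda>l k. (f(e := 0)) (l,k))) * s"
      by (intro multilinear_form_affine) auto
  qed auto
  thus "\<bar>multilinear_form N p W f\<bar> \<le> c" by simp
qed

text \<open>Exponential counting. For integers \<open>\<bar>z\<bar> \<le> z\<^sup>2\<close>, so \<open>1 \<le> 2^(4N)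
  2^(-\<Sum> \<bar>z\<^sub>k\<bar>)\<close> on the set. Summing over all integer vectors, each coordinate contributes
  at most 3, and \<open>16 \<cdot> 3 = 48\<close>.\<close>

lemma card_lattice_vectors: "real (card (lattice_vectors N)) \<le> 48 ^ N"
proof -
  have geo: "(\<Sum>z\<in>{- int K..int K}. (1/2::real) ^ nat \<bar>z\<bar>) = 3 - 2 * (1/2) ^ K" for K
  proof (induction K)
    case (Suc K)
    have "{- int (Suc K)..int (Suc K)} = insert (- int (Suc K)) (insert (int (Suc K)) {- int K..int K})" by auto
    thus ?case using Suc by (simp add: nat_add_distrib)
  qed simp
  let ?B = "{- int (4*N)..int (4*N)}"
  have "real (card (lattice_vectors N)) = (\<Sum>z\<in>lattice_vectors N. 1)" by simp
  also have "\<dots> \<le> (\<Sum>z\<in>lattice_vectors N. 2 ^ (4*N) * (\<Prod>k=1..N. (1/2::real) ^ nat \<bar>z k\<bar>))"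
  proof (intro sum_mono)
    fix z assume z: "z \<in> lattice_vectors N"
    have "(\<Sum>k=1..N. \<bar>z k\<bar>) \<le> (\<Sum>k=1..N. (z k)\<^sup>2)"
    proof (intro sum_mono)
      fix k show "\<bar>z k\<bar> \<le> (z k)\<^sup>2" by (rule int_abs_le_square)
    qed
    also have "\<dots> \<le> int (4*N)" using z by (simp add: lattice_vectors_def)
    finally have "int (\<Sum>k=1..N. nat \<bar>z k\<bar>) \<le> int (4*N)" by simp
    hence le: "(\<Sum>k=1..N. nat \<bar>z k\<bar>) \<le> 4*N" by linarith
    have "(1/2::real) ^ (4*N) \<le> (1/2) ^ (\<Sum>k=1..N. nat \<bar>z k\<bar>)" using le by (intro power_decreasing) auto
    also have "\<dots> = (\<Prod>k=1..N. (1/2::real) ^ nat \<bar>z k\<bar>)" by (rule power_sum)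
    finally have "2 ^ (4*N) * (1/2::real) ^ (4*N) \<le> 2 ^ (4*N) * (\<Prod>k=1..N. (1/2::real) ^ nat \<bar>z k\<bar>)"
      by (intro mult_left_mono) auto
    thus "1 \<le> 2 ^ (4*N) * (\<Prod>k=1..N. (1/2::real) ^ nat \<bar>z k\<bar>)" by (simp add: power_mult_distrib[symmetric])
  qed
  also have "\<dots> \<le> (\<Sum>z\<in>{1..N} \<rightarrow>\<^sub>E ?B. 2 ^ (4*N) * (\<Prod>k=1..N. (1/2::real) ^ nat \<bar>z k\<bar>))"
    by (intro sum_mono2 finite_PiE) (auto simp: lattice_vectors_def intro!: mult_nonneg_nonneg prod_nonneg)
  also have "\<dots> = 2 ^ (4*N) * (\<Prod>k=1..N. \<Sum>z\<in>?B. (1/2::real) ^ nat \<bar>z\<bar>)"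
    unfolding sum_distrib_left[symmetric] by (subst prod_sum_PiE) auto
  also have "\<dots> \<le> 2 ^ (4*N) * (\<Prod>k=1..N. 3)"
    unfolding geo by (intro mult_left_mono prod_mono) (auto simp: power_le_one intro: order_trans[of _ 2])
  also have "\<dots> = 48 ^ N" by (simp add: power_mult power_mult_distrib[symmetric])
  finally show ?thesis .
qed

text \<open>A value of the form at lattice points is a normal variable of variance at most \<open>4^p\<close>. At the level
  \<open>inj_const p \<surd>N\<close> the exponent of \<open>normal_tail\<close> is therefore at least \<open>(p ln 48
  + 1) N\<close>, which outweighs the \<open>48^(p N)\<close> lattice points by a factor \<open>exp N\<close>.\<close>

definition inj_const :: "nat \<Rightarrow> real" where
  "inj_const p = sqrt (4 ^ (p+1) * (real p * ln 48 + 1))"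

lemma (in prob_space) inj_norm_bound:
  assumes ind: "indep_vars (\<lambda>_. borel) (\<lambda>a \<omega>. W \<omega> a) (tensor_idx N p)"
    and gauss: "\<And>a. a \<in> tensor_idx N p \<Longrightarrow> distributed M lborel (\<lambda>\<omega>. W \<omega> a) std_normal_density"
    and N: "N > 0"
  obtains G where "G \<in> sets M" "prob G \<ge> 1 - sqrt 2 * exp (- real N)"
    "\<forall>\<omega>\<in>G. inj_norm_le N p (W \<omega>) (inj_const p * sqrt (real N))"
proof -
  let ?L = "{1..p} \<rightarrow>\<^sub>E lattice_vectors N" and ?t = "inj_const p * sqrt (real N)"
  have finL: "finite ?L" by (intro finite_PiE finite_lattice_vectors) auto
  define Bad where "Bad z = {\<omega>\<in>space M. \<bar>multilinear_form N p (W \<omega>) (lattice_point N z)\<bar> > ?t}" for z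
  have Wm: "(\<lambda>\<omega>. W \<omega> a) \<in> borel_measurable M" if "a \<in> tensor_idx N p" for a
    using distributed_measurable[OF gauss[OF that]] by simp
  have mm: "(\<lambda>\<omega>. multilinear_form N p (W \<omega>) f) \<in> borel_measurable M" for f
    unfolding multilinear_form_def using Wm by (intro borel_measurable_sum borel_measurable_times) auto
  have BadM: "Bad z \<in> sets M" for z unfolding Bad_def using mm[of "lattice_point N z"] by measurable
  have k0: "0 \<le> real p * ln 48 + 1" by (intro add_nonneg_nonneg mult_nonneg_nonneg) auto
  have t0: "0 \<le> ?t" unfolding inj_const_def using k0 by auto
  have bad: "prob (Bad z) \<le> sqrt 2 * exp (- ((real p * ln 48 + 1) * real N))" if z: "z \<in> ?L" for z
  proof -
    define c where "c a = (\<Prod>l=1..p. lattice_point N z l (a l))" for a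
    have eq: "multilinear_form N p (W \<omega>) (lattice_point N z) = (\<Sum>a\<in>tensor_idx N p. c a * W \<omega> a)" for \<omega>
      unfolding multilinear_form_def c_def by (simp add: mult.commute)
    have "(\<Sum>a\<in>tensor_idx N p. (c a)\<^sup>2) = (\<Sum>a\<in>{1..p} \<rightarrow>\<^sub>E {1..N}. \<Prod>l=1..p. (lattice_point N z l (a l))\<^sup>2)"
      unfolding c_def tensor_idx_def by (simp add: prod_power_distrib)
    also have "\<dots> = (\<Prod>l=1..p. \<Sum>k=1..N. (lattice_point N z l k)\<^sup>2)" by (subst prod_sum_PiE) auto
    also have "\<dots> \<le> (\<Prod>l=1..p. 4)"
    proof (intro prod_mono conjI sum_nonneg)
      fix l assume l: "l \<in> {1..p}"
      have "z l \<in> lattice_vectors N" using z l by auto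
      hence "(\<Sum>k=1..N. (z l k)\<^sup>2) \<le> int (4*N)" by (simp add: lattice_vectors_def)
      hence "real_of_int (\<Sum>k=1..N. (z l k)\<^sup>2) \<le> real_of_int (int (4*N))" by (simp only: of_int_le_iff)
      hence "(\<Sum>k=1..N. (real_of_int (z l k))\<^sup>2) / real N \<le> 4" using N by (simp add: pos_divide_le_eq)
      thus "(\<Sum>k=1..N. (lattice_point N z l k)\<^sup>2) \<le> 4"
        using N by (simp add: lattice_point_def power_divide sum_divide_distrib)
    qed auto
    finally have c4: "(\<Sum>a\<in>tensor_idx N p. (c a)\<^sup>2) \<le> 4 ^ p" by simp
    show ?thesis
    proof (cases "(\<Sum>a\<in>tensor_idx N p. (c a)\<^sup>2) = 0")
      case True
      hence "\<forall>a\<in>tensor_idx N p. c a = 0" by (subst (asm) sum_nonneg_eq_0_iff) (auto simp: finite_tensor_idx)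
      hence "Bad z = {}" unfolding Bad_def eq using t0 by auto
      thus ?thesis by simp
    next
      case False
      define s2 where "s2 = (\<Sum>a\<in>tensor_idx N p. (c a)\<^sup>2)"
      have s2: "0 < s2" using False unfolding s2_def by (simp add: less_le sum_nonneg)
      have "prob (Bad z) \<le> sqrt 2 * exp (- ?t\<^sup>2 / (4 * (sqrt s2)\<^sup>2))" unfolding Bad_def eq
        using s2 linear_combination_normal[OF finite_tensor_idx ind gauss, of c] t0
        by (intro normal_tail) (auto simp: s2_def)
      also have "\<dots> \<le> sqrt 2 * exp (- ((real p * ln 48 + 1) * real N))"
      proof -
        have "?t\<^sup>2 = 4 * 4 ^ p * ((real p * ln 48 + 1) * real N)"
          unfolding inj_const_def using k0 by (simp add: power_mult_distrib)
        moreover have "4 * s2 * ((real p * ln 48 + 1) * real N) \<le> 4 * 4 ^ p * ((real p * ln 48 + 1) * real N)"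
          using c4 k0 unfolding s2_def by (intro mult_right_mono) auto
        ultimately have le: "4 * s2 * ((real p * ln 48 + 1) * real N) \<le> ?t\<^sup>2" by (simp only:)
        have div: "c \<le> T / x" if "x * c \<le> T" "0 < x" for c T x :: real
          using that by (simp add: pos_le_divide_eq mult.commute)
        have "(real p * ln 48 + 1) * real N \<le> ?t\<^sup>2 / (4 * s2)"
          by (rule div[OF le]) (use s2 in simp)
        thus ?thesis using s2 by simp
      qed
      finally show ?thesis .
    qed
  qed
  define G where "G = space M - (\<Union>z\<in>?L. Bad z)"
  have U: "(\<Union>z\<in>?L. Bad z) \<in> sets M" using finL BadM by (intro sets.finite_UN) auto
  show ?thesis
  proof (rule that)
    show "G \<in> sets M" unfolding G_def using U by auto
    have "prob (\<Union>z\<in>?L. Bad z) \<le> (\<Sum>z\<in>?L. prob (Bad z))"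
      using BadM finL by (intro finite_measure_subadditive_finite) auto
    also have "\<dots> \<le> (\<Sum>z\<in>?L. sqrt 2 * exp (- ((real p * ln 48 + 1) * real N)))" by (intro sum_mono bad)
    also have "\<dots> = real (card ?L) * (sqrt 2 * exp (- ((real p * ln 48 + 1) * real N)))" by simp
    also have "real (card ?L) = real (card (lattice_vectors N)) ^ p"
      by (simp add: card_PiE finite_lattice_vectors)
    also have "real (card (lattice_vectors N)) ^ p * (sqrt 2 * exp (- ((real p * ln 48 + 1) * real N)))
       \<le> (48 ^ N) ^ p * (sqrt 2 * exp (- ((real p * ln 48 + 1) * real N)))"
      by (intro mult_right_mono power_mono card_lattice_vectors) auto
    also have "(48 ^ N) ^ p = exp (real p * ln 48 * real N)"
    proof -
      have "exp (real p * ln 48 * real N) = exp (real (N * p) * ln 48)" by (simp add: mult_ac)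
      also have "\<dots> = exp (ln 48) ^ (N * p)" by (rule exp_of_nat_mult)
      finally show ?thesis by (simp add: power_mult)
    qed
    also have "exp (real p * ln 48 * real N) * (sqrt 2 * exp (- ((real p * ln 48 + 1) * real N))) = sqrt 2 * exp (- real N)"
      by (simp add: exp_add[symmetric] algebra_simps)
    finally show "prob G \<ge> 1 - sqrt 2 * exp (- real N)" unfolding G_def prob_compl[OF U] by simp
    show "\<forall>\<omega>\<in>G. inj_norm_le N p (W \<omega>) ?t"
    proof
      fix \<omega> assume "\<omega> \<in> G"
      hence "\<bar>multilinear_form N p (W \<omega>) (lattice_point N z)\<bar> \<le> ?t" if "z \<in> ?L" for z
        using that by (force simp: G_def Bad_def not_less)
      thus "inj_norm_le N p (W \<omega>) ?t" by (intro inj_norm_le_lattice N)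
    qed
  qed
qed

section \<open>Rotation invariance of the uniform frame\<close>

definition reflect :: "nat \<Rightarrow> (nat \<Rightarrow> real) \<Rightarrow> (nat \<Rightarrow> real) \<Rightarrow> nat \<Rightarrow> real" where
  "reflect N w u = (\<lambda>k. u k - 2 * inner_N N w u / inner_N N w w * w k)"

text \<open>The matrix of the reflection at the hyperplane orthogonal to \<open>w\<close>; for \<open>w = 0\<close> division
  by zero makes it the identity.\<close>

definition householder :: "nat \<Rightarrow> (nat \<Rightarrow> real) \<Rightarrow> rmat" where
  "householder N w = (\<lambda>(i, j). (if i = j then 1 else 0) - 2 * w i * w j / inner_N N w w)"

lemma inner_N_linear:
  "inner_N N x (\<lambda>k. y k - c * z k) = inner_N N x y - c * inner_N N x z"
  "inner_N N (\<lambda>k. y k - c * z k) x = inner_N N y x - c * inner_N N z x"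
  unfolding inner_N_def by (simp_all add: algebra_simps sum_subtractf sum_distrib_left)

lemma reflect_adjoint: "inner_N N (reflect N w u) x = inner_N N u (reflect N w x)"
  unfolding reflect_def inner_N_linear by (simp add: inner_N_commute[of N u w])

lemma reflect_isometry: "inner_N N (reflect N w u) (reflect N w x) = inner_N N u x"
proof (cases "inner_N N w w = 0")
  case False
  thus ?thesis unfolding reflect_def inner_N_linear
    by (simp add: inner_N_commute[of N x w] inner_N_commute[of N u w] field_simps)
qed (simp add: reflect_def)

lemma reflect_orthogonal: "inner_N N w u = 0 \<Longrightarrow> reflect N w u = u"
  by (simp add: reflect_def)

lemma inner_N_self_eq_0: "inner_N N w w = 0 \<Longrightarrow> k \<in> {1..N} \<Longrightarrow> w k = 0"
  unfolding inner_N_def by (subst (asm) sum_nonneg_eq_0_iff) auto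

lemma reflect_swap:
  assumes "inner_N N u u = inner_N N v v" and k: "k \<in> {1..N}"
  shows "reflect N (\<lambda>k. u k - v k) u k = v k"
proof (cases "inner_N N (\<lambda>k. u k - v k) (\<lambda>k. u k - v k) = 0")
  case True
  from inner_N_self_eq_0[OF this k] True show ?thesis by (simp add: reflect_def)
next
  case False
  have "inner_N N (\<lambda>k. u k - v k) (\<lambda>k. u k - v k) = 2 * inner_N N (\<lambda>k. u k - v k) u"
  proof -
    have l: "inner_N N (\<lambda>k. u k - v k) x = inner_N N u x - inner_N N v x"
      and r: "inner_N N x (\<lambda>k. u k - v k) = inner_N N x u - inner_N N x v" for x
      using inner_N_linear(2)[of N u 1 v x] inner_N_linear(1)[of N x u 1 v] by simp_all
    show ?thesis unfolding r unfolding l using assms(1) by (simp add: inner_N_commute[of N v u])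
  qed
  thus ?thesis using False by (simp add: reflect_def)
qed

lemma householder_orthogonal: "orthogonal_mat N (householder N w)"
  unfolding orthogonal_mat_def
proof (intro ballI)
  fix i j assume ij: "i \<in> {1..N}" "j \<in> {1..N}"
  have col: "mat_col (householder N w) i k = reflect N w (unit_vec i) k" if "i \<in> {1..N}" for i k
  proof -
    have "inner_N N w (unit_vec i) = w i" unfolding inner_N_def unit_vec_def using that
      by (simp add: if_distrib[of "\<lambda>x. _ * x"] cong: if_cong)
    thus ?thesis by (simp add: mat_col_def householder_def reflect_def unit_vec_def mult_ac)
  qed
  have "inner_N N (mat_col (householder N w) i) (mat_col (householder N w) j)
      = inner_N N (reflect N w (unit_vec i)) (reflect N w (unit_vec j))"
    unfolding inner_N_def using col ij by (intro sum.cong) auto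
  also have "\<dots> = (if i = j then 1 else 0)" unfolding reflect_isometry unfolding inner_N_def unit_vec_def using ij
    by (simp add: if_distrib[of "\<lambda>x. _ * x"] if_distrib[of "\<lambda>x. x * _"] cong: if_cong)
  finally show "inner_N N (mat_col (householder N w) i) (mat_col (householder N w) j) = (if i = j then 1 else 0)" .
qed

lemma householder_mult:
  assumes "k \<in> {1..N}" "j \<in> {1..r}"
  shows "mat_mult N N r (householder N w) X (k, j) = reflect N w (mat_col X j) k"
proof -
  have "mat_mult N N r (householder N w) X (k, j) = (\<Sum>l=1..N. householder N w (k,l) * X (l,j))"
    using assms by (simp add: mat_mult_def mat_idx_def)
  also have "\<dots> = (\<Sum>l=1..N. (if l = k then X (l,j) else 0) - 2 * w k / inner_N N w w * (w l * X (l,j)))"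
    by (intro sum.cong) (auto simp: householder_def algebra_simps)
  also have "\<dots> = X (k,j) - 2 * w k / inner_N N w w * inner_N N w (mat_col X j)"
    using assms by (simp add: sum_subtractf inner_N_def mat_col_def sum_distrib_left)
  finally show ?thesis by (simp add: reflect_def mat_col_def mult_ac)
qed

definition frame_coords :: "nat \<Rightarrow> nat \<Rightarrow> nat \<Rightarrow> (nat \<Rightarrow> nat \<Rightarrow> real) \<Rightarrow> rmat \<Rightarrow> rmat" where
  "frame_coords N n r U X = (\<lambda>(i, j)\<in>mat_idx n r. inner_N N (U i) (mat_col X j))"

definition orthonormal :: "nat \<Rightarrow> nat \<Rightarrow> (nat \<Rightarrow> nat \<Rightarrow> real) \<Rightarrow> bool" where
  "orthonormal N n U \<longleftrightarrow> (\<forall>i\<in>{1..n}. \<forall>j\<in>{1..n}. inner_N N (U i) (U j) = (if i = j then 1 else 0))"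

lemma entry_measurable: "k \<in> {1..N} \<Longrightarrow> j \<in> {1..r} \<Longrightarrow> (\<lambda>X. X (k,j)) \<in> borel_measurable (mat_borel N r)"
  unfolding mat_borel_def by (rule measurable_component_singleton) (simp add: mat_idx_def)

lemma inner_col_measurable:
  "j \<in> {1..r} \<Longrightarrow> (\<lambda>X. inner_N N u (mat_col X j)) \<in> borel_measurable (mat_borel N r)"
  unfolding inner_N_def mat_col_def
  by (intro borel_measurable_sum borel_measurable_times entry_measurable) auto

lemma measurable_into_mat_borel:
  assumes "\<And>i j. i \<in> {1..n} \<Longrightarrow> j \<in> {1..r} \<Longrightarrow> (\<lambda>x. f x (i,j)) \<in> borel_measurable M"
  shows "(\<lambda>x. \<lambda>e\<in>mat_idx n r. f x e) \<in> measurable M (mat_borel n r)"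
  unfolding mat_borel_def using assms by (intro measurable_restrict) (auto simp: mat_idx_def)

lemma frame_coords_measurable: "frame_coords N n r U \<in> measurable (mat_borel N r) (mat_borel n r)"
  unfolding frame_coords_def[abs_def]
  by (rule measurable_into_mat_borel) (simp add: inner_col_measurable)

lemma mat_mult_measurable_left: "(\<lambda>X. mat_mult N N r Q X) \<in> measurable (mat_borel N r) (mat_borel N r)"
  unfolding mat_mult_def
  by (rule measurable_into_mat_borel) (auto intro!: borel_measurable_sum borel_measurable_times entry_measurable)

lemma mat_mult_measurable_right: "(\<lambda>X. mat_mult N r r X Q) \<in> measurable (mat_borel N r) (mat_borel N r)"
  unfolding mat_mult_def
  by (rule measurable_into_mat_borel) (auto intro!: borel_measurable_sum borel_measurable_times entry_measurable)

lemma frame_coords_cong: "(\<And>i k. i \<in> {1..n} \<Longrightarrow> k \<in> {1..N} \<Longrightarrow> U i k = U' i k) \<Longrightarrow> frame_coords N n r U = frame_coords N n r U'"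
  unfolding frame_coords_def inner_N_def mat_idx_def by (intro ext restrict_ext) (auto intro!: sum.cong)

locale uniform_frame =
  fixes N r :: nat and \<mu> :: "rmat measure"
  assumes unif: "uniform_stiefel N r \<mu>" and r1: "r \<ge> 1" and rN: "r \<le> N"
begin

sublocale prob_space \<mu> using unif by (simp add: uniform_stiefel_def)

lemma sets_mu: "sets \<mu> = sets (mat_borel N r)" using unif by (simp add: uniform_stiefel_def)

lemma measurable_mu: "measurable \<mu> K = measurable (mat_borel N r) K"
  by (rule measurable_cong_sets[OF sets_mu refl])

lemma stiefel_measurable: "stiefel N r \<in> sets \<mu>"
  using unif measure_notin_sets[of "stiefel N r" \<mu>] unfolding uniform_stiefel_def by fastforce

lemma AE_stiefel: "AE X in \<mu>. X \<in> stiefel N r"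
  using AE_in_set_eq_1[OF stiefel_measurable] unif by (simp add: uniform_stiefel_def)

lemma left_invariant: "orthogonal_mat N Q \<Longrightarrow> distr \<mu> (mat_borel N r) (\<lambda>X. mat_mult N N r Q X) = \<mu>"
  using unif by (simp add: uniform_stiefel_def)

lemma right_invariant: "orthogonal_mat r Q \<Longrightarrow> distr \<mu> (mat_borel N r) (\<lambda>X. mat_mult N r r X Q) = \<mu>"
  using unif by (simp add: uniform_stiefel_def)

lemma law_reflect:
  "distr \<mu> (mat_borel n r) (frame_coords N n r (\<lambda>i. reflect N w (U i))) = distr \<mu> (mat_borel n r) (frame_coords N n r U)"
proof -
  let ?T = "\<lambda>X. mat_mult N N r (householder N w) X"
  have "frame_coords N n r U (?T X) = frame_coords N n r (\<lambda>i. reflect N w (U i)) X" for X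
  proof -
    have "inner_N N (U i) (mat_col (?T X) j) = inner_N N (reflect N w (U i)) (mat_col X j)" if "j \<in> {1..r}" for i j
    proof -
      have "inner_N N (U i) (mat_col (?T X) j) = inner_N N (U i) (reflect N w (mat_col X j))"
        unfolding inner_N_def using that householder_mult[OF _ that]
        by (intro sum.cong refl) (simp add: mat_col_def)
      thus ?thesis by (simp add: reflect_adjoint)
    qed
    thus ?thesis unfolding frame_coords_def mat_idx_def by (intro restrict_ext) auto
  qed
  moreover have "distr \<mu> (mat_borel n r) (frame_coords N n r U)
      = distr (distr \<mu> (mat_borel N r) ?T) (mat_borel n r) (frame_coords N n r U)"
    using left_invariant[OF householder_orthogonal] by simp
  moreover have "\<dots> = distr \<mu> (mat_borel n r) (frame_coords N n r U \<circ> ?T)"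
    by (rule distr_distr) (use frame_coords_measurable mat_mult_measurable_left in \<open>auto simp: measurable_mu\<close>)
  ultimately show ?thesis by (simp add: comp_def)
qed

text \<open>Reflections suffice: the reflection that exchanges the \<open>(l+1)\<close>-st vectors of two orthonormal
  families fixes the first \<open>l\<close> vectors if these already agree, because they are orthogonal to both. So
  one family is moved onto the other in \<open>n\<close> steps.\<close>

lemma frame_law:
  assumes U: "orthonormal N n U" and V: "orthonormal N n V"
  shows "distr \<mu> (mat_borel n r) (frame_coords N n r U) = distr \<mu> (mat_borel n r) (frame_coords N n r V)"
proof -
  have "\<exists>U'. orthonormal N n U' \<and> distr \<mu> (mat_borel n r) (frame_coords N n r U') = distr \<mu> (mat_borel n r) (frame_coords N n r U)
     \<and> (\<forall>i\<in>{1..l}. \<forall>k\<in>{1..N}. U' i k = V i k)" if "l \<le> n" for l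
    using that
  proof (induction l)
    case 0 thus ?case using U by auto
  next
    case (Suc l)
    then obtain U' where U': "orthonormal N n U'"
      "distr \<mu> (mat_borel n r) (frame_coords N n r U') = distr \<mu> (mat_borel n r) (frame_coords N n r U)"
      "\<And>i k. i \<in> {1..l} \<Longrightarrow> k \<in> {1..N} \<Longrightarrow> U' i k = V i k" by auto
    let ?w = "\<lambda>k. U' (Suc l) k - V (Suc l) k"
    define U'' where "U'' = (\<lambda>i. reflect N ?w (U' i))"
    have Sl: "Suc l \<in> {1..n}" using Suc by simp
    have "orthonormal N n U''" using U'(1) by (simp add: orthonormal_def U''_def reflect_isometry)
    moreover have "distr \<mu> (mat_borel n r) (frame_coords N n r U'') = distr \<mu> (mat_borel n r) (frame_coords N n r U)"
      unfolding U''_def law_reflect by (rule U'(2))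
    moreover have "U'' i k = V i k" if i: "i \<in> {1..Suc l}" and k: "k \<in> {1..N}" for i k
    proof (cases "i = Suc l")
      case True
      have "inner_N N (U' (Suc l)) (U' (Suc l)) = inner_N N (V (Suc l)) (V (Suc l))"
        using U'(1) V Sl by (auto simp: orthonormal_def)
      thus ?thesis unfolding U''_def True by (rule reflect_swap[OF _ k])
    next
      case False
      hence il: "i \<in> {1..l}" using i by auto
      have "inner_N N (V (Suc l)) (U' i) = inner_N N (V (Suc l)) (V i)"
        unfolding inner_N_def using U'(3)[OF il] by (intro sum.cong) auto
      also have "\<dots> = 0" using V Sl il Suc.prems by (auto simp: orthonormal_def)
      finally have "inner_N N (V (Suc l)) (U' i) = 0" .
      moreover have "inner_N N (U' (Suc l)) (U' i) = 0" using U'(1) Sl il Suc.prems by (auto simp: orthonormal_def)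
      ultimately have "inner_N N ?w (U' i) = 0" using inner_N_linear(2)[of N "U' (Suc l)" 1 "V (Suc l)" "U' i"] by simp
      thus ?thesis unfolding U''_def using U'(3)[OF il k] by (simp add: reflect_orthogonal)
    qed
    ultimately show ?case by blast
  qed
  from this[OF order_refl] obtain U' where "distr \<mu> (mat_borel n r) (frame_coords N n r U') = distr \<mu> (mat_borel n r) (frame_coords N n r U)"
     "\<forall>i\<in>{1..n}. \<forall>k\<in>{1..N}. U' i k = V i k" by blast
  thus ?thesis using frame_coords_cong[of n N U' V r] by simp
qed

lemma prob_frame_eq:
  assumes "orthonormal N n U" "orthonormal N n V" and B: "B \<in> sets (mat_borel n r)"
  shows "prob {X\<in>space \<mu>. frame_coords N n r U X \<in> B} = prob {X\<in>space \<mu>. frame_coords N n r V X \<in> B}"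
proof -
  have "prob {X\<in>space \<mu>. frame_coords N n r U X \<in> B} = measure (distr \<mu> (mat_borel n r) (frame_coords N n r U)) B" for U
    using B frame_coords_measurable[of N n r U]
    by (subst measure_distr) (auto simp: measurable_mu intro!: arg_cong[where f=prob])
  thus ?thesis using frame_law[OF assms(1,2)] by simp
qed

text \<open>The case \<open>n = 1\<close> of \<open>prob_frame_eq\<close>, for linear combinations of the columns.\<close>

lemma prob_unit_eq:
  assumes "inner_N N u u = 1" "inner_N N v v = 1"
    and B: "B \<in> sets (borel :: real measure)"
  shows "prob {X\<in>space \<mu>. (\<Sum>j=1..r. c j * inner_N N u (mat_col X j)) \<in> B}
       = prob {X\<in>space \<mu>. (\<Sum>j=1..r. c j * inner_N N v (mat_col X j)) \<in> B}"
proof -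
  let ?B = "{Y\<in>space (mat_borel 1 r). (\<Sum>j=1..r. c j * Y (1,j)) \<in> B}"
  have "(\<lambda>Y. \<Sum>j=1..r. c j * Y (1,j)) \<in> borel_measurable (mat_borel 1 r)"
    by (intro borel_measurable_sum borel_measurable_times entry_measurable) auto
  from measurable_sets[OF this B] have "?B \<in> sets (mat_borel 1 r)" by (simp add: vimage_def Int_def conj_commute)
  moreover have "orthonormal N 1 (\<lambda>_. u)" "orthonormal N 1 (\<lambda>_. v)" using assms by (auto simp: orthonormal_def)
  ultimately have "prob {X\<in>space \<mu>. frame_coords N 1 r (\<lambda>_. u) X \<in> ?B} = prob {X\<in>space \<mu>. frame_coords N 1 r (\<lambda>_. v) X \<in> ?B}"
    by (intro prob_frame_eq)
  moreover have "{X\<in>space \<mu>. frame_coords N 1 r (\<lambda>_. u) X \<in> ?B} = {X\<in>space \<mu>. (\<Sum>j=1..r. c j * inner_N N u (mat_col X j)) \<in> B}" for u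
    using measurable_space[OF frame_coords_measurable[of N 1 r "\<lambda>_. u"]] sets_eq_imp_space_eq[OF sets_mu]
    by (auto simp: frame_coords_def mat_idx_def)
  ultimately show ?thesis by simp
qed

end

section \<open>Small balls and tails of frame coordinates\<close>

lemma (in prob_space) normal_small_ball:
  assumes Y: "distributed M lborel Y (normal_density 0 s)" and s: "s > 0" and t: "t \<ge> 0"
  shows "prob {\<omega>\<in>space M. \<bar>Y \<omega>\<bar> \<le> t} \<le> t / s"
proof -
  let ?A = "{- t..t}"
  have dens: "normal_density 0 s y \<le> 1 / (2 * s)" for y
  proof -
    have "2 * s \<le> sqrt (2 * pi * s\<^sup>2)"
    proof (rule real_le_rsqrt)
      have "4 * s\<^sup>2 \<le> 2 * pi * s\<^sup>2" using pi_ge_two by (intro mult_right_mono) auto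
      thus "(2 * s)\<^sup>2 \<le> 2 * pi * s\<^sup>2" by (simp add: power_mult_distrib)
    qed
    hence "1 / sqrt (2 * pi * s\<^sup>2) \<le> 1 / (2 * s)" using s by (intro divide_left_mono) auto
    moreover have "1 / sqrt (2 * pi * s\<^sup>2) * exp (- (y - 0)\<^sup>2 / (2 * s\<^sup>2)) \<le> 1 / sqrt (2 * pi * s\<^sup>2) * 1"
      by (intro mult_left_mono) auto
    ultimately show ?thesis unfolding normal_density_def by linarith
  qed
  have "emeasure M {\<omega>\<in>space M. \<bar>Y \<omega>\<bar> \<le> t} = emeasure M (Y -` ?A \<inter> space M)"
    by (intro arg_cong[where f="emeasure M"]) (auto simp: abs_le_iff)
  also have "\<dots> = (\<integral>\<^sup>+y. ennreal (normal_density 0 s y) * indicator ?A y \<partial>lborel)"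
    by (rule distributed_emeasure[OF Y]) simp
  also have "\<dots> \<le> (\<integral>\<^sup>+y. ennreal (1 / (2 * s)) * indicator ?A y \<partial>lborel)"
    by (intro nn_integral_mono mult_right_mono ennreal_leI dens) auto
  also have "\<dots> = ennreal (1 / (2 * s)) * emeasure lborel ?A" by (rule nn_integral_cmult_indicator) simp
  also have "\<dots> = ennreal (t / s)" using t s by (simp add: ennreal_mult[symmetric] field_simps)
  finally show ?thesis using t s by (simp add: emeasure_eq_measure)
qed

definition gauss1 :: "real measure" where "gauss1 = density lborel std_normal_density"
definition gauss_vec :: "nat \<Rightarrow> (nat \<Rightarrow> real) measure" where "gauss_vec N = PiM {1..N} (\<lambda>_. gauss1)"

lemma prob_space_gauss1: "prob_space gauss1"
  unfolding gauss1_def by (rule prob_space_normal_density) simp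

lemma sets_gauss1: "sets gauss1 = sets borel" by (simp add: gauss1_def)

lemma prob_space_gauss_vec: "prob_space (gauss_vec N)"
  unfolding gauss_vec_def by (rule prob_space_PiM) (rule prob_space_gauss1)

lemma gauss_vec_component: "k \<in> {1..N} \<Longrightarrow> (\<lambda>g. g k) \<in> borel_measurable (gauss_vec N)"
  unfolding gauss_vec_def measurable_cong_sets[OF refl sets_gauss1[symmetric]]
  by (rule measurable_component_singleton)

lemma gauss_vec_distr: "k \<in> {1..N} \<Longrightarrow> distr (gauss_vec N) borel (\<lambda>g. g k) = gauss1"
proof -
  assume k: "k \<in> {1..N}"
  have "distr (gauss_vec N) borel (\<lambda>g. g k) = distr (gauss_vec N) gauss1 (\<lambda>g. g k)"
    by (rule distr_cong) (auto simp: sets_gauss1)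
  also have "\<dots> = gauss1" unfolding gauss_vec_def
    using k by (intro distr_PiM_component prob_space_gauss1)
  finally show ?thesis .
qed

lemma gauss_vec_distributed:
  assumes k: "k \<in> {1..N}" shows "distributed (gauss_vec N) lborel (\<lambda>g. g k) std_normal_density"
proof -
  have "distr (gauss_vec N) lborel (\<lambda>g. g k) = distr (gauss_vec N) borel (\<lambda>g. g k)"
    by (rule distr_cong) auto
  thus ?thesis unfolding distributed_def
    using gauss_vec_component[OF k] gauss_vec_distr[OF k] by (simp add: gauss1_def)
qed

lemma gauss_vec_indep:
  assumes N: "N \<ge> 1"
  shows "prob_space.indep_vars (gauss_vec N) (\<lambda>_. borel) (\<lambda>k g. g k) {1..N}"
proof -
  interpret prob_space "gauss_vec N" by (rule prob_space_gauss_vec)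
  have "indep_vars (\<lambda>_. borel) (\<lambda>k g. g k) {1..N} \<longleftrightarrow>
     distr (gauss_vec N) (PiM {1..N} (\<lambda>_. borel)) (\<lambda>x. \<lambda>i\<in>{1..N}. x i)
       = PiM {1..N} (\<lambda>k. distr (gauss_vec N) borel (\<lambda>g. g k))"
    using N gauss_vec_component by (intro indep_vars_iff_distr_eq_PiM') auto
  moreover have "PiM {1..N} (\<lambda>k. distr (gauss_vec N) borel (\<lambda>g. g k)) = gauss_vec N"
    unfolding gauss_vec_def[of N] using gauss_vec_distr by (intro PiM_cong) (auto simp: gauss_vec_def)
  moreover have "distr (gauss_vec N) (PiM {1..N} (\<lambda>_. borel)) (\<lambda>x. \<lambda>i\<in>{1..N}. x i) = distr (gauss_vec N) (gauss_vec N) (\<lambda>x. x)"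
  proof (rule distr_cong)
    show "sets (PiM {1..N} (\<lambda>_. borel)) = sets (gauss_vec N)"
      unfolding gauss_vec_def by (intro sets_PiM_cong) (auto simp: sets_gauss1)
    show "(\<lambda>i\<in>{1..N}. x i) = x" if "x \<in> space (gauss_vec N)" for x
      using that by (auto simp: gauss_vec_def space_PiM PiE_def extensional_def restrict_def)
  qed simp
  ultimately show ?thesis by simp
qed

text \<open>Markov's inequality, since the expected squared length is \<open>N\<close>. Any constant lower bound on the
  probability would do.\<close>

lemma gauss_vec_norm:
  assumes N: "N \<ge> 1"
  shows "measure (gauss_vec N) {g\<in>space (gauss_vec N). 0 < inner_N N g g \<and> inner_N N g g \<le> 4 * real N} \<ge> 1/2"
proof -
  interpret prob_space "gauss_vec N" by (rule prob_space_gauss_vec)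
  let ?S = "space (gauss_vec N)"
  have m: "(\<lambda>g. inner_N N g g) \<in> borel_measurable (gauss_vec N)"
    unfolding inner_N_def by (intro borel_measurable_sum borel_measurable_times gauss_vec_component) auto
  have sq: "(\<integral>\<^sup>+g. ennreal (g k * g k) \<partial>gauss_vec N) = 1" if k: "k \<in> {1..N}" for k
  proof -
    have "(\<integral>\<^sup>+g. ennreal (g k * g k) \<partial>gauss_vec N) = (\<integral>\<^sup>+x. ennreal (std_normal_density x) * ennreal (x * x) \<partial>lborel)"
      by (rule distributed_nn_integral[OF gauss_vec_distributed[OF k], symmetric]) simp
    also have "\<dots> = (\<integral>\<^sup>+x. ennreal (std_normal_density x * x ^ (2 * 1)) \<partial>lborel)"
      by (simp add: ennreal_mult power2_eq_square)
    also have "\<dots> = ennreal (\<integral>x. std_normal_density x * x ^ (2 * 1) \<partial>lborel)"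
      using std_normal_moment_even[of 1] unfolding has_bochner_integral_iff
      by (intro nn_integral_eq_integral) (auto intro!: mult_nonneg_nonneg AE_I2 simp: normal_density_nonneg)
    also have "(\<integral>x. std_normal_density x * x ^ (2 * 1) \<partial>lborel) = 1"
      by (subst integral_std_normal_moment_even) (simp add: fact_2)
    finally show ?thesis by simp
  qed
  have "(\<integral>\<^sup>+g. ennreal (inner_N N g g) \<partial>gauss_vec N) = (\<integral>\<^sup>+g. (\<Sum>k=1..N. ennreal (g k * g k)) \<partial>gauss_vec N)"
    unfolding inner_N_def by (simp add: sum_ennreal)
  also have "\<dots> = (\<Sum>k=1..N. \<integral>\<^sup>+g. ennreal (g k * g k) \<partial>gauss_vec N)"
    by (intro nn_integral_sum measurable_compose[OF _ measurable_ennreal] borel_measurable_times gauss_vec_component) auto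
  also have "\<dots> = ennreal (real N)" using sq by (simp add: ennreal_of_nat_eq_real_of_nat)
  finally have E: "(\<integral>\<^sup>+g. ennreal (inner_N N g g) \<partial>gauss_vec N) = ennreal (real N)" .
  note m[measurable]
  let ?big = "{g\<in>?S. 4 * real N < inner_N N g g}"
  have "ennreal (4 * real N) * emeasure (gauss_vec N) ?big = (\<integral>\<^sup>+g. ennreal (4 * real N) * indicator ?big g \<partial>gauss_vec N)"
    by (rule nn_integral_cmult_indicator[symmetric]) measurable
  also have "\<dots> \<le> (\<integral>\<^sup>+g. ennreal (inner_N N g g) \<partial>gauss_vec N)"
    by (intro nn_integral_mono) (auto simp: indicator_def intro: ennreal_leI)
  also have "ennreal (4 * real N) * emeasure (gauss_vec N) ?big = ennreal (4 * real N * prob ?big)"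
    unfolding emeasure_eq_measure by (rule ennreal_mult[symmetric]) auto
  finally have "4 * real N * prob ?big \<le> real N" unfolding E by (subst (asm) ennreal_le_iff) auto
  hence "real N * (4 * prob ?big) \<le> real N * 1" by simp
  hence "prob ?big \<le> 1/4" using N by (subst (asm) mult_le_cancel_left_pos) auto
  moreover have "prob {g\<in>?S. inner_N N g g \<le> 0} \<le> 0"
  proof -
    have "prob {g\<in>?S. inner_N N g g \<le> 0} \<le> prob {g\<in>?S. \<bar>g 1\<bar> \<le> 0}"
    proof (rule finite_measure_mono)
      have [measurable]: "(\<lambda>g. g 1) \<in> borel_measurable (gauss_vec N)"
        using gauss_vec_component[of 1 N] N by simp
      show "{g\<in>?S. \<bar>g 1\<bar> \<le> 0} \<in> sets (gauss_vec N)" by measurable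
      show "{g\<in>?S. inner_N N g g \<le> 0} \<subseteq> {g\<in>?S. \<bar>g 1\<bar> \<le> 0}"
      proof
        fix g assume g: "g \<in> {g\<in>?S. inner_N N g g \<le> 0}"
        have "0 \<le> inner_N N g g" unfolding inner_N_def by (intro sum_nonneg) auto
        hence "inner_N N g g = 0" using g by auto
        thus "g \<in> {g\<in>?S. \<bar>g 1\<bar> \<le> 0}" using inner_N_self_eq_0[of N g 1] N g by auto
      qed
    qed
    also have "\<dots> \<le> 0 / 1" using gauss_vec_distributed[of 1 N] N by (intro normal_small_ball) auto
    finally show ?thesis by simp
  qed
  moreover have "1 \<le> prob {g\<in>?S. 0 < inner_N N g g \<and> inner_N N g g \<le> 4 * real N} + prob {g\<in>?S. 4 * real N < inner_N N g g}
      + prob {g\<in>?S. inner_N N g g \<le> 0}"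
  proof -
    have "1 = prob ?S" by (simp add: prob_space)
    also have "?S = {g\<in>?S. 0 < inner_N N g g \<and> inner_N N g g \<le> 4 * real N} \<union> {g\<in>?S. 4 * real N < inner_N N g g} \<union> {g\<in>?S. inner_N N g g \<le> 0}"
      by auto
    also have "prob \<dots> \<le> prob ({g\<in>?S. 0 < inner_N N g g \<and> inner_N N g g \<le> 4 * real N} \<union> {g\<in>?S. 4 * real N < inner_N N g g}) + prob {g\<in>?S. inner_N N g g \<le> 0}"
      by (rule measure_Un_le) measurable
    also have "\<dots> \<le> (prob {g\<in>?S. 0 < inner_N N g g \<and> inner_N N g g \<le> 4 * real N} + prob {g\<in>?S. 4 * real N < inner_N N g g}) + prob {g\<in>?S. inner_N N g g \<le> 0}"
      by (rule add_right_mono, rule measure_Un_le) measurable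
    finally show ?thesis .
  qed
  ultimately show ?thesis by linarith
qed

context uniform_frame
begin

definition col_comb :: "(nat \<Rightarrow> real) \<Rightarrow> rmat \<Rightarrow> nat \<Rightarrow> real" where
  "col_comb c X = (\<lambda>k. \<Sum>j=1..r. c j * X (k,j))"

lemma inner_col_comb: "(\<Sum>j=1..r. c j * inner_N N u (mat_col X j)) = inner_N N u (col_comb c X)"
proof -
  have "(\<Sum>j=1..r. c j * inner_N N u (mat_col X j)) = (\<Sum>j=1..r. \<Sum>k=1..N. u k * (c j * X (k,j)))"
    unfolding inner_N_def mat_col_def sum_distrib_left by (simp add: mult_ac)
  also have "\<dots> = inner_N N u (col_comb c X)" unfolding inner_N_def col_comb_def sum_distrib_left by (rule sum.swap)
  finally show ?thesis .
qed

lemma col_comb_norm: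
  assumes "X \<in> stiefel N r" shows "inner_N N (col_comb c X) (col_comb c X) = real N * (\<Sum>j=1..r. (c j)\<^sup>2)"
proof -
  have "inner_N N (col_comb c X) (col_comb c X) = (\<Sum>j=1..r. c j * inner_N N (col_comb c X) (mat_col X j))"
    by (rule inner_col_comb[symmetric])
  also have "\<dots> = (\<Sum>j=1..r. c j * (\<Sum>l=1..r. c l * inner_N N (mat_col X j) (mat_col X l)))"
  proof (intro sum.cong refl)
    fix j show "c j * inner_N N (col_comb c X) (mat_col X j) = c j * (\<Sum>l=1..r. c l * inner_N N (mat_col X j) (mat_col X l))"
      unfolding inner_col_comb[of c "mat_col X j" X] by (simp add: inner_N_commute)
  qed
  also have "\<dots> = (\<Sum>j=1..r. c j * (\<Sum>l=1..r. if l = j then c l * real N else 0))"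
    using assms by (intro sum.cong arg_cong2[where f="(*)"] refl) (auto simp: stiefel_inner)
  also have "\<dots> = real N * (\<Sum>j=1..r. (c j)\<^sup>2)" by (simp add: sum_distrib_left power2_eq_square mult_ac)
  finally show ?thesis .
qed

lemma col_comb_measurable: "k \<in> {1..N} \<Longrightarrow> (\<lambda>X. col_comb c X k) \<in> borel_measurable \<mu>"
  unfolding col_comb_def measurable_mu
  by (intro borel_measurable_sum borel_measurable_times entry_measurable) auto

text \<open>Let \<open>y\<close> be the combination of columns with coefficients \<open>c\<close>; almost surely
  \<open>\<bar>y\<bar> = \<surd>N\<close>. Draw a Gaussian vector \<open>g\<close> independently of \<open>X\<close>.
  For fixed \<open>g\<close> the probability in question equals that for the unit vector
  \<open>g/\<bar>g\<bar>\<close>, and with probability at least \<open>1/2\<close> it is at most the probability of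
  \<open>\<bar>\<langle>g, y\<rangle>\<bar> \<le> 2 \<surd>N \<delta>\<close>. For fixed \<open>X\<close> the variable
  \<open>\<langle>g, y\<rangle>\<close> is normal of variance \<open>N\<close>, so the latter is at most \<open>2
  \<delta>\<close>. Fubini's theorem gives \<open>p/2 \<le> 2 \<delta>\<close>.\<close>

lemma small_ball:
  assumes u: "inner_N N u u = 1" and c: "(\<Sum>j=1..r. (c j)\<^sup>2) = 1" and \<delta>: "\<delta> \<ge> 0"
  shows "prob {X\<in>space \<mu>. \<bar>inner_N N u (col_comb c X)\<bar> \<le> \<delta>} \<le> 4 * \<delta>"
proof -
  let ?G = "gauss_vec N"
  interpret G: prob_space ?G by (rule prob_space_gauss_vec)
  interpret P: pair_prob_space ?G \<mu> ..
  have N1: "N \<ge> 1" using r1 rN by simp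
  define p where "p = prob {X\<in>space \<mu>. \<bar>inner_N N u (col_comb c X)\<bar> \<le> \<delta>}"
  define t where "t = 2 * sqrt (real N) * \<delta>"
  have t0: "t \<ge> 0" unfolding t_def using \<delta> by auto
  define K where "K = {z\<in>space (?G \<Otimes>\<^sub>M \<mu>). \<bar>inner_N N (fst z) (col_comb c (snd z))\<bar> \<le> t}"
  define good where "good = {g\<in>space ?G. 0 < inner_N N g g \<and> inner_N N g g \<le> 4 * real N}"
  have Km: "K \<in> sets (?G \<Otimes>\<^sub>M \<mu>)"
  proof -
    have "(\<lambda>z. inner_N N (fst z) (col_comb c (snd z))) \<in> borel_measurable (?G \<Otimes>\<^sub>M \<mu>)"
      unfolding inner_N_def
      by (intro borel_measurable_sum borel_measurable_times measurable_compose[OF measurable_fst gauss_vec_component]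
           measurable_compose[OF measurable_snd col_comb_measurable])
    thus ?thesis unfolding K_def by measurable
  qed
  have goodm: "good \<in> sets ?G"
  proof -
    have "(\<lambda>g. inner_N N g g) \<in> borel_measurable ?G"
      unfolding inner_N_def by (intro borel_measurable_sum borel_measurable_times gauss_vec_component) auto
    thus ?thesis unfolding good_def by measurable
  qed
  have sec: "ennreal p \<le> emeasure \<mu> (Pair g -` K)" if g: "g \<in> good" for g
  proof -
    define n where "n = sqrt (inner_N N g g)"
    have n: "0 < n" "n \<le> 2 * sqrt (real N)" "n * n = inner_N N g g"
    proof -
      show "0 < n" "n * n = inner_N N g g" using g unfolding n_def good_def by auto
      have "n \<le> sqrt (4 * real N)" using g unfolding n_def good_def by (intro real_sqrt_le_mono) auto
      thus "n \<le> 2 * sqrt (real N)" by (simp add: real_sqrt_mult)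
    qed
    let ?e = "\<lambda>k. g k / n"
    have "inner_N N ?e ?e = inner_N N g g / (n * n)" unfolding inner_N_def by (simp add: sum_divide_distrib)
    hence "inner_N N ?e ?e = (n * n) / (n * n)" by (simp only: n(3))
    hence e1: "inner_N N ?e ?e = 1" using n(1) by simp
    have "p = prob {X\<in>space \<mu>. (\<Sum>j=1..r. c j * inner_N N u (mat_col X j)) \<in> {-\<delta>..\<delta>}}"
      unfolding p_def inner_col_comb by (intro arg_cong[where f=prob]) (auto simp: abs_le_iff)
    also have "\<dots> = prob {X\<in>space \<mu>. (\<Sum>j=1..r. c j * inner_N N ?e (mat_col X j)) \<in> {-\<delta>..\<delta>}}"
      by (rule prob_unit_eq[OF u e1]) simp
    also have "\<dots> \<le> prob (Pair g -` K)"
    proof (intro finite_measure_mono subsetI)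
      fix X assume "X \<in> {X\<in>space \<mu>. (\<Sum>j=1..r. c j * inner_N N ?e (mat_col X j)) \<in> {-\<delta>..\<delta>}}"
      hence X: "X \<in> space \<mu>" "\<bar>inner_N N ?e (col_comb c X)\<bar> \<le> \<delta>" unfolding inner_col_comb by (auto simp: abs_le_iff)
      have "inner_N N g (col_comb c X) = n * inner_N N ?e (col_comb c X)"
        unfolding inner_N_def sum_distrib_left using n(1) by (intro sum.cong) auto
      hence "\<bar>inner_N N g (col_comb c X)\<bar> = n * \<bar>inner_N N ?e (col_comb c X)\<bar>" using n(1) by (simp add: abs_mult)
      also have "\<dots> \<le> 2 * sqrt (real N) * \<delta>" using n X by (intro mult_mono) auto
      finally show "X \<in> Pair g -` K" using X g by (auto simp: K_def t_def good_def space_pair_measure)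
    next
      show "Pair g -` K \<in> events" using sets_Pair1[OF Km] .
    qed
    finally show ?thesis by (simp add: emeasure_eq_measure)
  qed
  have fib: "emeasure ?G ((\<lambda>g. (g, X)) -` K) \<le> ennreal (2 * \<delta>)" if X: "X \<in> stiefel N r" for X
  proof -
    have pos: "(\<Sum>k=1..N. (col_comb c X k)\<^sup>2) = real N"
      using col_comb_norm[OF X, of c] c by (simp add: inner_N_def power2_eq_square)
    have "distributed ?G lborel (\<lambda>g. \<Sum>k\<in>{1..N}. col_comb c X k * g k) (normal_density 0 (sqrt (\<Sum>k\<in>{1..N}. (col_comb c X k)\<^sup>2)))"
      by (rule G.linear_combination_normal[OF _ gauss_vec_indep[OF N1]]) (use gauss_vec_distributed pos N1 in auto)
    hence "distributed ?G lborel (\<lambda>g. inner_N N g (col_comb c X)) (normal_density 0 (sqrt (real N)))"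
      unfolding pos by (simp add: inner_N_def mult.commute)
    from G.normal_small_ball[OF this _ t0] N1
    have "G.prob {g\<in>space ?G. \<bar>inner_N N g (col_comb c X)\<bar> \<le> t} \<le> t / sqrt (real N)" by simp
    also have "t / sqrt (real N) = 2 * \<delta>" unfolding t_def using N1 by simp
    finally have "emeasure ?G {g\<in>space ?G. \<bar>inner_N N g (col_comb c X)\<bar> \<le> t} \<le> ennreal (2 * \<delta>)"
      using \<delta> by (simp add: G.emeasure_eq_measure ennreal_leI)
    moreover have "(\<lambda>g. (g, X)) -` K \<subseteq> {g\<in>space ?G. \<bar>inner_N N g (col_comb c X)\<bar> \<le> t}"
      by (auto simp: K_def space_pair_measure)
    moreover have "{g\<in>space ?G. \<bar>inner_N N g (col_comb c X)\<bar> \<le> t} \<in> sets ?G"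
    proof -
      have "(\<lambda>g. inner_N N g (col_comb c X)) \<in> borel_measurable ?G"
        unfolding inner_N_def by (intro borel_measurable_sum borel_measurable_times gauss_vec_component) auto
      thus ?thesis by measurable
    qed
    ultimately show ?thesis by (meson emeasure_mono order_trans)
  qed
  have "ennreal p * ennreal (1/2) \<le> ennreal p * emeasure ?G good"
    unfolding G.emeasure_eq_measure good_def by (intro mult_left_mono ennreal_leI gauss_vec_norm[OF N1]) auto
  also have "\<dots> = (\<integral>\<^sup>+g. ennreal p * indicator good g \<partial>?G)" using goodm by (simp add: nn_integral_cmult_indicator)
  also have "\<dots> \<le> (\<integral>\<^sup>+g. emeasure \<mu> (Pair g -` K) \<partial>?G)"
    by (intro nn_integral_mono) (auto simp: indicator_def sec)
  also have "\<dots> = emeasure (?G \<Otimes>\<^sub>M \<mu>) K" by (rule emeasure_pair_measure_alt[OF Km, symmetric])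
  also have "\<dots> = (\<integral>\<^sup>+X. emeasure ?G ((\<lambda>g. (g, X)) -` K) \<partial>\<mu>)" by (rule P.emeasure_pair_measure_alt2[OF Km])
  also have "\<dots> \<le> (\<integral>\<^sup>+X. ennreal (2 * \<delta>) \<partial>\<mu>)"
    by (rule nn_integral_mono_AE) (use AE_stiefel fib in auto)
  also have "\<dots> = ennreal (2 * \<delta>)" by (simp add: emeasure_space_1)
  also have "ennreal p * ennreal (1/2) = ennreal (p * (1/2))"
    by (rule ennreal_mult[symmetric]) (auto simp: p_def)
  finally have "ennreal (p * (1/2)) \<le> ennreal (2 * \<delta>)" .
  hence "p * (1/2) \<le> 2 * \<delta>" using \<delta> by (subst (asm) ennreal_le_iff) auto
  thus ?thesis unfolding p_def by simp
qed

lemma inner_measurable: "j \<in> {1..r} \<Longrightarrow> (\<lambda>X. inner_N N u (mat_col X j)) \<in> borel_measurable \<mu>"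
  unfolding measurable_mu by (rule inner_col_measurable)

lemma sum_unit_vec: "j \<in> {1..r} \<Longrightarrow> (\<Sum>i=1..r. unit_vec j i * f i) = f j"
  by (simp add: unit_vec_def if_distrib[of "\<lambda>x. x * _"] cong: if_cong)

lemma inner_unit_vec: "k \<in> {1..N} \<Longrightarrow> inner_N N (unit_vec k) x = x k"
  unfolding inner_N_def unit_vec_def by (simp add: if_distrib[of "\<lambda>x. x * _"] cong: if_cong)

text \<open>All \<open>N\<close> entries of a column have the law of \<open>\<langle>u, x\<rangle>\<close>, and their
  squares add up to \<open>N\<close>. So on average at most \<open>N / L\<^sup>2\<close> of them exceed
  \<open>L\<close>.\<close>

lemma entry_tail:
  assumes u: "inner_N N u u = 1" and j: "j \<in> {1..r}" and L: "L > 0"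
  shows "prob {X\<in>space \<mu>. \<bar>inner_N N u (mat_col X j)\<bar> > L} \<le> 1 / L\<^sup>2"
proof -
  have N1: "N \<ge> 1" using r1 rN by simp
  let ?p = "prob {X\<in>space \<mu>. \<bar>inner_N N u (mat_col X j)\<bar> > L}"
  let ?E = "\<lambda>k. {X\<in>space \<mu>. \<bar>X (k,j)\<bar> > L}"
  have Em: "?E k \<in> sets \<mu>" if "k \<in> {1..N}" for k
  proof -
    have "(\<lambda>X. X (k,j)) \<in> borel_measurable \<mu>" unfolding measurable_mu by (rule entry_measurable[OF that j])
    thus ?thesis by measurable
  qed
  have eq: "?p = prob (?E k)" if k: "k \<in> {1..N}" for k
  proof -
    have "?p = prob {X\<in>space \<mu>. (\<Sum>i=1..r. unit_vec j i * inner_N N u (mat_col X i)) \<in> {x. \<bar>x\<bar> > L}}"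
      unfolding sum_unit_vec[OF j] by simp
    also have "\<dots> = prob {X\<in>space \<mu>. (\<Sum>i=1..r. unit_vec j i * inner_N N (unit_vec k) (mat_col X i)) \<in> {x. \<bar>x\<bar> > L}}"
    proof (rule prob_unit_eq[OF u])
      show "inner_N N (unit_vec k) (unit_vec k) = 1" unfolding inner_unit_vec[OF k] by (simp add: unit_vec_def)
    qed measurable
    also have "\<dots> = prob (?E k)" unfolding sum_unit_vec[OF j] inner_unit_vec[OF k] by (simp add: mat_col_def)
    finally show ?thesis .
  qed
  have int: "integrable \<mu> (indicator (?E k) :: rmat \<Rightarrow> real)" if "k \<in> {1..N}" for k
    by (rule integrable_real_indicator) (use Em[OF that] in \<open>auto simp: emeasure_eq_measure\<close>)
  have "real N * ?p = (\<Sum>k=1..N. ?p)" by simp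
  also have "\<dots> = (\<Sum>k=1..N. prob (?E k))" by (intro sum.cong refl eq)
  also have "\<dots> = (\<Sum>k=1..N. expectation (indicator (?E k)))" using Em by simp
  also have "\<dots> = expectation (\<lambda>X. \<Sum>k=1..N. indicator (?E k) X)"
    using int by (intro Bochner_Integration.integral_sum[symmetric])
  also have "\<dots> \<le> expectation (\<lambda>X. real N / L\<^sup>2)"
  proof (rule integral_mono_AE)
    show "integrable \<mu> (\<lambda>X. \<Sum>k=1..N. indicator (?E k) X :: real)" by (intro Bochner_Integration.integrable_sum int)
    show "AE X in \<mu>. (\<Sum>k=1..N. indicator (?E k) X) \<le> real N / L\<^sup>2"
      using AE_stiefel
    proof eventually_elim
      case (elim X)
      have "(\<Sum>k=1..N. indicator (?E k) X) \<le> (\<Sum>k=1..N. (X (k,j))\<^sup>2 / L\<^sup>2)"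
      proof (intro sum_mono)
        fix k
        have "L\<^sup>2 \<le> (X (k,j))\<^sup>2" if "\<bar>X (k,j)\<bar> > L" using that L power_mono[of L "\<bar>X (k,j)\<bar>" 2] by simp
        thus "indicator (?E k) X \<le> (X (k,j))\<^sup>2 / L\<^sup>2" using L by (auto simp: indicator_def)
      qed
      also have "\<dots> = inner_N N (mat_col X j) (mat_col X j) / L\<^sup>2"
        by (simp add: inner_N_def mat_col_def sum_divide_distrib power2_eq_square)
      also have "\<dots> = real N / L\<^sup>2" using stiefel_inner[OF elim j j] by simp
      finally show ?case .
    qed
  qed simp
  finally have "real N * ?p \<le> real N * (1 / L\<^sup>2)" by (simp add: prob_space)
  thus ?thesis using N1 by (subst (asm) mult_le_cancel_left_pos) auto
qed

text \<open>Changing the signs of columns is a right multiplication by an orthogonal matrix. Hence the \<open>2^r\<close>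
  sign patterns of a row are equally likely, and they exhaust the space up to the null event that an entry vanishes.\<close>

lemma row_positive:
  assumes k: "k \<in> {1..N}"
  shows "1 \<le> 2 ^ r * prob {X\<in>space \<mu>. \<forall>j\<in>{1..r}. X (k,j) > 0}"
proof -
  let ?R = "{X\<in>space \<mu>. \<forall>j\<in>{1..r}. X (k,j) > 0}"
  define sg :: "nat set \<Rightarrow> nat \<Rightarrow> real" where "sg S j = (if j \<in> S then -1 else 1)" for S j
  define E where "E S = {X\<in>space \<mu>. \<forall>j\<in>{1..r}. X (k,j) * sg S j > 0}" for S
  have em: "(\<lambda>X. X (k,j)) \<in> borel_measurable \<mu>" if "j \<in> {1..r}" for j
    unfolding measurable_mu by (rule entry_measurable[OF k that])
  have Em: "E S \<in> sets \<mu>" for S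
    unfolding E_def
  proof (rule sets.sets_Collect_finite_All)
    fix j assume "j \<in> {1..r}"
    note em[OF this, measurable]
    show "{X\<in>space \<mu>. X (k,j) * sg S j > 0} \<in> sets \<mu>" by measurable
  qed auto
  have Rm: "?R \<in> sets \<mu>" using Em[of "{}"] by (simp add: E_def sg_def)
  have ER: "prob (E S) = prob ?R" for S
  proof -
    define Q where "Q = (\<lambda>(i::nat,j). if i = j then sg S j else 0)"
    have "orthogonal_mat r Q" unfolding orthogonal_mat_def
    proof (intro ballI)
      fix i j assume ij: "i \<in> {1..r}" "j \<in> {1..r}"
      have "inner_N r (mat_col Q i) (mat_col Q j) = (\<Sum>l=1..r. if l = i then (if i = j then sg S i * sg S i else 0) else 0)"
        unfolding inner_N_def mat_col_def Q_def by (intro sum.cong) auto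
      also have "\<dots> = (if i = j then 1 else 0)" using ij by (simp add: sg_def)
      finally show "inner_N r (mat_col Q i) (mat_col Q j) = (if i = j then 1 else 0)" .
    qed
    from right_invariant[OF this]
    have "prob ?R = measure (distr \<mu> (mat_borel N r) (\<lambda>X. mat_mult N r r X Q)) ?R" by simp
    also have "\<dots> = prob ((\<lambda>X. mat_mult N r r X Q) -` ?R \<inter> space \<mu>)"
      using Rm mat_mult_measurable_right[of N r Q] by (intro measure_distr) (auto simp: measurable_mu sets_mu)
    also have "(\<lambda>X. mat_mult N r r X Q) -` ?R \<inter> space \<mu> = E S"
    proof -
      have "mat_mult N r r X Q (k,j) = X (k,j) * sg S j" if "j \<in> {1..r}" for X j
      proof -
        have "mat_mult N r r X Q (k,j) = (\<Sum>l=1..r. X (k,l) * (if l = j then sg S j else 0))"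
          using that k unfolding mat_mult_def mat_idx_def Q_def by simp
        thus ?thesis using that by (simp add: if_distrib[of "\<lambda>x. _ * x"] cong: if_cong)
      qed
      moreover have "mat_mult N r r X Q \<in> space \<mu>" if "X \<in> space \<mu>" for X
        using measurable_space[OF mat_mult_measurable_right[of N r Q]] that sets_eq_imp_space_eq[OF sets_mu] by auto
      ultimately show ?thesis unfolding E_def by auto
    qed
    finally show ?thesis by simp
  qed
  let ?Z = "\<lambda>j. {X\<in>space \<mu>. X (k,j) = 0}"
  have Zm: "?Z j \<in> sets \<mu>" if "j \<in> {1..r}" for j using em[OF that] by measurable
  have Z0: "prob (?Z j) = 0" if j: "j \<in> {1..r}" for j
  proof -
    have u: "inner_N N (unit_vec k) (unit_vec k) = 1" unfolding inner_unit_vec[OF k] by (simp add: unit_vec_def)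
    have "(\<Sum>i=1..r. (unit_vec j i)\<^sup>2) = 1" using sum_unit_vec[OF j, of "unit_vec j"] by (simp add: power2_eq_square unit_vec_def)
    from small_ball[OF u this order_refl]
    have "prob {X\<in>space \<mu>. \<bar>inner_N N (unit_vec k) (col_comb (unit_vec j) X)\<bar> \<le> 0} \<le> 0" by simp
    moreover have "inner_N N (unit_vec k) (col_comb (unit_vec j) X) = X (k,j)" for X
      unfolding inner_unit_vec[OF k] col_comb_def by (rule sum_unit_vec[OF j])
    ultimately have "prob (?Z j) \<le> 0" by simp
    thus ?thesis using measure_nonneg[of \<mu> "?Z j"] by linarith
  qed
  have "space \<mu> \<subseteq> (\<Union>S\<in>Pow {1..r}. E S) \<union> (\<Union>j\<in>{1..r}. ?Z j)"
  proof
    fix X assume X: "X \<in> space \<mu>"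
    show "X \<in> (\<Union>S\<in>Pow {1..r}. E S) \<union> (\<Union>j\<in>{1..r}. ?Z j)"
    proof (cases "\<exists>j\<in>{1..r}. X (k,j) = 0")
      case False
      hence "X \<in> E {j\<in>{1..r}. X (k,j) < 0}" using X by (auto simp: E_def sg_def not_less less_le)
      hence "X \<in> (\<Union>S\<in>Pow {1..r}. E S)" by (rule UN_I[rotated]) auto
      thus ?thesis by (rule UnI1)
    qed (use X in auto)
  qed
  hence "prob (space \<mu>) \<le> prob ((\<Union>S\<in>Pow {1..r}. E S) \<union> (\<Union>j\<in>{1..r}. ?Z j))"
    using Em Zm by (intro finite_measure_mono sets.Un sets.finite_UN) auto
  also have "\<dots> \<le> prob (\<Union>S\<in>Pow {1..r}. E S) + prob (\<Union>j\<in>{1..r}. ?Z j)"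
    using Em Zm by (intro measure_Un_le sets.finite_UN) auto
  also have "\<dots> \<le> (\<Sum>S\<in>Pow {1..r}. prob (E S)) + (\<Sum>j\<in>{1..r}. prob (?Z j))"
    using Em Zm by (intro add_mono finite_measure_subadditive_finite) auto
  also have "\<dots> = 2 ^ r * prob ?R" using Z0 by (simp add: ER card_Pow)
  finally show ?thesis by (simp add: prob_space)
qed

end

section \<open>Frames with positive coordinates\<close>

lemma card_coincide:
  assumes ij: "i \<in> {1..r}" "j \<in> {1..r}" "i \<noteq> j"
  shows "card {m \<in> {1..r} \<rightarrow>\<^sub>E {1..N}. m i = m j} \<le> N ^ (r - 1)"
proof -
  let ?S = "{m \<in> {1..r} \<rightarrow>\<^sub>E {1..N}. m i = m j}" and ?f = "\<lambda>m::nat\<Rightarrow>nat. restrict m ({1..r} - {j})"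
  have "inj_on ?f ?S"
  proof (rule inj_onI)
    fix m m' assume m: "m \<in> ?S" "m' \<in> ?S" and eq: "?f m = ?f m'"
    have "m k = m' k" if k: "k \<in> {1..r} - {j}" for k using fun_cong[OF eq, of k] k by simp
    moreover from this have "m j = m' j" using m ij by auto
    ultimately show "m = m'" using m by (intro PiE_ext[of m "{1..r}" "\<lambda>_. {1..N}" m']) auto
  qed
  moreover have "?f ` ?S \<subseteq> ({1..r} - {j}) \<rightarrow>\<^sub>E {1..N}"
  proof (intro image_subsetI)
    fix m assume "m \<in> ?S"
    hence "m \<in> ({1..r} - {j}) \<rightarrow> {1..N}" by (auto simp: PiE_def Pi_def)
    thus "?f m \<in> ({1..r} - {j}) \<rightarrow>\<^sub>E {1..N}" by (simp only: restrict_PiE)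
  qed
  ultimately have "card ?S \<le> card (({1..r} - {j}) \<rightarrow>\<^sub>E {1..N})" by (intro card_inj_on_le) (auto intro!: finite_PiE)
  also have "\<dots> = N ^ (r - 1)" using ij by (simp add: card_PiE)
  finally show ?thesis .
qed

lemma card_not_inj:
  "card {m \<in> {1..r} \<rightarrow>\<^sub>E {1..N}. \<not> inj_on m {1..r}} \<le> r ^ 2 * N ^ (r - 1)"
proof -
  let ?P = "{(i,j) \<in> {1..r} \<times> {1..r}. i \<noteq> j}" and ?S = "\<lambda>(i,j). {m \<in> {1..r} \<rightarrow>\<^sub>E {1..N}. m i = m j}"
  have fin: "finite ?P" by (rule finite_subset[of _ "{1..r} \<times> {1..r}"]) auto
  have "{m \<in> {1..r} \<rightarrow>\<^sub>E {1..N}. \<not> inj_on m {1..r}} \<subseteq> (\<Union>x\<in>?P. ?S x)"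
  proof
    fix m assume m: "m \<in> {m \<in> {1..r} \<rightarrow>\<^sub>E {1..N}. \<not> inj_on m {1..r}}"
    then obtain i j where "i \<in> {1..r}" "j \<in> {1..r}" "m i = m j" "i \<noteq> j" unfolding inj_on_def by blast
    thus "m \<in> (\<Union>x\<in>?P. ?S x)" using m by (intro UN_I[of "(i,j)"]) auto
  qed
  moreover have finS: "finite (?S x)" for x by (cases x) (auto intro!: finite_PiE)
  ultimately have "card {m \<in> {1..r} \<rightarrow>\<^sub>E {1..N}. \<not> inj_on m {1..r}} \<le> card (\<Union>x\<in>?P. ?S x)"
    using fin by (intro card_mono finite_UN_I) auto
  also have "\<dots> \<le> (\<Sum>x\<in>?P. card (?S x))" by (rule card_UN_le[OF fin])
  also have "\<dots> \<le> (\<Sum>x\<in>?P. N ^ (r - 1))" 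
  proof (intro sum_mono)
    fix x assume "x \<in> ?P"
    then obtain i j where "x = (i,j)" "i \<in> {1..r}" "j \<in> {1..r}" "i \<noteq> j" by auto
    thus "card (?S x) \<le> N ^ (r - 1)" using card_coincide[of i r j N] by simp
  qed
  also have "\<dots> = card ?P * N ^ (r - 1)" by simp
  also have "\<dots> \<le> card ({1..r} \<times> {1..r}) * N ^ (r - 1)" by (intro mult_right_mono card_mono) auto
  finally show ?thesis by (simp add: power2_eq_square)
qed

context uniform_frame
begin

definition frame_positive :: "(nat \<Rightarrow> nat \<Rightarrow> real) \<Rightarrow> rmat set" where
  "frame_positive U = {X\<in>space \<mu>. \<forall>i\<in>{1..r}. \<forall>j\<in>{1..r}. inner_N N (U i) (mat_col X j) > 0}"

lemma prob_frame_positive_eq: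
  assumes "orthonormal N r U" "orthonormal N r V"
  shows "prob (frame_positive U) = prob (frame_positive V)"
proof -
  let ?B = "{Y\<in>space (mat_borel r r). \<forall>i\<in>{1..r}. \<forall>j\<in>{1..r}. Y (i,j) > 0}"
  have B: "?B \<in> sets (mat_borel r r)"
  proof (intro sets.sets_Collect_finite_All finite_atLeastAtMost)
    fix i j assume "i \<in> {1..r}" "j \<in> {1..r}"
    note entry_measurable[OF this, measurable]
    show "{Y\<in>space (mat_borel r r). Y (i,j) > 0} \<in> sets (mat_borel r r)" by measurable
  qed
  have eq: "{X\<in>space \<mu>. frame_coords N r r U X \<in> ?B} = frame_positive U" for U
    using measurable_space[OF frame_coords_measurable[of N r r U]] sets_eq_imp_space_eq[OF sets_mu]
    by (auto simp: frame_coords_def mat_idx_def frame_positive_def)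
  show ?thesis using prob_frame_eq[OF assms B] unfolding eq .
qed

text \<open>By rotation invariance the signals may be replaced by the coordinate vectors of any \<open>r\<close> distinct
  rows. Let \<open>h\<close> be the fraction of rows of \<open>X\<close> that are entirely positive; its expectation
  is at least \<open>c = 2^(-r)\<close>. Now \<open>h^r\<close> is the fraction of \<open>r\<close>-tuples of rows
  that are all positive, so its expectation is the wanted probability up to the tuples with a repetition, which are a
  fraction of at most \<open>r\<^sup>2/N\<close>. On the other hand this expectation is at least \<open>c^r\<close>,
  by convexity in the form of Bernoulli's inequality.\<close>

lemma frame_positive_prob:
  assumes U: "orthonormal N r U"
  shows "prob (frame_positive U) \<ge> (1 / 2 ^ r) ^ r - real r ^ 2 / real N"
proof -
  have N1: "N \<ge> 1" using r1 rN by simp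
  let ?R = "\<lambda>k. {X\<in>space \<mu>. \<forall>j\<in>{1..r}. X (k,j) > 0}"
  have Rm: "?R k \<in> sets \<mu>" if k: "k \<in> {1..N}" for k
  proof (intro sets.sets_Collect_finite_All finite_atLeastAtMost)
    fix j assume j: "j \<in> {1..r}"
    have [measurable]: "(\<lambda>X. X (k,j)) \<in> borel_measurable \<mu>" unfolding measurable_mu by (rule entry_measurable[OF k j])
    show "{X\<in>space \<mu>. X (k,j) > 0} \<in> sets \<mu>" by measurable
  qed
  define c :: real where "c = 1 / 2 ^ r"
  have c: "0 < c" by (simp add: c_def)
  have row: "c \<le> prob (?R k)" if "k \<in> {1..N}" for k using row_positive[OF that] by (simp add: c_def field_simps)
  define h :: "rmat \<Rightarrow> real" where "h X = (\<Sum>k=1..N. indicator (?R k) X) / real N" for X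
  have int_ind: "integrable \<mu> (indicator E :: rmat \<Rightarrow> real)" if "E \<in> sets \<mu>" for E
    by (rule integrable_real_indicator) (use that in \<open>auto simp: emeasure_eq_measure\<close>)
  have hi: "integrable \<mu> h" unfolding h_def
    by (intro integrable_divide Bochner_Integration.integrable_sum int_ind Rm) simp_all
  have Eh: "c \<le> expectation h"
  proof -
    have "expectation h = (\<Sum>k=1..N. prob (?R k)) / real N"
      unfolding h_def using int_ind Rm by (simp add: Bochner_Integration.integral_sum)
    moreover have "(\<Sum>k=1..N. c) \<le> (\<Sum>k=1..N. prob (?R k))" by (intro sum_mono row)
    ultimately show ?thesis using N1 by (simp add: pos_le_divide_eq mult.commute)
  qed
  define E where "E m = {X\<in>space \<mu>. \<forall>i\<in>{1..r}. X \<in> ?R (m i)}" for m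
  have Em: "E m \<in> sets \<mu>" if "m \<in> {1..r} \<rightarrow>\<^sub>E {1..N}" for m
    unfolding E_def
  proof (intro sets.sets_Collect_finite_All finite_atLeastAtMost)
    fix i assume "i \<in> {1..r}"
    hence "?R (m i) \<in> sets \<mu>" using that by (intro Rm) auto
    moreover have "{X\<in>space \<mu>. X \<in> ?R (m i)} = ?R (m i)" by auto
    ultimately show "{X\<in>space \<mu>. X \<in> ?R (m i)} \<in> sets \<mu>" by simp
  qed
  have hr: "h X ^ r = (\<Sum>m\<in>{1..r} \<rightarrow>\<^sub>E {1..N}. indicator (E m) X) / real N ^ r" if X: "X \<in> space \<mu>" for X
  proof -
    have "(\<Sum>k=1..N. indicator (?R k) X :: real) ^ r = (\<Prod>i=1..r. \<Sum>k=1..N. indicator (?R k) X)" by simp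
    also have "\<dots> = (\<Sum>m\<in>{1..r} \<rightarrow>\<^sub>E {1..N}. \<Prod>i=1..r. indicator (?R (m i)) X)" by (subst prod_sum_PiE) auto
    also have "\<dots> = (\<Sum>m\<in>{1..r} \<rightarrow>\<^sub>E {1..N}. indicator (E m) X)"
    proof (intro sum.cong refl)
      fix m
      show "(\<Prod>i=1..r. indicator (?R (m i)) X) = (indicator (E m) X :: real)"
      proof (cases "X \<in> E m")
        case True
        hence "(\<Prod>i=1..r. indicator (?R (m i)) X :: real) = (\<Prod>i=1..r. 1)" by (intro prod.cong) (auto simp: E_def)
        thus ?thesis using True by simp
      next
        case False
        then obtain i where i: "i \<in> {1..r}" "X \<notin> ?R (m i)" using X unfolding E_def by blast
        have "indicator (?R (m i)) X = (0::real)" by (rule indicator_simps(2)[OF i(2)])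
        hence "(\<Prod>i=1..r. indicator (?R (m i)) X :: real) = 0"
          by (intro prod_zero bexI[OF _ i(1)]) simp_all
        thus ?thesis using False by simp
      qed
    qed
    finally show ?thesis by (simp add: h_def power_divide)
  qed
  have "(c ^ r) * (1 + real r * (expectation h / c - 1)) \<le> expectation (\<lambda>X. (\<Sum>m\<in>{1..r} \<rightarrow>\<^sub>E {1..N}. indicator (E m) X) / real N ^ r)"
  proof -
    have "(c ^ r) * (1 + real r * (expectation h / c - 1)) = expectation (\<lambda>X. (c ^ r) * (1 + real r * (h X / c - 1)))"
      using hi by (simp add: prob_space)
    also have "\<dots> \<le> expectation (\<lambda>X. (\<Sum>m\<in>{1..r} \<rightarrow>\<^sub>E {1..N}. indicator (E m) X) / real N ^ r)"
    proof (rule integral_mono)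
      show "integrable \<mu> (\<lambda>X. (c ^ r) * (1 + real r * (h X / c - 1)))" using hi by simp
      show "integrable \<mu> (\<lambda>X. (\<Sum>m\<in>{1..r} \<rightarrow>\<^sub>E {1..N}. indicator (E m) X :: real) / real N ^ r)"
        by (intro integrable_divide Bochner_Integration.integrable_sum int_ind Em)
      fix X assume X: "X \<in> space \<mu>"
      have h0: "0 \<le> h X" unfolding h_def by (intro divide_nonneg_nonneg sum_nonneg) auto
      \<comment> \<open>The tangent of \<open>h^r\<close> at \<open>h = c\<close> lies below the graph.\<close>
      have "1 + real r * (h X / c - 1) \<le> (1 + (h X / c - 1)) ^ r"
        using h0 c by (intro Bernoulli_inequality) auto
      hence "c ^ r * (1 + real r * (h X / c - 1)) \<le> c ^ r * (h X / c) ^ r" using c by (intro mult_left_mono) auto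
      also have "\<dots> = h X ^ r" using c by (simp add: power_divide)
      finally show "c ^ r * (1 + real r * (h X / c - 1)) \<le> (\<Sum>m\<in>{1..r} \<rightarrow>\<^sub>E {1..N}. indicator (E m) X) / real N ^ r"
        unfolding hr[OF X] .
    qed
    finally show ?thesis .
  qed
  also have "\<dots> = (\<Sum>m\<in>{1..r} \<rightarrow>\<^sub>E {1..N}. prob (E m)) / real N ^ r"
    using int_ind[OF Em] Em by (simp add: Bochner_Integration.integral_sum)
  also have "(\<Sum>m\<in>{1..r} \<rightarrow>\<^sub>E {1..N}. prob (E m)) \<le> (\<Sum>m\<in>{1..r} \<rightarrow>\<^sub>E {1..N}. prob (frame_positive U) + (if inj_on m {1..r} then 0 else 1))"
  proof (intro sum_mono)
    fix m assume m: "m \<in> {1..r} \<rightarrow>\<^sub>E {1..N}"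
    show "prob (E m) \<le> prob (frame_positive U) + (if inj_on m {1..r} then 0 else 1)"
    proof (cases "inj_on m {1..r}")
      case True
      have mi: "m i \<in> {1..N}" if "i \<in> {1..r}" for i using m that by auto
      have "orthonormal N r (\<lambda>i. unit_vec (m i))" unfolding orthonormal_def
      proof (intro ballI)
        fix i j assume ij: "i \<in> {1..r}" "j \<in> {1..r}"
        show "inner_N N (unit_vec (m i)) (unit_vec (m j)) = (if i = j then 1 else 0)"
          unfolding inner_unit_vec[OF mi[OF ij(1)]] unfolding unit_vec_def inj_on_eq_iff[OF True ij] ..
      qed
      hence eq: "prob (frame_positive U) = prob (frame_positive (\<lambda>i. unit_vec (m i)))"
        by (rule prob_frame_positive_eq[OF U])
      have "inner_N N (unit_vec (m i)) (mat_col X j) = X (m i, j)" if "i \<in> {1..r}" for i j X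
        by (simp only: inner_unit_vec[OF mi[OF that]] mat_col_def)
      hence "E m = frame_positive (\<lambda>i. unit_vec (m i))" unfolding E_def frame_positive_def by auto
      thus ?thesis unfolding eq using True by simp
    qed (simp add: add_increasing)
  qed
  also have "\<dots> = real (card ({1..r} \<rightarrow>\<^sub>E {1..N})) * prob (frame_positive U) + real (card {m \<in> {1..r} \<rightarrow>\<^sub>E {1..N}. \<not> inj_on m {1..r}})"
  proof -
    have fin: "finite ({1..r} \<rightarrow>\<^sub>E {1..N})" by (intro finite_PiE) auto
    have "(\<Sum>m\<in>{1..r} \<rightarrow>\<^sub>E {1..N}. (if inj_on m {1..r} then 0 else 1 :: real)) = (\<Sum>m\<in>{m \<in> {1..r} \<rightarrow>\<^sub>E {1..N}. \<not> inj_on m {1..r}}. 1)"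
      by (rule sum.mono_neutral_cong_right) (use fin in auto)
    thus ?thesis by (simp add: sum.distrib)
  qed
  also have "\<dots> \<le> real N ^ r * prob (frame_positive U) + real (r ^ 2 * N ^ (r - 1))"
    using card_not_inj[of r N] by (intro add_mono of_nat_mono) (auto simp: card_PiE)
  finally have "(c ^ r) * (1 + real r * (expectation h / c - 1)) \<le> (real N ^ r * prob (frame_positive U) + real (r ^ 2 * N ^ (r - 1))) / real N ^ r"
    by (simp add: divide_right_mono)
  also have "\<dots> = prob (frame_positive U) + real r ^ 2 / real N"
  proof -
    have "real N ^ r = real N * real N ^ (r - 1)" using r1 by (simp add: power_eq_if)
    thus ?thesis using N1 by (simp add: add_divide_distrib)
  qed
  finally have "(c ^ r) * (1 + real r * (expectation h / c - 1)) \<le> prob (frame_positive U) + real r ^ 2 / real N" .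
  moreover have "c ^ r * 1 \<le> (c ^ r) * (1 + real r * (expectation h / c - 1))"
    using Eh c by (intro mult_left_mono) auto
  ultimately have "c ^ r \<le> prob (frame_positive U) + real r ^ 2 / real N" by linarith
  thus ?thesis by (simp add: c_def)
qed

section \<open>Genericity of the initial correlations\<close>

lemma gap_small_ball:
  assumes u: "inner_N N u u = 1" and ab: "a \<ge> a0" "b > 0" "a0 > 0" and \<delta>: "\<delta> \<ge> 0"
  shows "(\<Sum>j=1..r. (c j)\<^sup>2) = a\<^sup>2 + b\<^sup>2 \<Longrightarrow>
     prob {X\<in>space \<mu>. \<bar>inner_N N u (col_comb c X)\<bar> \<le> \<delta>} \<le> 4 * \<delta> / a0"
proof -
  assume c: "(\<Sum>j=1..r. (c j)\<^sup>2) = a\<^sup>2 + b\<^sup>2"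
  define k where "k = sqrt (a\<^sup>2 + b\<^sup>2)"
  have k: "a0 \<le> k" "0 < k" "k\<^sup>2 = a\<^sup>2 + b\<^sup>2"
  proof -
    have "a \<le> k" unfolding k_def by (rule real_le_rsqrt) simp
    thus "a0 \<le> k" "0 < k" using ab by auto
    show "k\<^sup>2 = a\<^sup>2 + b\<^sup>2" unfolding k_def by simp
  qed
  have "(\<Sum>j=1..r. (c j / k)\<^sup>2) = (\<Sum>j=1..r. (c j)\<^sup>2) / k\<^sup>2" by (simp add: power_divide sum_divide_distrib)
  hence c1: "(\<Sum>j=1..r. (c j / k)\<^sup>2) = 1" unfolding c k(3)[symmetric] using k(2) by simp
  have "inner_N N u (col_comb (\<lambda>j. c j / k) X) = inner_N N u (col_comb c X) / k" for X
    unfolding inner_col_comb[symmetric] by (simp add: sum_divide_distrib)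
  hence "{X\<in>space \<mu>. \<bar>inner_N N u (col_comb c X)\<bar> \<le> \<delta>} = {X\<in>space \<mu>. \<bar>inner_N N u (col_comb (\<lambda>j. c j / k) X)\<bar> \<le> \<delta> / k}"
    using k(2) by (auto simp: abs_divide divide_le_cancel)
  hence "prob {X\<in>space \<mu>. \<bar>inner_N N u (col_comb c X)\<bar> \<le> \<delta>} \<le> 4 * (\<delta> / k)"
    using small_ball[OF u c1, of "\<delta> / k"] \<delta> k(2) by simp
  also have "\<dots> \<le> 4 * \<delta> / a0" using k ab \<delta> by (simp add: frac_le)
  finally show ?thesis .
qed

text \<open>A union bound over \<open>2 r\<^sup>2 + 2 r\<^sup>3\<close> events. A weighted difference within a row
  \<open>i\<close> is the coordinate in the direction \<open>U i\<close> of a combination of two columns. A weighted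
  difference within a column is the coordinate of one column in a direction of the plane of two of the \<open>U
  i\<close>. In both cases the vector has to be normalized, which the lower bound \<open>w0\<close> on the weights
  makes harmless.\<close>

lemma generic_entries:
  assumes U: "orthonormal N r U" and w: "\<And>i j. i \<in> {1..r} \<Longrightarrow> j \<in> {1..r} \<Longrightarrow> w i j \<ge> w0" and w0: "w0 > 0"
    and \<delta>: "\<delta> > 0" and L: "L > 0"
  defines "y \<equiv> \<lambda>X i j. inner_N N (U i) (mat_col X j)"
  obtains E where "E \<in> sets \<mu>" "prob E \<le> 4 * \<delta> * (real r ^ 2 + 2 * real r ^ 3 / w0) + real r ^ 2 / L\<^sup>2"
    "\<forall>X\<in>space \<mu> - E. \<forall>i\<in>{1..r}. \<forall>j\<in>{1..r}. \<delta> < \<bar>y X i j\<bar> \<and> \<bar>y X i j\<bar> \<le> L"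
    "\<forall>X\<in>space \<mu> - E. \<forall>i\<in>{1..r}. \<forall>j\<in>{1..r}. \<forall>l\<in>{1..r} - {j}.
       \<delta> < \<bar>w i j * y X i j - w i l * y X i l\<bar> \<and> \<delta> < \<bar>w j i * y X j i - w l i * y X l i\<bar>"
proof -
  let ?I = "{1..r}" and ?I2 = "{1..r} \<times> {1..r}" and ?I3 = "{1..r} \<times> {1..r} \<times> {1..r}"
  have ym: "(\<lambda>X. y X i j) \<in> borel_measurable \<mu>" if "j \<in> ?I" for i j
    unfolding y_def by (rule inner_measurable[OF that])
  have w': "w i j > 0" if "i \<in> ?I" "j \<in> ?I" for i j using w[OF that] w0 by linarith
  have u1: "inner_N N (U i) (U i) = 1" if "i \<in> ?I" for i using U that by (auto simp: orthonormal_def)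
  have y_comb: "y X i j = inner_N N (U i) (col_comb (unit_vec j) X)" if "j \<in> ?I" for X i j
    unfolding y_def inner_col_comb[symmetric] using sum_unit_vec[OF that, of "\<lambda>j. inner_N N (U i) (mat_col X j)"] by simp
  define E1 where "E1 = (\<lambda>(i,j). {X\<in>space \<mu>. \<bar>y X i j\<bar> \<le> \<delta>})"
  define E2 where "E2 = (\<lambda>(i,j). {X\<in>space \<mu>. \<bar>y X i j\<bar> > L})"
  define E3 where "E3 = (\<lambda>(i,j,l). {X\<in>space \<mu>. j \<noteq> l \<and> \<bar>w i j * y X i j - w i l * y X i l\<bar> \<le> \<delta>})"
  define E4 where "E4 = (\<lambda>(i,j,l). {X\<in>space \<mu>. j \<noteq> l \<and> \<bar>w j i * y X j i - w l i * y X l i\<bar> \<le> \<delta>})"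
  have m1: "E1 x \<in> sets \<mu>" "E2 x \<in> sets \<mu>" if x2: "x \<in> ?I2" for x
  proof -
    obtain i j where x: "x = (i,j)" "i \<in> ?I" "j \<in> ?I" using x2 by auto
    note ym[OF x(3), measurable]
    show "E1 x \<in> sets \<mu>" "E2 x \<in> sets \<mu>" unfolding E1_def E2_def x by (simp_all, measurable)
  qed
  have m3: "E3 x \<in> sets \<mu>" "E4 x \<in> sets \<mu>" if x3: "x \<in> ?I3" for x
  proof -
    obtain i j l where x: "x = (i,j,l)" "i \<in> ?I" "j \<in> ?I" "l \<in> ?I" using x3 by auto
    note ym[OF x(2), measurable] ym[OF x(3), measurable] ym[OF x(4), measurable]
    show "E3 x \<in> sets \<mu>" "E4 x \<in> sets \<mu>" unfolding E3_def E4_def x by (simp_all, measurable)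
  qed
  have p1: "prob (E1 x) \<le> 4 * \<delta>" if x2: "x \<in> ?I2" for x
  proof -
    obtain i j where x: "x = (i,j)" "i \<in> ?I" "j \<in> ?I" using x2 by auto
    have "(\<Sum>i=1..r. (unit_vec j i)\<^sup>2) = 1" using sum_unit_vec[OF x(3), of "unit_vec j"] by (simp add: power2_eq_square unit_vec_def)
    from small_ball[OF u1[OF x(2)] this, of \<delta>] show ?thesis using \<delta> by (simp add: E1_def x y_comb[OF x(3)])
  qed
  have p2: "prob (E2 x) \<le> 1 / L\<^sup>2" if x2: "x \<in> ?I2" for x
  proof -
    obtain i j where x: "x = (i,j)" "i \<in> ?I" "j \<in> ?I" using x2 by auto
    show ?thesis using entry_tail[OF u1[OF x(2)] x(3) L] by (simp add: E2_def x y_def)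
  qed
  have p3: "prob (E3 x) \<le> 4 * \<delta> / w0" if x3: "x \<in> ?I3" for x
  proof -
    obtain i j l where x: "x = (i,j,l)" "i \<in> ?I" "j \<in> ?I" "l \<in> ?I" using x3 by auto
    show ?thesis
    proof (cases "j = l")
      case False
      define c where "c = (\<lambda>t. unit_vec j t * w i j - unit_vec l t * w i l)"
      have "(\<Sum>t=1..r. (c t)\<^sup>2) = (\<Sum>t=1..r. unit_vec j t * (w i j)\<^sup>2 + unit_vec l t * (w i l)\<^sup>2)"
        unfolding c_def using False by (intro sum.cong) (auto simp: unit_vec_def power2_eq_square)
      also have "\<dots> = (w i j)\<^sup>2 + (w i l)\<^sup>2" using x by (simp only: sum.distrib sum_unit_vec)
      finally have c2: "(\<Sum>t=1..r. (c t)\<^sup>2) = (w i j)\<^sup>2 + (w i l)\<^sup>2" .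
      have "inner_N N (U i) (col_comb c X) = w i j * y X i j - w i l * y X i l" for X
      proof -
        have "inner_N N (U i) (col_comb c X) = (\<Sum>t=1..r. unit_vec j t * (w i j * inner_N N (U i) (mat_col X t)))
            - (\<Sum>t=1..r. unit_vec l t * (w i l * inner_N N (U i) (mat_col X t)))"
          unfolding inner_col_comb[symmetric] c_def by (simp add: algebra_simps sum_subtractf)
        thus ?thesis using x by (simp only: sum_unit_vec y_def)
      qed
      thus ?thesis using gap_small_ball[OF u1[OF x(2)] w[OF x(2,3)] w'[OF x(2,4)] w0 _ c2, of \<delta>] \<delta> False
        by (simp add: E3_def x)
    qed (use w0 \<delta> in \<open>simp add: E3_def x\<close>)
  qed
  have p4: "prob (E4 x) \<le> 4 * \<delta> / w0" if x3: "x \<in> ?I3" for x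
  proof -
    obtain i j l where x: "x = (i,j,l)" "i \<in> ?I" "j \<in> ?I" "l \<in> ?I" using x3 by auto
    show ?thesis
    proof (cases "j = l")
      case False
      define k where "k = sqrt ((w j i)\<^sup>2 + (w l i)\<^sup>2)"
      have k: "w0 \<le> k" "0 < k" "k * k = (w j i)\<^sup>2 + (w l i)\<^sup>2"
      proof -
        have "w j i \<le> k" unfolding k_def by (rule real_le_rsqrt) simp
        thus "w0 \<le> k" "0 < k" using w[OF x(3,2)] w0 by auto
        show "k * k = (w j i)\<^sup>2 + (w l i)\<^sup>2" unfolding k_def by simp
      qed
      define u where "u = (\<lambda>t. (w j i * U j t - w l i * U l t) / k)"
      have U0: "inner_N N (U j) (U l) = 0" "inner_N N (U l) (U j) = 0" using U x False by (auto simp: orthonormal_def)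
      have inner_u: "inner_N N u z = (w j i * inner_N N (U j) z - w l i * inner_N N (U l) z) / k" for z
      proof -
        have "inner_N N u z = (\<Sum>t=1..N. (w j i * (U j t * z t) - w l i * (U l t * z t)) / k)"
          unfolding inner_N_def u_def by (intro sum.cong refl) (simp add: left_diff_distrib mult.assoc)
        thus ?thesis unfolding inner_N_def by (simp only: sum_divide_distrib[symmetric] sum_subtractf sum_distrib_left)
      qed
      have "inner_N N u u = (w j i * (w j i / k) + w l i * (w l i / k)) / k"
      proof -
        have "inner_N N (U j) u = w j i / k" "inner_N N (U l) u = - w l i / k"
          unfolding inner_N_commute[of N _ u] inner_u using u1 x U0 by simp_all
        thus ?thesis unfolding inner_u[of u] by simp
      qed
      also have "\<dots> = ((w j i)\<^sup>2 + (w l i)\<^sup>2) / (k * k)" by (simp add: power2_eq_square add_divide_distrib)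
      also have "\<dots> = 1" unfolding k(3)[symmetric] using k(2) by simp
      finally have uu: "inner_N N u u = 1" .
      have "(\<Sum>t=1..r. (unit_vec i t)\<^sup>2) = 1" using sum_unit_vec[OF x(2), of "unit_vec i"] by (simp add: power2_eq_square unit_vec_def)
      from small_ball[OF uu this, of "\<delta> / k"] have "prob {X\<in>space \<mu>. \<bar>inner_N N u (col_comb (unit_vec i) X)\<bar> \<le> \<delta> / k} \<le> 4 * (\<delta> / k)"
        using \<delta> k by simp
      moreover have "inner_N N u (col_comb (unit_vec i) X) = (w j i * y X j i - w l i * y X l i) / k" for X
        unfolding inner_u y_comb[OF x(2)] ..
      ultimately have "prob (E4 x) \<le> 4 * (\<delta> / k)" using k(2) False by (simp add: E4_def x abs_divide divide_le_cancel)
      also have "\<dots> \<le> 4 * \<delta> / w0" using k w0 \<delta> by (simp add: frac_le)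
      finally show ?thesis .
    qed (use w0 \<delta> in \<open>simp add: E4_def x\<close>)
  qed
  define E where "E = (\<Union>x\<in>?I2. E1 x) \<union> (\<Union>x\<in>?I2. E2 x) \<union> ((\<Union>x\<in>?I3. E3 x) \<union> (\<Union>x\<in>?I3. E4 x))"
  have uni: "prob (\<Union>x\<in>J. F x) \<le> real (card J) * b" "(\<Union>x\<in>J. F x) \<in> sets \<mu>"
    if "finite J" "\<And>x. x \<in> J \<Longrightarrow> F x \<in> sets \<mu>" "\<And>x. x \<in> J \<Longrightarrow> prob (F x) \<le> b" for J :: "'z set" and F b
  proof -
    show "(\<Union>x\<in>J. F x) \<in> sets \<mu>" using that by (intro sets.finite_UN) auto
    have "prob (\<Union>x\<in>J. F x) \<le> (\<Sum>x\<in>J. prob (F x))" using that by (intro finite_measure_subadditive_finite) auto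
    also have "\<dots> \<le> (\<Sum>x\<in>J. b)" by (intro sum_mono that)
    finally show "prob (\<Union>x\<in>J. F x) \<le> real (card J) * b" by simp
  qed
  have f2: "finite ?I2" "real (card ?I2) = real r ^ 2" by (simp_all add: power2_eq_square)
  have f3: "finite ?I3" "real (card ?I3) = real r ^ 3" by (simp_all add: power3_eq_cube)
  note b1 = uni[OF f2(1) m1(1) p1] and b2 = uni[OF f2(1) m1(2) p2] and b3 = uni[OF f3(1) m3(1) p3] and b4 = uni[OF f3(1) m3(2) p4]
  show ?thesis
  proof (rule that[of E])
    show "E \<in> sets \<mu>" unfolding E_def by (intro sets.Un b1 b2 b3 b4)
    have "prob E \<le> prob ((\<Union>x\<in>?I2. E1 x) \<union> (\<Union>x\<in>?I2. E2 x)) + prob ((\<Union>x\<in>?I3. E3 x) \<union> (\<Union>x\<in>?I3. E4 x))"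
      unfolding E_def by (intro measure_Un_le sets.Un b1(2) b2(2) b3(2) b4(2))
    also have "\<dots> \<le> (prob (\<Union>x\<in>?I2. E1 x) + prob (\<Union>x\<in>?I2. E2 x)) + (prob (\<Union>x\<in>?I3. E3 x) + prob (\<Union>x\<in>?I3. E4 x))"
      by (intro add_mono measure_Un_le b1(2) b2(2) b3(2) b4(2))
    also have "\<dots> \<le> (real r ^ 2 * (4 * \<delta>) + real r ^ 2 * (1 / L\<^sup>2)) + (real r ^ 3 * (4 * \<delta> / w0) + real r ^ 3 * (4 * \<delta> / w0))"
      using b1(1) b2(1) b3(1) b4(1) unfolding f2(2) f3(2) by (intro add_mono) auto
    also have "\<dots> = 4 * \<delta> * (real r ^ 2 + 2 * real r ^ 3 / w0) + real r ^ 2 / L\<^sup>2" by (simp add: algebra_simps add_divide_distrib)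
    finally show "prob E \<le> 4 * \<delta> * (real r ^ 2 + 2 * real r ^ 3 / w0) + real r ^ 2 / L\<^sup>2" .
    show "\<forall>X\<in>space \<mu> - E. \<forall>i\<in>?I. \<forall>j\<in>?I. \<delta> < \<bar>y X i j\<bar> \<and> \<bar>y X i j\<bar> \<le> L"
    proof (intro ballI)
      fix X i j assume X': "X \<in> space \<mu> - E" and ij: "i \<in> ?I" "j \<in> ?I"
      note X = DiffD1[OF X'] DiffD2[OF X']
      have "X \<notin> E1 (i,j)" "X \<notin> E2 (i,j)" using X(2) ij unfolding E_def by blast+
      thus "\<delta> < \<bar>y X i j\<bar> \<and> \<bar>y X i j\<bar> \<le> L" using X(1) by (auto simp: E1_def E2_def)
    qed
    show "\<forall>X\<in>space \<mu> - E. \<forall>i\<in>?I. \<forall>j\<in>?I. \<forall>l\<in>?I - {j}.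
       \<delta> < \<bar>w i j * y X i j - w i l * y X i l\<bar> \<and> \<delta> < \<bar>w j i * y X j i - w l i * y X l i\<bar>"
    proof (intro ballI)
      fix X i j l assume X': "X \<in> space \<mu> - E" and "i \<in> ?I" "j \<in> ?I" and l: "l \<in> ?I - {j}"
      note X = DiffD1[OF X'] DiffD2[OF X'] and ij = \<open>i \<in> ?I\<close> \<open>j \<in> ?I\<close> DiffD1[OF l]
      have jl: "j \<noteq> l" using l by auto
      have "X \<notin> E3 (i,j,l)" "X \<notin> E4 (i,j,l)" using X(2) ij unfolding E_def by blast+
      thus "\<delta> < \<bar>w i j * y X i j - w i l * y X i l\<bar> \<and> \<delta> < \<bar>w j i * y X j i - w l i * y X l i\<bar>"
        using X(1) jl by (auto simp: E3_def E4_def)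
    qed
  qed
qed

end

section \<open>Greedy matching of signals and columns\<close>

text \<open>Select the largest entry of the matrix \<open>s\<close>, delete its row and column, and repeat. An entry that is
  not selected disappears when its row or its column is deleted, and is at most the entry selected at that moment.\<close>

lemma greedy_matching:
  fixes s :: "nat \<Rightarrow> nat \<Rightarrow> real"
  assumes "finite B" "finite A" "card A = card B"
  shows "\<exists>f. bij_betw f B A \<and> (\<forall>i\<in>B. \<forall>j\<in>B. i \<noteq> j \<longrightarrow> s (f i) j \<le> s (f j) j \<or> s (f i) j \<le> s (f i) i)"
  using assms
proof (induction "card B" arbitrary: A B)
  case 0
  hence "A = {}" "B = {}" by auto
  thus ?case by (auto intro!: exI[of _ id])
next
  case (Suc n)
  have ne: "A \<times> B \<noteq> {}" using Suc by (auto simp: card_gt_0_iff simp flip: neq0_conv)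
  have fin: "finite (A \<times> B)" using Suc by auto
  let ?s = "\<lambda>x. s (fst x) (snd x)"
  have "Max (?s ` (A \<times> B)) \<in> ?s ` (A \<times> B)" using ne fin by (intro Max_in) auto
  then obtain a b where ab: "a \<in> A" "b \<in> B" "s a b = Max (?s ` (A \<times> B))" by auto
  have mx: "s i j \<le> s a b" if "i \<in> A" "j \<in> B" for i j
    unfolding ab(3) using fin that by (intro Max_ge image_eqI[of _ _ "(i,j)"]) auto
  obtain f where f: "bij_betw f (B - {b}) (A - {a})"
    "\<And>i j. i \<in> B - {b} \<Longrightarrow> j \<in> B - {b} \<Longrightarrow> i \<noteq> j \<Longrightarrow> s (f i) j \<le> s (f j) j \<or> s (f i) j \<le> s (f i) i"
  proof -
    have "card B = Suc n" using Suc.hyps(2) by simp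
    hence "n = card (B - {b})" "card (A - {a}) = card (B - {b})" using Suc.prems ab by simp_all
    from Suc.hyps(1)[OF this(1) _ _ this(2)] Suc.prems(1,2) that show thesis by blast
  qed
  define g where "g = f(b := a)"
  have "bij_betw g (B - {b}) (A - {a})" using f(1) by (rule bij_betw_cong[THEN iffD1, rotated]) (auto simp: g_def)
  hence "bij_betw g (insert b (B - {b})) (insert a (A - {a}))"
    using notIn_Un_bij_betw[of b "B - {b}" g "A - {a}"] by (simp add: g_def)
  hence g: "bij_betw g B A" using ab by (simp add: insert_absorb)
  moreover have "s (g i) j \<le> s (g j) j \<or> s (g i) j \<le> s (g i) i" if ij: "i \<in> B" "j \<in> B" "i \<noteq> j" for i j
  proof -
    have gi: "g i \<in> A" using g ij by (auto simp: bij_betw_def)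
    consider "i = b" | "j = b" | "i \<noteq> b" "j \<noteq> b" by blast
    thus ?thesis
    proof cases
      case 1 thus ?thesis using mx[OF ab(1) ij(2)] by (simp add: g_def)
    next
      case 2 thus ?thesis using mx[OF gi ij(2)] by (simp add: g_def)
    next
      case 3 thus ?thesis using f(2)[of i j] ij by (auto simp: g_def)
    qed
  qed
  ultimately show ?case by blast
qed

text \<open>The matching depends only on the order of the entries, that is on one of finitely many patterns. Defining it as
  a function of the pattern makes it measurable.\<close>

definition comparison_pattern :: "nat \<Rightarrow> (nat \<Rightarrow> nat \<Rightarrow> real) \<Rightarrow> (nat \<times> nat \<times> nat \<times> nat) set" where
  "comparison_pattern r s = {(i,j,k,l) \<in> {1..r} \<times> {1..r} \<times> {1..r} \<times> {1..r}. s i j \<le> s k l}"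

definition stable_match :: "nat \<Rightarrow> (nat \<times> nat \<times> nat \<times> nat) set \<Rightarrow> (nat \<Rightarrow> nat) \<Rightarrow> bool" where
  "stable_match r C \<sigma> \<longleftrightarrow> \<sigma> permutes {1..r} \<and> (\<forall>i\<in>{1..r}. \<forall>j\<in>{1..r}. i \<noteq> j \<longrightarrow>
     (\<sigma> i, j, \<sigma> j, j) \<in> C \<or> (\<sigma> i, j, \<sigma> i, i) \<in> C)"

text \<open>The default value makes this a permutation also for relations that are not the pattern of any matrix.\<close>

definition match_of :: "nat \<Rightarrow> (nat \<times> nat \<times> nat \<times> nat) set \<Rightarrow> nat \<Rightarrow> nat" where
  "match_of r C = (if \<exists>\<sigma>. stable_match r C \<sigma> then SOME \<sigma>. stable_match r C \<sigma> else id)"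

lemma match_of_permutes: "match_of r C permutes {1..r}"
proof (cases "\<exists>\<sigma>. stable_match r C \<sigma>")
  case True
  hence "stable_match r C (match_of r C)" unfolding match_of_def by (simp add: someI_ex)
  thus ?thesis by (simp add: stable_match_def)
qed (simp add: match_of_def permutes_id)

lemma match_of_stable:
  fixes s :: "nat \<Rightarrow> nat \<Rightarrow> real"
  assumes "i \<in> {1..r}" "j \<in> {1..r}" "i \<noteq> j"
  defines "\<sigma> \<equiv> match_of r (comparison_pattern r s)"
  shows "s (\<sigma> i) j \<le> s (\<sigma> j) j \<or> s (\<sigma> i) j \<le> s (\<sigma> i) i"
proof -
  let ?C = "comparison_pattern r s"
  obtain f where f: "bij_betw f {1..r} {1..r}"
    "\<And>i j. i \<in> {1..r} \<Longrightarrow> j \<in> {1..r} \<Longrightarrow> i \<noteq> j \<Longrightarrow> s (f i) j \<le> s (f j) j \<or> s (f i) j \<le> s (f i) i"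
    using greedy_matching[of "{1..r}" "{1..r}" s] by auto
  define g where "g = (\<lambda>i. if i \<in> {1..r} then f i else i)"
  have "bij_betw g {1..r} {1..r}" using f(1) by (rule bij_betw_cong[THEN iffD1, rotated]) (auto simp: g_def)
  hence gp: "g permutes {1..r}" by (rule bij_imp_permutes) (auto simp: g_def)
  have "stable_match r ?C g" unfolding stable_match_def
  proof (intro conjI ballI impI gp)
    fix i j assume ij: "i \<in> {1..r}" "j \<in> {1..r}" "i \<noteq> j"
    have "g i \<in> {1..r}" "g j \<in> {1..r}" using permutes_in_image[OF gp] ij by auto
    thus "(g i, j, g j, j) \<in> ?C \<or> (g i, j, g i, i) \<in> ?C"
      using f(2)[OF ij] ij by (auto simp: comparison_pattern_def g_def)
  qed
  hence "stable_match r ?C \<sigma>" unfolding \<sigma>_def match_of_def using someI[of "stable_match r ?C" g] by auto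
  hence "(\<sigma> i, j, \<sigma> j, j) \<in> ?C \<or> (\<sigma> i, j, \<sigma> i, i) \<in> ?C"
    using assms(1-3) unfolding stable_match_def by blast
  thus ?thesis by (auto simp: comparison_pattern_def)
qed

section \<open>Recovery of the matched signals from a generic start\<close>

text \<open>A gap between weighted initial values becomes a gap between blow-up times, by \<open>s'^q - s^q \<ge> \<delta>
  s^(q-1)\<close>.\<close>

lemma inverse_power_gap:
  fixes s s' \<delta> L :: real
  assumes s: "0 < s" "s + \<delta> \<le> s'" "s' \<le> L" and \<delta>: "0 < \<delta>" and q: "q \<ge> 1"
  shows "1 / s' ^ q + \<delta> / L ^ (q+1) \<le> 1 / s ^ q"
proof -
  have s': "0 < s'" "s \<le> s'" using s \<delta> by auto
  obtain n where n: "q = Suc n" using q by (cases q) auto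
  have "s ^ q + \<delta> * s ^ n = (s + \<delta>) * s ^ n" by (simp add: n algebra_simps)
  also have "\<dots> \<le> s' * s' ^ n" using s s' \<delta> by (intro mult_mono power_mono) auto
  finally have "s ^ q + \<delta> * s ^ n \<le> s' ^ q" by (simp add: n)
  hence "\<delta> * s ^ n / (s ^ q * s' ^ q) \<le> (s' ^ q - s ^ q) / (s ^ q * s' ^ q)"
    using s s' by (intro divide_right_mono) auto
  also have "\<dots> = 1 / s ^ q - 1 / s' ^ q" using s s' by (simp add: diff_divide_distrib)
  finally have 1: "\<delta> * s ^ n / (s ^ q * s' ^ q) \<le> 1 / s ^ q - 1 / s' ^ q" .
  have "\<delta> / L ^ (q+1) \<le> \<delta> / (s * s' ^ q)"
  proof (intro divide_left_mono mult_pos_pos)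
    have "s * s' ^ q \<le> L * L ^ q" using s s' by (intro mult_mono power_mono) auto
    thus "s * s' ^ q \<le> L ^ (q+1)" by simp
  qed (use s s' \<delta> in auto)
  also have "\<dots> = \<delta> * s ^ n / (s ^ q * s' ^ q)" using s s' by (simp add: n)
  finally show ?thesis using 1 by linarith
qed

text \<open>The weight is \<open>\<alpha>\<^sub>i\<^sub>j^(1/q)\<close>. The blow-up time of \<open>m' = \<alpha>
  m^(q+1)\<close> is \<open>1 / (q s^q)\<close> with \<open>s = \<alpha>^(1/q) m(0)\<close>, so ordering weighted
  correlations is ordering blow-up times.\<close>

definition entry_weight :: "nat \<Rightarrow> (nat \<Rightarrow> real) \<Rightarrow> nat \<Rightarrow> nat \<Rightarrow> real" where
  "entry_weight q lam i j = root q (real (q+2) * lam i * lam j)"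

definition signal_match :: "nat \<Rightarrow> nat \<Rightarrow> (nat \<Rightarrow> real) \<Rightarrow> nat \<Rightarrow> (nat \<Rightarrow> nat \<Rightarrow> real) \<Rightarrow> rmat \<Rightarrow> nat \<Rightarrow> nat" where
  "signal_match q r lam N v x = match_of r (comparison_pattern r (\<lambda>i j. entry_weight q lam i j * corr N v x i j))"

definition generic_start :: "nat \<Rightarrow> nat \<Rightarrow> (nat \<Rightarrow> real) \<Rightarrow> nat \<Rightarrow> (nat \<Rightarrow> nat \<Rightarrow> real) \<Rightarrow> real \<Rightarrow> real \<Rightarrow> rmat \<Rightarrow> bool" where
  "generic_start q r lam N v \<delta> L x \<longleftrightarrow> (\<forall>i\<in>{1..r}. \<forall>j\<in>{1..r}.
     \<delta> < sqrt (real N) * corr N v x i j \<and> sqrt (real N) * corr N v x i j \<le> L \<and>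
     (\<forall>l\<in>{1..r}. l \<noteq> j \<longrightarrow>
        \<delta> < sqrt (real N) * \<bar>entry_weight q lam i j * corr N v x i j - entry_weight q lam i l * corr N v x i l\<bar> \<and>
        \<delta> < sqrt (real N) * \<bar>entry_weight q lam j i * corr N v x j i - entry_weight q lam l i * corr N v x l i\<bar>))"

text \<open>Reduction to \<open>noisy_flow_escapes\<close> with \<open>b = 1/\<surd>N\<close>, after renumbering the signals
  by the matching. The noise is at most \<open>R/\<surd>M\<close>, and the growth condition on \<open>M\<close> says
  that this is below \<open>\<eta> b^(q+1)\<close> for large \<open>N\<close>. The threshold on \<open>N\<close> is
  uniform in the flow and in the noise tensor.\<close>

lemma flow_reaches_match:
  fixes q r :: nat and lam :: "nat \<Rightarrow> real" and M :: "nat \<Rightarrow> nat" and v :: "nat \<Rightarrow> nat \<Rightarrow> nat \<Rightarrow> real"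
  assumes q: "q \<ge> 1" and r: "r \<ge> 1"
    and lam: "\<And>i. i \<in> {1..r} \<Longrightarrow> l0 \<le> lam i \<and> lam i \<le> l1" and l0: "0 < l0"
    and M1: "\<And>N. M N \<ge> 1" and M: "much_less (\<lambda>N. real N ^ (q+1)) (\<lambda>N. real (M N))"
    and v: "\<And>N i j. N \<ge> r \<Longrightarrow> i \<in> {1..r} \<Longrightarrow> j \<in> {1..r} \<Longrightarrow> inner_N N (v N i) (v N j) = (if i = j then real N else 0)"
    and \<delta>: "0 < \<delta>" and L: "0 < L" and K: "0 \<le> K" and \<epsilon>: "0 < \<epsilon>"
  shows "eventually (\<lambda>N. \<forall>X W. gradient_flow N r (risk (q+2) r N (M N) lam (v N) W) X \<longrightarrow>
     inj_norm_le N (q+2) W (K * sqrt (real N)) \<longrightarrow> generic_start q r lam N (v N) \<delta> L (X 0) \<longrightarrow>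
     (\<forall>t\<ge>real (N+1) ^ (q+2). \<forall>i\<in>{1..r}. corr N (v N) (X t) (signal_match q r lam N (v N) (X 0) i) i \<ge> 1 - \<epsilon>))
     sequentially"
proof -
  let ?I = "{1..r}" and ?\<alpha> = "\<lambda>i j. real (q+2) * lam i * lam j"
  define a where "a = real (q+2) * l0 * l0"
  define A where "A = max 1 (real (q+2) * l1 * l1)"
  have l1: "0 < l1" using lam[of 1] l0 r by auto
  have a: "0 < a" unfolding a_def using l0 by simp
  have A1: "1 \<le> A" unfolding A_def by simp
  have \<alpha>: "a \<le> ?\<alpha> i j \<and> ?\<alpha> i j \<le> A" if "i \<in> ?I" "j \<in> ?I" for i j
  proof
    have "l0 * l0 \<le> lam i * lam j" using lam[OF that(1)] lam[OF that(2)] l0 by (intro mult_mono) auto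
    hence "real (q+2) * (l0 * l0) \<le> real (q+2) * (lam i * lam j)" by (intro mult_left_mono) auto
    thus "a \<le> ?\<alpha> i j" unfolding a_def by (simp only: mult.assoc)
    have "lam i * lam j \<le> l1 * l1" using lam[OF that(1)] lam[OF that(2)] l0 l1 by (intro mult_mono) auto
    hence "real (q+2) * (lam i * lam j) \<le> real (q+2) * (l1 * l1)" by (intro mult_left_mono) auto
    hence "?\<alpha> i j \<le> real (q+2) * l1 * l1" by (simp only: mult.assoc)
    thus "?\<alpha> i j \<le> A" unfolding A_def by (rule max.coboundedI2)
  qed
  define L' where "L' = root q A * L"
  have rootA: "0 < root q A" using q A1 by (intro real_root_gt_zero) auto
  have L': "0 < L'" unfolding L'_def using rootA L by simp
  \<comment> \<open>one constant for the lower bound on the entries and for the gap between blow-up times\<close>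
  define \<delta>' where "\<delta>' = min \<delta> (\<delta> / (real q * L' ^ (q+1)))"
  have \<delta>': "0 < \<delta>'" unfolding \<delta>'_def using \<delta> q L' by auto
  obtain b0 \<eta> T where c: "b0 > 0" "\<eta> > 0" "T > 0" and
    esc: "\<forall>b \<alpha> m E. 0 < b \<and> b < b0 \<and> correlation_flow q r \<alpha> a A (\<eta> * b ^ (q+1)) m E \<and>
      (\<forall>i\<in>{1..r}. \<forall>j\<in>{1..r}. \<delta>' * b \<le> m i j 0 \<and> (i \<noteq> j \<longrightarrow> (\<exists>h\<in>{i,j}.
         1 / (real q * \<alpha> h h * m h h 0 ^ q) + \<delta>' / b ^ q \<le> 1 / (real q * \<alpha> i j * m i j 0 ^ q))))
      \<longrightarrow> (\<forall>t\<ge>T / b ^ q. \<forall>i\<in>{1..r}. m i i t \<ge> 1 - \<epsilon>)"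
    by (rule noisy_flow_escapes[OF q r a A1 \<delta>' \<epsilon>])
  define R where "R = l1 * real (q+2) * K * (1 + real r)"
  have R: "0 \<le> R" unfolding R_def using l1 K by simp
  have ev1: "eventually (\<lambda>N. 1 / sqrt (real N) < b0) sequentially"
    by (rule order_tendstoD(2)[OF _ c(1)]) real_asymp
  have ev2: "eventually (\<lambda>N. R * sqrt (real N ^ (q+1) / real (M N)) < \<eta>) sequentially"
  proof (rule order_tendstoD(2)[OF _ c(2)])
    have "((\<lambda>N. R * sqrt (real N ^ (q+1) / real (M N))) \<longlongrightarrow> R * sqrt 0) sequentially"
      using M unfolding much_less_def by (intro tendsto_intros)
    thus "((\<lambda>N. R * sqrt (real N ^ (q+1) / real (M N))) \<longlongrightarrow> 0) sequentially" by simp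
  qed
  have ev3: "eventually (\<lambda>N. N \<ge> max r 1 \<and> real N \<ge> T) sequentially"
    by (intro eventually_conj eventually_ge_at_top eventually_compose_filterlim[OF _ filterlim_real_sequentially])
  show ?thesis using ev1 ev2 ev3
  proof eventually_elim
    case (elim N)
    have N: "N \<ge> r" "N > 0" "real N \<ge> T" using elim by auto
    show ?case
    proof (intro allI impI)
      fix X W t0
      assume t0: "real (N+1) ^ (q+2) \<le> t0" and gf: "gradient_flow N r (risk (q+2) r N (M N) lam (v N) W) X"
        and W: "inj_norm_le N (q+2) W (K * sqrt (real N))" and gs: "generic_start q r lam N (v N) \<delta> L (X 0)"
      define \<sigma> where "\<sigma> = signal_match q r lam N (v N) (X 0)"
      have \<sigma>: "\<sigma> permutes ?I" unfolding \<sigma>_def signal_match_def by (rule match_of_permutes)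
      have \<sigma>I: "\<sigma> i \<in> ?I" if "i \<in> ?I" for i using permutes_in_image[OF \<sigma>] that by simp
      have stief: "X t \<in> stiefel N r" if "t \<ge> 0" for t using gf that by (simp add: gradient_flow_def)
      define b where "b = 1 / sqrt (real N)"
      have b: "0 < b" "b < b0" unfolding b_def using elim N by auto
      define m where "m = (\<lambda>i j t. corr N (v N) (X t) (\<sigma> i) j)"
      define E where "E = (\<lambda>i j t. corr_noise (q+2) r N (M N) lam (v N) W (X t) (\<sigma> i) j)"
      define \<alpha>' where "\<alpha>' = (\<lambda>i j. ?\<alpha> (\<sigma> i) j)"
      have vN: "inner_N N (v N i) (v N j) = (if i = j then real N else 0)" if "i \<in> ?I" "j \<in> ?I" for i j
        by (rule v[OF N(1) that])
      have cf: "correlation_flow q r \<alpha>' a A (\<eta> * b ^ (q+1)) m E"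
      proof
        fix i j :: nat and t :: real assume ij: "i \<in> ?I" "j \<in> ?I"
        show "a \<le> \<alpha>' i j \<and> \<alpha>' i j \<le> A" unfolding \<alpha>'_def by (rule \<alpha>[OF \<sigma>I[OF ij(1)] ij(2)])
        assume t: "0 \<le> t"
        show "(m i j has_real_derivative \<alpha>' i j * m i j t ^ (q+1) - drag q r \<alpha>' (\<lambda>i j. m i j t) i j + E i j t) (at t within {0..})"
          using corr_flow[OF gf t N(2) \<sigma>I[OF ij(1)] ij(2) refl vN]
          unfolding m_def E_def \<alpha>'_def drag_relabel[OF \<sigma>, of q ?\<alpha> "\<lambda>i j. corr N (v N) (X t) i j"] by simp
        show "\<bar>m i j t\<bar> \<le> 1" unfolding m_def
          by (rule corr_le_1[OF stief[OF t] \<sigma>I[OF ij(1)] ij(2) N(2)]) (use vN[OF \<sigma>I[OF ij(1)] \<sigma>I[OF ij(1)]] in simp)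
        have "\<bar>E i j t\<bar> \<le> l1 * real (q+2) * K * (1 + real r) / sqrt (real (M N))" unfolding E_def
        proof (rule corr_noise_le[OF W stief[OF t] N(2) _ _ K _ \<sigma>I[OF ij(1)] ij(2)])
          show "0 < M N" using M1[of N] by simp
          show "0 \<le> lam i \<and> lam i \<le> l1" if "i \<in> ?I" for i using lam[OF that] l0 by linarith
          show "inner_N N (v N i) (v N i) = real N" if "i \<in> ?I" for i using vN[OF that that] by simp
        qed
        also have "\<dots> = R / sqrt (real (M N))" by (simp add: R_def)
        also have "\<dots> \<le> \<eta> * b ^ (q+1)"
        proof -
          have "sqrt (real N ^ (q+1) / real (M N)) = sqrt (real N) ^ (q+1) / sqrt (real (M N))"
            by (simp only: real_sqrt_divide real_sqrt_power)
          hence "R * (sqrt (real N) ^ (q+1) / sqrt (real (M N))) < \<eta>" using elim(2) by (simp only:)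
          hence "R / sqrt (real (M N)) * sqrt (real N) ^ (q+1) \<le> \<eta>" by simp
          thus ?thesis unfolding b_def using N(2) by (simp add: power_one_over pos_le_divide_eq divide_simps mult_ac)
        qed
        finally show "\<bar>E i j t\<bar> \<le> \<eta> * b ^ (q+1)" .
      qed (use q r a A1 c b in auto)
      define y where "y = (\<lambda>i j. sqrt (real N) * corr N (v N) (X 0) i j)"
      define s where "s = (\<lambda>i j. entry_weight q lam i j * y i j)"
      have m0: "m i j 0 = b * y (\<sigma> i) j" for i j unfolding m_def b_def y_def using N by simp
      have ew: "0 < entry_weight q lam i j" "entry_weight q lam i j ^ q = ?\<alpha> i j" "entry_weight q lam i j \<le> root q A"
        if ij: "i \<in> ?I" "j \<in> ?I" for i j
        unfolding entry_weight_def using \<alpha>[OF ij] a q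
        by (auto intro!: real_root_gt_zero real_root_pow_pos2 real_root_le_mono)
      have yb: "\<delta> < y i j" "y i j \<le> L" if "i \<in> ?I" "j \<in> ?I" for i j
        using gs that unfolding generic_start_def y_def by auto
      have sb: "0 < s i j" "s i j \<le> L'" if ij: "i \<in> ?I" "j \<in> ?I" for i j
        unfolding s_def L'_def using ew[OF ij] yb[OF ij] \<delta> rootA by (auto intro!: mult_mono mult_pos_pos)
      have inv: "1 / (real q * \<alpha>' i j * m i j 0 ^ q) = 1 / (real q * b ^ q) * (1 / s (\<sigma> i) j ^ q)" if "i \<in> ?I" "j \<in> ?I" for i j
        unfolding m0 \<alpha>'_def s_def power_mult_distrib ew(2)[OF \<sigma>I[OF that(1)] that(2)] by (simp add: mult_ac)
      have st: "\<forall>i\<in>{1..r}. \<forall>j\<in>{1..r}. \<delta>' * b \<le> m i j 0 \<and> (i \<noteq> j \<longrightarrow> (\<exists>h\<in>{i,j}.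
         1 / (real q * \<alpha>' h h * m h h 0 ^ q) + \<delta>' / b ^ q \<le> 1 / (real q * \<alpha>' i j * m i j 0 ^ q)))"
      proof (intro ballI conjI impI)
        fix i j assume ij: "i \<in> ?I" "j \<in> ?I"
        have "\<delta>' \<le> y (\<sigma> i) j" using yb[OF \<sigma>I[OF ij(1)] ij(2)] unfolding \<delta>'_def by linarith
        thus "\<delta>' * b \<le> m i j 0" unfolding m0 using b by (simp add: mult.commute)
      next
        fix i j assume ij: "i \<in> ?I" "j \<in> ?I" "i \<noteq> j"
        have gap: "1 / (real q * \<alpha>' h h * m h h 0 ^ q) + \<delta>' / b ^ q \<le> 1 / (real q * \<alpha>' i j * m i j 0 ^ q)"
          if h: "h \<in> ?I" "s (\<sigma> i) j + \<delta> \<le> s (\<sigma> h) h" for h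
        proof -
          have "1 / s (\<sigma> h) h ^ q + \<delta> / L' ^ (q+1) \<le> 1 / s (\<sigma> i) j ^ q"
            by (rule inverse_power_gap[OF sb(1)[OF \<sigma>I[OF ij(1)] ij(2)] h(2) sb(2)[OF \<sigma>I[OF h(1)] h(1)] \<delta> q])
          hence "1 / (real q * b ^ q) * (1 / s (\<sigma> h) h ^ q + \<delta> / L' ^ (q+1)) \<le> 1 / (real q * b ^ q) * (1 / s (\<sigma> i) j ^ q)"
            using b q by (intro mult_left_mono) auto
          moreover have "\<delta>' / b ^ q \<le> 1 / (real q * b ^ q) * (\<delta> / L' ^ (q+1))"
          proof -
            have "\<delta>' / b ^ q \<le> \<delta> / (real q * L' ^ (q+1)) / b ^ q" unfolding \<delta>'_def using b by (intro divide_right_mono) auto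
            thus ?thesis by (simp add: mult_ac)
          qed
          ultimately show ?thesis unfolding inv[OF h(1) h(1)] inv[OF ij(1,2)] distrib_left by linarith
        qed
        have mon: "s k l \<le> s k' l'" if "entry_weight q lam k l * corr N (v N) (X 0) k l \<le> entry_weight q lam k' l' * corr N (v N) (X 0) k' l'" for k l k' l'
          using mult_left_mono[OF that, of "sqrt (real N)"] unfolding s_def y_def by (simp add: mult_ac)
        have sdiff: "\<bar>s k l - s k' l'\<bar> = sqrt (real N) * \<bar>entry_weight q lam k l * corr N (v N) (X 0) k l - entry_weight q lam k' l' * corr N (v N) (X 0) k' l'\<bar>" for k l k' l'
        proof -
          have "s k l - s k' l' = sqrt (real N) * (entry_weight q lam k l * corr N (v N) (X 0) k l - entry_weight q lam k' l' * corr N (v N) (X 0) k' l')"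
            unfolding s_def y_def by (simp add: algebra_simps)
          thus ?thesis by (simp add: abs_mult)
        qed
        have g: "\<delta> < sqrt (real N) * \<bar>entry_weight q lam k k' * corr N (v N) (X 0) k k' - entry_weight q lam k l * corr N (v N) (X 0) k l\<bar>"
          "\<delta> < sqrt (real N) * \<bar>entry_weight q lam k' k * corr N (v N) (X 0) k' k - entry_weight q lam l k * corr N (v N) (X 0) l k\<bar>"
          if "k \<in> ?I" "k' \<in> ?I" "l \<in> ?I" "l \<noteq> k'" for k k' l
          using bspec[OF bspec[OF gs[unfolded generic_start_def] that(1)] that(2)] that(3,4) by simp_all
        have "s (\<sigma> i) j \<le> s (\<sigma> j) j \<or> s (\<sigma> i) j \<le> s (\<sigma> i) i"
          using match_of_stable[OF ij, of "\<lambda>i j. entry_weight q lam i j * corr N (v N) (X 0) i j"]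
          unfolding \<sigma>_def signal_match_def by (elim disjE) (intro disjI1 mon, assumption, intro disjI2 mon, assumption)
        thus "\<exists>h\<in>{i,j}. 1 / (real q * \<alpha>' h h * m h h 0 ^ q) + \<delta>' / b ^ q \<le> 1 / (real q * \<alpha>' i j * m i j 0 ^ q)"
        proof
          assume le: "s (\<sigma> i) j \<le> s (\<sigma> j) j"
          have ne: "\<sigma> i \<noteq> \<sigma> j" using \<sigma> ij(3) by (metis permutes_inj inj_eq)
          have "\<delta> < \<bar>s (\<sigma> i) j - s (\<sigma> j) j\<bar>"
            unfolding sdiff by (rule g(2)[OF ij(2) \<sigma>I[OF ij(1)] \<sigma>I[OF ij(2)] ne[symmetric]])
          hence "s (\<sigma> i) j + \<delta> \<le> s (\<sigma> j) j" using le by linarith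
          from gap[OF ij(2) this] show ?thesis by blast
        next
          assume le: "s (\<sigma> i) j \<le> s (\<sigma> i) i"
          have "\<delta> < \<bar>s (\<sigma> i) j - s (\<sigma> i) i\<bar>"
            unfolding sdiff by (rule g(1)[OF \<sigma>I[OF ij(1)] ij(2,1,3)])
          hence "s (\<sigma> i) j + \<delta> \<le> s (\<sigma> i) i" using le by linarith
          from gap[OF ij(1) this] show ?thesis by blast
        qed
      qed
      have all: "\<forall>t\<ge>T / b ^ q. \<forall>i\<in>{1..r}. m i i t \<ge> 1 - \<epsilon>"
        by (rule esc[THEN spec[of _ b], THEN spec[of _ \<alpha>'], THEN spec[of _ m], THEN spec[of _ E], THEN mp]) (intro conjI b cf st)
      \<comment> \<open>crude: the left-hand side is only of order \<open>N^(q/2)\<close>\<close>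
      have "T / b ^ q \<le> real (N+1) ^ (q+2)"
      proof -
        have N1: "1 \<le> real N" using N by simp
        have "sqrt (real N) \<le> real N" using N1 by (simp add: real_le_lsqrt power2_eq_square)
        hence "T * sqrt (real N) ^ q \<le> real N * real N ^ q" using N c by (intro mult_mono power_mono) auto
        also have "\<dots> = real N ^ (q+1)" by simp
        also have "\<dots> \<le> real (N+1) ^ (q+1)" by (intro power_mono) auto
        also have "\<dots> \<le> real (N+1) ^ (q+2)" by (intro power_increasing) auto
        finally show ?thesis unfolding b_def by (simp add: power_one_over)
      qed
      hence "T / b ^ q \<le> t0" using t0 by linarith
      thus "\<forall>i\<in>{1..r}. corr N (v N) (X t0) (signal_match q r lam N (v N) (X 0) i) i \<ge> 1 - \<epsilon>"
        using all unfolding m_def \<sigma>_def by blast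
    qed
  qed
qed

section \<open>Measurability and conditioning\<close>

text \<open>By continuity the infimum over an interval is an infimum over countably many times, hence measurable. The left
  endpoint is added because a degenerate interval may contain no rational.\<close>

lemma INF_ge_iff_countable:
  fixes f :: "real \<Rightarrow> real"
  assumes cont: "continuous_on {a..b} f" and ab: "a \<le> b" and bdd: "\<And>t. t \<in> {a..b} \<Longrightarrow> l \<le> f t"
  shows "(INF t\<in>{a..b}. f t) \<ge> c \<longleftrightarrow> (\<forall>t\<in>insert a (\<rat> \<inter> {a..b}). f t \<ge> c)"
proof
  assume le: "(INF t\<in>{a..b}. f t) \<ge> c"
  have bb: "bdd_below (f ` {a..b})" by (rule bdd_belowI2[of _ l]) (use bdd in auto)
  have "f t \<ge> c" if "t \<in> {a..b}" for t
    by (rule order_trans[OF le cINF_lower[OF bb that]])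
  thus "\<forall>t\<in>insert a (\<rat> \<inter> {a..b}). f t \<ge> c" using ab by auto
next
  assume all: "\<forall>t\<in>insert a (\<rat> \<inter> {a..b}). f t \<ge> c"
  have "f t \<ge> c" if t: "t \<in> {a..b}" for t
  proof (rule ccontr)
    assume "\<not> f t \<ge> c"
    hence lt: "f t < c" by simp
    have ab': "a < b" using t lt all ab by (cases "a = b") auto
    have "(f \<longlongrightarrow> f t) (at t within {a..b})" using cont t by (auto simp: continuous_on_def)
    hence "eventually (\<lambda>u. f u < c) (at t within {a..b})" using lt by (rule order_tendstoD)
    then obtain d where d: "d > 0" "\<And>u. u \<in> {a..b} \<Longrightarrow> u \<noteq> t \<Longrightarrow> dist u t < d \<Longrightarrow> f u < c"
      unfolding eventually_at by auto
    have "max a (t - d) < min b (t + d)" using t d(1) ab' by auto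
    from Rats_dense_in_real[OF this] obtain u where u: "u \<in> \<rat>" "max a (t - d) < u" "u < min b (t + d)" by blast
    hence "u \<in> {a..b}" "dist u t < d" by (auto simp: dist_real_def abs_less_iff)
    hence "f u < c" using d(2)[of u] lt by (cases "u = t") auto
    moreover have "f u \<ge> c" using all u \<open>u \<in> {a..b}\<close> by auto
    ultimately show False by simp
  qed
  thus "(INF t\<in>{a..b}. f t) \<ge> c" using ab by (intro cINF_greatest) auto
qed

lemma gradient_flow_corr_continuous:
  assumes gf: "gradient_flow N r f X" and j: "j \<in> {1..r}" and a: "0 \<le> a"
  shows "continuous_on {a..b} (\<lambda>t. corr N v (X t) i j)"
proof -
  have "continuous_on {a..b} (\<lambda>t. X t (k,j))" if k: "k \<in> {1..N}" for k
  proof (rule cont_within_Ici[OF _ a])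
    fix t assume "a \<le> t" "t \<le> b"
    thus "((\<lambda>t. X t (k,j)) has_real_derivative - riem_grad N r f (X t) (k,j)) (at t within {0..})"
      using gf k j a unfolding gradient_flow_def mat_idx_def by auto
  qed
  thus ?thesis unfolding corr_def inner_N_def mat_col_def divide_inverse by (intro continuous_intros) auto
qed

text \<open>Conditioning on an event of probability at least \<open>c\<close> multiplies the probability of the exceptional
  event \<open>B\<close> by at most \<open>1/c\<close>.\<close>

lemma (in prob_space) cond_prob_ge:
  assumes Q: "Q' \<in> events" and PQ: "S \<in> events" and B: "B \<in> events"
    and S: "S = {\<omega>\<in>space M. P \<omega> \<and> Q \<omega>}" and Q': "Q' = {\<omega>\<in>space M. Q \<omega>}"
    and sub: "Q' - B \<subseteq> S" and c: "0 < c" "c \<le> prob Q'" and e: "prob B \<le> e"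
  shows "cond_prob M P Q \<ge> 1 - e / c" "cond_prob M P Q \<le> 1"
proof -
  have Q0: "0 < prob Q'" using c by linarith
  have e0: "0 \<le> e" using e measure_nonneg[of M B] by linarith
  have cp: "cond_prob M P Q = prob S / prob Q'" unfolding cond_prob_def S Q' ..
  have "prob Q' \<le> prob (S \<union> B)" using sub Q PQ B by (intro finite_measure_mono) auto
  also have "\<dots> \<le> prob S + prob B" using PQ B by (rule measure_Un_le)
  finally have "prob Q' - e \<le> prob S" using e by linarith
  hence "(prob Q' - e) / prob Q' \<le> prob S / prob Q'" using Q0 by (intro divide_right_mono) auto
  moreover have "(prob Q' - e) / prob Q' = 1 - e / prob Q'" using Q0 by (simp add: diff_divide_distrib)
  moreover have "e / prob Q' \<le> e / c" using c e0 by (intro divide_left_mono) auto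
  ultimately show "cond_prob M P Q \<ge> 1 - e / c" unfolding cp by linarith
  have "prob S \<le> prob Q'" using Q unfolding S Q' by (intro finite_measure_mono) auto
  thus "cond_prob M P Q \<le> 1" unfolding cp using Q0 by simp
qed

lemma finite_comparison_patterns: "finite {C. C \<subseteq> {1..r::nat} \<times> {1..r::nat} \<times> {1..r::nat} \<times> {1..r::nat}}"
  by (simp flip: Pow_def)

lemma (in prob_space) match_event_measurable:
  fixes s :: "'a \<Rightarrow> nat \<Rightarrow> nat \<Rightarrow> real"
  assumes s: "\<And>i j. i \<in> {1..r} \<Longrightarrow> j \<in> {1..r} \<Longrightarrow> (\<lambda>\<omega>. s \<omega> i j) \<in> borel_measurable M"
  shows "{\<omega>\<in>space M. match_of r (comparison_pattern r (s \<omega>)) = \<pi>} \<in> events"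
proof -
  let ?I4 = "{1..r} \<times> {1..r} \<times> {1..r} \<times> {1..r}"
  let ?E = "\<lambda>C. {\<omega>\<in>space M. \<forall>x\<in>?I4. (s \<omega> (fst x) (fst (snd x)) \<le> s \<omega> (fst (snd (snd x))) (snd (snd (snd x)))) = (x \<in> C)}"
  have EM: "?E C \<in> events" for C
  proof (rule sets.sets_Collect_finite_All)
    fix x assume x: "x \<in> ?I4"
    obtain i j k l where ijkl: "x = (i,j,k,l)" "i \<in> {1..r}" "j \<in> {1..r}" "k \<in> {1..r}" "l \<in> {1..r}" using x by auto
    note s[OF ijkl(2,3), measurable] s[OF ijkl(4,5), measurable]
    show "{\<omega>\<in>space M. (s \<omega> (fst x) (fst (snd x)) \<le> s \<omega> (fst (snd (snd x))) (snd (snd (snd x)))) = (x \<in> C)} \<in> events"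
      unfolding ijkl(1) fst_conv snd_conv by measurable
  qed auto
  have "{\<omega>\<in>space M. match_of r (comparison_pattern r (s \<omega>)) = \<pi>} = (\<Union>C\<in>{C. C \<subseteq> ?I4 \<and> match_of r C = \<pi>}. ?E C)"
  proof (intro equalityI subsetI)
    fix \<omega> assume w: "\<omega> \<in> {\<omega>\<in>space M. match_of r (comparison_pattern r (s \<omega>)) = \<pi>}"
    show "\<omega> \<in> (\<Union>C\<in>{C. C \<subseteq> ?I4 \<and> match_of r C = \<pi>}. ?E C)"
      using w by (intro UN_I[of "comparison_pattern r (s \<omega>)"]) (auto simp: comparison_pattern_def)
  next
    fix \<omega> assume "\<omega> \<in> (\<Union>C\<in>{C. C \<subseteq> ?I4 \<and> match_of r C = \<pi>}. ?E C)"
    then obtain C where C: "C \<subseteq> ?I4" "match_of r C = \<pi>" "\<omega> \<in> ?E C" by blast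
    have "comparison_pattern r (s \<omega>) = C"
    proof (intro set_eqI)
      fix x :: "nat \<times> nat \<times> nat \<times> nat"
      obtain i j k l where x: "x = (i,j,k,l)" by (cases x) auto
      show "x \<in> comparison_pattern r (s \<omega>) \<longleftrightarrow> x \<in> C"
      proof (cases "x \<in> ?I4")
        case True
        hence "(s \<omega> i j \<le> s \<omega> k l) = (x \<in> C)" using C(3) unfolding x by auto
        thus ?thesis using True unfolding x comparison_pattern_def by simp
      next
        case False
        thus ?thesis using C(1) unfolding x comparison_pattern_def by auto
      qed
    qed
    thus "\<omega> \<in> {\<omega>\<in>space M. match_of r (comparison_pattern r (s \<omega>)) = \<pi>}" using C by auto
  qed
  moreover have "finite {C. C \<subseteq> ?I4 \<and> match_of r C = \<pi>}"
    by (rule finite_subset[OF _ finite_comparison_patterns[of r]]) (rule Collect_mono, rule impI, erule conjunct1)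
  ultimately show ?thesis using sets.finite_UN[of _ ?E M, OF _ EM] by (simp only:)
qed

lemma corr_measurable:
  "j \<in> {1..r} \<Longrightarrow> (\<lambda>x. corr N v x i j) \<in> borel_measurable (mat_borel N r)"
  unfolding corr_def by (intro borel_measurable_divide inner_col_measurable) auto

lemma power_much_less_time:
  assumes "p \<ge> 3"
  shows "much_less (\<lambda>N. real N powr ((real p - 2) / 2)) (\<lambda>N. real (N+1) ^ p)"
  unfolding much_less_def
proof (rule tendsto_sandwich[of "\<lambda>_. 0" _ _ "\<lambda>N. 1 / real (N+1)"])
  show "eventually (\<lambda>N. real N powr ((real p - 2) / 2) / real (N+1) ^ p \<le> 1 / real (N+1)) sequentially"
  proof (rule always_eventually, rule allI)
    fix N
    have "real N powr ((real p - 2) / 2) \<le> real (N+1) powr ((real p - 2) / 2)" using assms by (intro powr_mono2) auto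
    also have "\<dots> \<le> real (N+1) powr real (p - 1)" using assms by (intro powr_mono) auto
    also have "\<dots> = real (N+1) ^ (p - 1)" by (intro powr_realpow) auto
    finally have "real N powr ((real p - 2) / 2) / real (N+1) ^ p \<le> real (N+1) ^ (p - 1) / real (N+1) ^ p"
      by (intro divide_right_mono) auto
    also have "\<dots> = 1 / real (N+1)" using assms by (cases p) simp_all
    finally show "real N powr ((real p - 2) / 2) / real (N+1) ^ p \<le> 1 / real (N+1)" .
  qed
  show "(\<lambda>N. 1 / real (N+1)) \<longlonglongrightarrow> 0" by real_asymp
  show "eventually (\<lambda>N. 0 \<le> real N powr ((real p - 2) / 2) / real (N+1) ^ p) sequentially"
    by (intro always_eventually allI divide_nonneg_nonneg) auto
qed simp

section \<open>Recovery of all signals\<close>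

theorem theorem1p1:
  fixes p r :: nat
    and lam :: "nat \<Rightarrow> real"
    and M :: "nat \<Rightarrow> nat"
    and v :: "nat \<Rightarrow> nat \<Rightarrow> nat \<Rightarrow> real"
    and \<Omega> :: "nat \<Rightarrow> 'w measure"
    and W :: "nat \<Rightarrow> 'w \<Rightarrow> rtensor"
    and X :: "nat \<Rightarrow> real \<Rightarrow> 'w \<Rightarrow> rmat"
  assumes p: "p \<ge> 3"
    and r: "r \<ge> 1"
    and lam_pos: "\<And>i. i \<in> {1..r} \<Longrightarrow> lam i > 0"
    and lam_decreasing: "\<And>i j. i \<in> {1..r} \<Longrightarrow> j \<in> {1..r} \<Longrightarrow> i \<le> j \<Longrightarrow> lam i \<ge> lam j"
    and M_pos: "\<And>N. M N \<ge> 1"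
    and M_large: "much_less (\<lambda>N. real N ^ (p - 1)) (\<lambda>N. real (M N))"
    and v_orthogonal: "\<And>N i j. N \<ge> r \<Longrightarrow> i \<in> {1..r} \<Longrightarrow> j \<in> {1..r} \<Longrightarrow> i \<noteq> j \<Longrightarrow>
           inner_N N (v N i) (v N j) = 0"
    and v_norm: "\<And>N i. N \<ge> r \<Longrightarrow> i \<in> {1..r} \<Longrightarrow> sqrt (inner_N N (v N i) (v N i)) = sqrt (real N)"
    and prob: "\<And>N. N \<ge> r \<Longrightarrow> prob_space (\<Omega> N)"
    and W_indep: "\<And>N. N \<ge> r \<Longrightarrow>
           prob_space.indep_vars (\<Omega> N) (\<lambda>_. borel) (\<lambda>a \<omega>. W N \<omega> a) (tensor_idx N p)"
    and W_gaussian: "\<And>N a. N \<ge> r \<Longrightarrow> a \<in> tensor_idx N p \<Longrightarrow>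
           distributed (\<Omega> N) lborel (\<lambda>\<omega>. W N \<omega> a) std_normal_density"
    and X_measurable: "\<And>N t. N \<ge> r \<Longrightarrow> t \<ge> 0 \<Longrightarrow> X N t \<in> measurable (\<Omega> N) (mat_borel N r)"
    and X0_uniform: "\<And>N. N \<ge> r \<Longrightarrow>
           uniform_stiefel N r (distr (\<Omega> N) (mat_borel N r) (X N 0))"
    and X0_W_indep: "\<And>N. N \<ge> r \<Longrightarrow>
           prob_space.indep_set (\<Omega> N)
             {X N 0 -` A \<inter> space (\<Omega> N) |A. A \<in> sets (mat_borel N r)}
             {(\<lambda>\<omega>. restrict (W N \<omega>) (tensor_idx N p)) -` B \<inter> space (\<Omega> N) |B.
                B \<in> sets (Pi\<^sub>M (tensor_idx N p) (\<lambda>_. borel :: real measure))}"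
    and X_flow: "\<And>N \<omega>. N \<ge> r \<Longrightarrow> \<omega> \<in> space (\<Omega> N) \<Longrightarrow>
           gradient_flow N r (risk p r N (M N) lam (v N) (W N \<omega>)) (\<lambda>t. X N t \<omega>)"
  shows "\<exists>(\<sigma> :: nat \<Rightarrow> rmat \<Rightarrow> nat \<Rightarrow> nat) (T0 :: nat \<Rightarrow> real).
    (\<forall>N x. \<sigma> N x permutes {1..r}) \<and>
    (\<forall>N. T0 N > 0) \<and>
    much_less (\<lambda>N. real N powr ((real p - 2) / 2)) T0 \<and>
    (\<forall>\<epsilon>>0. \<forall>T :: nat \<Rightarrow> real. (\<forall>N. T N \<ge> T0 N) \<longrightarrow>
      (\<lambda>N. \<P>(\<omega> in \<Omega> N.
          (\<forall>i\<in>{1..r}.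
             (INF t\<in>{T0 N..T N}. corr N (v N) (X N t \<omega>) (\<sigma> N (X N 0 \<omega>) i) i) \<ge> 1 - \<epsilon>)
          \<bar> (\<forall>i\<in>{1..r}. \<forall>j\<in>{1..r}. corr N (v N) (X N 0 \<omega>) i j > 0)))
      \<longlonglongrightarrow> 1)"
proof -
  define q where "q = p - 2"
  have q: "q \<ge> 1" "p = q + 2" using p by (auto simp: q_def)
  let ?I = "{1..r}" and ?\<sigma> = "\<lambda>N x. signal_match q r lam N (v N) x" and ?T0 = "\<lambda>N::nat. real (N+1) ^ p"
  have lamb: "lam r \<le> lam i \<and> lam i \<le> lam 1" if "i \<in> ?I" for i using lam_decreasing[of i r] lam_decreasing[of 1 i] that by auto
  have lr: "0 < lam r" using lam_pos r by auto
  have vv: "inner_N N (v N i) (v N j) = (if i = j then real N else 0)" if "N \<ge> r" "i \<in> ?I" "j \<in> ?I" for N i j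
    using v_orthogonal[OF that] v_norm[OF that(1,2)] by auto
  \<comment> \<open>The signal strengths lie in \<open>[lam r, lam 1]\<close>, so this is a lower bound on all weights.\<close>
  define w0 where "w0 = root q (real (q+2) * lam r * lam r)"
  have w0: "0 < w0" unfolding w0_def using lr q by (intro real_root_gt_zero) auto
  have ww: "w0 \<le> entry_weight q lam i j" if ij: "i \<in> ?I" "j \<in> ?I" for i j
  proof -
    have "lam r * lam r \<le> lam i * lam j" using lamb[OF ij(1)] lamb[OF ij(2)] lr by (intro mult_mono) auto
    hence "real (q+2) * (lam r * lam r) \<le> real (q+2) * (lam i * lam j)" by (intro mult_left_mono) auto
    thus ?thesis unfolding w0_def entry_weight_def using q by (intro real_root_le_mono) (simp_all only: mult.assoc)
  qed
  define K where "K = inj_const p"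
  have K: "0 \<le> K" unfolding K_def inj_const_def by (intro real_sqrt_ge_zero mult_nonneg_nonneg add_nonneg_nonneg) auto
  \<comment> \<open>For large \<open>N\<close> the correlations are all positive with probability at least \<open>c / 2\<close>.\<close>
  define c where "c = (1 / 2 ^ r :: real) ^ r"
  have c: "0 < c" by (simp add: c_def)
  have main: "(\<lambda>N. \<P>(\<omega> in \<Omega> N. (\<forall>i\<in>?I. (INF t\<in>{?T0 N..T N}. corr N (v N) (X N t \<omega>) (?\<sigma> N (X N 0 \<omega>) i) i) \<ge> 1 - \<epsilon>)
          \<bar> (\<forall>i\<in>?I. \<forall>j\<in>?I. corr N (v N) (X N 0 \<omega>) i j > 0))) \<longlonglongrightarrow> 1" (is "?P \<longlonglongrightarrow> 1")
    if \<epsilon>: "\<epsilon> > 0" and T: "\<And>N. T N \<ge> ?T0 N" for \<epsilon> T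
  proof (rule LIMSEQ_I)
    fix e0 :: real assume "e0 > 0"
    define e where "e = min e0 1"
    have e: "0 < e" "e \<le> e0" unfolding e_def using \<open>e0 > 0\<close> by auto
    \<comment> \<open>A bad start and a large noise tensor each have probability at most \<open>\<gamma>\<close>; conditioned, \<open>2 \<gamma> / (c / 2) = e / 2\<close>.\<close>
    define \<gamma> where "\<gamma> = e * c / 8"
    have \<gamma>: "0 < \<gamma>" unfolding \<gamma>_def using e c by auto
    define R where "R = real r ^ 2 + 2 * real r ^ 3 / w0"
    have R: "0 < R" unfolding R_def using r w0 by (intro add_pos_nonneg) auto
    define \<delta> where "\<delta> = \<gamma> / (8 * R)"
    define L where "L = sqrt (2 * real r ^ 2 / \<gamma>)"
    have \<delta>: "0 < \<delta>" unfolding \<delta>_def using \<gamma> R by simp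
    have L: "0 < L" unfolding L_def using \<gamma> r by simp
    have L2: "L\<^sup>2 = 2 * real r ^ 2 / \<gamma>" unfolding L_def using \<gamma> by simp
    have small: "4 * \<delta> * R + real r ^ 2 / L\<^sup>2 = \<gamma>" unfolding L2 \<delta>_def using \<gamma> R r by (simp add: field_simps)
    have M': "much_less (\<lambda>N. real N ^ (q+1)) (\<lambda>N. real (M N))" using M_large unfolding q(2) by simp
    have ev1: "eventually (\<lambda>N. \<forall>Y W. gradient_flow N r (risk (q+2) r N (M N) lam (v N) W) Y \<longrightarrow>
     inj_norm_le N (q+2) W (K * sqrt (real N)) \<longrightarrow> generic_start q r lam N (v N) \<delta> L (Y 0) \<longrightarrow>
     (\<forall>t\<ge>real (N+1) ^ (q+2). \<forall>i\<in>{1..r}. corr N (v N) (Y t) (?\<sigma> N (Y 0) i) i \<ge> 1 - \<epsilon>)) sequentially"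
      by (rule flow_reaches_match[OF q(1) r lamb lr M_pos M' vv \<delta> L K \<epsilon>])
    have ev2: "eventually (\<lambda>N. sqrt 2 * exp (- real N) < \<gamma>) sequentially"
      by (rule order_tendstoD(2)[OF _ \<gamma>]) real_asymp
    have ev3: "eventually (\<lambda>N. real r ^ 2 / real N < c / 2) sequentially"
      by (rule order_tendstoD(2)[of _ 0]) (real_asymp, use c in simp)
    have "eventually (\<lambda>N. norm (?P N - 1) < e0) sequentially"
      using ev1 ev2 ev3 eventually_ge_at_top[of "max r 1"]
    proof eventually_elim
      case (elim N)
      have N: "N \<ge> r" "N > 0" using elim by auto
      interpret O: prob_space "\<Omega> N" by (rule prob[OF N(1)])
      let ?\<mu> = "distr (\<Omega> N) (mat_borel N r) (X N 0)"
      have X0: "X N 0 \<in> measurable (\<Omega> N) (mat_borel N r)" using X_measurable[OF N(1)] by simp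
      interpret U: uniform_frame N r ?\<mu> by unfold_locales (use X0_uniform[OF N(1)] r N in auto)
      \<comment> \<open>With normalized signals, frame coordinates are correlations times \<open>\<surd>N\<close>.\<close>
      define U where "U = (\<lambda>i k. v N i k / sqrt (real N))"
      have inner_U: "inner_N N (U i) x = sqrt (real N) * (inner_N N (v N i) x / real N)" for i x
      proof -
        have "inner_N N (U i) x = inner_N N (v N i) x / sqrt (real N)" unfolding inner_N_def U_def by (simp add: sum_divide_distrib)
        also have "\<dots> = sqrt (real N) * (inner_N N (v N i) x / real N)" using N by (simp add: real_div_sqrt field_simps)
        finally show ?thesis .
      qed
      have Uc: "inner_N N (U i) (mat_col x j) = sqrt (real N) * corr N (v N) x i j" for i j x
        unfolding inner_U corr_def ..
      have UU: "orthonormal N r U" unfolding orthonormal_def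
      proof (intro ballI)
        fix i j assume ij: "i \<in> ?I" "j \<in> ?I"
        have "inner_N N (U i) (U j) = sqrt (real N) * (inner_N N (U j) (v N i) / real N)"
          unfolding inner_U[of i] by (simp add: inner_N_commute)
        also have "\<dots> = inner_N N (v N j) (v N i) / real N"
        proof -
          have "sqrt n * (sqrt n * (x / n) / n) = x / n" if "n > 0" for n x :: real
          proof -
            have "sqrt n * (sqrt n * (x / n) / n) = (sqrt n * sqrt n) * (x / n) / n" by simp
            thus ?thesis using that by simp
          qed
          thus ?thesis unfolding inner_U[of j] using N by simp
        qed
        finally show "inner_N N (U i) (U j) = (if i = j then 1 else 0)" using vv[OF N(1) ij(2,1)] N by auto
      qed
      have sp: "space ?\<mu> = space (mat_borel N r)" by simp
      have pull: "O.prob {\<omega>\<in>space (\<Omega> N). X N 0 \<omega> \<in> B} = U.prob B" "{\<omega>\<in>space (\<Omega> N). X N 0 \<omega> \<in> B} \<in> O.events"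
        if "B \<in> sets (mat_borel N r)" for B
      proof -
        have "{\<omega>\<in>space (\<Omega> N). X N 0 \<omega> \<in> B} = X N 0 -` B \<inter> space (\<Omega> N)" by auto
        thus "O.prob {\<omega>\<in>space (\<Omega> N). X N 0 \<omega> \<in> B} = U.prob B" "{\<omega>\<in>space (\<Omega> N). X N 0 \<omega> \<in> B} \<in> O.events"
          using measurable_sets[OF X0 that] by (simp_all add: measure_distr[OF X0 that])
      qed
      obtain E where E: "E \<in> U.events" "U.prob E \<le> 4 * \<delta> * (real r ^ 2 + 2 * real r ^ 3 / w0) + real r ^ 2 / L\<^sup>2"
        "\<forall>x\<in>space ?\<mu> - E. \<forall>i\<in>?I. \<forall>j\<in>?I. \<delta> < \<bar>inner_N N (U i) (mat_col x j)\<bar> \<and> \<bar>inner_N N (U i) (mat_col x j)\<bar> \<le> L"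
        "\<forall>x\<in>space ?\<mu> - E. \<forall>i\<in>?I. \<forall>j\<in>?I. \<forall>l\<in>?I - {j}.
           \<delta> < \<bar>entry_weight q lam i j * inner_N N (U i) (mat_col x j) - entry_weight q lam i l * inner_N N (U i) (mat_col x l)\<bar> \<and>
           \<delta> < \<bar>entry_weight q lam j i * inner_N N (U j) (mat_col x i) - entry_weight q lam l i * inner_N N (U l) (mat_col x i)\<bar>"
        by (rule U.generic_entries[OF UU ww w0 \<delta> L])
      have E\<gamma>: "U.prob E \<le> \<gamma>" using E(2) small unfolding R_def by simp
      obtain G where G: "G \<in> O.events" "O.prob G \<ge> 1 - sqrt 2 * exp (- real N)"
        "\<forall>\<omega>\<in>G. inj_norm_le N p (W N \<omega>) (inj_const p * sqrt (real N))"
        by (rule O.inj_norm_bound[OF W_indep[OF N(1)] W_gaussian[OF N(1)] N(2)])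
      define Q where "Q = {\<omega>\<in>space (\<Omega> N). \<forall>i\<in>?I. \<forall>j\<in>?I. corr N (v N) (X N 0 \<omega>) i j > 0}"
      define S where "S = {\<omega>\<in>space (\<Omega> N). (\<forall>i\<in>?I. (INF t\<in>{?T0 N..T N}. corr N (v N) (X N t \<omega>) (?\<sigma> N (X N 0 \<omega>) i) i) \<ge> 1 - \<epsilon>)
          \<and> (\<forall>i\<in>?I. \<forall>j\<in>?I. corr N (v N) (X N 0 \<omega>) i j > 0)}"
      define B where "B = {\<omega>\<in>space (\<Omega> N). X N 0 \<omega> \<in> E} \<union> (space (\<Omega> N) - G)"
      have BM: "B \<in> O.events" unfolding B_def using pull(2)[of E] E(1) G(1) by auto
      have cm: "(\<lambda>\<omega>. corr N (v N) (X N t \<omega>) i j) \<in> borel_measurable (\<Omega> N)" if "0 \<le> t" "j \<in> ?I" for t i j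
        by (rule measurable_compose[OF X_measurable[OF N(1) that(1)] corr_measurable[OF that(2)]])
      have QM: "Q \<in> O.events" unfolding Q_def
      proof (intro sets.sets_Collect_finite_All finite_atLeastAtMost)
        fix i j assume "i \<in> ?I" "j \<in> ?I"
        note cm[OF order_refl this(2), of i, measurable]
        show "{\<omega>\<in>space (\<Omega> N). corr N (v N) (X N 0 \<omega>) i j > 0} \<in> O.events" by measurable
      qed
      have perm: "?\<sigma> N x permutes ?I" for x unfolding signal_match_def by (rule match_of_permutes)
      have T0: "0 \<le> ?T0 N" by simp
      let ?D = "insert (?T0 N) (\<rat> \<inter> {?T0 N..T N})"
      have inf_iff: "(INF t\<in>{?T0 N..T N}. corr N (v N) (X N t \<omega>) k i) \<ge> 1 - \<epsilon> \<longleftrightarrow> (\<forall>t\<in>?D. corr N (v N) (X N t \<omega>) k i \<ge> 1 - \<epsilon>)"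
        if w: "\<omega> \<in> space (\<Omega> N)" and ik: "i \<in> ?I" "k \<in> ?I" for \<omega> i k
      proof (rule INF_ge_iff_countable[OF gradient_flow_corr_continuous[OF X_flow[OF N(1) w] ik(1) T0] T])
        fix t assume "t \<in> {?T0 N..T N}"
        hence "0 \<le> t" using order_trans[OF T0] by auto
        hence st: "X N t \<omega> \<in> stiefel N r" using X_flow[OF N(1) w] by (auto simp: gradient_flow_def)
        have "inner_N N (v N k) (v N k) = real N" using vv[OF N(1) ik(2,2)] by simp
        from corr_le_1[OF st ik(2,1) N(2), of "v N", OF this] show "- 1 \<le> corr N (v N) (X N t \<omega>) k i" by linarith
      qed
      \<comment> \<open>The permutation takes finitely many values; for each of them the infimum is over a fixed correlation.\<close>
      have SM: "S \<in> O.events"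
      proof -
        let ?A = "\<lambda>\<pi>. {\<omega>\<in>space (\<Omega> N). ?\<sigma> N (X N 0 \<omega>) = \<pi>}"
        let ?C = "\<lambda>\<pi>. {\<omega>\<in>space (\<Omega> N). \<forall>i\<in>?I. \<forall>t\<in>?D. corr N (v N) (X N t \<omega>) (\<pi> i) i \<ge> 1 - \<epsilon>}"
        have AM: "?A \<pi> \<in> O.events" for \<pi>
          unfolding signal_match_def by (intro O.match_event_measurable borel_measurable_times cm) auto
        have CM: "?C \<pi> \<in> O.events" for \<pi>
        proof (rule sets.sets_Collect_finite_All)
          fix i assume i: "i \<in> ?I"
          show "{\<omega>\<in>space (\<Omega> N). \<forall>t\<in>?D. corr N (v N) (X N t \<omega>) (\<pi> i) i \<ge> 1 - \<epsilon>} \<in> O.events"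
          proof (rule sets.sets_Collect_countable_All')
            show "countable ?D" using countable_rat by auto
            fix t assume "t \<in> ?D"
            hence "0 \<le> t" using T0 order_trans[OF T0] by auto
            note cm[OF this i, of "\<pi> i", measurable]
            show "{\<omega>\<in>space (\<Omega> N). corr N (v N) (X N t \<omega>) (\<pi> i) i \<ge> 1 - \<epsilon>} \<in> O.events" by measurable
          qed
        qed simp
        have "S = (\<Union>\<pi>\<in>{\<pi>. \<pi> permutes ?I}. ?A \<pi> \<inter> ?C \<pi>) \<inter> Q"
        proof (intro set_eqI)
          fix \<omega>
          show "\<omega> \<in> S \<longleftrightarrow> \<omega> \<in> (\<Union>\<pi>\<in>{\<pi>. \<pi> permutes ?I}. ?A \<pi> \<inter> ?C \<pi>) \<inter> Q"
          proof (cases "\<omega> \<in> space (\<Omega> N)")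
            case True
            have "\<omega> \<in> S \<longleftrightarrow> \<omega> \<in> ?C (?\<sigma> N (X N 0 \<omega>)) \<and> \<omega> \<in> Q"
              unfolding S_def Q_def using True inf_iff[OF True _ permutes_in_image[OF perm, THEN iffD2]] by simp
            also have "\<dots> \<longleftrightarrow> \<omega> \<in> (\<Union>\<pi>\<in>{\<pi>. \<pi> permutes ?I}. ?A \<pi> \<inter> ?C \<pi>) \<inter> Q"
              using perm[of "X N 0 \<omega>"] True by blast
            finally show ?thesis .
          qed (auto simp: S_def)
        qed
        moreover have "(\<Union>\<pi>\<in>{\<pi>. \<pi> permutes ?I}. ?A \<pi> \<inter> ?C \<pi>) \<in> O.events"
          using AM CM finite_permutations[of ?I] by (intro sets.finite_UN) auto
        ultimately show ?thesis using QM by auto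
      qed
      have sub: "Q - B \<subseteq> S"
      proof
        fix \<omega> assume w: "\<omega> \<in> Q - B"
        have ws: "\<omega> \<in> space (\<Omega> N)" using w by (auto simp: Q_def)
        have wG: "\<omega> \<in> G" and wE: "X N 0 \<omega> \<notin> E" using w ws by (auto simp: B_def)
        have xs: "X N 0 \<omega> \<in> space ?\<mu>" using measurable_space[OF X0 ws] by simp
        have xE: "X N 0 \<omega> \<in> space ?\<mu> - E" using xs wE by simp
        have pos: "0 < corr N (v N) (X N 0 \<omega>) i j" if "i \<in> ?I" "j \<in> ?I" for i j using w that by (auto simp: Q_def)
        have sN: "0 < sqrt (real N)" using N by simp
        have fac: "\<bar>a * (sqrt (real N) * x) - b * (sqrt (real N) * y)\<bar> = sqrt (real N) * \<bar>a * x - b * y\<bar>" for a b x y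
        proof -
          have "a * (sqrt (real N) * x) - b * (sqrt (real N) * y) = sqrt (real N) * (a * x - b * y)" by (simp add: algebra_simps)
          thus ?thesis by (simp add: abs_mult)
        qed
        have gs: "generic_start q r lam N (v N) \<delta> L (X N 0 \<omega>)"
          unfolding generic_start_def
        proof (intro ballI conjI impI)
          fix i j assume ij: "i \<in> ?I" "j \<in> ?I"
          have "\<bar>inner_N N (U i) (mat_col (X N 0 \<omega>) j)\<bar> = sqrt (real N) * corr N (v N) (X N 0 \<omega>) i j"
            unfolding Uc using pos[OF ij] sN by (simp add: abs_mult)
          thus "\<delta> < sqrt (real N) * corr N (v N) (X N 0 \<omega>) i j" "sqrt (real N) * corr N (v N) (X N 0 \<omega>) i j \<le> L"
            using E(3)[THEN bspec, OF xE, THEN bspec, OF ij(1), THEN bspec, OF ij(2)] by simp_all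
          fix l assume l: "l \<in> ?I" "l \<noteq> j"
          have l': "l \<in> ?I - {j}" using l by auto
          note gaps = E(4)[THEN bspec, OF xE, THEN bspec, OF ij(1), THEN bspec, OF ij(2), THEN bspec, OF l']
          show "\<delta> < sqrt (real N) * \<bar>entry_weight q lam i j * corr N (v N) (X N 0 \<omega>) i j - entry_weight q lam i l * corr N (v N) (X N 0 \<omega>) i l\<bar>"
            using gaps[THEN conjunct1] unfolding Uc fac .
          show "\<delta> < sqrt (real N) * \<bar>entry_weight q lam j i * corr N (v N) (X N 0 \<omega>) j i - entry_weight q lam l i * corr N (v N) (X N 0 \<omega>) l i\<bar>"
            using gaps[THEN conjunct2] unfolding Uc fac .
        qed
        have fl: "gradient_flow N r (risk (q+2) r N (M N) lam (v N) (W N \<omega>)) (\<lambda>t. X N t \<omega>)"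
          using X_flow[OF N(1) ws] unfolding q(2) .
        have inj: "inj_norm_le N (q+2) (W N \<omega>) (K * sqrt (real N))" using G(3)[THEN bspec, OF wG] unfolding K_def q(2) .
        have fin: "\<forall>t\<ge>real (N+1) ^ (q+2). \<forall>i\<in>{1..r}. corr N (v N) (X N t \<omega>) (?\<sigma> N (X N 0 \<omega>) i) i \<ge> 1 - \<epsilon>"
          using elim(1)[THEN spec[of _ "\<lambda>t. X N t \<omega>"], THEN spec[of _ "W N \<omega>"], THEN mp, OF fl, THEN mp, OF inj, THEN mp, OF gs] .
        have "(INF t\<in>{?T0 N..T N}. corr N (v N) (X N t \<omega>) (?\<sigma> N (X N 0 \<omega>) i) i) \<ge> 1 - \<epsilon>" if i: "i \<in> ?I" for i
        proof (rule cINF_greatest)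
          show "{?T0 N..T N} \<noteq> {}" using T by simp
          fix t assume "t \<in> {?T0 N..T N}"
          hence "real (N+1) ^ (q+2) \<le> t" unfolding q(2) by simp
          thus "1 - \<epsilon> \<le> corr N (v N) (X N t \<omega>) (?\<sigma> N (X N 0 \<omega>) i) i" using fin i by blast
        qed
        thus "\<omega> \<in> S" using ws w unfolding S_def Q_def by blast
      qed
      have Qc: "c / 2 \<le> O.prob Q"
      proof -
        have fpos: "U.frame_positive U \<in> sets (mat_borel N r)"
          unfolding U.frame_positive_def sp
        proof (intro sets.sets_Collect_finite_All finite_atLeastAtMost)
          fix i j assume "i \<in> ?I" "j \<in> ?I"
          note inner_col_measurable[OF this(2), of N "U i", measurable]
          show "{x\<in>space (mat_borel N r). inner_N N (U i) (mat_col x j) > 0} \<in> sets (mat_borel N r)" by measurable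
        qed
        have "Q = {\<omega>\<in>space (\<Omega> N). X N 0 \<omega> \<in> U.frame_positive U}"
          unfolding Q_def U.frame_positive_def Uc sp using measurable_space[OF X0] N by (auto simp: zero_less_mult_iff)
        hence "O.prob Q = U.prob (U.frame_positive U)" using pull(1)[OF fpos] by simp
        thus ?thesis using U.frame_positive_prob[OF UU] elim(3) unfolding c_def by linarith
      qed
      have B2: "O.prob B \<le> 2 * \<gamma>"
      proof -
        have "O.prob B \<le> O.prob {\<omega>\<in>space (\<Omega> N). X N 0 \<omega> \<in> E} + O.prob (space (\<Omega> N) - G)"
          unfolding B_def using pull(2)[of E] E(1) G(1) by (intro measure_Un_le) auto
        moreover have "O.prob {\<omega>\<in>space (\<Omega> N). X N 0 \<omega> \<in> E} \<le> \<gamma>" using pull(1)[of E] E(1) E\<gamma> by simp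
        moreover have "O.prob (space (\<Omega> N) - G) \<le> \<gamma>" using O.prob_compl[OF G(1)] G(2) elim(2) by linarith
        ultimately show ?thesis by linarith
      qed
      have cP: "?P N \<ge> 1 - 2 * \<gamma> / (c / 2)" "?P N \<le> 1"
        using O.cond_prob_ge[OF QM SM BM S_def Q_def sub _ Qc B2] c by simp_all
      have "2 * \<gamma> / (c / 2) = e / 2" unfolding \<gamma>_def using c by simp
      hence "?P N > 1 - e0" using cP e by linarith
      thus "norm (?P N - 1) < e0" using cP(2) \<open>e0 > 0\<close> by simp
    qed
    thus "\<exists>no. \<forall>n\<ge>no. norm (?P n - 1) < e0" by (simp add: eventually_sequentially)
  qed
  show ?thesis
  proof (rule exI[of _ ?\<sigma>], rule exI[of _ ?T0], intro conjI allI impI)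
    show "?\<sigma> N x permutes ?I" for N x unfolding signal_match_def by (rule match_of_permutes)
    show "?T0 N > 0" for N by simp
    show "much_less (\<lambda>N. real N powr ((real p - 2) / 2)) ?T0" by (rule power_much_less_time[OF p])
    fix \<epsilon> :: real and T :: "nat \<Rightarrow> real" assume "\<epsilon> > 0" and T: "\<forall>N. T N \<ge> ?T0 N"
    show "(\<lambda>N. \<P>(\<omega> in \<Omega> N. (\<forall>i\<in>?I. (INF t\<in>{?T0 N..T N}. corr N (v N) (X N t \<omega>) (?\<sigma> N (X N 0 \<omega>) i) i) \<ge> 1 - \<epsilon>)
          \<bar> (\<forall>i\<in>?I. \<forall>j\<in>?I. corr N (v N) (X N 0 \<omega>) i j > 0))) \<longlonglongrightarrow> 1"
      by (rule main[OF \<open>\<epsilon> > 0\<close> T[THEN spec]])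
  qed
qed

end
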